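(* Let $d\ge1$, $\kappa>0$, $\lambda(k)=(\kappa^2+4\pi^2|k|^2)^{1/2}$, and for $\alpha\in\mathbb{R}$ let $\mu^{(\alpha)}_{CM}$ be the measure on $\mathbb{Z}^d$ with $\mu^{(\alpha)}_{CM}(\{k\})=|k|^{-2}\lambda(k)^{-2\alpha}$ for $k\ne0$ and $\mu^{(\alpha)}_{CM}(\{0\})=0$. For every $\alpha\in\mathbb{R}$ and every $k\ne0$, $$\mu^{(\alpha)}_{CM}(\{k\})=4\pi^2\lambda(k)^{-2(\alpha+1)}+\kappa^2\mu^{(\alpha+1)}_{CM}(\{k\}),$$ and iterating gives the absolutely convergent expansion $$\mu^{(\alpha)}_{CM}(\{k\})=4\pi^2\sum_{j\ge0}\kappa^{2j}\lambda(k)^{-2(\alpha+1+j)},\qquad k\ne0.$$ Consequently, for $\alpha>0$ and $\nu:=\alpha-d/2$, the canonical-Matérn field $u^{(\alpha)}$ satisfies, in the sense of equality in second order (equality of mean and covariance distributions, hence equality in law for these Gaussian fields), $$u^{(\alpha)}\;=\;2\pi\sum_{j\ge0}\kappa^jX^\perp_{\nu+1+j},$$ where the summands are independent and the series converges in $L^2(\Omega)$ after testing against any $\varphi\in\mathcal{S}(\mathbb{T}^d)$. In particular, in second order, $u^{(\alpha)}=2\pi X^\perp_{\nu+1}+R$ with $R$ independent of $X^\perp_{\nu+1}$ and of smoothness $\nu+2$, one unit of $\nu$ smoother. If moreover $\nu+1>0$, then $u^{(\alpha)}$ has samples in $C^{(\nu+1)^-}_{loc}$ and no more, i.e. it does not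 have samples in $C^{\nu'^-}_{loc}$ for any $\nu'>\nu+1$.
   Context: $\mathbb{T}^d=\mathbb{R}^d/\mathbb{Z}^d$ has total mass $1$; $\mathcal{S}(\mathbb{T}^d)=C^\infty(\mathbb{T}^d)$. A real generalized random field (GeRF) $Z$ is a continuous linear map $\mathcal{S}(\mathbb{T}^d)\to L^2(\Omega,\mathcal{A},\mathbb{P})$ taking real test functions to real random variables; all GeRFs have mean zero; it is Gaussian if every $\langle Z,\varphi\rangle$ is. $Z$ is stationary with spectral measure $\mu_Z$ (a positive measure on $\mathbb{Z}^d$ with $\sum_k(1+|k|^2)^{-N}\mu_Z(\{k\})<\infty$ for some $N$) if $\mathrm{Cov}(\langle Z,\varphi\rangle,\langle Z,\phi\rangle)=\langle\rho_Z,\varphi*\check{\bar\phi}\rangle$ with $\check f(x)=f(-x)$ and $\rho_Z=\sum_k\mu_Z(\{k\})e^{2\pi ik\cdot h}$ in $\mathcal{S}'(\mathbb{T}^d)$. The canonical field $G$ is the centred Gaussian stationary GeRF with covariance distribution $4\pi^2G_{-\Delta}$, where $G_{-\Delta}$ is the unique mean-zero solution of $-\Delta G_{-\Delta}=\delta_0-1$; its spectral measure is $\mu_G(\{k\})=|k|^{-2}$ for $k\ne0$ and $\mu_G(\{0\})=0$. For $\alpha>0$ the canonical-Matérn field $u^{(\alpha)}$ is the Gaussian stationary solution of $(\kappa^2-\Delta)^{\alpha/2}u^{(\alpha)}=G$ in second order, where $(\kappa^2-\Delta)^{\alpha/2}$ is the Fourier multiplier with symbol $\lambda(k)^\alpha$;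 equivalently, the Gaussian stationary GeRF with spectral measure $\mu^{(\alpha)}_{CM}$. $X^\perp_{\nu}$ denotes the Gaussian Matérn field of smoothness $\nu$ with the constant mode removed: the stationary Gaussian GeRF with spectral measure $\lambda(k)^{-2(\nu+d/2)}$ for $k\ne0$ and $0$ at $k=0$. "$R$ of smoothness $\nu+2$" means that $R$ is the stationary field whose spectral measure is bounded above and below, for $k\ne0$, by positive multiples of $\lambda(k)^{-2(\nu+2+d/2)}$. $C^{n,\gamma}_{loc}$ ($n\in\mathbb{N}_0$, $\gamma\in[0,1]$) is the space of functions $f$ for which $\partial^\beta f$ exists for $|\beta|\le n$ and, on each compact $K$, $|\partial^\beta f(x)-\partial^\beta f(y)|\le C_K\|x-y\|^\gamma$ for $|\beta|=n$; $C^{\gamma^-}_{loc}=\bigcap_{n'+\gamma'<\gamma}C^{n',\gamma'}_{loc}$ over $n'\in\mathbb{N}_0$, $\gamma'\in[0,1]$. A field has samples in a space if it has a modification given by a random function whose paths lie in that space almost surely. *)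

theory Defs
  imports "HOL-Probability.Probability"
begin

section \<open>Partial derivatives and function spaces\<close>

text \<open>The torus is handled through \<open>\<int>\<^sup>d\<close>-periodic functions on \<^typ>\<open>real^'d\<close>, where \<open>d = CARD('d)\<close>.
  A derivative \<open>\<partial>\<^sup>\<beta>\<close> is given by a list of coordinate directions, applied from right to left;
  the definitions below quantify over all lists, hence over all orders of differentiation.\<close>

definition partial :: "'d::finite \<Rightarrow> (real^'d \<Rightarrow> 'b::real_normed_vector) \<Rightarrow> real^'d \<Rightarrow> 'b" where
  "partial i f x = vector_derivative (\<lambda>t. f (x + t *\<^sub>R axis i 1)) (at 0)"

primrec partials :: "'d::finite list \<Rightarrow> (real^'d \<Rightarrow> 'b::real_normed_vector) \<Rightarrow> real^'d \<Rightarrow> 'b" where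
  "partials [] f = f"
| "partials (i # is) f = partial i (partials is f)"

definition has_partials :: "nat \<Rightarrow> (real^'d::finite \<Rightarrow> 'b::real_normed_vector) \<Rightarrow> bool" where
  "has_partials n f \<longleftrightarrow>
     (\<forall>is i x. length is < n \<longrightarrow>
        (\<lambda>t. partials is f (x + t *\<^sub>R axis i 1)) differentiable (at 0))"

definition smooth :: "(real^'d::finite \<Rightarrow> 'b::real_normed_vector) \<Rightarrow> bool" where
  "smooth f \<longleftrightarrow> (\<forall>n. has_partials n f) \<and> (\<forall>is. continuous_on UNIV (partials is f))"

definition laplacian :: "(real^'d::finite \<Rightarrow> 'b::real_normed_vector) \<Rightarrow> real^'d \<Rightarrow> 'b" where
  "laplacian f x = (\<Sum>i\<in>UNIV. partials [i, i] f x)"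

definition holder_loc :: "nat \<Rightarrow> real \<Rightarrow> (real^'d::finite \<Rightarrow> real) set" where
  "holder_loc n \<gamma> = {f. has_partials n f \<and>
     (\<forall>K. compact K \<longrightarrow> (\<exists>C. \<forall>is. length is = n \<longrightarrow>
        (\<forall>x\<in>K. \<forall>y\<in>K. \<bar>partials is f x - partials is f y\<bar> \<le> C * norm (x - y) powr \<gamma>)))}"

definition holder_loc_minus :: "real \<Rightarrow> (real^'d::finite \<Rightarrow> real) set" where
  "holder_loc_minus \<gamma> =
     \<Inter> {holder_loc n \<gamma>' | n \<gamma>'. 0 \<le> \<gamma>' \<and> \<gamma>' \<le> 1 \<and> real n + \<gamma>' < \<gamma>}"

section \<open>Analysis on the torus\<close>

definition lattice_vec :: "int^'d::finite \<Rightarrow> real^'d" where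
  "lattice_vec k = (\<chi> i. real_of_int (k $ i))"

definition test_functions :: "(real^'d::finite \<Rightarrow> complex) set" where
  "test_functions = {\<phi>. smooth \<phi> \<and> (\<forall>x k. \<phi> (x + lattice_vec k) = \<phi> x)}"

text \<open>Basic neighbourhoods of the Frechet topology of \<open>C\<^sup>\<infinity>\<close>.\<close>

definition test_nhd :: "nat \<Rightarrow> real \<Rightarrow> (real^'d::finite \<Rightarrow> complex) \<Rightarrow> (real^'d \<Rightarrow> complex) set" where
  "test_nhd N \<delta> \<phi> = {\<psi> \<in> test_functions.
     \<forall>is. length is \<le> N \<longrightarrow> (\<forall>x. cmod (partials is \<psi> x - partials is \<phi> x) < \<delta>)}"

definition torus_integral :: "(real^'d::finite \<Rightarrow> complex) \<Rightarrow> complex" where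
  "torus_integral f = (LINT x:cbox 0 One|lborel. f x)"

definition torus_conv ::
  "(real^'d::finite \<Rightarrow> complex) \<Rightarrow> (real^'d \<Rightarrow> complex) \<Rightarrow> real^'d \<Rightarrow> complex" where
  "torus_conv f g x = torus_integral (\<lambda>y. f (x - y) * g y)"

definition conj_reflect :: "(real^'d::finite \<Rightarrow> complex) \<Rightarrow> real^'d \<Rightarrow> complex" where
  "conj_reflect f x = cnj (f (- x))"

definition character :: "int^'d::finite \<Rightarrow> real^'d \<Rightarrow> complex" where
  "character k x = cis (2 * pi * (lattice_vec k \<bullet> x))"

definition fourier_coeff :: "(real^'d::finite \<Rightarrow> complex) \<Rightarrow> int^'d \<Rightarrow> complex" where
  "fourier_coeff f k = torus_integral (\<lambda>x. f x * character (- k) x)"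

definition fourier_multiplier ::
  "(int^'d::finite \<Rightarrow> real) \<Rightarrow> (real^'d \<Rightarrow> complex) \<Rightarrow> real^'d \<Rightarrow> complex" where
  "fourier_multiplier m f x =
     (\<Sum>\<^sub>\<infinity>k. complex_of_real (m k) * fourier_coeff f k * character k x)"

definition distribution :: "((real^'d::finite \<Rightarrow> complex) \<Rightarrow> complex) \<Rightarrow> bool" where
  "distribution T \<longleftrightarrow>
     (\<forall>\<phi>\<in>test_functions. \<forall>\<psi>\<in>test_functions. \<forall>a b.
        T (\<lambda>x. a * \<phi> x + b * \<psi> x) = a * T \<phi> + b * T \<psi>) \<and>
     (\<forall>\<phi>\<in>test_functions. \<forall>\<epsilon>>0. \<exists>N. \<exists>\<delta>>0. \<forall>\<psi>\<in>test_nhd N \<delta> \<phi>. cmod (T \<psi> - T \<phi>) < \<epsilon>)"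

text \<open>The mean-zero solution of \<open>- \<Delta> T = \<delta>\<^sub>0 - 1\<close>; it is unique as a functional on
  \<^const>\<open>test_functions\<close>.\<close>

definition green_distribution :: "((real^'d::finite \<Rightarrow> complex) \<Rightarrow> complex) \<Rightarrow> bool" where
  "green_distribution T \<longleftrightarrow> distribution T \<and> T (\<lambda>x. 1) = 0 \<and>
     (\<forall>\<phi>\<in>test_functions. T (\<lambda>x. - laplacian \<phi> x) = \<phi> 0 - torus_integral \<phi>)"

section \<open>Generalized random fields\<close>

definition covariance :: "'a measure \<Rightarrow> ('a \<Rightarrow> complex) \<Rightarrow> ('a \<Rightarrow> complex) \<Rightarrow> complex" where
  "covariance M X Y =
     (LINT \<omega>|M. (X \<omega> - (LINT \<eta>|M. X \<eta>)) * cnj (Y \<omega> - (LINT \<eta>|M. Y \<eta>)))"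

definition l2_norm :: "'a measure \<Rightarrow> ('a \<Rightarrow> complex) \<Rightarrow> real" where
  "l2_norm M X = sqrt (LINT \<omega>|M. (cmod (X \<omega>))\<^sup>2)"

text \<open>Elements of \<open>L\<^sup>2(\<Omega>)\<close> are given by representatives, so identities between them are almost sure.
  Fields are centred and real; only the values on \<^const>\<open>test_functions\<close> matter.\<close>

definition gerf :: "'a measure \<Rightarrow> ((real^'d::finite \<Rightarrow> complex) \<Rightarrow> 'a \<Rightarrow> complex) \<Rightarrow> bool" where
  "gerf M Z \<longleftrightarrow> prob_space M \<and>
     (\<forall>\<phi>\<in>test_functions. Z \<phi> \<in> borel_measurable M \<and> integrable M (\<lambda>\<omega>. (cmod (Z \<phi> \<omega>))\<^sup>2)) \<and>
     (\<forall>\<phi>\<in>test_functions. \<forall>\<psi>\<in>test_functions. \<forall>a b.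
        AE \<omega> in M. Z (\<lambda>x. a * \<phi> x + b * \<psi> x) \<omega> = a * Z \<phi> \<omega> + b * Z \<psi> \<omega>) \<and>
     (\<forall>\<phi>\<in>test_functions. \<forall>\<epsilon>>0. \<exists>N. \<exists>\<delta>>0. \<forall>\<psi>\<in>test_nhd N \<delta> \<phi>.
        l2_norm M (\<lambda>\<omega>. Z \<psi> \<omega> - Z \<phi> \<omega>) < \<epsilon>) \<and>
     (\<forall>\<phi>\<in>test_functions. (\<forall>x. \<phi> x \<in> \<real>) \<longrightarrow> (AE \<omega> in M. Z \<phi> \<omega> \<in> \<real>)) \<and>
     (\<forall>\<phi>\<in>test_functions. (LINT \<omega>|M. Z \<phi> \<omega>) = 0)"

text \<open>Constants count as Gaussian (zero variance).\<close>

definition gaussian_rv :: "'a measure \<Rightarrow> ('a \<Rightarrow> real) \<Rightarrow> bool" where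
  "gaussian_rv M X \<longleftrightarrow> X \<in> borel_measurable M \<and>
     ((\<exists>m. AE \<omega> in M. X \<omega> = m) \<or>
      (\<exists>m \<sigma>. \<sigma> > 0 \<and> distributed M lborel X (normal_density m \<sigma>)))"

definition gaussian_gerf :: "'a measure \<Rightarrow> ((real^'d::finite \<Rightarrow> complex) \<Rightarrow> 'a \<Rightarrow> complex) \<Rightarrow> bool" where
  "gaussian_gerf M Z \<longleftrightarrow> gerf M Z \<and>
     (\<forall>\<phi>\<in>test_functions. (\<forall>x. \<phi> x \<in> \<real>) \<longrightarrow> gaussian_rv M (\<lambda>\<omega>. Re (Z \<phi> \<omega>)))"

definition spectral_measure :: "(int^'d::finite) measure \<Rightarrow> bool" where
  "spectral_measure \<mu> \<longleftrightarrow> sets \<mu> = UNIV \<and>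
     (\<exists>N::nat. (\<integral>\<^sup>+k. ennreal ((1 + (norm (lattice_vec k))\<^sup>2) powr (- real N)) * emeasure \<mu> {k}
        \<partial>count_space UNIV) < \<infinity>)"

text \<open>The distribution \<open>\<Sum>\<^sub>k \<mu>({k}) e\<^sup>2\<^sup>\<pi>\<^sup>i\<^sup>k\<^sup>\<cdot>\<^sup>h\<close>, as a functional on test functions.\<close>

definition spectral_distribution ::
  "(int^'d::finite) measure \<Rightarrow> (real^'d \<Rightarrow> complex) \<Rightarrow> complex" where
  "spectral_distribution \<mu> \<phi> =
     (\<Sum>\<^sub>\<infinity>k. complex_of_real (measure \<mu> {k}) * torus_integral (\<lambda>h. character k h * \<phi> h))"

definition has_covariance_distribution ::
  "'a measure \<Rightarrow> ((real^'d::finite \<Rightarrow> complex) \<Rightarrow> 'a \<Rightarrow> complex) \<Rightarrow>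
   ((real^'d \<Rightarrow> complex) \<Rightarrow> complex) \<Rightarrow> bool" where
  "has_covariance_distribution M Z \<rho> \<longleftrightarrow>
     (\<forall>\<phi>\<in>test_functions. \<forall>\<psi>\<in>test_functions.
        covariance M (Z \<phi>) (Z \<psi>) = \<rho> (torus_conv \<phi> (conj_reflect \<psi>)))"

definition stationary_gerf ::
  "'a measure \<Rightarrow> ((real^'d::finite \<Rightarrow> complex) \<Rightarrow> 'a \<Rightarrow> complex) \<Rightarrow> (int^'d) measure \<Rightarrow> bool" where
  "stationary_gerf M Z \<mu> \<longleftrightarrow> gerf M Z \<and> spectral_measure \<mu> \<and>
     has_covariance_distribution M Z (spectral_distribution \<mu>)"

definition second_order_eq ::
  "'a measure \<Rightarrow> ((real^'d::finite \<Rightarrow> complex) \<Rightarrow> 'a \<Rightarrow> complex) \<Rightarrow>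
   'b measure \<Rightarrow> ((real^'d \<Rightarrow> complex) \<Rightarrow> 'b \<Rightarrow> complex) \<Rightarrow> bool" where
  "second_order_eq M Z N W \<longleftrightarrow>
     (\<forall>\<phi>\<in>test_functions. (LINT \<omega>|M. Z \<phi> \<omega>) = (LINT \<omega>|N. W \<phi> \<omega>)) \<and>
     (\<forall>\<phi>\<in>test_functions. \<forall>\<psi>\<in>test_functions.
        covariance M (Z \<phi>) (Z \<psi>) = covariance N (W \<phi>) (W \<psi>))"

definition eq_in_law ::
  "'a measure \<Rightarrow> ((real^'d::finite \<Rightarrow> complex) \<Rightarrow> 'a \<Rightarrow> complex) \<Rightarrow>
   'b measure \<Rightarrow> ((real^'d \<Rightarrow> complex) \<Rightarrow> 'b \<Rightarrow> complex) \<Rightarrow> bool" where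
  "eq_in_law M Z N W \<longleftrightarrow>
     (\<forall>(n::nat) \<phi>. (\<forall>i<n. \<phi> i \<in> test_functions) \<longrightarrow>
        distr M (\<Pi>\<^sub>M i\<in>{..<n}. borel) (\<lambda>\<omega>. \<lambda>i\<in>{..<n}. Z (\<phi> i) \<omega>) =
        distr N (\<Pi>\<^sub>M i\<in>{..<n}. borel) (\<lambda>\<omega>. \<lambda>i\<in>{..<n}. W (\<phi> i) \<omega>))"

definition field_algebra ::
  "'a measure \<Rightarrow> ((real^'d::finite \<Rightarrow> complex) \<Rightarrow> 'a \<Rightarrow> complex) \<Rightarrow> 'a set set" where
  "field_algebra M Z = sigma_sets (space M)
     {Z \<phi> -` A \<inter> space M | \<phi> A. \<phi> \<in> test_functions \<and> A \<in> sets borel}"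

definition independent_fields ::
  "'a measure \<Rightarrow> ('i \<Rightarrow> (real^'d::finite \<Rightarrow> complex) \<Rightarrow> 'a \<Rightarrow> complex) \<Rightarrow> 'i set \<Rightarrow> bool" where
  "independent_fields M X I \<longleftrightarrow> prob_space.indep_sets M (\<lambda>i. field_algebra M (X i)) I"

definition independent_pair ::
  "'a measure \<Rightarrow> ((real^'d::finite \<Rightarrow> complex) \<Rightarrow> 'a \<Rightarrow> complex) \<Rightarrow>
   ((real^'d \<Rightarrow> complex) \<Rightarrow> 'a \<Rightarrow> complex) \<Rightarrow> bool" where
  "independent_pair M Z W \<longleftrightarrow>
     prob_space.indep_set M (field_algebra M Z) (field_algebra M W)"

definition l2_series ::
  "'a measure \<Rightarrow> (nat \<Rightarrow> (real^'d::finite \<Rightarrow> complex) \<Rightarrow> 'a \<Rightarrow> complex) \<Rightarrow>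
   ((real^'d \<Rightarrow> complex) \<Rightarrow> 'a \<Rightarrow> complex) \<Rightarrow> bool" where
  "l2_series M Y S \<longleftrightarrow>
     (\<forall>\<phi>\<in>test_functions.
        (\<lambda>n. l2_norm M (\<lambda>\<omega>. (\<Sum>j<n. Y j \<phi> \<omega>) - S \<phi> \<omega>)) \<longlonglongrightarrow> 0)"

text \<open>A random function is a jointly measurable \<open>u\<close> whose paths are functions on the torus;
  it represents \<open>Z\<close> when \<open>\<langle>Z,\<phi>\<rangle> = \<integral> u \<phi>\<close> almost surely, for each test function.
  Integrability is demanded because the Bochner integral is \<open>0\<close> otherwise.\<close>

definition has_samples ::
  "'a measure \<Rightarrow> ((real^'d::finite \<Rightarrow> complex) \<Rightarrow> 'a \<Rightarrow> complex) \<Rightarrow> (real^'d \<Rightarrow> real) set \<Rightarrow> bool" where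
  "has_samples M Z F \<longleftrightarrow>
     (\<exists>u. (\<lambda>(x, \<omega>). u x \<omega>) \<in> borel_measurable (borel \<Otimes>\<^sub>M M) \<and>
        (\<forall>\<omega>\<in>space M. \<forall>x k. u (x + lattice_vec k) \<omega> = u x \<omega>) \<and>
        (AE \<omega> in M. (\<lambda>x. u x \<omega>) \<in> F) \<and>
        (\<forall>\<phi>\<in>test_functions. AE \<omega> in M.
           set_integrable lborel (cbox 0 One) (\<lambda>x. complex_of_real (u x \<omega>) * \<phi> x) \<and>
           Z \<phi> \<omega> = torus_integral (\<lambda>x. complex_of_real (u x \<omega>) * \<phi> x)))"

section \<open>Canonical and Matern fields\<close>

definition lam :: "real \<Rightarrow> int^'d::finite \<Rightarrow> real" where
  "lam \<kappa> k = sqrt (\<kappa>\<^sup>2 + 4 * pi\<^sup>2 * (norm (lattice_vec k))\<^sup>2)"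

definition mu_CM :: "real \<Rightarrow> real \<Rightarrow> (int^'d::finite) measure" where
  "mu_CM \<kappa> \<alpha> = point_measure UNIV (\<lambda>k. ennreal
     (if k = 0 then 0 else norm (lattice_vec k) powr (-2) * lam \<kappa> k powr (-2 * \<alpha>)))"

definition mu_perp :: "real \<Rightarrow> real \<Rightarrow> (int^'d::finite) measure" where
  "mu_perp \<kappa> \<nu> = point_measure UNIV (\<lambda>k. ennreal
     (if k = 0 then 0 else lam \<kappa> k powr (-2 * (\<nu> + real CARD('d) / 2))))"

definition canonical_field :: "'a measure \<Rightarrow> ((real^'d::finite \<Rightarrow> complex) \<Rightarrow> 'a \<Rightarrow> complex) \<Rightarrow> bool" where
  "canonical_field M G \<longleftrightarrow> gaussian_gerf M G \<and> (\<exists>\<mu>. stationary_gerf M G \<mu>) \<and>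
     (\<exists>T. green_distribution T \<and>
        has_covariance_distribution M G (\<lambda>\<phi>. complex_of_real (4 * pi\<^sup>2) * T \<phi>))"

text \<open>Fourier multipliers act on fields by transposition; the reflected symbol comes from
  \<open>\<langle>Z, e\<^sub>-\<^sub>k\<rangle>\<close> being the \<open>k\<close>-th Fourier coefficient of \<open>Z\<close>.\<close>

definition field_multiplier ::
  "(int^'d::finite \<Rightarrow> real) \<Rightarrow> ((real^'d \<Rightarrow> complex) \<Rightarrow> 'a \<Rightarrow> complex) \<Rightarrow>
   (real^'d \<Rightarrow> complex) \<Rightarrow> 'a \<Rightarrow> complex" where
  "field_multiplier m Z \<phi> = Z (fourier_multiplier (\<lambda>k. m (- k)) \<phi>)"

text \<open>\<open>u\<close> on \<open>M\<close> is the Gaussian stationary solution of \<open>(\<kappa>\<^sup>2 - \<Delta>)\<^sup>\<alpha>\<^sup>/\<^sup>2 u = G\<close> in second order,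
  with \<open>G\<close> a canonical field on \<open>N\<close>.\<close>

definition canonical_matern ::
  "real \<Rightarrow> real \<Rightarrow> 'b measure \<Rightarrow> ((real^'d::finite \<Rightarrow> complex) \<Rightarrow> 'b \<Rightarrow> complex) \<Rightarrow>
   'a measure \<Rightarrow> ((real^'d \<Rightarrow> complex) \<Rightarrow> 'a \<Rightarrow> complex) \<Rightarrow> bool" where
  "canonical_matern \<kappa> \<alpha> N G M u \<longleftrightarrow> canonical_field N G \<and>
     gaussian_gerf M u \<and> (\<exists>\<mu>. stationary_gerf M u \<mu>) \<and>
     second_order_eq M (field_multiplier (\<lambda>k. lam \<kappa> k powr \<alpha>) u) N G"

definition matern_perp ::
  "real \<Rightarrow> real \<Rightarrow> 'a measure \<Rightarrow> ((real^'d::finite \<Rightarrow> complex) \<Rightarrow> 'a \<Rightarrow> complex) \<Rightarrow> bool" where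
  "matern_perp \<kappa> \<nu> M X \<longleftrightarrow> gaussian_gerf M X \<and> stationary_gerf M X (mu_perp \<kappa> \<nu>)"

definition independent_matern_family ::
  "real \<Rightarrow> real \<Rightarrow> 'a measure \<Rightarrow> (nat \<Rightarrow> (real^'d::finite \<Rightarrow> complex) \<Rightarrow> 'a \<Rightarrow> complex) \<Rightarrow> bool" where
  "independent_matern_family \<kappa> \<nu> M X \<longleftrightarrow> prob_space M \<and>
     (\<forall>j. matern_perp \<kappa> (\<nu> + real j) M (X j)) \<and> independent_fields M X UNIV"

definition of_smoothness ::
  "real \<Rightarrow> real \<Rightarrow> 'a measure \<Rightarrow> ((real^'d::finite \<Rightarrow> complex) \<Rightarrow> 'a \<Rightarrow> complex) \<Rightarrow> bool" where
  "of_smoothness \<kappa> s M R \<longleftrightarrow>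
     (\<exists>\<mu>. stationary_gerf M R \<mu> \<and> (\<exists>a>0. \<exists>b>0. \<forall>k. k \<noteq> 0 \<longrightarrow>
        a * lam \<kappa> k powr (-2 * (s + real CARD('d) / 2)) \<le> measure \<mu> {k} \<and>
        measure \<mu> {k} \<le> b * lam \<kappa> k powr (-2 * (s + real CARD('d) / 2))))"

end

theory Submission
  imports Defs
begin

text \<open>
  Since \<open>4\<pi>\<^sup>2|k|\<^sup>2 = \<lambda>(k)\<^sup>2 - \<kappa>\<^sup>2\<close>, the weight \<open>|k|\<^sup>-\<^sup>2\<close> solves \<open>|k|\<^sup>-\<^sup>2 = \<lambda>(k)\<^sup>-\<^sup>2 (4\<pi>\<^sup>2 + \<kappa>\<^sup>2|k|\<^sup>-\<^sup>2)\<close>, and iterating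
  gives a geometric series of ratio at most \<open>\<kappa>\<^sup>2/(\<kappa>\<^sup>2 + 4\<pi>\<^sup>2)\<close> away from \<open>k = 0\<close>. For independent fields the
  corresponding series converges both in \<open>L\<^sup>2\<close> and almost surely, and covariances add up. The laws agree
  because the joint characteristic functions of a centred Gaussian field are determined by its covariance.

  Regularity: the derivatives of order \<open>l\<close> of the dyadic frequency block \<open>m\<close> have variance of order
  \<open>2\<^sup>2\<^sup>m\<^sup>(\<^sup>l \<^sup>- \<^sup>r\<^sup>)\<close> with \<open>r = \<nu> + 1\<close>. High Gaussian moments and a union bound over a fine grid control the blocks
  uniformly, up to an arbitrarily small power, so the block series converges in every Hoelder class below \<open>r\<close>.

  Sharpness: let \<open>\<psi>\<close> be an iterated difference, with step \<open>-1/(4R)\<close>, of a Fejer kernel of width about \<open>1/R\<close>.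
  Samples in a class above \<open>r\<close> would force \<open>\<langle>u,\<psi>\<rangle> = O(R\<^sup>-\<^sup>s)\<close> almost surely for some \<open>s > r\<close>, whereas the variance of
  this Gaussian variable is at least of order \<open>R\<^sup>-\<^sup>2\<^sup>r\<close>; the normalised variables would be standard
  normal and tend to \<open>0\<close>.
\<close>

section \<open>Characters and the unit cell\<close>

text \<open>A field is given by representatives in L^2, so linearity and reality hold outside null
  sets that depend on the test functions. Pathwise arguments are therefore reduced to countably many
  of them: characters, tolerances 1/(n+1), a sequence of probes. The spectral measure is read off on
  single characters, where the multiplier, the Green distribution and the convolution in the
  covariance all act by scalars. For \<alpha> \<ge> 0 the weights are bounded in k, so Bessel's
  inequality controls covariances by sup norms alone. Gaussianity is assumed for each real pairing,
  not jointly; since every real combination of real and imaginary parts of pairings is almost surely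
  the pairing with one real test function, one-dimensional laws suffice. The Hoelder constant of a
  sample path is random and nothing is known about its moments; this is why the sharpness argument
  passes through almost sure convergence and bounded characteristic functions instead of comparing
  variances.\<close>

lemma lattice_vec_add: "lattice_vec (k + l) = lattice_vec k + lattice_vec l"
  by (simp add: lattice_vec_def vec_eq_iff)

lemma lattice_vec_uminus: "lattice_vec (- k) = - lattice_vec k"
  by (simp add: lattice_vec_def vec_eq_iff)

lemma lattice_vec_0 [simp]: "lattice_vec 0 = 0"
  by (simp add: lattice_vec_def vec_eq_iff)

lemma lattice_vec_eq_0_iff [simp]: "lattice_vec k = 0 \<longleftrightarrow> k = 0"
  by (simp add: lattice_vec_def vec_eq_iff)

lemma character_add: "character k (x + y) = character k x * character k y"
  by (simp add: character_def inner_add_right cis_mult distrib_left)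

lemma character_add_index: "character (k + l) x = character k x * character l x"
  by (simp add: character_def lattice_vec_add inner_add_left cis_mult distrib_left)

lemma character_uminus: "character (- k) x = cnj (character k x)"
  by (simp add: character_def lattice_vec_uminus cis_cnj)

lemma character_minus: "character k (- x) = cnj (character k x)"
  by (simp add: character_def cis_cnj)

lemma cmod_character [simp]: "cmod (character k x) = 1"
  by (simp add: character_def)

lemma character_0 [simp]: "character 0 x = 1" "character k 0 = 1"
  by (simp_all add: character_def)

lemma character_lattice [simp]: "character k (lattice_vec l) = 1"
proof -
  have "lattice_vec k \<bullet> lattice_vec l = real_of_int (\<Sum>i\<in>UNIV. k $ i * l $ i)"
    by (simp add: lattice_vec_def inner_vec_def)
  then show ?thesis
    unfolding character_def by (metis Ints_of_int cis_multiple_2pi)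
qed

lemma character_periodic [simp]: "character k (x + lattice_vec l) = character k x"
  by (simp add: character_add)

lemma character_axis: "character k (t *\<^sub>R axis i 1) = cis (2 * pi * (real_of_int (k $ i) * t))"
  by (simp add: character_def inner_axis lattice_vec_def mult.commute)

lemma continuous_on_character [continuous_intros]:
  "continuous_on A f \<Longrightarrow> continuous_on A (\<lambda>x. character k (f x))"
  unfolding character_def cis_conv_exp by (intro continuous_intros)

lemma borel_measurable_character [measurable]: "character k \<in> borel_measurable borel"
  by (intro borel_measurable_continuous_onI continuous_on_character continuous_on_id)

text \<open>The closed unit cube has volume one, so \<open>torus_integral\<close> becomes an
  expectation and bounded measurable functions are integrable at once.\<close>

definition tor :: "(real^'d::finite) measure" where
  "tor = restrict_space lborel (cbox 0 One)"

lemma space_tor: "space tor = cbox 0 One"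
  by (simp add: tor_def space_restrict_space)

lemma measurable_tor: "f \<in> borel_measurable borel \<Longrightarrow> f \<in> borel_measurable tor"
  unfolding tor_def by (intro measurable_restrict_space1) simp

lemma prob_space_tor: "prob_space (tor :: (real^'d::finite) measure)"
proof
  have "emeasure lborel (cbox (0::real^'d) One) = 1"
    by (simp add: emeasure_lborel_cbox_eq inner_Basis)
  then show "emeasure (tor :: (real^'d) measure) (space tor) = 1"
    unfolding tor_def by (subst emeasure_restrict_space) (auto simp: space_restrict_space)
qed

interpretation tor: prob_space "tor :: (real^'d::finite) measure"
  by (rule prob_space_tor)

lemma torus_integral_tor: "torus_integral f = (LINT x|tor. f x)"
  unfolding torus_integral_def tor_def set_lebesgue_integral_def
  by (subst integral_restrict_space) auto

lemma integrable_tor_iff: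
  fixes f :: "real^'d::finite \<Rightarrow> complex"
  shows "integrable tor f \<longleftrightarrow> set_integrable lborel (cbox 0 One) f"
  unfolding tor_def set_integrable_def by (subst integrable_restrict_space) auto

lemma integrable_tor_bounded:
  fixes f :: "real^'d::finite \<Rightarrow> 'b::{banach,second_countable_topology}"
  assumes "f \<in> borel_measurable borel" "\<And>x. norm (f x) \<le> B"
  shows "integrable tor f"
  by (rule tor.integrable_const_bound[where B = B]) (simp_all add: assms measurable_tor)

section \<open>Fundamental domains and the invariance of the torus integral\<close>

definition periodic :: "(real^'d::finite \<Rightarrow> 'b) \<Rightarrow> bool" where
  "periodic f \<longleftrightarrow> (\<forall>x k. f (x + lattice_vec k) = f x)"

text \<open>Unlike the closed cube behind \<open>tor\<close>, the half-open cube contains exactly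
  one point of each coset of the lattice; the two differ by a null set.\<close>

definition unit_cell :: "(real^'d::finite) set" where
  "unit_cell = {x. \<forall>i. 0 \<le> x $ i \<and> x $ i < 1}"

lemma unit_cell_borel [measurable]: "unit_cell \<in> sets borel"
proof -
  have eq: "unit_cell = (\<Inter>i. {x::real^'d. 0 \<le> x $ i} \<inter> {x. x $ i < 1})"
    by (auto simp: unit_cell_def)
  have "{x::real^'d. 0 \<le> x $ i} \<inter> {x. x $ i < 1} \<in> sets borel" for i
    by (intro sets.Int borel_closed borel_open closed_halfspace_component_ge_cart open_halfspace_component_lt_cart)
  then show ?thesis
    unfolding eq by (intro sets.countable_INT'') simp_all
qed

lemma lattice_translate_unit_cell: "\<exists>!k. x + lattice_vec k \<in> (unit_cell :: (real^'d::finite) set)"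
proof (rule ex1I)
  have "0 \<le> x $ i + real_of_int (- \<lfloor>x $ i\<rfloor>) \<and> x $ i + real_of_int (- \<lfloor>x $ i\<rfloor>) < 1" for i
    using floor_correct[of "x $ i"] by simp linarith
  then show "x + lattice_vec (\<chi> i. - \<lfloor>x $ i\<rfloor>) \<in> unit_cell"
    by (simp add: unit_cell_def lattice_vec_def)
next
  fix k assume "x + lattice_vec k \<in> unit_cell"
  then have "0 \<le> x $ i + real_of_int (k $ i) \<and> x $ i + real_of_int (k $ i) < 1" for i
    by (simp add: unit_cell_def lattice_vec_def)
  then have "\<lfloor>x $ i\<rfloor> = - (k $ i)" for i
    by (intro floor_unique) (simp_all add: minus_le_iff less_diff_eq add.commute, (smt (verit))+)
  then show "k = (\<chi> i. - \<lfloor>x $ i\<rfloor>)"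
    by (simp add: vec_eq_iff)
qed

lemma sum_Basis_component [simp]: "(\<Sum>b\<in>Basis. b $ i) = (1::real)" for i :: "'d::finite"
  using inner_sum_left_Basis[of "axis i 1 :: real^'d" "\<lambda>_. 1"]
  by (simp add: inner_axis)

text \<open>The half-open cube lies between the open and the closed cube, and these two have the
  same volume.\<close>

lemma AE_unit_cell: "AE x in lborel. (x \<in> unit_cell) = (x \<in> cbox 0 (One::real^'d::finite))"
proof -
  have N: "cbox 0 One - box 0 (One::real^'d) \<in> null_sets lborel"
  proof (rule null_setsI)
    have "emeasure lborel (cbox 0 One - box 0 (One::real^'d)) =
        emeasure lborel (cbox 0 (One::real^'d)) - emeasure lborel (box 0 (One::real^'d))"
      by (intro emeasure_Diff) (auto simp: emeasure_lborel_box_eq box_subset_cbox)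
    then show "emeasure lborel (cbox 0 One - box 0 (One::real^'d)) = 0"
      by (simp add: emeasure_lborel_box_eq emeasure_lborel_cbox_eq inner_Basis)
  qed auto
  have "{x \<in> space lborel. (x \<in> unit_cell) \<noteq> (x \<in> cbox 0 (One::real^'d))} \<subseteq> cbox 0 One - box 0 One"
    by (auto simp: unit_cell_def mem_box_cart intro: less_imp_le)
  then show ?thesis
    by (intro AE_I'[OF N])
qed

lemma nn_integral_tor:
  assumes "f \<in> borel_measurable borel"
  shows "(\<integral>\<^sup>+x. f x \<partial>tor) = (\<integral>\<^sup>+x. indicator unit_cell x * f x \<partial>(lborel :: (real^'d::finite) measure))"
proof -
  have "(\<integral>\<^sup>+x. f x \<partial>tor) = (\<integral>\<^sup>+x. f x * indicator (cbox 0 One) x \<partial>lborel)"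
    unfolding tor_def by (subst nn_integral_restrict_space) auto
  also have "\<dots> = (\<integral>\<^sup>+x. indicator unit_cell x * f x \<partial>lborel)"
    using AE_unit_cell by (intro nn_integral_cong_AE) (auto split: split_indicator)
  finally show ?thesis .
qed

lemma nn_integral_lborel_translate:
  fixes c :: "'a::euclidean_space"
  assumes "f \<in> borel_measurable borel"
  shows "(\<integral>\<^sup>+x. f (c + x) \<partial>lborel) = (\<integral>\<^sup>+x. f x \<partial>lborel)"
  using assms by (subst (2) lborel_distr_plus[of c, symmetric]) (simp add: nn_integral_distr)

lemma nn_integral_lborel_reflect:
  fixes f :: "'a::euclidean_space \<Rightarrow> ennreal"
  assumes [measurable]: "f \<in> borel_measurable borel"
  shows "(\<integral>\<^sup>+x. f (- x) \<partial>lborel) = (\<integral>\<^sup>+x. f x \<partial>lborel)"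
proof -
  have "(\<integral>\<^sup>+x. f x \<partial>lborel) = (\<integral>\<^sup>+x. f x \<partial>(density (distr lborel borel (\<lambda>x. 0 + (-1::real) *\<^sub>R x)) (\<lambda>_. \<bar>-1::real\<bar>^DIM('a))))"
    by (subst lborel_affine[of "-1" 0]) auto
  also have "\<dots> = (\<integral>\<^sup>+x. f (- x) \<partial>lborel)"
    by (simp add: nn_integral_density nn_integral_distr)
  finally show ?thesis ..
qed

text \<open>Unfolding: insert the partition of unity given by the translates of
  \<open>unit_cell\<close>, exchange sum and integral, translate each summand back by its lattice
  vector, which periodicity of f permits, and collapse the sum over the translates of D.\<close>

lemma nn_integral_fundamental_domain:
  fixes D :: "(real^'d::finite) set"
  assumes [measurable]: "D \<in> sets borel" "f \<in> borel_measurable borel"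
    and per: "periodic f" and D: "\<And>x. \<exists>!k. x + lattice_vec k \<in> D"
  shows "(\<integral>\<^sup>+x. indicator D x * f x \<partial>lborel) = (\<integral>\<^sup>+x. f x \<partial>tor)"
proof -
  have inf: "infinite (UNIV :: (int^'d) set)"
    by (rule infinite_UNIV_vec[OF infinite_UNIV_int])
  define e :: "nat \<Rightarrow> int^'d" where "e = from_nat_into UNIV"
  have e: "bij e"
    unfolding e_def using bij_betw_from_nat_into[OF countableI_type inf] by simp
  have sum1: "(\<Sum>n. indicator E (x + lattice_vec (e n))) = (1::ennreal)"
    if E: "\<And>x. \<exists>!k. x + lattice_vec k \<in> E" and e: "bij e"
    for E and x :: "real^'d" and e :: "nat \<Rightarrow> int^'d"
  proof -
    obtain k where k: "x + lattice_vec k \<in> E" "\<And>l. x + lattice_vec l \<in> E \<Longrightarrow> l = k"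
      using E by metis
    obtain n where n: "e n = k" using bij_is_surj[OF e] by (metis surj_def)
    have en: "e m = k \<longleftrightarrow> m = n" for m using bij_is_inj[OF e] n by (metis injD)
    have "indicator E (x + lattice_vec (e m)) = (if m = n then 1 else 0 :: ennreal)" for m
    proof -
      have "x + lattice_vec (e m) \<in> E \<longleftrightarrow> m = n"
        using k(1) k(2)[of "e m"] en[of m] by blast
      then show ?thesis by (simp add: indicator_def)
    qed
    then show ?thesis
      using sums_single[of n "\<lambda>_. 1::ennreal"] by (simp add: sums_iff)
  qed
  have "(\<integral>\<^sup>+x. indicator D x * f x \<partial>lborel) =
      (\<integral>\<^sup>+x. (\<Sum>n. indicator unit_cell (x + lattice_vec (e n)) * (indicator D x * f x)) \<partial>lborel)"
    by (simp add: sum1[OF lattice_translate_unit_cell e])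
  also have "\<dots> = (\<Sum>n. \<integral>\<^sup>+x. indicator unit_cell (x + lattice_vec (e n)) * (indicator D x * f x) \<partial>lborel)"
    by (intro nn_integral_suminf) measurable
  also have "\<dots> = (\<Sum>n. \<integral>\<^sup>+x. indicator D (x + lattice_vec (- e n)) * (indicator unit_cell x * f x) \<partial>lborel)"
  proof (intro suminf_cong)
    fix n
    have "f (lattice_vec (- e n) + x) = f x" for x
      using per by (metis add.commute periodic_def)
    then show "(\<integral>\<^sup>+x. indicator unit_cell (x + lattice_vec (e n)) * (indicator D x * f x) \<partial>lborel) =
        (\<integral>\<^sup>+x. indicator D (x + lattice_vec (- e n)) * (indicator unit_cell x * f x) \<partial>lborel)"
      by (subst nn_integral_lborel_translate[of _ "lattice_vec (- e n)", symmetric])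
        (auto simp: lattice_vec_uminus intro!: nn_integral_cong split: split_indicator)
  qed
  also have "\<dots> = (\<integral>\<^sup>+x. (\<Sum>n. indicator D (x + lattice_vec (- e n)) * (indicator unit_cell x * f x)) \<partial>lborel)"
    by (intro nn_integral_suminf[symmetric]) measurable
  also have "\<dots> = (\<integral>\<^sup>+x. indicator unit_cell x * f x \<partial>lborel)"
  proof -
    \<comment> \<open>Moving the translation from the cell to D reverses its sign; negation permutes
      the lattice, so the translates of D still hit every point exactly once.\<close>
    have "bij (\<lambda>n. - e n)"
      using bij_comp[OF e bij_uminus] by (simp add: comp_def)
    from sum1[OF D this] show ?thesis by simp
  qed
  also have "\<dots> = (\<integral>\<^sup>+x. f x \<partial>tor)"
    by (rule nn_integral_tor[symmetric]) fact
  finally show ?thesis .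
qed

text \<open>A shifted half-open cube is another fundamental domain, so a shift of a periodic
  integrand merely exchanges one domain for another.\<close>

lemma nn_integral_tor_translate:
  assumes [measurable]: "f \<in> borel_measurable borel" and "periodic f"
  shows "(\<integral>\<^sup>+x. f (x + a) \<partial>tor) = (\<integral>\<^sup>+x. f x \<partial>(tor :: (real^'d::finite) measure))"
proof -
  define D where "D = (\<lambda>x. - a + x) -` (unit_cell :: (real^'d) set)"
  have [measurable]: "D \<in> sets borel"
    unfolding D_def by (rule measurable_sets_borel[OF _ unit_cell_borel]) measurable
  have D: "\<exists>!k. x + lattice_vec k \<in> D" for x
    using lattice_translate_unit_cell[of "- a + x"] unfolding D_def vimage_eq add.assoc .
  have "(\<integral>\<^sup>+x. f (x + a) \<partial>tor) = (\<integral>\<^sup>+x. indicator unit_cell x * f (x + a) \<partial>lborel)"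
    by (rule nn_integral_tor) measurable
  also have "\<dots> = (\<integral>\<^sup>+x. indicator D x * f x \<partial>lborel)"
    by (subst nn_integral_lborel_translate[of _ a, symmetric])
      (auto simp: D_def add.commute intro!: nn_integral_cong split: split_indicator)
  also have "\<dots> = (\<integral>\<^sup>+x. f x \<partial>tor)"
    by (rule nn_integral_fundamental_domain[OF _ _ assms(2) D]) measurable
  finally show ?thesis .
qed

text \<open>The reflected cell is half-open on the opposite side but is again a fundamental domain:
  the lattice vector for x is minus the one for -x.\<close>

lemma nn_integral_tor_reflect:
  assumes [measurable]: "f \<in> borel_measurable borel" and "periodic f"
  shows "(\<integral>\<^sup>+x. f (- x) \<partial>tor) = (\<integral>\<^sup>+x. f x \<partial>(tor :: (real^'d::finite) measure))"
proof -
  define D where "D = uminus -` (unit_cell :: (real^'d) set)"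
  have [measurable]: "D \<in> sets borel"
    unfolding D_def by (rule measurable_sets_borel[OF _ unit_cell_borel]) measurable
  have D: "\<exists>!k. x + lattice_vec k \<in> D" for x
  proof -
    obtain k where k: "- x + lattice_vec k \<in> unit_cell" "\<And>l. - x + lattice_vec l \<in> unit_cell \<Longrightarrow> l = k"
      using lattice_translate_unit_cell[of "- x"] by blast
    show ?thesis
    proof (rule ex1I[of _ "- k"])
      show "x + lattice_vec (- k) \<in> D" using k(1) by (simp add: D_def lattice_vec_uminus)
    next
      fix l assume "x + lattice_vec l \<in> D"
      then have "- x + lattice_vec (- l) \<in> unit_cell" by (simp add: D_def lattice_vec_uminus)
      then show "l = - k" using k(2) by force
    qed
  qed
  have "(\<integral>\<^sup>+x. f (- x) \<partial>tor) = (\<integral>\<^sup>+x. indicator unit_cell x * f (- x) \<partial>lborel)"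
    by (rule nn_integral_tor) measurable
  also have "\<dots> = (\<integral>\<^sup>+x. indicator D x * f x \<partial>lborel)"
    by (subst nn_integral_lborel_reflect[symmetric])
      (auto simp: D_def intro!: nn_integral_cong split: split_indicator)
  also have "\<dots> = (\<integral>\<^sup>+x. f x \<partial>tor)"
    by (rule nn_integral_fundamental_domain[OF _ _ assms(2) D]) measurable
  finally show ?thesis .
qed

text \<open>The representative of x in \<open>unit_cell\<close>. Composition with it makes every
  function periodic, in particular the indicator of an arbitrary Borel set.\<close>

definition wrap :: "real^'d::finite \<Rightarrow> real^'d" where
  "wrap x = (\<chi> i. frac (x $ i))"

lemma wrap_measurable [measurable]: "wrap \<in> borel_measurable borel"
proof -
  have "wrap x \<bullet> b = frac (x \<bullet> b)" if "b \<in> Basis" for x b :: "real^'a"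
    using that by (auto simp: wrap_def Basis_vec_def inner_axis)
  then show ?thesis
    by (subst borel_measurable_euclidean_space) (simp add: frac_def)
qed

lemma periodic_wrap: "periodic f \<Longrightarrow> f (wrap x) = f x"
proof -
  assume "periodic f"
  then have "f (x + lattice_vec (\<chi> i. - \<lfloor>x $ i\<rfloor>)) = f x"
    by (simp add: periodic_def)
  moreover have "x + lattice_vec (\<chi> i. - \<lfloor>x $ i\<rfloor>) = wrap x"
    by (simp add: wrap_def frac_def lattice_vec_def vec_eq_iff)
  ultimately show ?thesis by simp
qed

lemma wrap_lattice: "wrap (x + lattice_vec k) = wrap x"
  by (simp add: wrap_def lattice_vec_def vec_eq_iff frac_def)

text \<open>Invariance for nonnegative periodic integrands says that \<open>wrap\<close> and
  \<open>wrap\<close> after T have the same law under \<open>tor\<close>. A periodic f factors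
  through \<open>wrap\<close>, so its integrability and its Bochner integral depend on that law
  alone.\<close>

lemma integral_tor_invariant:
  fixes T :: "real^'d::finite \<Rightarrow> real^'d" and f :: "real^'d \<Rightarrow> 'b::{banach,second_countable_topology}"
  assumes [measurable]: "T \<in> borel_measurable borel" "f \<in> borel_measurable borel"
    and "periodic f"
    and T: "\<And>g::real^'d \<Rightarrow> ennreal. g \<in> borel_measurable borel \<Longrightarrow> periodic g \<Longrightarrow>
      (\<integral>\<^sup>+x. g (T x) \<partial>tor) = (\<integral>\<^sup>+x. g x \<partial>tor)"
  shows "integrable tor (\<lambda>x. f (T x)) \<longleftrightarrow> integrable tor f"
    and "(LINT x|tor. f (T x)) = (LINT x|tor. f x)"
proof -
  have mt [measurable]: "wrap \<in> measurable tor borel" "(\<lambda>x. wrap (T x)) \<in> measurable tor borel"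
    by (intro measurable_tor; measurable)+
  have eq: "distr tor borel (\<lambda>x. wrap (T x)) = distr tor borel wrap"
  proof (rule measure_eqI)
    fix A assume "A \<in> sets (distr tor borel (\<lambda>x. wrap (T x)))"
    then have [measurable]: "A \<in> sets borel" by simp
    have per: "periodic (\<lambda>x. indicator A (wrap x) :: ennreal)"
      by (simp add: periodic_def wrap_lattice)
    have "emeasure (distr tor borel (\<lambda>x. wrap (T x))) A = (\<integral>\<^sup>+x. indicator A (wrap (T x)) \<partial>tor)"
      by (simp add: nn_integral_distr flip: nn_integral_indicator)
    also have "\<dots> = (\<integral>\<^sup>+x. indicator A (wrap x) \<partial>tor)"
      by (rule T[OF _ per]) measurable
    also have "\<dots> = emeasure (distr tor borel wrap) A"
      by (simp add: nn_integral_distr flip: nn_integral_indicator)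
    finally show "emeasure (distr tor borel (\<lambda>x. wrap (T x))) A = emeasure (distr tor borel wrap) A" .
  qed simp
  have "integrable tor (\<lambda>x. f (T x)) \<longleftrightarrow> integrable (distr tor borel (\<lambda>x. wrap (T x))) f"
    by (subst integrable_distr_eq) (simp_all add: periodic_wrap[OF assms(3)])
  moreover have "integrable tor f \<longleftrightarrow> integrable (distr tor borel wrap) f"
    by (subst integrable_distr_eq) (simp_all add: periodic_wrap[OF assms(3)])
  ultimately show "integrable tor (\<lambda>x. f (T x)) \<longleftrightarrow> integrable tor f"
    by (simp add: eq)
  have "(LINT x|tor. f (T x)) = (LINT x|distr tor borel (\<lambda>x. wrap (T x)). f x)"
    by (subst integral_distr) (simp_all add: periodic_wrap[OF assms(3)])
  moreover have "(LINT x|tor. f x) = (LINT x|distr tor borel wrap. f x)"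
    by (subst integral_distr) (simp_all add: periodic_wrap[OF assms(3)])
  ultimately show "(LINT x|tor. f (T x)) = (LINT x|tor. f x)"
    by (simp add: eq)
qed

lemma
  fixes f :: "real^'d::finite \<Rightarrow> 'b::{banach,second_countable_topology}"
  assumes "f \<in> borel_measurable borel" "periodic f"
  shows integrable_tor_translate: "integrable tor (\<lambda>x. f (x + a)) \<longleftrightarrow> integrable tor f"
    and integral_tor_translate: "(LINT x|tor. f (x + a)) = (LINT x|tor. f x)"
    and integral_tor_reflect: "(LINT x|tor. f (- x)) = (LINT x|tor. f x)"
proof -
  have [measurable]: "(\<lambda>x::real^'d. x + a) \<in> borel_measurable borel" by simp
  note tr = integral_tor_invariant[where T = "\<lambda>x. x + a", OF this assms nn_integral_tor_translate]
  show "integrable tor (\<lambda>x. f (x + a)) \<longleftrightarrow> integrable tor f" by (rule tr(1))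
  show "(LINT x|tor. f (x + a)) = (LINT x|tor. f x)" by (rule tr(2))
  show "(LINT x|tor. f (- x)) = (LINT x|tor. f x)"
    by (rule integral_tor_invariant(2)[where T = uminus, OF _ assms nn_integral_tor_reflect]) simp
qed

text \<open>A shift by half a period in a direction i with \<open>k $ i\<close> nonzero changes the
  sign of the character but not its integral.\<close>

lemma integral_character: "(LINT x|tor. character k x) = (if k = 0 then 1 else 0)"
proof (cases "k = 0")
  case True
  then show ?thesis by (simp add: tor.prob_space)
next
  case False
  then obtain i where i: "k $ i \<noteq> 0" by (auto simp: vec_eq_iff)
  define a :: "real^'a" where "a = (1 / (2 * real_of_int (k $ i))) *\<^sub>R axis i 1"
  have "character k a = -1"
    using i by (simp add: a_def character_axis)
  then have "(LINT x|tor. character k (x + a)) = - (LINT x|tor. character k x)"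
    by (simp add: character_add)
  moreover have "(LINT x|tor. character k (x + a)) = (LINT x|tor. character k x)"
    by (rule integral_tor_translate) (auto simp: periodic_def)
  ultimately show ?thesis using False by simp
qed

lemma integrable_character [simp]: "integrable tor (character k)"
  by (rule integrable_tor_bounded[where B = 1]) simp_all

lemma torus_integral_character_mult:
  "torus_integral (\<lambda>x. character k x * character l x) = (if l = - k then 1 else 0)"
proof -
  have "(k + l = 0) = (l = - k)" by (simp add: add_eq_0_iff)
  then show ?thesis
    by (simp add: torus_integral_tor integral_character flip: character_add_index)
qed

section \<open>Fourier coefficients of test functions\<close>

lemma borel_measurable_cnj [measurable]: "cnj \<in> borel_measurable borel"
  by (intro borel_measurable_continuous_onI continuous_intros)

text \<open>\<open>partial\<close> is defined by a derivative at parameter 0 only; moving the base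
  point along the line gives the derivative at every parameter, as the mean value theorem
  requires.\<close>

lemma line_derivative:
  fixes g :: "real^'d::finite \<Rightarrow> 'b::real_normed_vector"
  assumes "\<And>x. ((\<lambda>t. g (x + t *\<^sub>R v)) has_vector_derivative g' x) (at 0)"
  shows "((\<lambda>t. g (x + t *\<^sub>R v)) has_vector_derivative g' (x + s *\<^sub>R v)) (at s)"
proof -
  have "((\<lambda>t. t - s) has_vector_derivative 1) (at s)"
    by (auto intro!: derivative_eq_intros)
  moreover have "((\<lambda>t. g ((x + s *\<^sub>R v) + t *\<^sub>R v)) has_vector_derivative g' (x + s *\<^sub>R v)) (at (s - s))"
    using assms by simp
  ultimately have "((\<lambda>t. g ((x + s *\<^sub>R v) + t *\<^sub>R v)) \<circ> (\<lambda>t. t - s) has_vector_derivative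
      1 *\<^sub>R g' (x + s *\<^sub>R v)) (at s)"
    by (rule vector_diff_chain_at)
  then show ?thesis
    by (simp add: comp_def scaleR_diff_left)
qed

text \<open>Iterated partials are identified by guessing: a family indexed by lists of directions,
  in which each member differentiates to the next, must consist of the iterated partials of its
  first member. Every concrete computation of derivatives below is an instance.\<close>

lemma
  fixes F :: "'d::finite list \<Rightarrow> real^'d \<Rightarrow> 'b::real_normed_vector"
  assumes F: "\<And>is i x. length is < n \<Longrightarrow>
      ((\<lambda>t. F is (x + t *\<^sub>R axis i 1)) has_vector_derivative F (i # is) x) (at 0)"
  shows partials_family: "length is \<le> n \<Longrightarrow> partials is (F []) = F is"
    and has_partials_family: "has_partials n (F [])"
proof -
  show P: "length is \<le> n \<Longrightarrow> partials is (F []) = F is" for "is"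
  proof (induction "is")
    case (Cons i js)
    then show ?case
      using F[of js _ i] by (auto simp: fun_eq_iff partial_def intro!: vector_derivative_at)
  qed simp
  show "has_partials n (F [])"
    unfolding has_partials_def
  proof (intro allI impI)
    fix "is" :: "'d list" and i x assume "length is < n"
    then show "(\<lambda>t. partials is (F []) (x + t *\<^sub>R axis i 1)) differentiable at 0"
      using F[of "is" x i] P[of "is"] by (auto intro: differentiableI_vector)
  qed
qed

lemma smooth_family:
  fixes F :: "'d::finite list \<Rightarrow> real^'d \<Rightarrow> 'b::real_normed_vector"
  assumes F: "\<And>is i x. ((\<lambda>t. F is (x + t *\<^sub>R axis i 1)) has_vector_derivative F (i # is) x) (at 0)"
    and c: "\<And>is. continuous_on UNIV (F is)"
  shows "smooth (F [])" "partials is (F []) = F is"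
proof -
  show P: "partials is (F []) = F is" for "is"
    by (rule partials_family[of "length is"]) (simp_all add: F)
  show "smooth (F [])"
    unfolding smooth_def using has_partials_family[of _ F, OF F] by (simp add: P c)
qed

lemma has_partials_deriv:
  assumes "has_partials n f" "length is < n"
  shows "((\<lambda>t. partials is f (x + t *\<^sub>R axis i 1)) has_vector_derivative partials (i # is) f x) (at 0)"
  using assms by (auto simp: has_partials_def partial_def vector_derivative_works[symmetric])

lemma smooth_deriv:
  "smooth f \<Longrightarrow> ((\<lambda>t. partials is f (x + t *\<^sub>R axis i 1)) has_vector_derivative partials (i # is) f x) (at 0)"
  using has_partials_deriv[of "Suc (length is)" f "is" x i] by (simp add: smooth_def del: partials.simps)

lemma smooth_continuous: "smooth f \<Longrightarrow> continuous_on UNIV (partials is f)"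
  by (simp add: smooth_def)

lemma
  fixes f g :: "real^'d::finite \<Rightarrow> complex"
  assumes "smooth f" "smooth g"
  shows smooth_linear: "smooth (\<lambda>x. a * f x + b * g x)"
    and partials_linear: "partials is (\<lambda>x. a * f x + b * g x) = (\<lambda>x. a * partials is f x + b * partials is g x)"
proof -
  let ?F = "\<lambda>is x. a * partials is f x + b * partials is g x"
  have 1: "((\<lambda>t. ?F is (x + t *\<^sub>R axis i 1)) has_vector_derivative ?F (i # is) x) (at 0)" for "is" i x
    by (intro has_vector_derivative_add has_vector_derivative_mult_right smooth_deriv assms)
  have 2: "continuous_on UNIV (?F is)" for "is"
    by (intro continuous_intros smooth_continuous assms)
  show "smooth (\<lambda>x. a * f x + b * g x)"
    using smooth_family(1)[of ?F, OF 1 2] by simp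
  show "partials is (\<lambda>x. a * f x + b * g x) = ?F is"
    using smooth_family(2)[of ?F, OF 1 2] by simp
qed

lemma smooth_cnj:
  fixes f :: "real^'d::finite \<Rightarrow> complex"
  assumes "smooth f"
  shows "smooth (\<lambda>x. cnj (f x))"
proof -
  let ?F = "\<lambda>is x. cnj (partials is f x)"
  have 1: "((\<lambda>t. ?F is (x + t *\<^sub>R axis i 1)) has_vector_derivative ?F (i # is) x) (at 0)" for "is" i x
    by (intro has_vector_derivative_cnj smooth_deriv assms)
  have 2: "continuous_on UNIV (?F is)" for "is"
    by (intro continuous_intros smooth_continuous assms)
  show ?thesis
    using smooth_family(1)[of ?F, OF 1 2] by simp
qed

text \<open>The eigenvalue of the iterated derivative on \<open>character k\<close>.\<close>

definition char_factor :: "int^'d::finite \<Rightarrow> 'd list \<Rightarrow> complex" where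
  "char_factor k is = (\<Prod>i\<leftarrow>is. 2 * pi * \<i> * of_int (k $ i))"

lemma char_factor_simps [simp]:
  "char_factor k [] = 1"
  "char_factor k (i # is) = 2 * pi * \<i> * of_int (k $ i) * char_factor k is"
  by (simp_all add: char_factor_def)

lemma character_deriv:
  "((\<lambda>t. c * character k (x + t *\<^sub>R axis i 1)) has_vector_derivative
     2 * pi * \<i> * of_int (k $ i) * c * character k x) (at 0)"
proof -
  have "((\<lambda>t. character k x * c * exp (of_real t * (2 * pi * \<i> * of_int (k $ i)))) has_vector_derivative
      character k x * c * ((2 * pi * \<i> * of_int (k $ i)) * exp (of_real 0 * (2 * pi * \<i> * of_int (k $ i))))) (at 0)"
    by (intro has_vector_derivative_mult_right)
      (auto intro!: derivative_eq_intros has_vector_derivative_real_field)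
  moreover have "c * character k (x + t *\<^sub>R axis i 1) = character k x * c * exp (of_real t * (2 * pi * \<i> * of_int (k $ i)))" for t
    by (simp add: character_add character_axis cis_conv_exp mult_ac)
  ultimately have "((\<lambda>t. c * character k (x + t *\<^sub>R axis i 1)) has_vector_derivative
      character k x * c * ((2 * pi * \<i> * of_int (k $ i)) * exp (of_real 0 * (2 * pi * \<i> * of_int (k $ i))))) (at 0)"
    by presburger
  then show ?thesis
    by (simp add: mult_ac)
qed

lemma smooth_character: "smooth (character k)"
  and partials_character: "partials is (character k) = (\<lambda>x. char_factor k is * character k x)"
proof -
  let ?F = "\<lambda>is x. char_factor k is * character k x"
  have 1: "((\<lambda>t. ?F is (x + t *\<^sub>R axis i 1)) has_vector_derivative ?F (i # is) x) (at 0)" for "is" i x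
    using character_deriv[of "char_factor k is" k x i] by (simp add: mult_ac)
  have 2: "continuous_on UNIV (?F is)" for "is"
    by (intro continuous_intros)
  show "smooth (character k)"
    using smooth_family(1)[of ?F, OF 1 2] by simp
  show "partials is (character k) = ?F is"
    using smooth_family(2)[of ?F, OF 1 2] by simp
qed

section \<open>Closure properties and boundedness of test functions\<close>

lemma character_test [simp]: "character k \<in> test_functions"
  by (simp add: test_functions_def smooth_character)

lemma test_linear: "\<phi> \<in> test_functions \<Longrightarrow> \<psi> \<in> test_functions \<Longrightarrow> (\<lambda>x. a * \<phi> x + b * \<psi> x) \<in> test_functions"
  by (simp add: test_functions_def smooth_linear)

lemma test_scale: "\<phi> \<in> test_functions \<Longrightarrow> (\<lambda>x. a * \<phi> x) \<in> test_functions"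
  using test_linear[of \<phi> \<phi> a 0] by simp

lemma test_zero: "(\<lambda>x. 0) \<in> test_functions"
  using test_scale[OF character_test, of 0 0] by simp

lemma test_cnj: "\<phi> \<in> test_functions \<Longrightarrow> (\<lambda>x. cnj (\<phi> x)) \<in> test_functions"
  by (simp add: test_functions_def smooth_cnj)

lemma test_sum:
  "(\<And>j. j \<in> I \<Longrightarrow> \<phi> j \<in> test_functions) \<Longrightarrow> (\<lambda>x. \<Sum>j\<in>I. c j * \<phi> j x) \<in> test_functions"
proof (induction I rule: infinite_finite_induct)
  case (insert j I)
  then have "(\<lambda>x. c j * \<phi> j x + 1 * (\<Sum>j\<in>I. c j * \<phi> j x)) \<in> test_functions"
    by (intro test_linear) auto
  with insert show ?case by simp
qed (simp_all add: test_zero)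

lemma test_diff: "\<phi> \<in> test_functions \<Longrightarrow> \<psi> \<in> test_functions \<Longrightarrow> (\<lambda>x. \<phi> x - \<psi> x) \<in> test_functions"
  using test_linear[of \<phi> \<psi> 1 "-1"] by simp

lemma test_Re: "\<phi> \<in> test_functions \<Longrightarrow> (\<lambda>x. complex_of_real (Re (\<phi> x))) \<in> test_functions"
  using test_linear[OF _ test_cnj, of \<phi> \<phi> "1/2" "1/2"] by (simp add: complex_eq_iff[abs_def] complex_add_cnj add_divide_distrib[symmetric])

lemma test_Im: "\<phi> \<in> test_functions \<Longrightarrow> (\<lambda>x. complex_of_real (Im (\<phi> x))) \<in> test_functions"
  using test_Re[OF test_scale[of \<phi> "- \<i>"]] by simp

text \<open>A continuous function is bounded on the compact cube, and \<open>wrap\<close> carries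
  every point there without changing the value.\<close>

lemma continuous_periodic_bounded:
  fixes f :: "real^'d::finite \<Rightarrow> 'b::real_normed_vector"
  assumes "continuous_on UNIV f" "periodic f"
  obtains B where "0 \<le> B" "\<And>x. norm (f x) \<le> B"
proof -
  have "compact (f ` cbox 0 One)"
    by (intro compact_continuous_image compact_cbox continuous_on_subset[OF assms(1)]) simp
  then obtain B where B: "\<And>x. x \<in> cbox 0 One \<Longrightarrow> norm (f x) \<le> B"
    by (meson bounded_iff compact_imp_bounded imageI)
  have "norm (f x) \<le> B" for x
  proof -
    have "wrap x \<in> cbox 0 One"
      by (simp add: mem_box_cart wrap_def less_imp_le[OF frac_lt_1])
    from B[OF this] show ?thesis by (simp add: periodic_wrap[OF assms(2)])
  qed
  moreover have "0 \<le> B" using calculation[of 0] norm_ge_zero order_trans by blast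
  ultimately show thesis using that by blast
qed

lemma periodic_partials: "periodic f \<Longrightarrow> periodic (partials is f)"
proof (induction "is")
  case (Cons i js)
  have "partials js f (x + lattice_vec k + t *\<^sub>R axis i 1) = partials js f (x + t *\<^sub>R axis i 1)" for x k t
  proof -
    have "partials js f ((x + t *\<^sub>R axis i 1) + lattice_vec k) = partials js f (x + t *\<^sub>R axis i 1)"
      using Cons(1)[OF Cons(2)] unfolding periodic_def by blast
    then show ?thesis by (simp add: add_ac)
  qed
  then show ?case by (simp add: periodic_def partial_def)
qed simp

lemma test_periodic: "\<phi> \<in> test_functions \<Longrightarrow> periodic \<phi>"
  by (simp add: test_functions_def periodic_def)

lemma test_smooth: "\<phi> \<in> test_functions \<Longrightarrow> smooth \<phi>"
  by (simp add: test_functions_def)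

lemma test_continuous: "\<phi> \<in> test_functions \<Longrightarrow> continuous_on UNIV \<phi>"
  using smooth_continuous[of \<phi> "[]"] by (simp add: test_functions_def)

lemma test_measurable: "\<phi> \<in> test_functions \<Longrightarrow> \<phi> \<in> borel_measurable borel"
  by (intro borel_measurable_continuous_onI test_continuous)

lemma test_bounded:
  assumes "\<phi> \<in> test_functions"
  obtains B where "0 \<le> B" "\<And>x. cmod (\<phi> x) \<le> B"
  by (rule continuous_periodic_bounded[OF test_continuous[OF assms] test_periodic[OF assms]]) (rule that)

lemma test_integrable: "\<phi> \<in> test_functions \<Longrightarrow> integrable tor \<phi>"
  by (meson integrable_tor_bounded test_bounded test_measurable)

lemma test_partials: "\<phi> \<in> test_functions \<Longrightarrow> partials is \<phi> \<in> test_functions"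
proof -
  assume \<phi>: "\<phi> \<in> test_functions"
  have app: "partials (js @ is) \<phi> = partials js (partials is \<phi>)" for js
    by (induction js) auto
  have 1: "((\<lambda>t. partials (js @ is) \<phi> (x + t *\<^sub>R axis i 1)) has_vector_derivative partials ((i # js) @ is) \<phi> x) (at 0)" for js i x
    using smooth_deriv[OF test_smooth[OF \<phi>]] by simp
  have 2: "continuous_on UNIV (partials (js @ is) \<phi>)" for js
    by (intro smooth_continuous test_smooth \<phi>)
  have "smooth (partials is \<phi>)"
    using smooth_family(1)[of "\<lambda>js. partials (js @ is) \<phi>", OF 1 2] by simp
  then show ?thesis
    using periodic_partials[OF test_periodic[OF \<phi>], of "is"] by (simp add: test_functions_def periodic_def)
qed

text \<open>Pairs with the unconjugated character, hence equals \<open>fourier_coeff\<close> at -k.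
  This is the convention of \<open>spectral_distribution\<close>, so no reflection of the lattice
  appears in covariances.\<close>

definition char_coeff :: "(real^'d::finite \<Rightarrow> complex) \<Rightarrow> int^'d \<Rightarrow> complex" where
  "char_coeff f k = torus_integral (\<lambda>x. character k x * f x)"

lemma char_coeff_tor: "char_coeff f k = (LINT x|tor. character k x * f x)"
  by (simp add: char_coeff_def torus_integral_tor)

lemma char_coeff_integrable:
  assumes "\<phi> \<in> test_functions"
  shows "integrable tor (\<lambda>x. character k x * \<phi> x)"
proof -
  have [measurable]: "\<phi> \<in> borel_measurable borel" using assms by (rule test_measurable)
  obtain B where B: "\<And>x. cmod (\<phi> x) \<le> B" using test_bounded[OF assms] by metis
  show ?thesis
    by (rule integrable_tor_bounded[where B = B]) (simp_all add: norm_mult B)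
qed

lemma char_coeff_character: "char_coeff (character l) k = (if l = - k then 1 else 0)"
  by (simp add: char_coeff_def torus_integral_character_mult)

lemma char_coeff_linear:
  assumes "\<phi> \<in> test_functions" "\<psi> \<in> test_functions"
  shows "char_coeff (\<lambda>x. a * \<phi> x + b * \<psi> x) k = a * char_coeff \<phi> k + b * char_coeff \<psi> k"
proof -
  have "char_coeff (\<lambda>x. a * \<phi> x + b * \<psi> x) k =
      (LINT x|tor. a * (character k x * \<phi> x) + b * (character k x * \<psi> x))"
    unfolding char_coeff_tor by (intro Bochner_Integration.integral_cong) (simp_all add: algebra_simps)
  also have "\<dots> = a * char_coeff \<phi> k + b * char_coeff \<psi> k"
    unfolding char_coeff_tor
    by (subst Bochner_Integration.integral_add) (simp_all add: char_coeff_integrable assms)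
  finally show ?thesis .
qed

lemma char_coeff_sum:
  assumes "\<And>j. j \<in> I \<Longrightarrow> \<phi> j \<in> test_functions"
  shows "char_coeff (\<lambda>x. \<Sum>j\<in>I. c j * \<phi> j x) k = (\<Sum>j\<in>I. c j * char_coeff (\<phi> j) k)"
  using assms
proof (induction I rule: infinite_finite_induct)
  case (insert j I)
  then have "char_coeff (\<lambda>x. c j * \<phi> j x + 1 * (\<Sum>j\<in>I. c j * \<phi> j x)) k =
      c j * char_coeff (\<phi> j) k + 1 * char_coeff (\<lambda>x. \<Sum>j\<in>I. c j * \<phi> j x) k"
    by (intro char_coeff_linear test_sum) auto
  with insert show ?case by simp
qed (simp_all add: char_coeff_tor)

lemma char_coeff_cnj: "char_coeff (\<lambda>x. cnj (\<phi> x)) k = cnj (char_coeff \<phi> (- k))"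
  unfolding char_coeff_tor by (simp add: character_uminus flip: Bochner_Integration.integral_cnj)

lemma cmod_char_coeff_le:
  assumes "\<phi> \<in> test_functions" "\<And>x. cmod (\<phi> x) \<le> B"
  shows "cmod (char_coeff \<phi> k) \<le> B"
proof -
  have "cmod (char_coeff \<phi> k) \<le> (LINT x|tor. cmod (character k x * \<phi> x))"
    unfolding char_coeff_tor by (rule integral_norm_bound)
  also have "\<dots> \<le> (LINT x|(tor :: (real^'a) measure). B)"
    by (intro integral_mono integrable_norm char_coeff_integrable assms) (simp_all add: assms norm_mult)
  finally show ?thesis by (simp add: tor.prob_space)
qed

text \<open>The difference quotients of g have integral zero by translation invariance. The mean
  value inequality bounds them all by a bound for the derivative, so dominated convergence passes
  the zero on to the derivative.\<close>

lemma integral_derivative_zero: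
  fixes g g' :: "real^'d::finite \<Rightarrow> complex"
  assumes g: "\<And>x. ((\<lambda>t. g (x + t *\<^sub>R axis i 1)) has_vector_derivative g' x) (at 0)"
    and c: "continuous_on UNIV g" "continuous_on UNIV g'" and per: "periodic g" "periodic g'"
  shows "(LINT x|tor. g' x) = 0"
proof -
  have [measurable]: "g \<in> borel_measurable borel" "g' \<in> borel_measurable borel"
    by (intro borel_measurable_continuous_onI c)+
  obtain B where B: "\<And>x. cmod (g' x) \<le> B" using continuous_periodic_bounded[OF c(2) per(2)] by metis
  obtain C where C: "\<And>x. cmod (g x) \<le> C" using continuous_periodic_bounded[OF c(1) per(1)] by metis
  define h where "h n = 1 / real (Suc n)" for n
  have h0: "h n > 0" for n by (simp add: h_def)
  have hlim: "h \<longlonglongrightarrow> 0" unfolding h_def by (rule LIMSEQ_Suc[OF lim_1_over_n])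
  define q where "q n x = (g (x + h n *\<^sub>R axis i 1) - g x) /\<^sub>R h n" for n x
  have [measurable]: "q n \<in> borel_measurable borel" for n unfolding q_def by measurable
  have ig: "integrable tor g" by (rule integrable_tor_bounded[OF _ C]) simp
  have ig2: "integrable tor (\<lambda>x. g (x + a))" for a by (rule integrable_tor_bounded[OF _ C]) simp
  have q0: "(LINT x|tor. q n x) = 0" for n
    unfolding q_def using integral_tor_translate[of g "h n *\<^sub>R axis i 1"] per ig ig2 by simp
  have qlim: "(\<lambda>n. q n x) \<longlonglongrightarrow> g' x" for x
  proof -
    have "((\<lambda>t. norm (g (x + t *\<^sub>R axis i 1) - g x - t *\<^sub>R g' x) / norm t) \<longlongrightarrow> 0) (at 0)"
      using g[of x] unfolding has_vector_derivative_def has_derivative_at by simp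
    moreover have "\<forall>\<^sub>F t in at 0. norm (g (x + t *\<^sub>R axis i 1) - g x - t *\<^sub>R g' x) / norm t =
        norm ((g (x + t *\<^sub>R axis i 1) - g x) /\<^sub>R t - g' x)"
    proof (rule eventually_at_filter[THEN iffD2], intro always_eventually allI impI)
      fix t :: real assume "t \<noteq> 0"
      then have "(g (x + t *\<^sub>R axis i 1) - g x) /\<^sub>R t - g' x = (g (x + t *\<^sub>R axis i 1) - g x - t *\<^sub>R g' x) /\<^sub>R t"
        by (simp add: scaleR_diff_right)
      then show "norm (g (x + t *\<^sub>R axis i 1) - g x - t *\<^sub>R g' x) / norm t =
          norm ((g (x + t *\<^sub>R axis i 1) - g x) /\<^sub>R t - g' x)"
        by (simp add: divide_inverse mult.commute)
    qed
    ultimately have "((\<lambda>t. norm ((g (x + t *\<^sub>R axis i 1) - g x) /\<^sub>R t - g' x)) \<longlongrightarrow> 0) (at 0)"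
      by (rule Lim_transform_eventually)
    then have "((\<lambda>t. (g (x + t *\<^sub>R axis i 1) - g x) /\<^sub>R t) \<longlongrightarrow> g' x) (at 0)"
      using LIM_zero_cancel tendsto_norm_zero_iff by blast
    moreover have "filterlim h (at 0) sequentially"
      using hlim h0 by (intro filterlim_atI) (auto intro!: always_eventually simp: less_le)
    ultimately show ?thesis unfolding q_def by (rule filterlim_compose)
  qed
  have qB: "cmod (q n x) \<le> B" for n x
  proof -
    have "norm (g (x + h n *\<^sub>R axis i 1) - g (x + 0 *\<^sub>R axis i 1)) \<le> B * norm (h n - 0)"
      by (rule differentiable_bound[where f' = "\<lambda>s t. t *\<^sub>R g' (x + s *\<^sub>R axis i 1)" and S = UNIV])
        (use line_derivative[OF g] B in \<open>auto simp: has_vector_derivative_def intro!: onorm_le mult_left_mono simp: mult.commute[of B]\<close>)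
    then have "cmod (g (x + h n *\<^sub>R axis i 1) - g x) / h n \<le> B"
      using h0[of n] by (simp add: divide_le_eq)
    then show ?thesis using h0[of n] by (simp add: q_def divide_inverse mult.commute)
  qed
  have "(\<lambda>n. LINT x|tor. q n x) \<longlonglongrightarrow> (LINT x|tor. g' x)"
    by (rule integral_dominated_convergence[where w = "\<lambda>_. B"])
      (use qlim qB in \<open>simp_all add: measurable_tor\<close>)
  then show ?thesis by (simp add: q0 LIMSEQ_const_iff)
qed

text \<open>Integration by parts on the torus: the derivative of \<open>character k\<close> times
  \<phi> integrates to zero, with no boundary term.\<close>

lemma char_coeff_partial:
  assumes "\<phi> \<in> test_functions"
  shows "char_coeff (partial i \<phi>) k = - (2 * pi * \<i> * of_int (k $ i)) * char_coeff \<phi> k"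
proof -
  let ?g = "\<lambda>x. character k x * \<phi> x"
  let ?g' = "\<lambda>x. (2 * pi * \<i> * of_int (k $ i)) * (character k x * \<phi> x) + character k x * partial i \<phi> x"
  have p: "partial i \<phi> \<in> test_functions" using test_partials[OF assms, of "[i]"] by simp
  have d: "((\<lambda>t. ?g (x + t *\<^sub>R axis i 1)) has_vector_derivative ?g' x) (at 0)" for x
    using has_vector_derivative_mult[OF character_deriv[of 1 k x i] smooth_deriv[OF test_smooth[OF assms], of "[]" x i]]
    by (simp add: algebra_simps)
  have "(LINT x|tor. ?g' x) = 0"
  proof (rule integral_derivative_zero[OF d])
    show "continuous_on UNIV ?g" "continuous_on UNIV ?g'"
      by (intro continuous_intros test_continuous p assms)+
    show "periodic ?g" "periodic ?g'"
      using test_periodic[OF assms] test_periodic[OF p] by (simp_all add: periodic_def)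
  qed
  moreover have "(LINT x|tor. ?g' x) = (2 * pi * \<i> * of_int (k $ i)) * char_coeff \<phi> k + char_coeff (partial i \<phi>) k"
    unfolding char_coeff_tor
    by (subst Bochner_Integration.integral_add) (simp_all add: char_coeff_integrable assms p del: of_real_mult)
  ultimately show ?thesis by (simp add: add_eq_0_iff)
qed

lemma char_coeff_replicate:
  assumes "\<phi> \<in> test_functions"
  shows "char_coeff (partials (replicate n i) \<phi>) k = (- (2 * pi * \<i> * of_int (k $ i))) ^ n * char_coeff \<phi> k"
  by (induction n) (simp_all add: char_coeff_partial[OF test_partials[OF assms]])

section \<open>Boxes in the lattice and the decay of Fourier coefficients\<close>

definition int_box :: "nat \<Rightarrow> (int^'d::finite) set" where
  "int_box n = {k. \<forall>i. \<bar>k $ i\<bar> \<le> int n}"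

lemma int_box_bij: "bij_betw vec_lambda (PiE (UNIV :: 'd::finite set) (\<lambda>_. {- int n..int n})) (int_box n :: (int^'d) set)"
  by (rule bij_betw_byWitness[where f' = vec_nth])
    (auto simp: int_box_def abs_le_iff PiE_iff minus_le_iff)

lemma finite_int_box [simp]: "finite (int_box n)"
  using bij_betw_finite[OF int_box_bij] by (simp add: finite_PiE)

lemma card_int_box: "card (int_box n :: (int^'d::finite) set) = (2 * n + 1) ^ CARD('d)"
proof -
  have "nat (2 * int n + 1) = 2 * n + 1" by simp
  then show ?thesis
    using bij_betw_same_card[OF int_box_bij[of n, where 'd = 'd]] by (simp add: card_PiE)
qed

lemma finite_subset_int_box:
  assumes "finite F"
  shows "\<exists>n. F \<subseteq> (int_box n :: (int^'d::finite) set)"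
proof -
  define n where "n = (\<Sum>k\<in>F. \<Sum>i\<in>UNIV. nat \<bar>k $ i\<bar>)"
  have "k \<in> int_box n" if "k \<in> F" for k
  proof -
    have "nat \<bar>k $ i\<bar> \<le> n" for i
      using member_le_sum[of i UNIV "\<lambda>i. nat \<bar>k $ i\<bar>"] member_le_sum[OF that, of "\<lambda>k. \<Sum>i\<in>UNIV. nat \<bar>k $ i\<bar>"] assms
      by (simp add: n_def)
    then show ?thesis by (simp add: int_box_def nat_le_iff)
  qed
  then show ?thesis by auto
qed

text \<open>The induction runs on the sharper bound 5 - 4/(n+1), which is an equality for n = 0. The
  two new terms at distance a contribute 2/(1 + a^2), which is at most the telescoping difference
  4/a - 4/(a+1).\<close>

lemma sum_inverse_squares_int_bounded: "(\<Sum>j\<in>{- int n..int n}. 1 / (1 + (real_of_int j)\<^sup>2)) \<le> 5"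
proof -
  have "(\<Sum>j\<in>{- int n..int n}. 1 / (1 + (real_of_int j)\<^sup>2)) \<le> 5 - 4 / real (Suc n)"
  proof (induction n)
    case (Suc n)
    define a where "a = real (Suc n)"
    have a: "a \<ge> 1" by (simp add: a_def)
    have "{- int (Suc n)..int (Suc n)} = insert (- int (Suc n)) (insert (int (Suc n)) {- int n..int n})"
      by auto
    then have "(\<Sum>j\<in>{- int (Suc n)..int (Suc n)}. 1 / (1 + (real_of_int j)\<^sup>2)) =
        1 / (1 + (real_of_int (- int (Suc n)))\<^sup>2) + (1 / (1 + (real_of_int (int (Suc n)))\<^sup>2) +
          (\<Sum>j\<in>{- int n..int n}. 1 / (1 + (real_of_int j)\<^sup>2)))"
      by simp
    also have "\<dots> = 2 / (1 + a\<^sup>2) + (\<Sum>j\<in>{- int n..int n}. 1 / (1 + (real_of_int j)\<^sup>2))"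
      unfolding a_def of_int_minus of_int_of_nat_eq power2_minus by simp
    also have "\<dots> \<le> 2 / (1 + a\<^sup>2) + (5 - 4 / a)"
      using Suc by (simp add: a_def)
    also have "\<dots> \<le> 5 - 4 / (a + 1)"
    proof -
      have "2 / (1 + a\<^sup>2) \<le> 4 / (a * (a + 1))"
      proof -
        have "0 \<le> (a - 1)\<^sup>2" "0 \<le> a * a" by simp_all
        then have "2 * (a * (a + 1)) \<le> 4 * (1 + a\<^sup>2)"
          unfolding power2_eq_square by (simp only: algebra_simps)
        moreover have "0 < 1 + a\<^sup>2" "0 < a * (a + 1)" using a by (simp_all add: add_pos_nonneg)
        ultimately show ?thesis by (simp add: divide_le_eq le_divide_eq mult_ac)
      qed
      also have "\<dots> = 4 / a - 4 / (a + 1)"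
        using a by (simp add: field_simps)
      finally show ?thesis by simp
    qed
    finally show ?case by (simp add: a_def add.commute)
  qed simp
  also have "\<dots> \<le> 5" by simp
  finally show ?thesis .
qed

lemma lattice_vec_component [simp]: "lattice_vec k $ i = real_of_int (k $ i)"
  by (simp add: lattice_vec_def)

lemma norm_lattice_vec_sq: "(norm (lattice_vec k))\<^sup>2 = (\<Sum>i\<in>UNIV. (real_of_int (k $ i))\<^sup>2)"
  unfolding power2_norm_eq_inner by (simp add: inner_vec_def power2_eq_square)

text \<open>Each factor 1 + |k|^2 dominates 1 + k_i^2, so the d-th power dominates the product over
  the coordinates. The sum of that product over a box factorises into d one-dimensional sums, each
  at most 5.\<close>

lemma summable_lattice_weight:
  "(\<lambda>k::int^'d::finite. 1 / (1 + (norm (lattice_vec k))\<^sup>2) ^ CARD('d)) summable_on UNIV"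
proof (rule nonneg_bdd_above_summable_on)
  define w where "w j = 1 / (1 + (real_of_int j)\<^sup>2)" for j
  have w0: "w j \<ge> 0" for j by (simp add: w_def)
  have le: "1 / (1 + (norm (lattice_vec k))\<^sup>2) ^ CARD('d) \<le> (\<Prod>i\<in>UNIV. w (k $ i))" for k :: "int^'d"
  proof -
    have "(\<Prod>i\<in>(UNIV::'d set). 1 + (real_of_int (k $ i))\<^sup>2) \<le> (\<Prod>i\<in>(UNIV::'d set). 1 + (norm (lattice_vec k))\<^sup>2)"
      unfolding norm_lattice_vec_sq by (intro prod_mono conjI add_left_mono member_le_sum) auto
    then show ?thesis
      unfolding w_def prod_dividef by (intro frac_le) (auto intro!: prod_pos simp: add_pos_nonneg)
  qed
  have box: "(\<Sum>k\<in>(int_box n :: (int^'d) set). \<Prod>i\<in>UNIV. w (k $ i)) \<le> 5 ^ CARD('d)" for n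
  proof -
    have "(\<Sum>k\<in>int_box n. \<Prod>i\<in>(UNIV::'d set). w (k $ i)) = (\<Sum>p\<in>PiE (UNIV::'d set) (\<lambda>_. {- int n..int n}). \<Prod>i\<in>UNIV. w (p i))"
      using sum.reindex_bij_betw[OF int_box_bij, of "\<lambda>k::int^'d. \<Prod>i\<in>UNIV. w (k $ i)" n, symmetric] by simp
    also have "\<dots> = (\<Prod>i\<in>(UNIV::'d set). \<Sum>j\<in>{- int n..int n}. w j)"
      by (subst prod_sum_PiE) auto
    also have "\<dots> \<le> (\<Prod>i\<in>(UNIV::'d set). 5)"
      by (intro prod_mono conjI sum_nonneg w0) (simp add: w_def sum_inverse_squares_int_bounded)
    finally show ?thesis by simp
  qed
  show "bdd_above (sum (\<lambda>k::int^'d. 1 / (1 + (norm (lattice_vec k))\<^sup>2) ^ CARD('d)) ` {F. F \<subseteq> UNIV \<and> finite F})"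
  proof (rule bdd_aboveI2)
    fix F :: "(int^'d) set" assume "F \<in> {F. F \<subseteq> UNIV \<and> finite F}"
    then obtain n where n: "F \<subseteq> int_box n" using finite_subset_int_box by auto
    have "(\<Sum>k\<in>F. 1 / (1 + (norm (lattice_vec k))\<^sup>2) ^ CARD('d)) \<le> (\<Sum>k\<in>F. \<Prod>i\<in>UNIV. w (k $ i))"
      by (intro sum_mono le)
    also have "\<dots> \<le> (\<Sum>k\<in>(int_box n :: (int^'d) set). \<Prod>i\<in>UNIV. w (k $ i))"
      by (intro sum_mono2 n finite_int_box prod_nonneg w0)
    finally have "(\<Sum>k\<in>F. 1 / (1 + (norm (lattice_vec k))\<^sup>2) ^ CARD('d)) \<le> (\<Sum>k\<in>(int_box n :: (int^'d) set). \<Prod>i\<in>UNIV. w (k $ i))" .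
    then show "(\<Sum>k\<in>F. 1 / (1 + (norm (lattice_vec k))\<^sup>2) ^ CARD('d)) \<le> 5 ^ CARD('d)"
      using box[of n] by linarith
  qed
qed simp

text \<open>For the largest component k_i one has |k|^2 \<le> d k_i^2. Differentiating 2d times in
  that direction multiplies the coefficient by a number of modulus at least k_i^(2d), while the
  result stays bounded by the sup norm of the derivative.\<close>

lemma char_coeff_decay:
  assumes "\<phi> \<in> (test_functions :: (real^'d::finite \<Rightarrow> complex) set)"
  obtains C where "0 \<le> C" "\<And>k. cmod (char_coeff \<phi> k) \<le> C * (1 / (1 + (norm (lattice_vec k))\<^sup>2) ^ CARD('d))"
proof -
  let ?d = "CARD('d)"
  obtain B where B: "0 \<le> B" "\<And>x. cmod (\<phi> x) \<le> B" using test_bounded[OF assms] by metis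
  have "\<forall>i. \<exists>B\<ge>0. \<forall>x. cmod (partials (replicate (2 * ?d) i) \<phi> x) \<le> B"
    using test_bounded[OF test_partials[OF assms]] by metis
  then obtain D where D: "\<And>i. 0 \<le> D i" "\<And>i x. cmod (partials (replicate (2 * ?d) i) \<phi> x) \<le> D i"
    by metis
  define C where "C = 2 ^ ?d * (B + real ?d ^ ?d * (\<Sum>i\<in>UNIV. D i))"
  have "cmod (char_coeff \<phi> k) \<le> C * (1 / (1 + (norm (lattice_vec k))\<^sup>2) ^ ?d)" for k
  proof -
    define N where "N = (norm (lattice_vec k))\<^sup>2"
    define a where "a = cmod (char_coeff \<phi> k)"
    have N0: "0 \<le> N" and a0: "0 \<le> a" by (simp_all add: N_def a_def)
    have aB: "a \<le> B" unfolding a_def by (rule cmod_char_coeff_le[OF assms B(2)])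
    obtain i where i: "\<And>j. (real_of_int (k $ j))\<^sup>2 \<le> (real_of_int (k $ i))\<^sup>2"
    proof -
      define f where "f = (\<lambda>j. (real_of_int (k $ j))\<^sup>2)"
      have "Max (range f) \<in> range f" by (rule Max_in) auto
      then obtain i where "f i = Max (range f)" by (metis imageE)
      then have "f j \<le> f i" for j by simp
      then show thesis using that[of i] unfolding f_def by blast
    qed
    have "N \<le> real ?d * (real_of_int (k $ i))\<^sup>2"
      unfolding N_def norm_lattice_vec_sq using sum_bounded_above[of UNIV "\<lambda>j. (real_of_int (k $ j))\<^sup>2", OF i] by simp
    then have "N ^ ?d \<le> (real ?d * (real_of_int (k $ i))\<^sup>2) ^ ?d"
      using N0 by (rule power_mono)
    also have "\<dots> = real ?d ^ ?d * \<bar>real_of_int (k $ i)\<bar> ^ (2 * ?d)"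
      by (simp add: power_mult_distrib power_mult)
    also have "\<dots> \<le> real ?d ^ ?d * (2 * pi * \<bar>real_of_int (k $ i)\<bar>) ^ (2 * ?d)"
      using pi_ge_two by (intro mult_left_mono power_mono) (auto simp: mult_le_cancel_right1)
    finally have "N ^ ?d * a \<le> real ?d ^ ?d * ((2 * pi * \<bar>real_of_int (k $ i)\<bar>) ^ (2 * ?d) * a)"
      by (subst mult.assoc[symmetric]) (rule mult_right_mono[OF _ a0])
    also have "(2 * pi * \<bar>real_of_int (k $ i)\<bar>) ^ (2 * ?d) * a = cmod (char_coeff (partials (replicate (2 * ?d) i) \<phi>) k)"
      unfolding char_coeff_replicate[OF assms] a_def by (simp add: norm_mult norm_power)
    also have "\<dots> \<le> D i" by (rule cmod_char_coeff_le[OF test_partials[OF assms] D(2)])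
    also have "D i \<le> (\<Sum>i\<in>UNIV. D i)" by (rule member_le_sum) (auto simp: D)
    finally have Na: "N ^ ?d * a \<le> real ?d ^ ?d * (\<Sum>i\<in>UNIV. D i)"
      by (simp add: mult_left_mono)
    \<comment> \<open>Splits the weight into a constant, paired with the sup bound for \<phi>, and a
      pure power of N, paired with the bound from the derivatives.\<close>
    have "(1 + N) ^ ?d \<le> 2 ^ ?d * (1 + N ^ ?d)"
    proof (cases "N \<le> 1")
      case True
      then have "(1 + N) ^ ?d \<le> 2 ^ ?d" using N0 by (intro power_mono) auto
      also have "\<dots> \<le> 2 ^ ?d * (1 + N ^ ?d)" using N0 by simp
      finally show ?thesis .
    next
      case False
      then have "(1 + N) ^ ?d \<le> (2 * N) ^ ?d" using N0 by (intro power_mono) auto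
      also have "\<dots> \<le> 2 ^ ?d * (1 + N ^ ?d)" by (simp add: power_mult_distrib)
      finally show ?thesis .
    qed
    then have "(1 + N) ^ ?d * a \<le> 2 ^ ?d * (1 + N ^ ?d) * a"
      using a0 by (rule mult_right_mono)
    also have "\<dots> = 2 ^ ?d * (a + N ^ ?d * a)" by (simp add: algebra_simps)
    also have "\<dots> \<le> C" unfolding C_def using aB Na by (intro mult_left_mono add_mono) auto
    finally show ?thesis
      using N0 by (simp add: a_def N_def le_divide_eq add_pos_nonneg mult.commute)
  qed
  moreover have "0 \<le> C" unfolding C_def using B D by (intro mult_nonneg_nonneg add_nonneg_nonneg sum_nonneg) auto
  ultimately show thesis using that by blast
qed

lemma char_coeff_summable:
  assumes "\<phi> \<in> (test_functions :: (real^'d::finite \<Rightarrow> complex) set)"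
  shows "(\<lambda>k. cmod (char_coeff \<phi> k)) summable_on UNIV"
proof -
  obtain C where "\<And>k. cmod (char_coeff \<phi> k) \<le> C * (1 / (1 + (norm (lattice_vec k))\<^sup>2) ^ CARD('d))"
    using char_coeff_decay[OF assms] by metis
  then show ?thesis
    by (intro summable_on_comparison_test[OF summable_on_cmult_right[OF summable_lattice_weight, of C]]) auto
qed

text \<open>Expand the nonnegative integral of |f - s|^2, where s is the partial Fourier sum over F:
  both mixed terms and the square of s have the same integral T, which leaves the integral of |f|^2
  minus T.\<close>

lemma bessel_inequality:
  assumes "f \<in> borel_measurable borel" "\<And>x. cmod (f x) \<le> B" and F: "finite F"
  shows "(\<Sum>k\<in>F. (cmod (char_coeff f k))\<^sup>2) \<le> B\<^sup>2"
proof -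
  note [measurable] = assms(1)
  define c where "c k = char_coeff f k" for k
  \<comment> \<open>The index -k belongs to the convention of \<open>char_coeff\<close>: the
    coefficient at k is the inner product of f with \<open>character (- k)\<close>.\<close>
  define s where "s x = (\<Sum>k\<in>F. c k * character (- k) x)" for x
  have [measurable]: "s \<in> borel_measurable borel" unfolding s_def by measurable
  have sB: "cmod (s x) \<le> (\<Sum>k\<in>F. cmod (c k))" for x
    unfolding s_def by (rule order_trans[OF norm_sum]) (simp add: norm_mult)
  define S where "S = (\<Sum>k\<in>F. cmod (c k))"
  have B0: "0 \<le> B" using assms(2)[of 0] norm_ge_zero order_trans by blast
  have S0: "0 \<le> S" by (simp add: S_def sum_nonneg)
  have if2: "integrable tor (\<lambda>x. f x * cnj (f x))"
    by (rule integrable_tor_bounded[where B = "B * B"], measurable, simp only: norm_mult complex_mod_cnj)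
      (intro mult_mono assms(2) B0, simp)
  have ifs: "integrable tor (\<lambda>x. f x * cnj (s x))" "integrable tor (\<lambda>x. s x * cnj (f x))"
  proof -
    show "integrable tor (\<lambda>x. f x * cnj (s x))"
      by (rule integrable_tor_bounded[where B = "B * S"], measurable, simp only: norm_mult complex_mod_cnj)
        (intro mult_mono assms(2) B0 sB[folded S_def], simp)
    show "integrable tor (\<lambda>x. s x * cnj (f x))"
      by (rule integrable_tor_bounded[where B = "S * B"], measurable, simp only: norm_mult complex_mod_cnj)
        (intro mult_mono assms(2) S0 sB[folded S_def], simp)
  qed
  have iss: "integrable tor (\<lambda>x. s x * cnj (s x))"
    by (rule integrable_tor_bounded[where B = "S * S"], measurable, simp only: norm_mult complex_mod_cnj)
      (intro mult_mono sB[folded S_def] S0, simp)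
  have ick: "integrable tor (\<lambda>x. character k x * f x)" for k
    by (rule integrable_tor_bounded[where B = B]) (simp_all add: norm_mult assms(2))
  define T where "T = complex_of_real (\<Sum>k\<in>F. (cmod (c k))\<^sup>2)"
  have 1: "(LINT x|tor. f x * cnj (s x)) = T"
  proof -
    have "(LINT x|tor. f x * cnj (s x)) = (LINT x|tor. (\<Sum>k\<in>F. cnj (c k) * (character k x * f x)))"
      by (intro Bochner_Integration.integral_cong) (simp_all add: s_def sum_distrib_left character_uminus mult_ac)
    also have "\<dots> = (\<Sum>k\<in>F. cnj (c k) * c k)"
      by (subst Bochner_Integration.integral_sum) (simp_all add: ick c_def char_coeff_tor)
    also have "\<dots> = T" unfolding T_def of_real_sum complex_norm_square by (simp add: mult.commute)
    finally show ?thesis .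
  qed
  have 2: "(LINT x|tor. s x * cnj (f x)) = T"
  proof -
    have "(LINT x|tor. s x * cnj (f x)) = cnj (LINT x|tor. f x * cnj (s x))"
      by (simp add: mult.commute flip: Bochner_Integration.integral_cnj)
    then show ?thesis by (simp add: 1) (simp add: T_def)
  qed
  have 3: "(LINT x|tor. s x * cnj (s x)) = T"
  proof -
    have "(LINT x|tor. s x * cnj (s x)) = (LINT x|tor. (\<Sum>k\<in>F. \<Sum>l\<in>F. c k * cnj (c l) * character (l - k) x))"
      by (intro Bochner_Integration.integral_cong refl)
        (simp add: s_def sum_product character_uminus character_add_index[of _ "- _", simplified] mult_ac)
    also have "\<dots> = (\<Sum>k\<in>F. \<Sum>l\<in>F. c k * cnj (c l) * (if l = k then 1 else 0))"
      by (subst Bochner_Integration.integral_sum, simp, intro sum.cong refl, subst Bochner_Integration.integral_sum)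
        (auto simp: integral_character)
    also have "\<dots> = (\<Sum>k\<in>F. c k * cnj (c k))"
      using F by (intro sum.cong refl) (simp add: if_distrib cong: if_cong)
    also have "\<dots> = T" unfolding T_def of_real_sum complex_norm_square ..
    finally show ?thesis .
  qed
  have "(LINT x|tor. (f x - s x) * cnj (f x - s x)) =
      (LINT x|tor. f x * cnj (f x) - f x * cnj (s x) - s x * cnj (f x) + s x * cnj (s x))"
    by (intro Bochner_Integration.integral_cong refl) (simp add: algebra_simps)
  also have "\<dots> = (LINT x|tor. f x * cnj (f x)) - T"
    by (simp add: if2 ifs iss 1 2 3)
  finally have "(LINT x|tor. f x * cnj (f x)) - T = (LINT x|tor. complex_of_real ((cmod (f x - s x))\<^sup>2))"
    by (simp only: complex_norm_square)
  also have "\<dots> = complex_of_real (LINT x|tor. (cmod (f x - s x))\<^sup>2)" by (rule integral_complex_of_real)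
  finally have eq: "(LINT x|tor. f x * cnj (f x)) - T = complex_of_real (LINT x|tor. (cmod (f x - s x))\<^sup>2)" .
  have "0 \<le> (LINT x|tor. (cmod (f x - s x))\<^sup>2)"
    by (rule Bochner_Integration.integral_nonneg) simp
  also have "\<dots> = Re (LINT x|tor. f x * cnj (f x)) - Re T"
    using arg_cong[OF eq, of Re] by simp
  finally have "Re T \<le> Re (LINT x|tor. f x * cnj (f x))" by simp
  also have "\<dots> \<le> cmod (LINT x|tor. f x * cnj (f x))" by (rule complex_Re_le_cmod)
  also have "\<dots> \<le> (LINT x|tor. cmod (f x * cnj (f x)))" by (rule integral_norm_bound)
  also have "\<dots> \<le> (LINT x|(tor :: (real^'a) measure). B * B)"
    by (intro integral_mono integrable_norm if2) (auto simp: norm_mult intro!: mult_mono assms(2) B0)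
  finally show ?thesis by (simp add: T_def c_def tor.prob_space power2_eq_square)
qed

text \<open>Diagonalises the covariance: convolution with the reflected conjugate becomes
  multiplication by the conjugate coefficient. Fubini applies because both functions are bounded;
  translation and reflection invariance then separate the two factors.\<close>

lemma char_coeff_conv:
  assumes "\<phi> \<in> test_functions" "\<psi> \<in> test_functions"
  shows "char_coeff (torus_conv \<phi> (conj_reflect \<psi>)) k = char_coeff \<phi> k * cnj (char_coeff \<psi> k)"
proof -
  have [measurable]: "\<phi> \<in> borel_measurable borel" "\<psi> \<in> borel_measurable borel"
    using assms by (simp_all add: test_measurable)
  obtain B where B: "0 \<le> B" "\<And>x. cmod (\<phi> x) \<le> B" using test_bounded[OF assms(1)] by metis
  obtain C where C: "0 \<le> C" "\<And>x. cmod (\<psi> x) \<le> C" using test_bounded[OF assms(2)] by metis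
  interpret P: pair_sigma_finite "tor :: (real^'a) measure" "tor :: (real^'a) measure" ..
  interpret Q: pair_prob_space "tor :: (real^'a) measure" "tor :: (real^'a) measure" ..
  have mt [measurable]: "(\<lambda>x. x) \<in> measurable tor (borel :: (real^'a) measure)"
    by (rule measurable_tor) simp
  have [measurable]: "fst \<in> borel_measurable ((tor :: (real^'a) measure) \<Otimes>\<^sub>M (tor :: (real^'a) measure))"
    using measurable_compose[OF measurable_fst mt] by simp
  have [measurable]: "snd \<in> borel_measurable ((tor :: (real^'a) measure) \<Otimes>\<^sub>M (tor :: (real^'a) measure))"
    using measurable_compose[OF measurable_snd mt] by simp
  let ?h = "\<lambda>x y. character k x * (\<phi> (x - y) * cnj (\<psi> (- y)))"
  have int: "integrable (tor \<Otimes>\<^sub>M tor) (\<lambda>(x, y). ?h x y)"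
    unfolding case_prod_beta
    by (rule Q.P.integrable_const_bound[where B = "B * C"])
      (auto simp: norm_mult intro!: mult_mono B C AE_I2)
  have "char_coeff (torus_conv \<phi> (conj_reflect \<psi>)) k = (LINT x|tor. LINT y|tor. ?h x y)"
    unfolding char_coeff_tor torus_conv_def torus_integral_tor conj_reflect_def
    by simp
  also have "\<dots> = (LINT y|tor. LINT x|tor. ?h x y)"
    by (rule P.Fubini_integral[OF int, symmetric])
  also have "\<dots> = (LINT y|tor. char_coeff \<phi> k * cnj (character k (- y) * \<psi> (- y)))"
  proof (intro Bochner_Integration.integral_cong refl)
    fix y
    have "(LINT x|tor. ?h x y) = (LINT x|tor. character k (x + - y) * \<phi> (x + - y) * (character k y * cnj (\<psi> (- y))))"
    proof (intro Bochner_Integration.integral_cong refl)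
      fix x
      have "character k x = character k (x + - y) * character k y"
        by (simp flip: character_add)
      then show "?h x y = character k (x + - y) * \<phi> (x + - y) * (character k y * cnj (\<psi> (- y)))"
        by simp
    qed
    also have "\<dots> = (LINT x|tor. character k (x + - y) * \<phi> (x + - y)) * (character k y * cnj (\<psi> (- y)))"
      by simp
    also have "(LINT x|tor. character k (x + - y) * \<phi> (x + - y)) = char_coeff \<phi> k"
      unfolding char_coeff_tor
      using integral_tor_translate[of "\<lambda>x. character k x * \<phi> x" "- y"] test_periodic[OF assms(1)]
      by (simp add: periodic_def)
    finally show "(LINT x|tor. ?h x y) = char_coeff \<phi> k * cnj (character k (- y) * \<psi> (- y))"
      by (simp add: character_minus)
  qed
  also have "\<dots> = char_coeff \<phi> k * cnj (LINT y|tor. character k (- y) * \<psi> (- y))"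
    by (simp del: complex_cnj_mult)
  also have "(LINT y|tor. character k (- y) * \<psi> (- y)) = char_coeff \<psi> k"
    unfolding char_coeff_tor
    using integral_tor_reflect[of "\<lambda>x. character k x * \<psi> x"] test_periodic[OF assms(2)]
    by (simp add: periodic_def)
  finally show ?thesis .
qed

lemma spectral_distribution_conv:
  assumes "\<phi> \<in> test_functions" "\<psi> \<in> test_functions"
  shows "spectral_distribution \<mu> (torus_conv \<phi> (conj_reflect \<psi>)) =
    (\<Sum>\<^sub>\<infinity>k. complex_of_real (measure \<mu> {k}) * (char_coeff \<phi> k * cnj (char_coeff \<psi> k)))"
  unfolding spectral_distribution_def char_coeff_conv[OF assms, symmetric] by (simp add: char_coeff_def)

section \<open>Square-integrable series and stationary fields\<close>

lemma integrable_l2_mult: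
  fixes f g :: "'a \<Rightarrow> complex"
  assumes [measurable]: "f \<in> borel_measurable M" "g \<in> borel_measurable M"
    and "integrable M (\<lambda>\<omega>. (cmod (f \<omega>))\<^sup>2)" "integrable M (\<lambda>\<omega>. (cmod (g \<omega>))\<^sup>2)"
  shows "integrable M (\<lambda>\<omega>. f \<omega> * g \<omega>)" "integrable M (\<lambda>\<omega>. f \<omega> * cnj (g \<omega>))"
proof -
  have i: "integrable M (\<lambda>\<omega>. (cmod (f \<omega>))\<^sup>2 + (cmod (g \<omega>))\<^sup>2)"
    using assms by simp
  have b: "norm (cmod (f \<omega>) * cmod (g \<omega>)) \<le> norm ((cmod (f \<omega>))\<^sup>2 + (cmod (g \<omega>))\<^sup>2)" for \<omega>
  proof -
    have "cmod (f \<omega>) * cmod (g \<omega>) \<le> 2 * cmod (f \<omega>) * cmod (g \<omega>)" by simp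
    also have "\<dots> \<le> (cmod (f \<omega>))\<^sup>2 + (cmod (g \<omega>))\<^sup>2" by (rule sum_squares_bound)
    finally show ?thesis by simp
  qed
  show "integrable M (\<lambda>\<omega>. f \<omega> * g \<omega>)" "integrable M (\<lambda>\<omega>. f \<omega> * cnj (g \<omega>))"
    using b by (auto intro!: Bochner_Integration.integrable_bound[OF i] simp: norm_mult)
qed

lemma (in prob_space) integrable_l2:
  fixes f :: "'a \<Rightarrow> complex"
  assumes "f \<in> borel_measurable M" "integrable M (\<lambda>\<omega>. (cmod (f \<omega>))\<^sup>2)"
  shows "integrable M f"
  using integrable_l2_mult(1)[of f M "\<lambda>_. 1"] assms by simp

text \<open>Almost sure absolute convergence together with one square-integrable bound for all
  partial sums. This allows dominated convergence for means, squared norms and inner products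
  alike.\<close>

definition l2_dominated :: "'a measure \<Rightarrow> (nat \<Rightarrow> 'a \<Rightarrow> complex) \<Rightarrow> bool" where
  "l2_dominated M Y \<longleftrightarrow> (\<forall>n. Y n \<in> borel_measurable M) \<and>
     (AE \<omega> in M. summable (\<lambda>n. cmod (Y n \<omega>))) \<and>
     (\<exists>D. D \<in> borel_measurable M \<and> integrable M (\<lambda>\<omega>. (D \<omega>)\<^sup>2) \<and>
        (AE \<omega> in M. \<forall>N. cmod (\<Sum>n<N. Y n \<omega>) \<le> D \<omega>))"

text \<open>With weights \<open>v\<close> of finite sum \<open>V\<close>, Cauchy--Schwarz bounds every partial sum by
  \<open>(V \<Sum> |Y n|\<^sup>2 / v n)\<^sup>1\<^sup>/\<^sup>2\<close>, which is square integrable by monotone convergence.\<close>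

lemma (in prob_space) l2_dominatedI:
  assumes [measurable]: "\<And>n. Y n \<in> borel_measurable M"
    and int: "\<And>n. integrable M (\<lambda>\<omega>. (cmod (Y n \<omega>))\<^sup>2)"
    and le: "\<And>n. (LINT \<omega>|M. (cmod (Y n \<omega>))\<^sup>2) \<le> (w n)\<^sup>2"
    and w: "\<And>n. 0 \<le> w n" "summable w"
  shows "l2_dominated M Y"
proof -
  \<comment> \<open>The geometric term keeps v strictly positive, so that division by v n is
    legitimate even where w n = 0.\<close>
  define v where "v n = w n + (1/2) ^ n" for n
  have v0: "v n > 0" for n using w(1)[of n] by (simp add: v_def add_nonneg_pos)
  have vs: "summable v" unfolding v_def by (intro summable_add w summable_geometric) simp
  define V where "V = suminf v"
  have V0: "0 \<le> V" unfolding V_def using v0 by (intro suminf_nonneg vs) (simp add: less_imp_le)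
  define g where "g \<omega> = (\<Sum>n. ennreal ((cmod (Y n \<omega>))\<^sup>2 / v n))" for \<omega>
  have [measurable]: "g \<in> borel_measurable M" unfolding g_def by measurable
  have "(\<integral>\<^sup>+\<omega>. g \<omega> \<partial>M) = (\<Sum>n. \<integral>\<^sup>+\<omega>. ennreal ((cmod (Y n \<omega>))\<^sup>2 / v n) \<partial>M)"
    unfolding g_def by (intro nn_integral_suminf) measurable
  also have "\<dots> \<le> (\<Sum>n. ennreal (v n))"
  proof (intro suminf_le summableI)
    fix n
    have "(\<integral>\<^sup>+\<omega>. ennreal ((cmod (Y n \<omega>))\<^sup>2 / v n) \<partial>M) = ennreal ((LINT \<omega>|M. (cmod (Y n \<omega>))\<^sup>2) / v n)"
      using int[of n] v0[of n] by (subst nn_integral_eq_integral) (auto simp: less_imp_le)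
    also have "\<dots> \<le> ennreal (v n)"
    proof (rule ennreal_leI)
      have "(LINT \<omega>|M. (cmod (Y n \<omega>))\<^sup>2) \<le> (v n)\<^sup>2"
        by (rule order_trans[OF le power_mono]) (simp_all add: v_def w)
      then show "(LINT \<omega>|M. (cmod (Y n \<omega>))\<^sup>2) / v n \<le> v n"
        using v0[of n] by (simp add: divide_le_eq power2_eq_square)
    qed
    finally show "(\<integral>\<^sup>+\<omega>. ennreal ((cmod (Y n \<omega>))\<^sup>2 / v n) \<partial>M) \<le> ennreal (v n)" .
  qed
  also have "\<dots> = ennreal V"
    unfolding V_def using v0 vs by (intro suminf_ennreal2) (auto simp: less_imp_le)
  finally have gi: "(\<integral>\<^sup>+\<omega>. g \<omega> \<partial>M) \<le> ennreal V" .
  then have "(\<integral>\<^sup>+\<omega>. g \<omega> \<partial>M) \<noteq> \<infinity>" by (auto simp: top_unique)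
  then have fin: "AE \<omega> in M. g \<omega> \<noteq> \<infinity>" by (intro nn_integral_PInf_AE) auto
  define D where "D \<omega> = sqrt (V * enn2real (g \<omega>))" for \<omega>
  have D2: "(D \<omega>)\<^sup>2 = V * enn2real (g \<omega>)" for \<omega> using V0 by (simp add: D_def)
  have ge: "AE \<omega> in M. ennreal (enn2real (g \<omega>)) = g \<omega>"
    using fin by eventually_elim (simp add: less_top)
  have "integrable M (\<lambda>\<omega>. enn2real (g \<omega>))"
  proof (rule integrableI_nonneg)
    have "(\<integral>\<^sup>+\<omega>. ennreal (enn2real (g \<omega>)) \<partial>M) = (\<integral>\<^sup>+\<omega>. g \<omega> \<partial>M)"
      using ge by (intro nn_integral_cong_AE)
    then show "(\<integral>\<^sup>+\<omega>. ennreal (enn2real (g \<omega>)) \<partial>M) < \<infinity>"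
      using gi by (simp add: le_less_trans[OF _ ennreal_less_top])
  qed auto
  then have 1: "integrable M (\<lambda>\<omega>. (D \<omega>)\<^sup>2)" by (simp add: D2)
  have 2: "D \<in> borel_measurable M" unfolding D_def by measurable
  have 3: "AE \<omega> in M. summable (\<lambda>n. cmod (Y n \<omega>)) \<and> (\<forall>N. cmod (\<Sum>n<N. Y n \<omega>) \<le> D \<omega>)"
    using fin
  proof eventually_elim
    fix \<omega> assume fin: "g \<omega> \<noteq> \<infinity>"
    define z where "z n = (cmod (Y n \<omega>))\<^sup>2 / v n" for n
    have z0: "0 \<le> z n" for n using v0[of n] by (simp add: z_def)
    have zs: "summable z" using fin z0 unfolding g_def z_def[symmetric] by (intro summable_suminf_not_top) auto
    have gz: "g \<omega> = ennreal (suminf z)"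
      unfolding g_def z_def[symmetric] by (rule suminf_ennreal2[OF z0 zs])
    \<comment> \<open>From v |Y| \<le> v^2 + |Y|^2 after division by v; both bounding series are
      summable, hence so is |Y|.\<close>
    have "cmod (Y n \<omega>) \<le> v n + z n" for n
    proof -
      have "0 \<le> (v n - cmod (Y n \<omega>))\<^sup>2" "0 \<le> cmod (Y n \<omega>) * v n" using v0[of n] by simp_all
      then have "cmod (Y n \<omega>) * v n \<le> v n * v n + (cmod (Y n \<omega>))\<^sup>2"
        by (simp add: power2_eq_square algebra_simps)
      then have "cmod (Y n \<omega>) \<le> (v n * v n + (cmod (Y n \<omega>))\<^sup>2) / v n"
        using v0[of n] by (simp add: le_divide_eq)
      then show ?thesis using v0[of n] by (simp add: z_def add_divide_distrib)
    qed
    then have "summable (\<lambda>n. cmod (Y n \<omega>))"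
      by (intro summable_comparison_test'[OF summable_add[OF vs zs], of 0]) simp
    moreover have "cmod (\<Sum>n<N. Y n \<omega>) \<le> D \<omega>" for N
    proof -
      have "(\<Sum>n<N. cmod (Y n \<omega>))\<^sup>2 = (\<Sum>n<N. sqrt (v n) * (cmod (Y n \<omega>) / sqrt (v n)))\<^sup>2"
        using v0 by (simp add: less_imp_neq[OF v0, symmetric])
      also have "\<dots> \<le> (\<Sum>n<N. (sqrt (v n))\<^sup>2) * (\<Sum>n<N. (cmod (Y n \<omega>) / sqrt (v n))\<^sup>2)"
        by (rule Cauchy_Schwarz_ineq_sum)
      also have "\<dots> = (\<Sum>n<N. v n) * (\<Sum>n<N. z n)"
        using v0 by (simp add: z_def power_divide less_imp_le)
      also have "\<dots> \<le> V * suminf z"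
        unfolding V_def using v0 z0 V0
        by (intro mult_mono sum_le_suminf vs zs sum_nonneg) (auto simp: less_imp_le V_def)
      also have "\<dots> = (D \<omega>)\<^sup>2" using z0 zs by (simp add: D2 gz suminf_nonneg)
      finally have "(\<Sum>n<N. cmod (Y n \<omega>)) \<le> D \<omega>"
        by (rule power2_le_imp_le) (use V0 in \<open>simp add: D_def\<close>)
      then show ?thesis using norm_sum[of "\<lambda>n. Y n \<omega>" "{..<N}"] by simp
    qed
    ultimately show "summable (\<lambda>n. cmod (Y n \<omega>)) \<and> (\<forall>N. cmod (\<Sum>n<N. Y n \<omega>) \<le> D \<omega>)" by blast
  qed
  have "AE \<omega> in M. summable (\<lambda>n. cmod (Y n \<omega>))" "AE \<omega> in M. \<forall>N. cmod (\<Sum>n<N. Y n \<omega>) \<le> D \<omega>"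
    using 3 by (auto elim!: eventually_mono)
  with 1 2 show ?thesis unfolding l2_dominated_def using assms(1) by blast
qed

section \<open>Limits of means, norms and inner products of dominated series\<close>

context prob_space
begin

lemma l2_dominated_sum_measurable: "l2_dominated M Y \<Longrightarrow> (\<lambda>\<omega>. \<Sum>n. Y n \<omega>) \<in> borel_measurable M"
  unfolding l2_dominated_def by (intro borel_measurable_suminf) auto

lemma l2_dominated_sums: "l2_dominated M Y \<Longrightarrow> AE \<omega> in M. (\<lambda>N. \<Sum>n<N. Y n \<omega>) \<longlonglongrightarrow> (\<Sum>n. Y n \<omega>)"
  unfolding l2_dominated_def by (auto elim!: eventually_mono intro!: summable_LIMSEQ dest: summable_norm_cancel)

lemma l2_dominated_bound:
  assumes "l2_dominated M Y"
  obtains D where "D \<in> borel_measurable M" "integrable M (\<lambda>\<omega>. (D \<omega>)\<^sup>2)"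
    "AE \<omega> in M. 0 \<le> D \<omega> \<and> cmod (\<Sum>n. Y n \<omega>) \<le> D \<omega> \<and> (\<forall>N. cmod (\<Sum>n<N. Y n \<omega>) \<le> D \<omega>)"
proof -
  obtain D where D: "D \<in> borel_measurable M" "integrable M (\<lambda>\<omega>. (D \<omega>)\<^sup>2)"
      "AE \<omega> in M. \<forall>N. cmod (\<Sum>n<N. Y n \<omega>) \<le> D \<omega>"
    using assms unfolding l2_dominated_def by blast
  have "AE \<omega> in M. 0 \<le> D \<omega> \<and> cmod (\<Sum>n. Y n \<omega>) \<le> D \<omega> \<and> (\<forall>N. cmod (\<Sum>n<N. Y n \<omega>) \<le> D \<omega>)"
    using D(3) l2_dominated_sums[OF assms]
  proof eventually_elim
    case (elim \<omega>)
    then have "cmod (\<Sum>n. Y n \<omega>) \<le> D \<omega>"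
      by (intro LIMSEQ_le_const2[OF tendsto_norm]) auto
    with elim show ?case using order_trans[OF norm_ge_zero] by blast
  qed
  with D that show thesis by blast
qed

lemma l2_dominated_square_integrable:
  assumes "l2_dominated M Y"
  shows "integrable M (\<lambda>\<omega>. (cmod (\<Sum>n. Y n \<omega>))\<^sup>2)"
    and "integrable M (\<lambda>\<omega>. (cmod (\<Sum>n<N. Y n \<omega>))\<^sup>2)"
proof -
  note [measurable] = l2_dominated_sum_measurable[OF assms]
  have [measurable]: "Y n \<in> borel_measurable M" for n using assms by (simp add: l2_dominated_def)
  obtain D where D: "D \<in> borel_measurable M" "integrable M (\<lambda>\<omega>. (D \<omega>)\<^sup>2)"
    "AE \<omega> in M. 0 \<le> D \<omega> \<and> cmod (\<Sum>n. Y n \<omega>) \<le> D \<omega> \<and> (\<forall>N. cmod (\<Sum>n<N. Y n \<omega>) \<le> D \<omega>)"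
    using l2_dominated_bound[OF assms] .
  show "integrable M (\<lambda>\<omega>. (cmod (\<Sum>n. Y n \<omega>))\<^sup>2)"
    by (rule Bochner_Integration.integrable_bound[OF D(2)], simp)
      (use D(3) in eventually_elim, simp add: power_mono)
  show "integrable M (\<lambda>\<omega>. (cmod (\<Sum>n<N. Y n \<omega>))\<^sup>2)"
    by (rule Bochner_Integration.integrable_bound[OF D(2)], simp)
      (use D(3) in eventually_elim, simp add: power_mono)
qed

lemma l2_dominated_norm_limit:
  assumes "l2_dominated M Y"
  shows "(\<lambda>N. LINT \<omega>|M. (cmod ((\<Sum>n<N. Y n \<omega>) - (\<Sum>n. Y n \<omega>)))\<^sup>2) \<longlonglongrightarrow> 0"
proof -
  note [measurable] = l2_dominated_sum_measurable[OF assms]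
  have [measurable]: "Y n \<in> borel_measurable M" for n using assms by (simp add: l2_dominated_def)
  obtain D where D: "D \<in> borel_measurable M" "integrable M (\<lambda>\<omega>. (D \<omega>)\<^sup>2)"
    "AE \<omega> in M. 0 \<le> D \<omega> \<and> cmod (\<Sum>n. Y n \<omega>) \<le> D \<omega> \<and> (\<forall>N. cmod (\<Sum>n<N. Y n \<omega>) \<le> D \<omega>)"
    using l2_dominated_bound[OF assms] .
  have "(\<lambda>N. LINT \<omega>|M. (cmod ((\<Sum>n<N. Y n \<omega>) - (\<Sum>n. Y n \<omega>)))\<^sup>2) \<longlonglongrightarrow> (LINT \<omega>|M. 0)"
  proof (rule integral_dominated_convergence[where w = "\<lambda>\<omega>. 4 * (D \<omega>)\<^sup>2"])
    show "AE \<omega> in M. (\<lambda>N. (cmod ((\<Sum>n<N. Y n \<omega>) - (\<Sum>n. Y n \<omega>)))\<^sup>2) \<longlonglongrightarrow> 0"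
      using l2_dominated_sums[OF assms]
    proof eventually_elim
      case (elim \<omega>)
      then have "(\<lambda>N. (cmod ((\<Sum>n<N. Y n \<omega>) - (\<Sum>n. Y n \<omega>)))\<^sup>2) \<longlonglongrightarrow> (cmod ((\<Sum>n. Y n \<omega>) - (\<Sum>n. Y n \<omega>)))\<^sup>2"
        by (intro tendsto_intros)
      then show ?case by simp
    qed
    show "AE \<omega> in M. norm ((cmod ((\<Sum>n<N. Y n \<omega>) - (\<Sum>n. Y n \<omega>)))\<^sup>2) \<le> 4 * (D \<omega>)\<^sup>2" for N
      using D(3)
    proof eventually_elim
      case (elim \<omega>)
      have "cmod ((\<Sum>n<N. Y n \<omega>) - (\<Sum>n. Y n \<omega>)) \<le> 2 * D \<omega>"
        using elim norm_triangle_ineq4[of "\<Sum>n<N. Y n \<omega>" "\<Sum>n. Y n \<omega>"] by (smt (verit))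
      then have "(cmod ((\<Sum>n<N. Y n \<omega>) - (\<Sum>n. Y n \<omega>)))\<^sup>2 \<le> (2 * D \<omega>)\<^sup>2"
        by (rule power_mono) simp
      then show ?case by (simp add: power_mult_distrib)
    qed
  qed (use D in simp_all)
  then show ?thesis by simp
qed

lemma l2_dominated_inner_limit:
  assumes "l2_dominated M Y" "l2_dominated M Y'"
  shows "(\<lambda>N. LINT \<omega>|M. (\<Sum>n<N. Y n \<omega>) * cnj (\<Sum>n<N. Y' n \<omega>)) \<longlonglongrightarrow> (LINT \<omega>|M. (\<Sum>n. Y n \<omega>) * cnj (\<Sum>n. Y' n \<omega>))"
proof -
  note [measurable] = assms[THEN l2_dominated_sum_measurable]
  have [measurable]: "Y n \<in> borel_measurable M" "Y' n \<in> borel_measurable M" for n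
    using assms by (simp_all add: l2_dominated_def)
  obtain D where D: "D \<in> borel_measurable M" "integrable M (\<lambda>\<omega>. (D \<omega>)\<^sup>2)"
    "AE \<omega> in M. 0 \<le> D \<omega> \<and> cmod (\<Sum>n. Y n \<omega>) \<le> D \<omega> \<and> (\<forall>N. cmod (\<Sum>n<N. Y n \<omega>) \<le> D \<omega>)"
    using l2_dominated_bound[OF assms(1)] .
  obtain E where E: "E \<in> borel_measurable M" "integrable M (\<lambda>\<omega>. (E \<omega>)\<^sup>2)"
    "AE \<omega> in M. 0 \<le> E \<omega> \<and> cmod (\<Sum>n. Y' n \<omega>) \<le> E \<omega> \<and> (\<forall>N. cmod (\<Sum>n<N. Y' n \<omega>) \<le> E \<omega>)"
    using l2_dominated_bound[OF assms(2)] .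
  show ?thesis
  proof (rule integral_dominated_convergence[where w = "\<lambda>\<omega>. (D \<omega>)\<^sup>2 + (E \<omega>)\<^sup>2"])
    show "AE \<omega> in M. (\<lambda>N. (\<Sum>n<N. Y n \<omega>) * cnj (\<Sum>n<N. Y' n \<omega>)) \<longlonglongrightarrow> (\<Sum>n. Y n \<omega>) * cnj (\<Sum>n. Y' n \<omega>)"
      using l2_dominated_sums[OF assms(1)] l2_dominated_sums[OF assms(2)]
      by eventually_elim (intro tendsto_intros)
    show "AE \<omega> in M. norm ((\<Sum>n<N. Y n \<omega>) * cnj (\<Sum>n<N. Y' n \<omega>)) \<le> (D \<omega>)\<^sup>2 + (E \<omega>)\<^sup>2" for N
      using D(3) E(3)
    proof eventually_elim
      case (elim \<omega>)
      then have "norm ((\<Sum>n<N. Y n \<omega>) * cnj (\<Sum>n<N. Y' n \<omega>)) \<le> D \<omega> * E \<omega>"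
        unfolding norm_mult complex_mod_cnj by (intro mult_mono) auto
      also have "\<dots> \<le> (D \<omega>)\<^sup>2 + (E \<omega>)\<^sup>2"
        using sum_squares_bound[of "D \<omega>" "E \<omega>"] mult_nonneg_nonneg[of "D \<omega>" "E \<omega>"] elim by linarith
      finally show ?case .
    qed
  qed (use D E in simp_all)
qed

lemma l2_dominated_mean_limit:
  assumes "l2_dominated M Y"
  shows "(\<lambda>N. LINT \<omega>|M. (\<Sum>n<N. Y n \<omega>)) \<longlonglongrightarrow> (LINT \<omega>|M. (\<Sum>n. Y n \<omega>))"
proof -
  note [measurable] = l2_dominated_sum_measurable[OF assms]
  have [measurable]: "Y n \<in> borel_measurable M" for n using assms by (simp add: l2_dominated_def)
  obtain D where D: "D \<in> borel_measurable M" "integrable M (\<lambda>\<omega>. (D \<omega>)\<^sup>2)"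
    "AE \<omega> in M. 0 \<le> D \<omega> \<and> cmod (\<Sum>n. Y n \<omega>) \<le> D \<omega> \<and> (\<forall>N. cmod (\<Sum>n<N. Y n \<omega>) \<le> D \<omega>)"
    using l2_dominated_bound[OF assms] .
  show ?thesis
  proof (rule integral_dominated_convergence[where w = "\<lambda>\<omega>. 1 + (D \<omega>)\<^sup>2"])
    show "AE \<omega> in M. norm (\<Sum>n<N. Y n \<omega>) \<le> 1 + (D \<omega>)\<^sup>2" for N
      using D(3)
    proof eventually_elim
      case (elim \<omega>)
      then have "norm (\<Sum>n<N. Y n \<omega>) \<le> D \<omega>" by blast
      also have "\<dots> \<le> 1 + (D \<omega>)\<^sup>2"
        using sum_squares_bound[of 1 "D \<omega>"] elim by simp
      finally show ?case .
    qed
  qed (use D l2_dominated_sums[OF assms] in simp_all)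
qed

end

section \<open>Spectral quadratic forms with bounded weights\<close>

lemma summable_on_bounded_mult:
  fixes f :: "'i \<Rightarrow> complex"
  assumes "(\<lambda>k. cmod (f k)) summable_on A" "\<And>k. k \<in> A \<Longrightarrow> cmod (g k) \<le> B"
  shows "(\<lambda>k. cmod (f k * g k)) summable_on A"
proof (rule summable_on_comparison_test)
  show "(\<lambda>k. cmod (f k) * B) summable_on A" by (rule summable_on_cmult_left[OF assms(1)])
  show "cmod (f k * g k) \<le> cmod (f k) * B" if "k \<in> A" for k
    using assms(2)[OF that] by (simp add: norm_mult mult_left_mono)
qed simp

lemma spectral_summable:
  assumes "\<phi> \<in> test_functions" "\<psi> \<in> test_functions" "\<And>k. 0 \<le> m k" "\<And>k. m k \<le> B"
  shows "(\<lambda>k. cmod (complex_of_real (m k) * (char_coeff \<phi> k * cnj (char_coeff \<psi> k)))) summable_on UNIV"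
proof -
  obtain C where C: "\<And>x. cmod (\<psi> x) \<le> C" using test_bounded[OF assms(2)] by metis
  have "cmod (cnj (char_coeff \<psi> k) * complex_of_real (m k)) \<le> C * B" for k
    unfolding norm_mult complex_mod_cnj
    using cmod_char_coeff_le[OF assms(2) C, of k] assms(3,4)[of k] order_trans[OF norm_ge_zero C]
    by (intro mult_mono) auto
  then show ?thesis
    using summable_on_bounded_mult[OF char_coeff_summable[OF assms(1)],
      of "\<lambda>k. cnj (char_coeff \<psi> k) * complex_of_real (m k)" "C * B"] by (simp add: mult_ac)
qed

text \<open>Bessel's inequality with a bounded weight: the variance is controlled by the sup norm of
  the test function, without any of its derivatives.\<close>

lemma spectral_form_le:
  assumes "\<phi> \<in> test_functions" "\<And>x. cmod (\<phi> x) \<le> C" "\<And>k. 0 \<le> m k" "\<And>k. m k \<le> B"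
  shows "Re (\<Sum>\<^sub>\<infinity>k. complex_of_real (m k) * (char_coeff \<phi> k * cnj (char_coeff \<phi> k))) \<le> B * C\<^sup>2"
proof -
  have B0: "0 \<le> B" using assms(3,4)[of 0] by linarith
  have eq: "complex_of_real (m k) * (char_coeff \<phi> k * cnj (char_coeff \<phi> k)) =
      complex_of_real (m k * (cmod (char_coeff \<phi> k))\<^sup>2)" for k
    by (simp add: complex_norm_square[symmetric])
  have s: "(\<lambda>k. m k * (cmod (char_coeff \<phi> k))\<^sup>2) summable_on UNIV"
    using spectral_summable[OF assms(1,1), of m B] assms(3,4) unfolding eq
    by (simp add: norm_mult norm_power)
  have "(\<Sum>\<^sub>\<infinity>k. m k * (cmod (char_coeff \<phi> k))\<^sup>2) \<le> B * C\<^sup>2"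
  proof (rule infsum_le_finite_sums[OF s])
    fix F :: "(int^'a) set" assume F: "finite F"
    have "(\<Sum>k\<in>F. m k * (cmod (char_coeff \<phi> k))\<^sup>2) \<le> B * (\<Sum>k\<in>F. (cmod (char_coeff \<phi> k))\<^sup>2)"
      unfolding sum_distrib_left using assms(4) by (intro sum_mono mult_right_mono) auto
    also have "\<dots> \<le> B * C\<^sup>2"
      using bessel_inequality[OF test_measurable[OF assms(1)] assms(2) F] B0 by (rule mult_left_mono)
    finally show "(\<Sum>k\<in>F. m k * (cmod (char_coeff \<phi> k))\<^sup>2) \<le> B * C\<^sup>2" .
  qed
  moreover have "(\<lambda>k. complex_of_real (m k * (cmod (char_coeff \<phi> k))\<^sup>2)) summable_on UNIV"
    using abs_summable_summable[OF spectral_summable[of \<phi> \<phi> m B, OF assms(1,1,3,4)]] unfolding eq .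
  ultimately show ?thesis unfolding eq by (simp add: infsum_Re[symmetric] del: of_real_mult)
qed

text \<open>For bounded point masses the growth condition holds with exponent d, since the inverse
  d-th power of 1 + |k|^2 is summable over the lattice.\<close>

lemma spectral_measureI:
  fixes \<mu> :: "(int^'d::finite) measure"
  assumes "sets \<mu> = UNIV" "\<And>k. emeasure \<mu> {k} \<le> ennreal B" "0 \<le> B"
  shows "spectral_measure \<mu>"
proof -
  define W where "W = (\<lambda>k::int^'d. 1 / (1 + (norm (lattice_vec k))\<^sup>2) ^ CARD('d))"
  have W0: "0 \<le> W k" for k by (simp add: W_def)
  have "Infinite_Set_Sum.abs_summable_on W UNIV"
    using summable_lattice_weight[where 'd = 'd] W0 by (subst abs_summable_equivalent[symmetric]) (simp add: W_def)
  then have "integrable (count_space UNIV) W" by (simp add: Infinite_Set_Sum.abs_summable_on_def)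
  then have fin: "(\<integral>\<^sup>+k. ennreal (W k) \<partial>count_space UNIV) < \<infinity>"
    using W0 by (simp add: integrable_iff_bounded)
  have "(\<integral>\<^sup>+k. ennreal ((1 + (norm (lattice_vec k))\<^sup>2) powr (- real CARD('d))) * emeasure \<mu> {k} \<partial>count_space UNIV)
      \<le> (\<integral>\<^sup>+k. ennreal B * ennreal (W k) \<partial>count_space UNIV)"
  proof (rule nn_integral_mono)
    fix k :: "int^'d"
    have "(1 + (norm (lattice_vec k))\<^sup>2) powr (- real CARD('d)) = W k"
      by (simp add: W_def powr_minus powr_realpow add_pos_nonneg divide_inverse)
    then show "ennreal ((1 + (norm (lattice_vec k))\<^sup>2) powr (- real CARD('d))) * emeasure \<mu> {k} \<le> ennreal B * ennreal (W k)"
      using assms(2)[of k] by (simp add: mult.commute[of "ennreal B"] mult_left_mono)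
  qed
  also have "\<dots> = ennreal B * (\<integral>\<^sup>+k. ennreal (W k) \<partial>count_space UNIV)"
    by (rule nn_integral_cmult) simp
  also have "\<dots> < \<infinity>" using fin by (simp add: ennreal_mult_less_top)
  finally show ?thesis unfolding spectral_measure_def using assms(1) by blast
qed

lemma test_nhd_bound: "\<psi> \<in> test_nhd 0 \<delta> \<phi> \<Longrightarrow> cmod (\<psi> x - \<phi> x) < \<delta>"
  unfolding test_nhd_def by (auto dest: spec[of _ "[]"])

text \<open>Continuity is not assumed but derived: the squared distance of two pairings is the
  variance of the pairing with the difference, which \<open>spectral_form_le\<close> bounds by the
  sup norm. Neighbourhoods of order N = 0 are therefore enough.\<close>

lemma stationary_gerfI:
  fixes Z :: "(real^'d::finite \<Rightarrow> complex) \<Rightarrow> 'a \<Rightarrow> complex"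
  assumes "prob_space M"
    and meas: "\<And>\<phi>. \<phi> \<in> test_functions \<Longrightarrow> Z \<phi> \<in> borel_measurable M"
    and l2: "\<And>\<phi>. \<phi> \<in> test_functions \<Longrightarrow> integrable M (\<lambda>\<omega>. (cmod (Z \<phi> \<omega>))\<^sup>2)"
    and lin: "\<And>\<phi> \<psi> a b. \<phi> \<in> test_functions \<Longrightarrow> \<psi> \<in> test_functions \<Longrightarrow>
        AE \<omega> in M. Z (\<lambda>x. a * \<phi> x + b * \<psi> x) \<omega> = a * Z \<phi> \<omega> + b * Z \<psi> \<omega>"
    and re: "\<And>\<phi>. \<phi> \<in> test_functions \<Longrightarrow> (\<And>x. \<phi> x \<in> \<real>) \<Longrightarrow> AE \<omega> in M. Z \<phi> \<omega> \<in> \<real>"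
    and mean: "\<And>\<phi>. \<phi> \<in> test_functions \<Longrightarrow> (LINT \<omega>|M. Z \<phi> \<omega>) = 0"
    and cov: "\<And>\<phi> \<psi>. \<phi> \<in> test_functions \<Longrightarrow> \<psi> \<in> test_functions \<Longrightarrow>
        (LINT \<omega>|M. Z \<phi> \<omega> * cnj (Z \<psi> \<omega>)) =
        (\<Sum>\<^sub>\<infinity>k. complex_of_real (m k) * (char_coeff \<phi> k * cnj (char_coeff \<psi> k)))"
    and m: "\<And>k. 0 \<le> m k" "\<And>k. m k \<le> B"
    and \<mu>: "sets \<mu> = UNIV" "\<And>k. emeasure \<mu> {k} = ennreal (m k)"
  shows "stationary_gerf M Z \<mu>"
proof -
  interpret prob_space M by fact
  have B0: "0 \<le> B" using m[of 0] by linarith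
  have cont: "\<exists>N. \<exists>\<delta>>0. \<forall>\<psi>\<in>test_nhd N \<delta> \<phi>. l2_norm M (\<lambda>\<omega>. Z \<psi> \<omega> - Z \<phi> \<omega>) < \<epsilon>"
    if \<phi>: "\<phi> \<in> test_functions" and "\<epsilon> > 0" for \<phi> \<epsilon>
  proof (intro exI conjI ballI)
    \<comment> \<open>B + 1 avoids a division by zero when B = 0, and the factor 2 leaves room for a
      strict inequality.\<close>
    define \<delta> where "\<delta> = \<epsilon> / (2 * sqrt (B + 1))"
    have B1: "0 < sqrt (B + 1)" using B0 by simp
    show d0: "0 < \<delta>" using \<open>\<epsilon> > 0\<close> B1 by (simp add: \<delta>_def)
    fix \<psi> assume \<psi>n: "\<psi> \<in> test_nhd 0 \<delta> \<phi>"
    then have \<psi>: "\<psi> \<in> test_functions" by (simp add: test_nhd_def)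
    let ?f = "\<lambda>x. 1 * \<psi> x + (-1) * \<phi> x"
    have f: "?f \<in> test_functions" by (rule test_linear[OF \<psi> \<phi>])
    have fb: "cmod (?f x) \<le> \<delta>" for x using test_nhd_bound[OF \<psi>n, of x] by simp
    have "(LINT \<omega>|M. (cmod (Z \<psi> \<omega> - Z \<phi> \<omega>))\<^sup>2) = (LINT \<omega>|M. (cmod (Z ?f \<omega>))\<^sup>2)"
    proof (rule integral_cong_AE)
      show "AE \<omega> in M. (cmod (Z \<psi> \<omega> - Z \<phi> \<omega>))\<^sup>2 = (cmod (Z ?f \<omega>))\<^sup>2"
        using lin[OF \<psi> \<phi>, of 1 "-1"] by eventually_elim simp
    qed (use meas[OF f] meas[OF \<phi>] meas[OF \<psi>] in measurable)
    also have "\<dots> = Re (complex_of_real (LINT \<omega>|M. (cmod (Z ?f \<omega>))\<^sup>2))" by simp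
    also have "complex_of_real (LINT \<omega>|M. (cmod (Z ?f \<omega>))\<^sup>2) = (LINT \<omega>|M. Z ?f \<omega> * cnj (Z ?f \<omega>))"
      by (simp only: integral_complex_of_real[symmetric] complex_norm_square)
    also have "Re \<dots> \<le> B * \<delta>\<^sup>2"
      unfolding cov[OF f f] by (rule spectral_form_le[OF f fb m])
    also have "\<dots> < (sqrt (B + 1) * \<delta>)\<^sup>2"
      using B0 d0 by (simp add: power_mult_distrib)
    finally have "l2_norm M (\<lambda>\<omega>. Z \<psi> \<omega> - Z \<phi> \<omega>) < sqrt (B + 1) * \<delta>"
      unfolding l2_norm_def using B1 d0 by (intro real_less_lsqrt) auto
    also have "\<dots> < \<epsilon>" using B1 \<open>\<epsilon> > 0\<close> by (simp add: \<delta>_def)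
    finally show "l2_norm M (\<lambda>\<omega>. Z \<psi> \<omega> - Z \<phi> \<omega>) < \<epsilon>" .
  qed
  have "gerf M Z"
    unfolding gerf_def using assms(1) meas l2 lin cont re mean by blast
  moreover have "spectral_measure \<mu>"
    using m(2) by (intro spectral_measureI[OF \<mu>(1) _ B0]) (simp add: \<mu>(2) ennreal_leI)
  moreover have "has_covariance_distribution M Z (spectral_distribution \<mu>)"
    unfolding has_covariance_distribution_def covariance_def
    using m(1) by (simp add: mean cov spectral_distribution_conv measure_def \<mu>(2))
  ultimately show ?thesis by (simp add: stationary_gerf_def)
qed

section \<open>Characteristic functions\<close>

lemma (in prob_space) expectation_char:
  assumes "X \<in> borel_measurable M"
  shows "(LINT \<omega>|M. iexp (t * X \<omega>)) = char (distr M borel X) t"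
  unfolding char_def using assms by (subst integral_distr) auto

lemma (in prob_space) integrable_iexp_mult:
  assumes "X \<in> borel_measurable M" "f \<in> borel_measurable M" "\<And>\<omega>. cmod (f \<omega>) \<le> B"
  shows "integrable M (\<lambda>\<omega>. f \<omega> * iexp (X \<omega>))"
  using assms by (intro integrable_const_bound[where B = B]) (auto simp: norm_mult)

text \<open>\<open>gaussian_rv\<close> admits constants, so there are two cases: a centred constant
  is almost surely 0 with v = 0, and otherwise division by the standard deviation reduces everything
  to the standard normal law.\<close>

lemma (in prob_space) gaussian_rv_char_moments:
  assumes g: "gaussian_rv M X" and mean: "(LINT \<omega>|M. X \<omega>) = 0" and var: "(LINT \<omega>|M. (X \<omega>)\<^sup>2) = v"
  shows "(LINT \<omega>|M. iexp (t * X \<omega>)) = of_real (exp (- (t\<^sup>2 * v) / 2))"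
    and "integrable M (\<lambda>\<omega>. (X \<omega>) ^ (2 * q))"
    and "(LINT \<omega>|M. (X \<omega>) ^ (2 * q)) = fact (2 * q) / (2 ^ q * fact q) * v ^ q"
proof -
  have [measurable]: "X \<in> borel_measurable M" using g by (simp add: gaussian_rv_def)
  have "(LINT \<omega>|M. iexp (t * X \<omega>)) = of_real (exp (- (t\<^sup>2 * v) / 2)) \<and>
    integrable M (\<lambda>\<omega>. (X \<omega>) ^ (2 * q)) \<and> (LINT \<omega>|M. (X \<omega>) ^ (2 * q)) = fact (2 * q) / (2 ^ q * fact q) * v ^ q"
  proof (cases "\<exists>m. AE \<omega> in M. X \<omega> = m")
    case True
    then obtain m where m: "AE \<omega> in M. X \<omega> = m" by blast
    have "(LINT \<omega>|M. X \<omega>) = (LINT \<omega>|M. m)"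
      by (rule integral_cong_AE) (use m in simp_all)
    then have "m = 0" using mean by (simp add: prob_space)
    with m have X0: "AE \<omega> in M. X \<omega> = 0" by simp
    have "(LINT \<omega>|M. (X \<omega>)\<^sup>2) = (LINT \<omega>|M. (0::real))"
      by (rule integral_cong_AE) (use X0 in \<open>auto elim!: eventually_mono\<close>)
    then have v: "v = 0" using var by simp
    have "(LINT \<omega>|M. iexp (t * X \<omega>)) = (LINT \<omega>|M. 1)"
      by (rule integral_cong_AE) (use X0 in \<open>auto elim!: eventually_mono\<close>)
    moreover have "integrable M (\<lambda>\<omega>. (X \<omega>) ^ (2 * q)) \<longleftrightarrow> integrable M (\<lambda>\<omega>. (0::real) ^ (2 * q))"
      by (rule integrable_cong_AE) (use X0 in \<open>auto elim!: eventually_mono\<close>)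
    moreover have "(LINT \<omega>|M. (X \<omega>) ^ (2 * q)) = (LINT \<omega>|M. (0::real) ^ (2 * q))"
      by (rule integral_cong_AE) (use X0 in \<open>auto elim!: eventually_mono\<close>)
    \<comment> \<open>For q = 0 both sides are 1, because 0 ^ 0 = 1; for q > 0 both vanish.\<close>
    ultimately show ?thesis
      by (cases "q = 0") (simp_all add: v prob_space zero_power)
  next
    case False
    then obtain m \<sigma> where \<sigma>: "\<sigma> > 0" and d: "distributed M lborel X (normal_density m \<sigma>)"
      using g by (auto simp: gaussian_rv_def)
    have m: "m = 0" using normal_distributed_expectation[OF \<sigma> d] mean by simp
    have v: "v = \<sigma>\<^sup>2" using normal_distributed_variance[OF \<sigma> d] var mean by simp
    have std: "distributed M lborel (\<lambda>\<omega>. X \<omega> / \<sigma>) std_normal_density"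
      using d normal_standard_normal_convert[OF \<sigma>, of X m] m by simp
    have "(LINT \<omega>|M. iexp (t * X \<omega>)) = (LINT \<omega>|M. iexp ((t * \<sigma>) * (X \<omega> / \<sigma>)))"
      using \<sigma> by simp
    also have "\<dots> = char (distr M borel (\<lambda>\<omega>. X \<omega> / \<sigma>)) (t * \<sigma>)"
      by (rule expectation_char) simp
    also have "distr M borel (\<lambda>\<omega>. X \<omega> / \<sigma>) = std_normal_distribution"
      using distributed_distr_eq_density[OF std] by (simp cong: distr_cong)
    also have "char std_normal_distribution (t * \<sigma>) = of_real (exp (- (t\<^sup>2 * v) / 2))"
      by (simp add: char_std_normal_distribution v power_mult_distrib)
    finally have 1: "(LINT \<omega>|M. iexp (t * X \<omega>)) = of_real (exp (- (t\<^sup>2 * v) / 2))" .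
    have nm: "has_bochner_integral lborel (\<lambda>x. normal_density m \<sigma> x * x ^ (2 * q)) (fact (2 * q) / ((2 / \<sigma>\<^sup>2)^q * fact q))"
      using normal_moment_even[OF \<sigma>, of m q] m by simp
    have 2: "integrable M (\<lambda>\<omega>. (X \<omega>) ^ (2 * q))"
      using distributed_integrable[OF d, of "\<lambda>x. x ^ (2 * q)"] nm
      by (simp add: has_bochner_integral_iff)
    have "(LINT \<omega>|M. (X \<omega>) ^ (2 * q)) = (LINT x|lborel. normal_density m \<sigma> x * x ^ (2 * q))"
      using distributed_integral[OF d, of "\<lambda>x. x ^ (2 * q)"] by simp
    also have "\<dots> = fact (2 * q) / (2 ^ q * fact q) * v ^ q"
      using nm \<sigma> by (simp add: has_bochner_integral_iff v power_divide)
    finally show ?thesis using 1 2 by blast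
  qed
  then show "(LINT \<omega>|M. iexp (t * X \<omega>)) = of_real (exp (- (t\<^sup>2 * v) / 2))"
    "integrable M (\<lambda>\<omega>. (X \<omega>) ^ (2 * q))"
    "(LINT \<omega>|M. (X \<omega>) ^ (2 * q)) = fact (2 * q) / (2 ^ q * fact q) * v ^ q" by blast+
qed

text \<open>Levy's uniqueness theorem applied to X divided by its standard deviation. Zero variance
  is treated apart, as there is then no density: X vanishes almost surely and falls under the
  constant case.\<close>

lemma (in prob_space) gaussian_rvI:
  assumes [measurable]: "X \<in> borel_measurable M" and i: "integrable M (\<lambda>\<omega>. (X \<omega>)\<^sup>2)" and v: "(LINT \<omega>|M. (X \<omega>)\<^sup>2) = v"
    and char: "\<And>t. (LINT \<omega>|M. iexp (t * X \<omega>)) = of_real (exp (- (t\<^sup>2 * v) / 2))"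
  shows "gaussian_rv M X"
proof (cases "v = 0")
  case True
  then have "AE \<omega> in M. (X \<omega>)\<^sup>2 = 0"
    using integral_nonneg_eq_0_iff_AE[OF i] v by simp
  then have "AE \<omega> in M. X \<omega> = 0" by simp
  then show ?thesis unfolding gaussian_rv_def by auto
next
  case False
  have "0 \<le> v" unfolding v[symmetric] by (rule Bochner_Integration.integral_nonneg) simp
  define \<sigma> where "\<sigma> = sqrt v"
  have \<sigma>: "\<sigma> > 0" "\<sigma>\<^sup>2 = v" using False \<open>0 \<le> v\<close> by (simp_all add: \<sigma>_def)
  have "distr M borel (\<lambda>\<omega>. X \<omega> / \<sigma>) = std_normal_distribution"
  proof (rule Levy_uniqueness)
    show "real_distribution (distr M borel (\<lambda>\<omega>. X \<omega> / \<sigma>))" by (rule real_distribution_distr) simp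
    show "real_distribution std_normal_distribution" by (rule real_dist_normal_dist)
    show "char (distr M borel (\<lambda>\<omega>. X \<omega> / \<sigma>)) = char std_normal_distribution"
    proof
      fix t
      have "char (distr M borel (\<lambda>\<omega>. X \<omega> / \<sigma>)) t = (LINT \<omega>|M. iexp ((t / \<sigma>) * X \<omega>))"
        by (subst expectation_char[symmetric]) simp_all
      also have "\<dots> = char std_normal_distribution t"
        unfolding char char_std_normal_distribution using False by (simp add: power_divide \<sigma>(2))
      finally show "char (distr M borel (\<lambda>\<omega>. X \<omega> / \<sigma>)) t = char std_normal_distribution t" .
    qed
  qed
  then have "distributed M lborel (\<lambda>\<omega>. X \<omega> / \<sigma>) std_normal_density"
    unfolding distributed_def by (simp cong: distr_cong)
  then have "distributed M lborel X (normal_density 0 \<sigma>)"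
    using normal_standard_normal_convert[OF \<sigma>(1), of X 0] by simp
  then show ?thesis unfolding gaussian_rv_def using \<sigma>(1) by auto
qed

text \<open>The complex measure with density \<open>f\<close> is handled by the probability measure with density
  proportional to \<open>2 + f\<close>, to which one-dimensional uniqueness applies.\<close>

lemma weighted_char_unique:
  assumes "prob_space M" "prob_space N"
    and [measurable]: "f \<in> borel_measurable M" "X \<in> borel_measurable M" "g \<in> borel_measurable N" "Y \<in> borel_measurable N"
    and f1: "\<And>\<omega>. \<bar>f \<omega>\<bar> \<le> (1::real)" and g1: "\<And>\<omega>. \<bar>g \<omega>\<bar> \<le> (1::real)"
    and e: "\<And>s. (LINT \<omega>|M. iexp (s * X \<omega>)) = (LINT \<omega>|N. iexp (s * Y \<omega>))"
    and fe: "\<And>s. (LINT \<omega>|M. of_real (f \<omega>) * iexp (s * X \<omega>)) = (LINT \<omega>|N. of_real (g \<omega>) * iexp (s * Y \<omega>))"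
    and A: "A \<in> sets borel"
  shows "(LINT \<omega>|M. f \<omega> * indicator A (X \<omega>)) = (LINT \<omega>|N. g \<omega> * indicator A (Y \<omega>))"
proof -
  interpret M: prob_space M by fact
  interpret N: prob_space N by fact
  have dens: "prob_space (density K (\<lambda>\<omega>. ennreal ((2 + h \<omega>) / c)))
       \<and> (LINT \<omega>|density K (\<lambda>\<omega>. ennreal ((2 + h \<omega>) / c)). iexp (s * Z \<omega>)) =
          (2 * (LINT \<omega>|K. iexp (s * Z \<omega>)) + (LINT \<omega>|K. of_real (h \<omega>) * iexp (s * Z \<omega>))) / of_real c
       \<and> measure (density K (\<lambda>\<omega>. ennreal ((2 + h \<omega>) / c))) (Z -` A \<inter> space K) =
          (2 * (LINT \<omega>|K. indicator A (Z \<omega>)) + (LINT \<omega>|K. h \<omega> * indicator A (Z \<omega>))) / c"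
    if "prob_space K" and [measurable]: "h \<in> borel_measurable K" "Z \<in> borel_measurable K"
      and h1: "\<And>\<omega>. \<bar>h \<omega>\<bar> \<le> (1::real)" and c: "c = 2 + (LINT \<omega>|K. h \<omega>)" and A: "A \<in> sets borel"
    for K :: "'c measure" and h Z c s and A :: "real set"
  proof -
    interpret K: prob_space K by fact
    note [measurable] = A
    have ih: "integrable K h" by (rule K.integrable_const_bound[where B = 1]) (use h1 in auto)
    \<comment> \<open>Since |h| \<le> 1, the function 2 + h is at least 1; the constant c is its
      total mass and hence positive as well.\<close>
    have h2: "0 < 2 + h \<omega>" for \<omega> using h1[of \<omega>] by linarith
    have "(LINT \<omega>|K. -1) \<le> (LINT \<omega>|K. h \<omega>)"
      by (intro integral_mono ih) (use h1 in \<open>auto simp: abs_le_iff minus_le_iff\<close>)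
    then have c0: "c > 0" unfolding c by (simp add: K.prob_space)
    have ih2: "integrable K (\<lambda>\<omega>. (2 + h \<omega>) / c)" using ih by simp
    have "prob_space (density K (\<lambda>\<omega>. ennreal ((2 + h \<omega>) / c)))"
    proof
      have "emeasure (density K (\<lambda>\<omega>. ennreal ((2 + h \<omega>) / c))) (space K) = (\<integral>\<^sup>+\<omega>. ennreal ((2 + h \<omega>) / c) \<partial>K)"
        by (subst emeasure_density) (auto intro!: nn_integral_cong)
      also have "\<dots> = ennreal (LINT \<omega>|K. (2 + h \<omega>) / c)"
        using h2 c0 ih2 by (intro nn_integral_eq_integral) (auto simp: less_imp_le)
      also have "\<dots> = 1" using c0 ih by (simp add: c K.prob_space)
      finally show "emeasure (density K (\<lambda>\<omega>. ennreal ((2 + h \<omega>) / c))) (space (density K (\<lambda>\<omega>. ennreal ((2 + h \<omega>) / c)))) = 1"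
        by simp
    qed
    moreover have "(LINT \<omega>|density K (\<lambda>\<omega>. ennreal ((2 + h \<omega>) / c)). iexp (s * Z \<omega>)) =
          (2 * (LINT \<omega>|K. iexp (s * Z \<omega>)) + (LINT \<omega>|K. of_real (h \<omega>) * iexp (s * Z \<omega>))) / of_real c"
    proof -
      have ie: "integrable K (\<lambda>\<omega>. iexp (s * Z \<omega>))"
        using K.integrable_iexp_mult[of "\<lambda>\<omega>. s * Z \<omega>" "\<lambda>_. 1" 1] by simp
      have ihe: "integrable K (\<lambda>\<omega>. of_real (h \<omega>) * iexp (s * Z \<omega>))"
        by (rule K.integrable_iexp_mult[where B = 1]) (use h1 in simp_all)
      have "(LINT \<omega>|density K (\<lambda>\<omega>. ennreal ((2 + h \<omega>) / c)). iexp (s * Z \<omega>)) =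
          (LINT \<omega>|K. ((2 + h \<omega>) / c) *\<^sub>R iexp (s * Z \<omega>))"
        using h2 c0 by (subst integral_density) (auto simp: less_imp_le)
      also have "\<dots> = (LINT \<omega>|K. (2 * iexp (s * Z \<omega>) + of_real (h \<omega>) * iexp (s * Z \<omega>)) / of_real c)"
        by (intro Bochner_Integration.integral_cong refl) (simp add: scaleR_conv_of_real algebra_simps)
      finally show ?thesis using ie ihe by simp
    qed
    moreover have "measure (density K (\<lambda>\<omega>. ennreal ((2 + h \<omega>) / c))) (Z -` A \<inter> space K) =
          (2 * (LINT \<omega>|K. indicator A (Z \<omega>)) + (LINT \<omega>|K. h \<omega> * indicator A (Z \<omega>))) / c"
    proof -
      have ii: "integrable K (\<lambda>\<omega>. indicator A (Z \<omega>) :: real)"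
        by (rule K.integrable_const_bound[where B = 1]) auto
      have ihi: "integrable K (\<lambda>\<omega>. h \<omega> * indicator A (Z \<omega>))"
        by (rule K.integrable_const_bound[where B = 1]) (use h1 in \<open>auto simp: indicator_def\<close>)
      have "measure (density K (\<lambda>\<omega>. ennreal ((2 + h \<omega>) / c))) (Z -` A \<inter> space K) =
         (LINT \<omega>|density K (\<lambda>\<omega>. ennreal ((2 + h \<omega>) / c)). indicator (Z -` A \<inter> space K) \<omega>)"
        by simp
      also have "\<dots> = (LINT \<omega>|K. ((2 + h \<omega>) / c) *\<^sub>R indicator (Z -` A \<inter> space K) \<omega>)"
        using h2 c0 by (subst integral_density) (auto simp: less_imp_le)
      also have "\<dots> = (LINT \<omega>|K. (2 * indicator A (Z \<omega>) + h \<omega> * indicator A (Z \<omega>)) / c)"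
        by (intro Bochner_Integration.integral_cong refl) (simp add: indicator_def algebra_simps)
      finally show ?thesis using ii ihi by simp
    qed
    ultimately show ?thesis by blast
  qed
  have main: "2 * (LINT \<omega>|M. indicator A (X \<omega>)) + (LINT \<omega>|M. F \<omega> * indicator A (X \<omega>)) =
      2 * (LINT \<omega>|N. indicator A (Y \<omega>)) + (LINT \<omega>|N. G \<omega> * indicator A (Y \<omega>))"
    if [measurable]: "F \<in> borel_measurable M" "G \<in> borel_measurable N"
      and F1: "\<And>\<omega>. \<bar>F \<omega>\<bar> \<le> (1::real)" and G1: "\<And>\<omega>. \<bar>G \<omega>\<bar> \<le> (1::real)"
      and FG: "\<And>s. (LINT \<omega>|M. of_real (F \<omega>) * iexp (s * X \<omega>)) = (LINT \<omega>|N. of_real (G \<omega>) * iexp (s * Y \<omega>))" for F G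
  proof -
    define c where "c = 2 + (LINT \<omega>|M. F \<omega>)"
    \<comment> \<open>The frequency s = 0 shows that both densities have the same normalising
      constant.\<close>
    have c': "c = 2 + (LINT \<omega>|N. G \<omega>)"
      using FG[of 0] by (simp add: c_def integral_complex_of_real)
    have iF: "integrable M F" by (rule M.integrable_const_bound[where B = 1]) (use F1 in auto)
    have "(LINT \<omega>|M. -1) \<le> (LINT \<omega>|M. F \<omega>)"
      by (intro integral_mono iF) (use F1 in \<open>auto simp: abs_le_iff minus_le_iff\<close>)
    then have c0: "c > 0" unfolding c_def by (simp add: M.prob_space)
    define M' where "M' = density M (\<lambda>\<omega>. ennreal ((2 + F \<omega>) / c))"
    define N' where "N' = density N (\<lambda>\<omega>. ennreal ((2 + G \<omega>) / c))"
    note dM = dens[OF assms(1) that(1) assms(4) F1 c_def A, folded M'_def]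
    note dN = dens[OF assms(2) that(2) assms(6) G1 c' A, folded N'_def]
    interpret M': prob_space M' using dM by blast
    interpret N': prob_space N' using dN by blast
    have [measurable]: "X \<in> borel_measurable M'" "Y \<in> borel_measurable N'"
      by (simp_all add: M'_def N'_def)
    have "distr M' borel X = distr N' borel Y"
    proof (rule Levy_uniqueness)
      show "real_distribution (distr M' borel X)" by (rule M'.real_distribution_distr) simp
      show "real_distribution (distr N' borel Y)" by (rule N'.real_distribution_distr) simp
      show "char (distr M' borel X) = char (distr N' borel Y)"
      proof
        fix t
        show "char (distr M' borel X) t = char (distr N' borel Y) t"
          using dM[of t] dN[of t] FG[of t] e[of t]
          by (simp add: M'.expectation_char[symmetric] N'.expectation_char[symmetric])
      qed
    qed
    moreover have "measure (distr M' borel X) A = measure M' (X -` A \<inter> space M')"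
      by (rule measure_distr) (simp_all add: A)
    moreover have "measure (distr N' borel Y) A = measure N' (Y -` A \<inter> space N')"
      by (rule measure_distr) (simp_all add: A)
    moreover have "space M' = space M" "space N' = space N"
      by (simp_all add: M'_def N'_def)
    ultimately have eqm: "measure M' (X -` A \<inter> space M) = measure N' (Y -` A \<inter> space N)"
      by metis
    have "(2 * (LINT \<omega>|M. indicator A (X \<omega>)) + (LINT \<omega>|M. F \<omega> * indicator A (X \<omega>))) / c =
        (2 * (LINT \<omega>|N. indicator A (Y \<omega>)) + (LINT \<omega>|N. G \<omega> * indicator A (Y \<omega>))) / c"
      by (rule trans[OF trans[OF dM[of 0, THEN conjunct2, THEN conjunct2, symmetric] eqm]
          dN[of 0, THEN conjunct2, THEN conjunct2]])
    moreover have "x = y" if "x / c = y / c" for x y using that c0 by simp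
    ultimately show ?thesis by blast
  qed
  \<comment> \<open>Zero weights give equality of the plain indicator integrals, which cancels the
    contribution of the constant 2 in the weighted identity.\<close>
  have "2 * (LINT \<omega>|M. indicator A (X \<omega>)) + (LINT \<omega>|M. 0 * indicator A (X \<omega>)) =
      2 * (LINT \<omega>|N. indicator A (Y \<omega>)) + (LINT \<omega>|N. (0::real) * indicator A (Y \<omega>))"
    by (rule main) simp_all
  moreover have "(LINT \<omega>|M. (0::real) * indicator A (X \<omega>)) = 0" "(LINT \<omega>|N. (0::real) * indicator A (Y \<omega>)) = 0"
    by (simp_all only: mult_zero_left Bochner_Integration.integral_zero)
  moreover note main[OF assms(3,5) f1 g1 fe]
  ultimately show ?thesis by linarith
qed

text \<open>\<open>weighted_char_unique\<close> accepts real weights only, whereas hypotheses about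
  characteristic functions concern exponentials. Euler's formulas for cosine and sine, encoded by u
  and w, mediate between the two.\<close>

lemma (in prob_space) integral_trig_split:
  assumes [measurable]: "P \<in> borel_measurable M" "\<theta> \<in> borel_measurable M" "Z \<in> borel_measurable M"
    and P1: "\<And>\<omega>. \<bar>P \<omega>\<bar> \<le> (1::real)"
    and T: "\<And>x. complex_of_real (T x) = u * iexp x + w * iexp (- x)"
  shows "(LINT \<omega>|M. of_real (P \<omega> * T (\<theta> \<omega>)) * iexp (s * Z \<omega>)) =
      u * (LINT \<omega>|M. of_real (P \<omega>) * iexp (s * Z \<omega> + 1 * \<theta> \<omega>)) +
      w * (LINT \<omega>|M. of_real (P \<omega>) * iexp (s * Z \<omega> + (-1) * \<theta> \<omega>))"
proof -
  have i: "integrable M (\<lambda>\<omega>. of_real (P \<omega>) * iexp (s * Z \<omega> + a * \<theta> \<omega>))" for a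
    by (rule integrable_iexp_mult[where B = 1]) (use P1 in simp_all)
  have eq: "of_real (P \<omega> * T (\<theta> \<omega>)) * iexp (s * Z \<omega>) =
      u * (of_real (P \<omega>) * iexp (s * Z \<omega> + 1 * \<theta> \<omega>)) + w * (of_real (P \<omega>) * iexp (s * Z \<omega> + (-1) * \<theta> \<omega>))" for \<omega>
    by (simp add: T algebra_simps exp_add exp_diff exp_minus divide_inverse)
  show ?thesis
    unfolding eq by (subst Bochner_Integration.integral_add; (intro integrable_mult_right i)?) (simp only: integral_mult_right_zero)
qed

text \<open>Interpolates between characteristic functions (J empty) and probabilities of rectangles
  (J = I). One coordinate at a time, an exponential is replaced by an indicator: the remaining
  factors, with their exponential split into cosine and sine, form a bounded real weight for
  one-dimensional uniqueness in the chosen coordinate.\<close>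

lemma indicator_prod_char_unique:
  fixes X :: "'i \<Rightarrow> 'a \<Rightarrow> real" and Y :: "'i \<Rightarrow> 'b \<Rightarrow> real"
  assumes "prob_space M" "prob_space N" and "finite I"
    and [measurable]: "\<And>i. X i \<in> borel_measurable M" "\<And>i. Y i \<in> borel_measurable N"
    and char: "\<And>t. (LINT \<omega>|M. iexp (\<Sum>i\<in>I. t i * X i \<omega>)) = (LINT \<omega>|N. iexp (\<Sum>i\<in>I. t i * Y i \<omega>))"
    and A [measurable]: "\<And>i. A i \<in> sets borel"
    and "J \<subseteq> I"
  shows "(LINT \<omega>|M. of_real (\<Prod>j\<in>J. indicator (A j) (X j \<omega>)) * iexp (\<Sum>i\<in>I - J. t i * X i \<omega>)) =
     (LINT \<omega>|N. of_real (\<Prod>j\<in>J. indicator (A j) (Y j \<omega>)) * iexp (\<Sum>i\<in>I - J. t i * Y i \<omega>))"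
proof -
  interpret M: prob_space M by fact
  interpret N: prob_space N by fact
  have "finite J" using assms(3,8) finite_subset by blast
  then show ?thesis using \<open>J \<subseteq> I\<close>
  proof (induction J arbitrary: t rule: finite_induct)
    case empty
    then show ?case using char by simp
  next
    case (insert j J)
    let ?PM = "\<lambda>\<omega>. (\<Prod>j\<in>J. indicator (A j) (X j \<omega>)) :: real"
    let ?PN = "\<lambda>\<omega>. (\<Prod>j\<in>J. indicator (A j) (Y j \<omega>)) :: real"
    let ?K = "I - insert j J"
    let ?\<theta> = "\<lambda>\<omega>. \<Sum>i\<in>?K. t i * X i \<omega>"
    let ?\<eta> = "\<lambda>\<omega>. \<Sum>i\<in>?K. t i * Y i \<omega>"
    have IJ: "I - J = insert j ?K" "j \<notin> ?K" "finite ?K" using insert assms(3) by auto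
    have P1: "\<bar>\<Prod>j\<in>J. indicator (A j) (z j)\<bar> \<le> (1::real)" for z :: "'i \<Rightarrow> real"
      by (simp add: abs_prod) (intro prod_le_1, simp)
    \<comment> \<open>The induction hypothesis holds for all t, so the frequency s at j is free and
      the others may be scaled by a; the values a = 1 and a = -1 serve the two exponentials in
      cosine and sine.\<close>
    have e1: "(LINT \<omega>|M. of_real (?PM \<omega>) * iexp (s * X j \<omega> + a * ?\<theta> \<omega>)) =
        (LINT \<omega>|N. of_real (?PN \<omega>) * iexp (s * Y j \<omega> + a * ?\<eta> \<omega>))" for s a
    proof -
      have *: "(\<Sum>i\<in>?K. ((\<lambda>i. a * t i)(j := s)) i * z i) = (\<Sum>i\<in>?K. a * t i * z i)" for z :: "'i \<Rightarrow> real"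
        by (rule sum.cong) auto
      show ?thesis
        using insert.IH[of "(\<lambda>i. a * t i)(j := s)"] insert.prems
        unfolding IJ(1) sum.insert[OF IJ(3,2)] * by (simp add: sum_distrib_left mult.assoc)
    qed
    have e0: "(LINT \<omega>|M. iexp (s * X j \<omega>)) = (LINT \<omega>|N. iexp (s * Y j \<omega>))" for s
    proof -
      have jI: "j \<in> I" using insert.prems by blast
      have "(\<Sum>i\<in>I. ((\<lambda>_. 0)(j := s)) i * z i) = s * z j" for z :: "'i \<Rightarrow> real"
        using sum.delta[OF assms(3), of j "\<lambda>i. s * z i"] jI
        by (simp add: if_distrib[of "\<lambda>x. x * _"] fun_upd_def cong: if_cong)
      then show ?thesis using char[of "(\<lambda>_. 0)(j := s)"] by simp
    qed
    have trig: "(LINT \<omega>|M. (?PM \<omega> * T (?\<theta> \<omega>)) * indicator (A j) (X j \<omega>)) =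
        (LINT \<omega>|N. (?PN \<omega> * T (?\<eta> \<omega>)) * indicator (A j) (Y j \<omega>))"
      if T: "\<And>x. complex_of_real (T x) = u * iexp x + w * iexp (- x)" "\<And>x. \<bar>T x\<bar> \<le> 1" "T \<in> borel_measurable borel"
      for T u w
    proof (rule weighted_char_unique[OF assms(1,2)])
      note [measurable] = T(3)
      show "(\<lambda>\<omega>. ?PM \<omega> * T (?\<theta> \<omega>)) \<in> borel_measurable M" "(\<lambda>\<omega>. ?PN \<omega> * T (?\<eta> \<omega>)) \<in> borel_measurable N"
        by measurable
      show "\<bar>?PM \<omega> * T (?\<theta> \<omega>)\<bar> \<le> 1" for \<omega>
        unfolding abs_mult using mult_mono[OF P1 T(2)] by simp
      show "\<bar>?PN \<omega> * T (?\<eta> \<omega>)\<bar> \<le> 1" for \<omega>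
        unfolding abs_mult using mult_mono[OF P1 T(2)] by simp
      show "(LINT \<omega>|M. of_real (?PM \<omega> * T (?\<theta> \<omega>)) * iexp (s * X j \<omega>)) =
          (LINT \<omega>|N. of_real (?PN \<omega> * T (?\<eta> \<omega>)) * iexp (s * Y j \<omega>))" for s
      proof -
        have "(LINT \<omega>|M. of_real (?PM \<omega> * T (?\<theta> \<omega>)) * iexp (s * X j \<omega>)) =
            u * (LINT \<omega>|M. of_real (?PM \<omega>) * iexp (s * X j \<omega> + 1 * ?\<theta> \<omega>)) +
            w * (LINT \<omega>|M. of_real (?PM \<omega>) * iexp (s * X j \<omega> + (-1) * ?\<theta> \<omega>))"
          by (rule M.integral_trig_split[OF _ _ _ P1 T(1)]) measurable
        also have "\<dots> = u * (LINT \<omega>|N. of_real (?PN \<omega>) * iexp (s * Y j \<omega> + 1 * ?\<eta> \<omega>)) +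
            w * (LINT \<omega>|N. of_real (?PN \<omega>) * iexp (s * Y j \<omega> + (-1) * ?\<eta> \<omega>))"
          by (simp only: e1)
        also have "\<dots> = (LINT \<omega>|N. of_real (?PN \<omega> * T (?\<eta> \<omega>)) * iexp (s * Y j \<omega>))"
          by (rule N.integral_trig_split[OF _ _ _ P1 T(1), symmetric]) measurable
        finally show ?thesis .
      qed
    qed (use e0 in simp_all)
    have c: "(LINT \<omega>|M. (?PM \<omega> * cos (?\<theta> \<omega>)) * indicator (A j) (X j \<omega>)) =
        (LINT \<omega>|N. (?PN \<omega> * cos (?\<eta> \<omega>)) * indicator (A j) (Y j \<omega>))"
      by (rule trig[of _ "1/2" "1/2"]) (auto simp: complex_eq_iff Re_exp Im_exp)
    have s: "(LINT \<omega>|M. (?PM \<omega> * sin (?\<theta> \<omega>)) * indicator (A j) (X j \<omega>)) =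
        (LINT \<omega>|N. (?PN \<omega> * sin (?\<eta> \<omega>)) * indicator (A j) (Y j \<omega>))"
      by (rule trig[of _ "-\<i>/2" "\<i>/2"]) (auto simp: complex_eq_iff Re_exp Im_exp)
    \<comment> \<open>Reassembles the exponential of the remaining coordinates from its cosine and
      sine parts.\<close>
    have comb: "(LINT \<omega>|K. of_real (indicator (A j) (Z \<omega>) * P \<omega>) * iexp (\<theta> \<omega>)) =
        of_real (LINT \<omega>|K. (P \<omega> * cos (\<theta> \<omega>)) * indicator (A j) (Z \<omega>)) +
        \<i> * of_real (LINT \<omega>|K. (P \<omega> * sin (\<theta> \<omega>)) * indicator (A j) (Z \<omega>))"
      if "prob_space K" and [measurable]: "P \<in> borel_measurable K" "\<theta> \<in> borel_measurable K" "Z \<in> borel_measurable K"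
        and P1: "\<And>\<omega>. \<bar>P \<omega>\<bar> \<le> (1::real)" for K :: "'c measure" and P \<theta> Z
    proof -
      interpret K: prob_space K by fact
      have b: "\<bar>(P \<omega> * T (\<theta> \<omega>)) * indicator (A j) (Z \<omega>)\<bar> \<le> 1" if "\<And>x. \<bar>T x\<bar> \<le> 1" for T :: "real \<Rightarrow> real" and \<omega>
        using mult_mono[OF P1[of \<omega>] that[of "\<theta> \<omega>"]] by (simp add: abs_mult indicator_def)
      have i: "integrable K (\<lambda>\<omega>. (P \<omega> * cos (\<theta> \<omega>)) * indicator (A j) (Z \<omega>))" "integrable K (\<lambda>\<omega>. (P \<omega> * sin (\<theta> \<omega>)) * indicator (A j) (Z \<omega>))"
        by (rule K.integrable_const_bound[where B = 1]; use b[of cos] b[of sin] in simp)+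
      have eq: "of_real (indicator (A j) (Z \<omega>) * P \<omega>) * iexp (\<theta> \<omega>) =
          of_real ((P \<omega> * cos (\<theta> \<omega>)) * indicator (A j) (Z \<omega>)) + \<i> * of_real ((P \<omega> * sin (\<theta> \<omega>)) * indicator (A j) (Z \<omega>))" for \<omega>
        by (simp add: complex_eq_iff cis_conv_exp[symmetric])
      have ic: "complex_integrable K (\<lambda>\<omega>. of_real ((P \<omega> * cos (\<theta> \<omega>)) * indicator (A j) (Z \<omega>)))"
           "complex_integrable K (\<lambda>\<omega>. of_real ((P \<omega> * sin (\<theta> \<omega>)) * indicator (A j) (Z \<omega>)))"
        using i by (simp_all only: complex_of_real_integrable_eq)
      show ?thesis
        unfolding eq using ic
        by (subst Bochner_Integration.integral_add) (simp_all only: integrable_mult_right integral_mult_right_zero integral_complex_of_real)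
    qed
    have "(LINT \<omega>|M. of_real (indicator (A j) (X j \<omega>) * ?PM \<omega>) * iexp (?\<theta> \<omega>)) =
        (LINT \<omega>|N. of_real (indicator (A j) (Y j \<omega>) * ?PN \<omega>) * iexp (?\<eta> \<omega>))"
      by (subst (1 2) comb) (simp_all only: assms(1,2) c s P1, measurable)
    then show ?case
      unfolding prod.insert[OF insert.hyps] .
  qed
qed

text \<open>Rectangles form an intersection-stable generator of the product algebra, and the measure
  of a rectangle is the expectation of a product of indicators, which
  \<open>indicator_prod_char_unique\<close> compares once no exponential is left.\<close>

lemma char_unique_PiM:
  fixes X :: "'i \<Rightarrow> 'a \<Rightarrow> real" and Y :: "'i \<Rightarrow> 'b \<Rightarrow> real"
  assumes "prob_space M" "prob_space N" and I: "finite I"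
    and [measurable]: "\<And>i. X i \<in> borel_measurable M" "\<And>i. Y i \<in> borel_measurable N"
    and char: "\<And>t. (LINT \<omega>|M. iexp (\<Sum>i\<in>I. t i * X i \<omega>)) = (LINT \<omega>|N. iexp (\<Sum>i\<in>I. t i * Y i \<omega>))"
  shows "distr M (\<Pi>\<^sub>M i\<in>I. borel) (\<lambda>\<omega>. \<lambda>i\<in>I. X i \<omega>) = distr N (\<Pi>\<^sub>M i\<in>I. borel) (\<lambda>\<omega>. \<lambda>i\<in>I. Y i \<omega>)"
proof -
  interpret M: prob_space M by fact
  interpret N: prob_space N by fact
  have rectangle: "emeasure (distr K (\<Pi>\<^sub>M i\<in>I. borel) (\<lambda>\<omega>. \<lambda>i\<in>I. Z i \<omega>)) (Pi\<^sub>E I A) =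
      ennreal (LINT \<omega>|K. (\<Prod>i\<in>I. indicator (A i) (Z i \<omega>)))"
    if "prob_space K" and [measurable]: "\<And>i. Z i \<in> borel_measurable K" "\<And>i. A i \<in> sets borel"
    for K :: "'c measure" and Z :: "'i \<Rightarrow> 'c \<Rightarrow> real" and A
  proof -
    interpret K: prob_space K by fact
    let ?S = "(\<lambda>\<omega>. \<lambda>i\<in>I. Z i \<omega>) -` Pi\<^sub>E I A \<inter> space K"
    have [measurable]: "(\<lambda>\<omega>. \<lambda>i\<in>I. Z i \<omega>) \<in> measurable K (\<Pi>\<^sub>M i\<in>I. borel)"
      by (rule measurable_restrict) simp
    have PE [measurable]: "Pi\<^sub>E I A \<in> sets (\<Pi>\<^sub>M i\<in>I. borel)"
      using I by (intro sets_PiM_I_finite) auto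
    have "emeasure (distr K (\<Pi>\<^sub>M i\<in>I. borel) (\<lambda>\<omega>. \<lambda>i\<in>I. Z i \<omega>)) (Pi\<^sub>E I A) = ennreal (measure K ?S)"
      by (subst emeasure_distr) (simp_all add: K.emeasure_eq_measure)
    also have "measure K ?S = (LINT \<omega>|K. indicator ?S \<omega>)"
      by simp
    also have "\<dots> = (LINT \<omega>|K. (\<Prod>i\<in>I. indicator (A i) (Z i \<omega>)))"
      using I by (intro Bochner_Integration.integral_cong refl) (auto simp: indicator_def PiE_iff prod_eq_1_iff)
    finally show ?thesis .
  qed
  show ?thesis
  proof (rule measure_eqI_PiM_finite[OF I, where A = "\<lambda>_. space (\<Pi>\<^sub>M i\<in>I. borel)"])
    fix A :: "'i \<Rightarrow> real set" assume A: "\<And>i. i \<in> I \<Longrightarrow> A i \<in> sets borel"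
    \<comment> \<open>Outside I the sets A are arbitrary, whereas the comparison asks for Borel sets
      at every index; the empty set fills the gap.\<close>
    define B where "B i = (if i \<in> I then A i else {})" for i
    have B: "B i \<in> sets borel" for i using A by (simp add: B_def)
    have AB: "Pi\<^sub>E I A = Pi\<^sub>E I B" by (rule PiE_cong) (simp add: B_def)
    have "(LINT \<omega>|M. of_real (\<Prod>j\<in>I. indicator (B j) (X j \<omega>)) * iexp (\<Sum>i\<in>I - I. 0 * X i \<omega>)) =
     (LINT \<omega>|N. of_real (\<Prod>j\<in>I. indicator (B j) (Y j \<omega>)) * iexp (\<Sum>i\<in>I - I. 0 * Y i \<omega>))"
      by (rule indicator_prod_char_unique[OF assms(1-5) char B, where t = "\<lambda>_. 0"]) simp
    then have "(LINT \<omega>|M. (\<Prod>j\<in>I. indicator (B j) (X j \<omega>)) :: real) = (LINT \<omega>|N. (\<Prod>j\<in>I. indicator (B j) (Y j \<omega>)))"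
      by (simp add: integral_complex_of_real del: of_real_prod)
    then show "emeasure (distr M (\<Pi>\<^sub>M i\<in>I. borel) (\<lambda>\<omega>. \<lambda>i\<in>I. X i \<omega>)) (Pi\<^sub>E I A) =
        emeasure (distr N (\<Pi>\<^sub>M i\<in>I. borel) (\<lambda>\<omega>. \<lambda>i\<in>I. Y i \<omega>)) (Pi\<^sub>E I A)"
      unfolding AB by (simp only: rectangle[OF assms(1,4) B] rectangle[OF assms(2,5) B])
  next
    show "range (\<lambda>_::nat. space (\<Pi>\<^sub>M i\<in>I. borel)) \<subseteq> prod_algebra I (\<lambda>_. borel)"
      using I by (auto simp: space_PiM intro!: prod_algebraI_finite)
    have "prob_space (distr M (\<Pi>\<^sub>M i\<in>I. borel) (\<lambda>\<omega>. \<lambda>i\<in>I. X i \<omega>))"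
      by (rule M.prob_space_distr) (rule measurable_restrict, simp)
    then interpret D: prob_space "distr M (\<Pi>\<^sub>M i\<in>I. borel) (\<lambda>\<omega>. \<lambda>i\<in>I. X i \<omega>)" .
    show "emeasure (distr M (\<Pi>\<^sub>M i\<in>I. borel) (\<lambda>\<omega>. \<lambda>i\<in>I. X i \<omega>)) (space (\<Pi>\<^sub>M i\<in>I. borel)) \<noteq> \<infinity>"
      by (simp add: D.emeasure_eq_measure)
  qed simp_all
qed

text \<open>Complex coordinates are split into real and imaginary parts indexed by pairs with a
  boolean; the measurable map T puts them together again, so equality of the real laws is pushed
  forward.\<close>

lemma complex_char_unique_PiM:
  fixes Z :: "nat \<Rightarrow> 'a \<Rightarrow> complex" and W :: "nat \<Rightarrow> 'b \<Rightarrow> complex"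
  assumes "prob_space M" "prob_space N"
    and Z [measurable]: "\<And>i. i < n \<Longrightarrow> Z i \<in> borel_measurable M" and W [measurable]: "\<And>i. i < n \<Longrightarrow> W i \<in> borel_measurable N"
    and char: "\<And>a b. (LINT \<omega>|M. iexp (\<Sum>i<n. a i * Re (Z i \<omega>) + b i * Im (Z i \<omega>))) =
      (LINT \<omega>|N. iexp (\<Sum>i<n. a i * Re (W i \<omega>) + b i * Im (W i \<omega>)))"
  shows "distr M (\<Pi>\<^sub>M i\<in>{..<n}. borel) (\<lambda>\<omega>. \<lambda>i\<in>{..<n}. Z i \<omega>) = distr N (\<Pi>\<^sub>M i\<in>{..<n}. borel) (\<lambda>\<omega>. \<lambda>i\<in>{..<n}. W i \<omega>)"
proof -
  define part where "part b z = (if b then Re z else Im z)" for b and z :: complex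
  define X where "X p \<omega> = (if fst p < n then part (snd p) (Z (fst p) \<omega>) else 0)" for p \<omega>
  define Y where "Y p \<omega> = (if fst p < n then part (snd p) (W (fst p) \<omega>) else 0)" for p \<omega>
  define I where "I = {..<n} \<times> (UNIV :: bool set)"
  define T where "T v = (\<lambda>i\<in>{..<n}. Complex (v (i, True)) (v (i, False)))" for v :: "nat \<times> bool \<Rightarrow> real"
  have I: "finite I" by (simp add: I_def)
  have [measurable]: "part b \<in> borel_measurable borel" for b
  proof -
    have "part b = (if b then Re else Im)" by (auto simp: part_def fun_eq_iff)
    then show ?thesis by simp
  qed
  have X [measurable]: "X p \<in> borel_measurable M" for p
    using Z unfolding X_def by (cases "fst p < n") simp_all
  have Y [measurable]: "Y p \<in> borel_measurable N" for p
    using W unfolding Y_def by (cases "fst p < n") simp_all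
  have sumX: "(\<Sum>p\<in>I. t p * X p \<omega>) = (\<Sum>i<n. t (i, True) * Re (Z i \<omega>) + t (i, False) * Im (Z i \<omega>))" for t \<omega>
    unfolding I_def by (subst sum.cartesian_product[symmetric, where g = "\<lambda>i b. t (i, b) * X (i, b) \<omega>", simplified])
      (simp add: UNIV_bool X_def part_def add.commute)
  have sumY: "(\<Sum>p\<in>I. t p * Y p \<omega>) = (\<Sum>i<n. t (i, True) * Re (W i \<omega>) + t (i, False) * Im (W i \<omega>))" for t \<omega>
    unfolding I_def by (subst sum.cartesian_product[symmetric, where g = "\<lambda>i b. t (i, b) * Y (i, b) \<omega>", simplified])
      (simp add: UNIV_bool Y_def part_def add.commute)
  have eq: "distr M (\<Pi>\<^sub>M i\<in>I. borel) (\<lambda>\<omega>. \<lambda>i\<in>I. X i \<omega>) = distr N (\<Pi>\<^sub>M i\<in>I. borel) (\<lambda>\<omega>. \<lambda>i\<in>I. Y i \<omega>)"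
    by (rule char_unique_PiM[OF assms(1,2) I X Y]) (simp only: sumX sumY char)
  have T [measurable]: "T \<in> measurable (\<Pi>\<^sub>M i\<in>I. borel) (\<Pi>\<^sub>M i\<in>{..<n}. borel)"
    unfolding T_def
  proof (rule measurable_restrict)
    fix i assume "i \<in> {..<n}"
    then have "(i, b) \<in> I" for b by (simp add: I_def)
    then have [measurable]: "(\<lambda>v. v (i, b)) \<in> borel_measurable (\<Pi>\<^sub>M i\<in>I. borel)" for b
      by (rule measurable_component_singleton)
    have "(\<lambda>v. complex_of_real (v (i, True)) + \<i> * complex_of_real (v (i, False))) \<in> borel_measurable (\<Pi>\<^sub>M i\<in>I. borel)"
      by measurable
    then show "(\<lambda>v. Complex (v (i, True)) (v (i, False))) \<in> borel_measurable (\<Pi>\<^sub>M i\<in>I. borel)"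
      by (simp add: Complex_eq)
  qed
  have TX: "T (\<lambda>i\<in>I. X i \<omega>) = (\<lambda>i\<in>{..<n}. Z i \<omega>)" for \<omega>
    by (auto simp: T_def I_def X_def part_def fun_eq_iff)
  have TY: "T (\<lambda>i\<in>I. Y i \<omega>) = (\<lambda>i\<in>{..<n}. W i \<omega>)" for \<omega>
    by (auto simp: T_def I_def Y_def part_def fun_eq_iff)
  have "distr (distr M (\<Pi>\<^sub>M i\<in>I. borel) (\<lambda>\<omega>. \<lambda>i\<in>I. X i \<omega>)) (\<Pi>\<^sub>M i\<in>{..<n}. borel) T =
      distr M (\<Pi>\<^sub>M i\<in>{..<n}. borel) (\<lambda>\<omega>. \<lambda>i\<in>{..<n}. Z i \<omega>)"
    by (subst distr_distr) (auto simp: comp_def TX intro!: measurable_restrict)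
  moreover have "distr (distr N (\<Pi>\<^sub>M i\<in>I. borel) (\<lambda>\<omega>. \<lambda>i\<in>I. Y i \<omega>)) (\<Pi>\<^sub>M i\<in>{..<n}. borel) T =
      distr N (\<Pi>\<^sub>M i\<in>{..<n}. borel) (\<lambda>\<omega>. \<lambda>i\<in>{..<n}. W i \<omega>)"
    by (subst distr_distr) (auto simp: comp_def TY intro!: measurable_restrict)
  ultimately show ?thesis using eq by simp
qed

section \<open>Fields from independent normal coefficients\<close>

text \<open>The two characters combine to cos + sin, so this is the pairing of \<phi> with a real
  function. Real basis functions permit independent real normal coefficients, without the symmetry
  constraint between k and -k that complex ones would carry.\<close>

definition hartley_coeff :: "(real^'d::finite \<Rightarrow> complex) \<Rightarrow> int^'d \<Rightarrow> complex" where
  "hartley_coeff \<phi> k = (1 - \<i>) / 2 * char_coeff \<phi> k + (1 + \<i>) / 2 * char_coeff \<phi> (- k)"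

lemma hartley_coeff_linear:
  assumes "\<phi> \<in> test_functions" "\<psi> \<in> test_functions"
  shows "hartley_coeff (\<lambda>x. a * \<phi> x + b * \<psi> x) k = a * hartley_coeff \<phi> k + b * hartley_coeff \<psi> k"
  unfolding hartley_coeff_def char_coeff_linear[OF assms] by (simp add: algebra_simps)

lemma hartley_coeff_real:
  assumes "\<And>x. \<phi> x \<in> \<real>"
  shows "hartley_coeff \<phi> k \<in> \<real>"
proof -
  have "\<phi> = (\<lambda>x. cnj (\<phi> x))" using assms by (simp add: fun_eq_iff Reals_cnj_iff)
  then have "char_coeff \<phi> (- k) = cnj (char_coeff \<phi> k)"
    using char_coeff_cnj[of \<phi> "- k"] by simp
  then show ?thesis
    unfolding hartley_coeff_def Reals_cnj_iff by simp
qed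

lemma hartley_coeff_summable:
  assumes "\<phi> \<in> test_functions"
  shows "(\<lambda>k. cmod (hartley_coeff \<phi> k)) summable_on UNIV"
proof (rule summable_on_comparison_test)
  have neg: "(\<lambda>k. cmod (char_coeff \<phi> (- k))) summable_on UNIV"
    using summable_on_reindex_bij_betw[OF bij_uminus, of "\<lambda>k. cmod (char_coeff \<phi> k)"] char_coeff_summable[OF assms] by simp
  show "(\<lambda>k. cmod (char_coeff \<phi> k) + cmod (char_coeff \<phi> (- k))) summable_on UNIV"
    by (rule summable_on_add[OF char_coeff_summable[OF assms] neg])
  have c: "cmod ((1 - \<i>) / 2) \<le> 1" "cmod ((1 + \<i>) / 2) \<le> 1"
    using norm_triangle_ineq4[of 1 \<i>] norm_triangle_ineq[of 1 \<i>] by (simp_all add: norm_divide)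
  have c': "cmod ((1 - \<i>) / 2 * z) \<le> cmod z" "cmod ((1 + \<i>) / 2 * z) \<le> cmod z" for z
    unfolding norm_mult using mult_right_mono[OF c(1), of "cmod z"] mult_right_mono[OF c(2), of "cmod z"] by simp_all
  show "cmod (hartley_coeff \<phi> k) \<le> cmod (char_coeff \<phi> k) + cmod (char_coeff \<phi> (- k))" for k
    unfolding hartley_coeff_def
    by (rule order_trans[OF norm_triangle_ineq add_mono[OF c']])
qed simp

text \<open>With \<open>p = (1 - \<i>) / 2\<close> one has \<open>|p|\<^sup>2 = 1/2\<close> and \<open>p\<^sup>2 + cnj p\<^sup>2 = 0\<close>, so for an even weight the mixed
  terms cancel when \<open>k\<close> and \<open>- k\<close> are exchanged.\<close>

lemma hartley_spectral_form:
  assumes \<phi>: "\<phi> \<in> test_functions" and \<psi>: "\<psi> \<in> test_functions"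
    and m: "\<And>k. 0 \<le> m k" "\<And>k. m k \<le> B" "\<And>k. m (- k) = m k"
  shows "(\<Sum>\<^sub>\<infinity>k. complex_of_real (m k) * (hartley_coeff \<phi> k * cnj (hartley_coeff \<psi> k))) =
    (\<Sum>\<^sub>\<infinity>k. complex_of_real (m k) * (char_coeff \<phi> k * cnj (char_coeff \<psi> k)))"
proof -
  define f where "f k = complex_of_real (m k) * (char_coeff \<phi> k * cnj (char_coeff \<psi> k))" for k
  define g where "g k = complex_of_real (m k) * (char_coeff \<phi> k * cnj (char_coeff \<psi> (- k)))" for k
  have sf: "f summable_on UNIV"
    unfolding f_def by (rule abs_summable_summable[OF spectral_summable[OF \<phi> \<psi> m(1,2)]])
  have sg: "g summable_on UNIV"
  proof -
    obtain C where C: "\<And>x. cmod (\<psi> x) \<le> C" using test_bounded[OF \<psi>] by metis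
    have "(\<lambda>k. cmod (char_coeff \<phi> k * (cnj (char_coeff \<psi> (- k)) * complex_of_real (m k)))) summable_on UNIV"
    proof (rule summable_on_bounded_mult[OF char_coeff_summable[OF \<phi>]])
      show "cmod (cnj (char_coeff \<psi> (- k)) * complex_of_real (m k)) \<le> C * B" for k
        unfolding norm_mult complex_mod_cnj
        using cmod_char_coeff_le[OF \<psi> C, of "- k"] m(1,2)[of k] order_trans[OF norm_ge_zero C]
        by (intro mult_mono) auto
    qed
    moreover have "char_coeff \<phi> k * (cnj (char_coeff \<psi> (- k)) * complex_of_real (m k)) = g k" for k
      by (simp add: g_def)
    ultimately show ?thesis
      by (simp only: abs_summable_summable)
  qed
  have rf: "(\<lambda>k. f (- k)) summable_on UNIV" "(\<Sum>\<^sub>\<infinity>k. f (- k)) = (\<Sum>\<^sub>\<infinity>k. f k)"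
    using summable_on_reindex_bij_betw[OF bij_uminus, of f] infsum_reindex_bij_betw[OF bij_uminus, of f] sf by auto
  have rg: "(\<lambda>k. g (- k)) summable_on UNIV" "(\<Sum>\<^sub>\<infinity>k. g (- k)) = (\<Sum>\<^sub>\<infinity>k. g k)"
    using summable_on_reindex_bij_betw[OF bij_uminus, of g] infsum_reindex_bij_betw[OF bij_uminus, of g] sg by auto
  have eq: "complex_of_real (m k) * (hartley_coeff \<phi> k * cnj (hartley_coeff \<psi> k)) =
      1/2 * (f k + f (- k)) + ((- \<i> / 2) * g k + (\<i> / 2) * g (- k))" for k
    unfolding hartley_coeff_def f_def g_def m(3)
    by (simp add: algebra_simps)
  have "(\<Sum>\<^sub>\<infinity>k. complex_of_real (m k) * (hartley_coeff \<phi> k * cnj (hartley_coeff \<psi> k))) =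
      1/2 * ((\<Sum>\<^sub>\<infinity>k. f k) + (\<Sum>\<^sub>\<infinity>k. f (- k))) + ((- \<i> / 2) * (\<Sum>\<^sub>\<infinity>k. g k) + (\<i> / 2) * (\<Sum>\<^sub>\<infinity>k. g (- k)))"
    unfolding eq
    by (intro infsumI has_sum_add has_sum_cmult_right has_sum_infsum sf sg rf(1) rg(1))
  also have "\<dots> = (\<Sum>\<^sub>\<infinity>k. f k)" by (simp add: rf(2) rg(2))
  finally show ?thesis by (simp add: f_def)
qed

lemma abs_summable_on_bij_sums:
  fixes f :: "'i \<Rightarrow> 'b::banach"
  assumes "bij (e :: nat \<Rightarrow> 'i)" "(\<lambda>k. norm (f k)) summable_on UNIV"
  shows "summable (\<lambda>n. norm (f (e n)))" "(\<lambda>n. f (e n)) sums (\<Sum>\<^sub>\<infinity>k. f k)"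
proof -
  have s: "(\<lambda>n. norm (f (e n))) summable_on UNIV"
    using summable_on_reindex_bij_betw[OF assms(1), of "\<lambda>k. norm (f k)"] assms(2) by simp
  then show "summable (\<lambda>n. norm (f (e n)))" by (rule summable_on_imp_summable)
  have "((\<lambda>n. f (e n)) has_sum (\<Sum>\<^sub>\<infinity>n. f (e n))) UNIV"
    using abs_summable_summable[OF s] by (rule has_sum_infsum)
  then show "(\<lambda>n. f (e n)) sums (\<Sum>\<^sub>\<infinity>k. f k)"
    using has_sum_imp_sums infsum_reindex_bij_betw[OF assms(1), of f] by metis
qed

definition lattice_enum :: "nat \<Rightarrow> int^'d::finite" where
  "lattice_enum = from_nat_into UNIV"

lemma bij_lattice_enum: "bij (lattice_enum :: nat \<Rightarrow> int^'d::finite)"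
proof -
  have inf: "infinite (UNIV :: (int^'d) set)" by (rule infinite_UNIV_vec[OF infinite_UNIV_int])
  show ?thesis
    unfolding lattice_enum_def by (rule bij_betw_from_nat_into[OF countableI_type inf])
qed

text \<open>The Karhunen-Loeve expansion, in the Hartley basis, of the field with spectral weight
  a^2. The series is taken pointwise in \<omega>, so it is a measurable function of the sequence
  \<xi>.\<close>

definition gauss_series ::
  "(int^'d::finite \<Rightarrow> real) \<Rightarrow> (nat \<Rightarrow> 'a \<Rightarrow> real) \<Rightarrow> (real^'d \<Rightarrow> complex) \<Rightarrow> 'a \<Rightarrow> complex" where
  "gauss_series a \<xi> \<phi> \<omega> =
     (\<Sum>n. complex_of_real (a (lattice_enum n)) * hartley_coeff \<phi> (lattice_enum n) * of_real (\<xi> n \<omega>))"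

section \<open>Random series with independent standard normal coefficients\<close>

locale iid_normal = prob_space M for M :: "'a measure" +
  fixes \<xi> :: "nat \<Rightarrow> 'a \<Rightarrow> real"
  assumes indep: "indep_vars (\<lambda>_. borel) \<xi> UNIV"
    and normal: "\<And>n. distr M borel (\<xi> n) = std_normal_distribution"
begin

lemma xi_measurable [measurable]: "\<xi> n \<in> borel_measurable M"
  using indep by (auto simp: indep_vars_def)

lemma xi_moments: "integrable M (\<xi> n)" "integrable M (\<lambda>\<omega>. (\<xi> n \<omega>)\<^sup>2)"
  "(LINT \<omega>|M. \<xi> n \<omega>) = 0" "(LINT \<omega>|M. (\<xi> n \<omega>)\<^sup>2) = 1"
proof -
  have d: "integrable M (\<lambda>\<omega>. g (\<xi> n \<omega>)) = integrable std_normal_distribution g"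
    "(LINT \<omega>|M. g (\<xi> n \<omega>)) = (LINT x|std_normal_distribution. g x)"
    if "g \<in> borel_measurable borel" for g :: "real \<Rightarrow> real"
    unfolding normal[of n, symmetric] using that by (simp_all add: integrable_distr_eq integral_distr)
  show "integrable M (\<xi> n)" "integrable M (\<lambda>\<omega>. (\<xi> n \<omega>)\<^sup>2)"
    using d(1)[of "\<lambda>x. x"] d(1)[of "\<lambda>x. x\<^sup>2"] integrable_std_normal_distribution_moment[of 1]
      integrable_std_normal_distribution_moment[of 2] by simp_all
  show "(LINT \<omega>|M. \<xi> n \<omega>) = 0" "(LINT \<omega>|M. (\<xi> n \<omega>)\<^sup>2) = 1"
    using d(2)[of "\<lambda>x. x"] d(2)[of "\<lambda>x. x\<^sup>2"] integral_std_normal_distribution_moment_odd[of 1]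
      std_normal_distribution_even_moments(1)[of 1] by simp_all
qed

lemma xi_orthonormal: "integrable M (\<lambda>\<omega>. \<xi> n \<omega> * \<xi> m \<omega>)"
  "(LINT \<omega>|M. \<xi> n \<omega> * \<xi> m \<omega>) = (if n = m then 1 else 0)"
proof -
  have "integrable M (\<lambda>\<omega>. \<xi> n \<omega> * \<xi> m \<omega>) \<and> (LINT \<omega>|M. \<xi> n \<omega> * \<xi> m \<omega>) = (if n = m then 1 else 0)"
  proof (cases "n = m")
    case True
    then show ?thesis using xi_moments[of m] by (simp add: power2_eq_square)
  next
    case False
    have iv: "indep_vars (\<lambda>_. borel) \<xi> {n, m}"
      using indep_vars_subset[OF indep, of "{n, m}"] by simp
    show ?thesis
      using indep_vars_lebesgue_integral[OF _ iv] indep_vars_integrable[OF _ iv] xi_moments False by simp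
  qed
  then show "integrable M (\<lambda>\<omega>. \<xi> n \<omega> * \<xi> m \<omega>)" "(LINT \<omega>|M. \<xi> n \<omega> * \<xi> m \<omega>) = (if n = m then 1 else 0)" by blast+
qed

lemma char_finite_sum: "(LINT \<omega>|M. iexp (t * (\<Sum>n<N. c n * \<xi> n \<omega>))) = of_real (exp (- (t\<^sup>2 * (\<Sum>n<N. (c n)\<^sup>2)) / 2))"
proof -
  have iv: "indep_vars (\<lambda>_. borel) (\<lambda>n \<omega>. c n * \<xi> n \<omega>) {..<N}"
    using indep_vars_compose2[OF indep_vars_subset[OF indep, of "{..<N}"], of "\<lambda>n x. c n * x" "\<lambda>_. borel"] by simp
  have "(LINT \<omega>|M. iexp (t * (\<Sum>n<N. c n * \<xi> n \<omega>))) = char (distr M borel (\<lambda>\<omega>. \<Sum>n<N. c n * \<xi> n \<omega>)) t"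
    by (rule expectation_char) simp
  also have "\<dots> = (\<Prod>n<N. char (distr M borel (\<lambda>\<omega>. c n * \<xi> n \<omega>)) t)"
    by (rule char_distr_sum[OF iv])
  also have "\<dots> = (\<Prod>n<N. of_real (exp (- (t * c n)\<^sup>2 / 2)))"
  proof (rule prod.cong[OF refl])
    fix n
    have "char (distr M borel (\<lambda>\<omega>. c n * \<xi> n \<omega>)) t = (LINT \<omega>|M. iexp ((t * c n) * \<xi> n \<omega>))"
      by (subst expectation_char[symmetric]) (simp_all add: mult.assoc)
    also have "\<dots> = char std_normal_distribution (t * c n)"
      by (subst expectation_char) (simp_all add: normal)
    finally show "char (distr M borel (\<lambda>\<omega>. c n * \<xi> n \<omega>)) t = of_real (exp (- (t * c n)\<^sup>2 / 2))"
      by (simp add: char_std_normal_distribution)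
  qed
  also have "\<dots> = of_real (exp (\<Sum>n<N. - (t * c n)\<^sup>2 / 2))"
    by (simp add: exp_sum)
  also have "(\<Sum>n<N. - (t * c n)\<^sup>2 / 2) = - (t\<^sup>2 * (\<Sum>n<N. (c n)\<^sup>2)) / 2"
    by (simp add: sum_distrib_left sum_negf sum_divide_distrib[symmetric] power_mult_distrib)
  finally show ?thesis .
qed

text \<open>Boundedness of a makes the coefficients of a test function absolutely summable, hence
  the series is dominated in L^2. Orthonormality of the normals gives the covariance in Hartley
  form, and Gaussianity survives the limit because the characteristic functions converge.\<close>

lemma gauss_series_field:
  fixes a :: "int^'d::finite \<Rightarrow> real"
  assumes a: "\<And>k. 0 \<le> a k" "\<And>k. a k \<le> B" "\<And>k. a (- k) = a k"
    and \<mu>: "sets \<mu> = UNIV" "\<And>k. emeasure \<mu> {k} = ennreal ((a k)\<^sup>2)"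
  shows "stationary_gerf M (gauss_series a \<xi>) \<mu>" "gaussian_gerf M (gauss_series a \<xi>)"
proof -
  let ?e = "lattice_enum :: nat \<Rightarrow> int^'d"
  define b where "b \<phi> n = complex_of_real (a (?e n)) * hartley_coeff \<phi> (?e n)" for \<phi> n
  define Y where "Y \<phi> n \<omega> = b \<phi> n * of_real (\<xi> n \<omega>)" for \<phi> n \<omega>
  have Z: "gauss_series a \<xi> \<phi> \<omega> = (\<Sum>n. Y \<phi> n \<omega>)" for \<phi> \<omega>
    by (simp add: gauss_series_def Y_def b_def)
  have B0: "0 \<le> B" using a(1,2)[of 0] by linarith
  have bs: "summable (\<lambda>n. cmod (b \<phi> n))" if "\<phi> \<in> test_functions" for \<phi>
  proof -
    have "(\<lambda>k. cmod (hartley_coeff \<phi> k * complex_of_real (a k))) summable_on UNIV"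
      by (rule summable_on_bounded_mult[OF hartley_coeff_summable[OF that], of _ B]) (use a in simp)
    from abs_summable_on_bij_sums(1)[OF bij_lattice_enum this] show ?thesis
      by (simp add: b_def mult.commute)
  qed
  have [measurable]: "Y \<phi> n \<in> borel_measurable M" for \<phi> n
    unfolding Y_def by measurable
  have Ysq: "(\<lambda>\<omega>. (cmod (Y \<phi> n \<omega>))\<^sup>2) = (\<lambda>\<omega>. (cmod (b \<phi> n))\<^sup>2 * (\<xi> n \<omega>)\<^sup>2)" for \<phi> n
    by (simp add: Y_def norm_mult power_mult_distrib fun_eq_iff)
  have dom: "l2_dominated M (Y \<phi>)" if "\<phi> \<in> test_functions" for \<phi>
  proof (rule l2_dominatedI)
    show "summable (\<lambda>n. cmod (b \<phi> n))" by (rule bs[OF that])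
    show "integrable M (\<lambda>\<omega>. (cmod (Y \<phi> n \<omega>))\<^sup>2)" "(LINT \<omega>|M. (cmod (Y \<phi> n \<omega>))\<^sup>2) \<le> (cmod (b \<phi> n))\<^sup>2" for n
      unfolding Ysq using xi_moments[of n] by simp_all
  qed simp_all
  have sums: "AE \<omega> in M. summable (\<lambda>n. Y \<phi> n \<omega>)" if "\<phi> \<in> test_functions" for \<phi>
    using dom[OF that] unfolding l2_dominated_def by (auto elim!: eventually_mono dest: summable_norm_cancel)
  have cov: "(LINT \<omega>|M. gauss_series a \<xi> \<phi> \<omega> * cnj (gauss_series a \<xi> \<psi> \<omega>)) =
      (\<Sum>\<^sub>\<infinity>k. complex_of_real ((a k)\<^sup>2) * (char_coeff \<phi> k * cnj (char_coeff \<psi> k)))"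
    and covs: "(\<lambda>n. b \<phi> n * cnj (b \<psi> n)) sums (LINT \<omega>|M. gauss_series a \<xi> \<phi> \<omega> * cnj (gauss_series a \<xi> \<psi> \<omega>))"
    if \<phi>: "\<phi> \<in> test_functions" and \<psi>: "\<psi> \<in> test_functions" for \<phi> \<psi>
  proof -
    have part: "(LINT \<omega>|M. (\<Sum>n<N. Y \<phi> n \<omega>) * cnj (\<Sum>n<N. Y \<psi> n \<omega>)) = (\<Sum>n<N. b \<phi> n * cnj (b \<psi> n))" for N
    proof -
      have "(LINT \<omega>|M. (\<Sum>n<N. Y \<phi> n \<omega>) * cnj (\<Sum>n<N. Y \<psi> n \<omega>)) =
          (LINT \<omega>|M. (\<Sum>n<N. \<Sum>m<N. b \<phi> n * cnj (b \<psi> m) * of_real (\<xi> n \<omega> * \<xi> m \<omega>)))"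
        by (intro Bochner_Integration.integral_cong refl) (simp add: Y_def sum_product mult_ac)
      also have "\<dots> = (\<Sum>n<N. \<Sum>m<N. b \<phi> n * cnj (b \<psi> m) * of_real (if n = m then 1 else 0))"
      proof -
        have i: "integrable M (\<lambda>\<omega>. b \<phi> n * cnj (b \<psi> m) * complex_of_real (\<xi> n \<omega> * \<xi> m \<omega>))" for n m
          using xi_orthonormal(1)[of n m] by (intro integrable_mult_right) (simp only: complex_of_real_integrable_eq)
        show ?thesis
          by (simp only: Bochner_Integration.integral_sum Bochner_Integration.integrable_sum i
              integral_mult_right_zero integral_complex_of_real xi_orthonormal(2))
      qed
      also have "\<dots> = (\<Sum>n<N. b \<phi> n * cnj (b \<psi> n))"
        by (simp add: if_distrib cong: if_cong)
      finally show ?thesis .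
    qed
    have lim: "(\<lambda>N. \<Sum>n<N. b \<phi> n * cnj (b \<psi> n)) \<longlonglongrightarrow> (LINT \<omega>|M. gauss_series a \<xi> \<phi> \<omega> * cnj (gauss_series a \<xi> \<psi> \<omega>))"
      using l2_dominated_inner_limit[OF dom[OF \<phi>] dom[OF \<psi>]] unfolding part Z .
    then show "(\<lambda>n. b \<phi> n * cnj (b \<psi> n)) sums (LINT \<omega>|M. gauss_series a \<xi> \<phi> \<omega> * cnj (gauss_series a \<xi> \<psi> \<omega>))"
      by (simp add: sums_def)
    obtain C where C: "0 \<le> C" "\<And>x. cmod (\<psi> x) \<le> C" using test_bounded[OF \<psi>] by metis
    have hb: "cmod (hartley_coeff \<psi> k) \<le> 2 * C" for k
    proof -
      have "cmod (hartley_coeff \<psi> k) \<le> cmod ((1 - \<i>) / 2) * cmod (char_coeff \<psi> k) + cmod ((1 + \<i>) / 2) * cmod (char_coeff \<psi> (- k))"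
        unfolding hartley_coeff_def by (metis norm_mult norm_triangle_ineq)
      also have "\<dots> \<le> 1 * C + 1 * C"
        using norm_triangle_ineq4[of 1 \<i>] norm_triangle_ineq[of 1 \<i>] cmod_char_coeff_le[OF \<psi> C(2)] C(1)
        by (intro add_mono mult_mono) (simp_all add: norm_divide)
      finally show ?thesis by simp
    qed
    have hsum: "(\<lambda>k. cmod (complex_of_real ((a k)\<^sup>2) * (hartley_coeff \<phi> k * cnj (hartley_coeff \<psi> k)))) summable_on UNIV"
    proof -
      have "(\<lambda>k. cmod (hartley_coeff \<phi> k * (cnj (hartley_coeff \<psi> k) * complex_of_real ((a k)\<^sup>2)))) summable_on UNIV"
      proof (rule summable_on_bounded_mult[OF hartley_coeff_summable[OF \<phi>]])
        show "cmod (cnj (hartley_coeff \<psi> k) * complex_of_real ((a k)\<^sup>2)) \<le> 2 * C * B\<^sup>2" for k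
          unfolding norm_mult complex_mod_cnj norm_of_real
          using hb[of k] a(1,2)[of k] C(1) by (intro mult_mono) (auto intro!: power_mono)
      qed
      then show ?thesis by (simp add: mult_ac)
    qed
    have "(\<lambda>n. b \<phi> n * cnj (b \<psi> n)) sums (\<Sum>\<^sub>\<infinity>k. complex_of_real ((a k)\<^sup>2) * (hartley_coeff \<phi> k * cnj (hartley_coeff \<psi> k)))"
      using abs_summable_on_bij_sums(2)[OF bij_lattice_enum hsum] by (simp add: b_def power2_eq_square mult_ac)
    \<comment> \<open>The evenness of a is what allows the passage from the Hartley basis back to
      characters.\<close>
    also have "(\<Sum>\<^sub>\<infinity>k. complex_of_real ((a k)\<^sup>2) * (hartley_coeff \<phi> k * cnj (hartley_coeff \<psi> k))) =
        (\<Sum>\<^sub>\<infinity>k. complex_of_real ((a k)\<^sup>2) * (char_coeff \<phi> k * cnj (char_coeff \<psi> k)))"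
      by (rule hartley_spectral_form[OF \<phi> \<psi>, where B = "B\<^sup>2"]) (use a in \<open>auto intro!: power_mono\<close>)
    finally show "(LINT \<omega>|M. gauss_series a \<xi> \<phi> \<omega> * cnj (gauss_series a \<xi> \<psi> \<omega>)) =
        (\<Sum>\<^sub>\<infinity>k. complex_of_real ((a k)\<^sup>2) * (char_coeff \<phi> k * cnj (char_coeff \<psi> k)))"
      using lim by (simp add: sums_def LIMSEQ_unique)
  qed
  have meas: "gauss_series a \<xi> \<phi> \<in> borel_measurable M" if "\<phi> \<in> test_functions" for \<phi>
    using l2_dominated_sum_measurable[OF dom[OF that]] unfolding Z[abs_def] .
  have l2: "integrable M (\<lambda>\<omega>. (cmod (gauss_series a \<xi> \<phi> \<omega>))\<^sup>2)" if "\<phi> \<in> test_functions" for \<phi>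
    using l2_dominated_square_integrable(1)[OF dom[OF that]] unfolding Z .
  have mean: "(LINT \<omega>|M. gauss_series a \<xi> \<phi> \<omega>) = 0" if "\<phi> \<in> test_functions" for \<phi>
  proof -
    have "(LINT \<omega>|M. (\<Sum>n<N. Y \<phi> n \<omega>)) = 0" for N
      unfolding Y_def using xi_moments(1,3)
      by (simp add: Bochner_Integration.integral_sum complex_of_real_integrable_eq integral_complex_of_real)
    then show ?thesis
      using l2_dominated_mean_limit[OF dom[OF that]] unfolding Z by (simp add: LIMSEQ_const_iff)
  qed
  have breal: "b \<phi> n = of_real (Re (b \<phi> n))" if "\<And>x. \<phi> x \<in> \<real>" for \<phi> n
    using hartley_coeff_real[of \<phi>, OF that] unfolding b_def by (simp add: complex_is_Real_iff complex_eq_iff)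
  have re: "AE \<omega> in M. gauss_series a \<xi> \<phi> \<omega> \<in> \<real>" if \<phi>: "\<phi> \<in> test_functions" "\<And>x. \<phi> x \<in> \<real>" for \<phi>
    using sums[OF \<phi>(1)]
  proof eventually_elim
    case (elim \<omega>)
    have "Im (Y \<phi> n \<omega>) = 0" for n
      unfolding Y_def by (subst breal[OF \<phi>(2)]) simp
    then have "Im (\<Sum>n. Y \<phi> n \<omega>) = 0" using Im_suminf[OF elim] by simp
    then show ?case by (simp add: Z complex_is_Real_iff)
  qed
  have lin: "AE \<omega> in M. gauss_series a \<xi> (\<lambda>x. c * \<phi> x + d * \<psi> x) \<omega> = c * gauss_series a \<xi> \<phi> \<omega> + d * gauss_series a \<xi> \<psi> \<omega>"
    if \<phi>: "\<phi> \<in> test_functions" and \<psi>: "\<psi> \<in> test_functions" for \<phi> \<psi> c d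
    using sums[OF \<phi>] sums[OF \<psi>]
  proof eventually_elim
    case (elim \<omega>)
    have "Y (\<lambda>x. c * \<phi> x + d * \<psi> x) n \<omega> = c * Y \<phi> n \<omega> + d * Y \<psi> n \<omega>" for n
      unfolding Y_def b_def hartley_coeff_linear[OF \<phi> \<psi>] by (simp add: algebra_simps)
    then show ?case
      using elim by (simp add: Z suminf_add[symmetric] suminf_mult summable_mult)
  qed
  show st: "stationary_gerf M (gauss_series a \<xi>) \<mu>"
    by (rule stationary_gerfI[where m = "\<lambda>k. (a k)\<^sup>2" and B = "B\<^sup>2"])
      (use prob_space_axioms meas l2 lin re mean cov \<mu> a in \<open>auto intro!: power_mono\<close>)
  have "gaussian_rv M (\<lambda>\<omega>. Re (gauss_series a \<xi> \<phi> \<omega>))" if \<phi>: "\<phi> \<in> test_functions" "\<And>x. \<phi> x \<in> \<real>" for \<phi>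
  proof (rule gaussian_rvI)
    note [measurable] = meas[OF \<phi>(1)]
    show "(\<lambda>\<omega>. Re (gauss_series a \<xi> \<phi> \<omega>)) \<in> borel_measurable M" by measurable
    have sq: "AE \<omega> in M. (cmod (gauss_series a \<xi> \<phi> \<omega>))\<^sup>2 = (Re (gauss_series a \<xi> \<phi> \<omega>))\<^sup>2"
      using re[OF \<phi>] by eventually_elim (simp add: complex_is_Real_iff cmod_power2)
    show "integrable M (\<lambda>\<omega>. (Re (gauss_series a \<xi> \<phi> \<omega>))\<^sup>2)"
      using l2[OF \<phi>(1)] integrable_cong_AE[OF _ _ sq] by simp
    define r where "r n = Re (b \<phi> n)" for n
    have br: "b \<phi> n = of_real (r n)" for n unfolding r_def by (rule breal[OF \<phi>(2)])
    have "complex_of_real (LINT \<omega>|M. (Re (gauss_series a \<xi> \<phi> \<omega>))\<^sup>2) = complex_of_real (LINT \<omega>|M. (cmod (gauss_series a \<xi> \<phi> \<omega>))\<^sup>2)"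
      using integral_cong_AE[OF _ _ sq] by simp
    also have "\<dots> = (LINT \<omega>|M. gauss_series a \<xi> \<phi> \<omega> * cnj (gauss_series a \<xi> \<phi> \<omega>))"
      by (simp only: integral_complex_of_real[symmetric] complex_norm_square)
    finally have "(\<lambda>n. complex_of_real ((r n)\<^sup>2)) sums complex_of_real (LINT \<omega>|M. (Re (gauss_series a \<xi> \<phi> \<omega>))\<^sup>2)"
      using covs[OF \<phi>(1) \<phi>(1)] by (simp add: br power2_eq_square)
    then have rs: "(\<lambda>n. (r n)\<^sup>2) sums (LINT \<omega>|M. (Re (gauss_series a \<xi> \<phi> \<omega>))\<^sup>2)"
      by (simp only: sums_of_real_iff)
    \<comment> \<open>Two limits of one sequence: dominated convergence along the almost sure limit,
      and the explicit Gaussian values, whose variances converge to that of the limit.\<close>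
    show "(LINT \<omega>|M. iexp (t * Re (gauss_series a \<xi> \<phi> \<omega>))) =
        of_real (exp (- (t\<^sup>2 * (LINT \<omega>|M. (Re (gauss_series a \<xi> \<phi> \<omega>))\<^sup>2)) / 2))" for t
    proof (rule LIMSEQ_unique)
      have ReY: "Re (\<Sum>n<N. Y \<phi> n \<omega>) = (\<Sum>n<N. r n * \<xi> n \<omega>)" for N \<omega>
        by (simp add: Y_def br)
      show "(\<lambda>N. LINT \<omega>|M. iexp (t * (\<Sum>n<N. r n * \<xi> n \<omega>))) \<longlonglongrightarrow> (LINT \<omega>|M. iexp (t * Re (gauss_series a \<xi> \<phi> \<omega>)))"
      proof (rule integral_dominated_convergence[where w = "\<lambda>_. 1"])
        show "AE \<omega> in M. (\<lambda>N. iexp (t * (\<Sum>n<N. r n * \<xi> n \<omega>))) \<longlonglongrightarrow> iexp (t * Re (gauss_series a \<xi> \<phi> \<omega>))"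
          using l2_dominated_sums[OF dom[OF \<phi>(1)]]
        proof eventually_elim
          case (elim \<omega>)
          then have "(\<lambda>N. iexp (t * Re (\<Sum>n<N. Y \<phi> n \<omega>))) \<longlonglongrightarrow> iexp (t * Re (\<Sum>n. Y \<phi> n \<omega>))"
            by (intro tendsto_intros)
          then show ?case unfolding ReY Z .
        qed
      qed simp_all
      show "(\<lambda>N. LINT \<omega>|M. iexp (t * (\<Sum>n<N. r n * \<xi> n \<omega>))) \<longlonglongrightarrow>
          of_real (exp (- (t\<^sup>2 * (LINT \<omega>|M. (Re (gauss_series a \<xi> \<phi> \<omega>))\<^sup>2)) / 2))"
        unfolding char_finite_sum using rs unfolding sums_def
        by (intro tendsto_intros) auto
    qed
  qed simp
  with st show "gaussian_gerf M (gauss_series a \<xi>)"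
    unfolding gaussian_gerf_def stationary_gerf_def by blast
qed

end

section \<open>Spectral weights and covariances\<close>

lemma lam_sq: "(lam \<kappa> k)\<^sup>2 = \<kappa>\<^sup>2 + 4 * pi\<^sup>2 * (norm (lattice_vec k))\<^sup>2"
  by (simp add: lam_def add_nonneg_nonneg)

lemma lam_uminus [simp]: "lam \<kappa> (- k) = lam \<kappa> k"
  by (simp add: lam_def lattice_vec_uminus)

lemma lam_pos [simp]: "0 < \<kappa> \<Longrightarrow> 0 < lam \<kappa> k"
  by (simp add: lam_def add_pos_nonneg)

lemma norm_lattice_vec_ge_1: "k \<noteq> 0 \<Longrightarrow> 1 \<le> norm (lattice_vec k)"
proof -
  assume "k \<noteq> 0"
  then obtain i where "k $ i \<noteq> 0" by (auto simp: vec_eq_iff)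
  then have "1 \<le> \<bar>lattice_vec k $ i\<bar>" by simp
  also have "\<dots> \<le> norm (lattice_vec k)" by (rule component_le_norm_cart)
  finally show ?thesis .
qed

text \<open>The least value of \<open>lam \<kappa>\<close> on nonzero frequencies, where |k| \<ge>
  1. It exceeds \<kappa>, and the ratio of the two is the rate of every geometric bound
  below.\<close>

definition lam_min :: "real \<Rightarrow> real" where
  "lam_min \<kappa> = sqrt (\<kappa>\<^sup>2 + 4 * pi\<^sup>2)"

lemma lam_ge_min: "k \<noteq> 0 \<Longrightarrow> lam_min \<kappa> \<le> lam \<kappa> k"
  unfolding lam_min_def lam_def
  using power_mono[OF norm_lattice_vec_ge_1, of k 2] by (simp add: mult_le_cancel_left1)

lemma lam_min_gt: "0 < \<kappa> \<Longrightarrow> \<kappa> < lam_min \<kappa>"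
  unfolding lam_min_def by (rule real_less_rsqrt) (simp add: pi_gt_zero)

definition cm_weight :: "real \<Rightarrow> real \<Rightarrow> int^'d::finite \<Rightarrow> real" where
  "cm_weight \<kappa> \<alpha> k = (if k = 0 then 0 else norm (lattice_vec k) powr (-2) * lam \<kappa> k powr (-2 * \<alpha>))"

text \<open>Indexed by the exponent \<beta> = \<nu> + d/2, which keeps the dimension out of the
  recursion.\<close>

definition lam_weight :: "real \<Rightarrow> real \<Rightarrow> int^'d::finite \<Rightarrow> real" where
  "lam_weight \<kappa> \<beta> k = (if k = 0 then 0 else lam \<kappa> k powr (-2 * \<beta>))"

lemma emeasure_point_measure_singleton: "emeasure (point_measure UNIV f) {k} = f k"
  by (subst emeasure_point_measure_finite2) auto

lemma sets_mu [simp]: "sets (mu_CM \<kappa> \<alpha>) = UNIV" "sets (mu_perp \<kappa> \<nu>) = UNIV"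
  by (simp_all add: mu_CM_def mu_perp_def sets_point_measure)

lemma emeasure_mu:
  "emeasure (mu_CM \<kappa> \<alpha>) {k} = ennreal (cm_weight \<kappa> \<alpha> k)"
  "emeasure (mu_perp \<kappa> \<nu>) {k} = ennreal (lam_weight \<kappa> (\<nu> + real CARD('d) / 2) (k :: int^'d::finite))"
  by (simp_all add: mu_CM_def mu_perp_def emeasure_point_measure_singleton cm_weight_def lam_weight_def)

lemma weight_nonneg [simp]: "0 \<le> cm_weight \<kappa> \<alpha> k" "0 \<le> lam_weight \<kappa> \<beta> k"
  by (simp_all add: cm_weight_def lam_weight_def)

lemma measure_mu:
  "measure (mu_CM \<kappa> \<alpha>) {k} = cm_weight \<kappa> \<alpha> k"
  "measure (mu_perp \<kappa> \<nu>) {k} = lam_weight \<kappa> (\<nu> + real CARD('d) / 2) (k :: int^'d::finite)"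
  by (simp_all add: measure_def emeasure_mu)

lemma lam_weight_le:
  assumes "0 < \<kappa>" "0 \<le> \<beta>"
  shows "lam_weight \<kappa> \<beta> k \<le> lam_min \<kappa> powr (-2 * \<beta>)"
proof (cases "k = 0")
  case False
  have "0 < lam_min \<kappa>" using lam_min_gt[OF assms(1)] assms(1) by linarith
  with False assms show ?thesis
    by (simp add: lam_weight_def powr_mono2' lam_ge_min)
qed (simp add: lam_weight_def)

lemma cm_weight_le:
  assumes "0 < \<kappa>" "0 \<le> \<alpha>"
  shows "cm_weight \<kappa> \<alpha> k \<le> lam_min \<kappa> powr (-2 * \<alpha>)"
proof (cases "k = 0")
  case False
  have "norm (lattice_vec k) powr (-2) \<le> 1"
  proof -
    have "norm (lattice_vec k) powr (-2) \<le> norm (lattice_vec k) powr 0"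
      using norm_lattice_vec_ge_1[OF False] by (intro powr_mono) auto
    also have "\<dots> = 1" using norm_lattice_vec_ge_1[OF False] by auto
    finally show ?thesis .
  qed
  then have "norm (lattice_vec k) powr (-2) * lam_weight \<kappa> \<alpha> k \<le> 1 * lam_min \<kappa> powr (-2 * \<alpha>)"
    by (intro mult_mono lam_weight_le assms) simp_all
  with False show ?thesis by (simp add: cm_weight_def lam_weight_def)
qed (simp add: cm_weight_def)

lemma cm_weight_rec:
  assumes "0 < \<kappa>"
  shows "cm_weight \<kappa> \<alpha> k = 4 * pi\<^sup>2 * lam_weight \<kappa> (\<alpha> + 1) k + \<kappa>\<^sup>2 * cm_weight \<kappa> (\<alpha> + 1) k"
proof (cases "k = 0")
  case False
  define n where "n = norm (lattice_vec k)"
  define l where "l = lam \<kappa> k"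
  have n: "n > 0" using False by (simp add: n_def)
  have l: "l > 0" using assms by (simp add: l_def)
  have e: "l powr (-2 * \<alpha>) = l\<^sup>2 * l powr (-2 * (\<alpha> + 1))"
    using l by (simp add: powr_add[symmetric] flip: powr_numeral)
  have n2: "n powr (-2) = 1 / n\<^sup>2" using n by (simp add: powr_minus divide_inverse)
  have l2: "l\<^sup>2 = \<kappa>\<^sup>2 + 4 * pi\<^sup>2 * n\<^sup>2" unfolding l_def n_def by (rule lam_sq)
  have "n powr (-2) * l powr (-2 * \<alpha>) = 4 * pi\<^sup>2 * l powr (-2 * (\<alpha> + 1)) + \<kappa>\<^sup>2 * (n powr (-2) * l powr (-2 * (\<alpha> + 1)))"
    unfolding e n2 l2 using n by (simp add: field_simps)
  then show ?thesis using False by (simp add: cm_weight_def lam_weight_def n_def l_def)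
qed (simp add: cm_weight_def lam_weight_def)

text \<open>The remainder is kept explicit so that the identity can be summed over k against test
  functions before N tends to infinity.\<close>

lemma cm_weight_expand:
  assumes "0 < \<kappa>"
  shows "cm_weight \<kappa> \<alpha> k = (\<Sum>j<N. 4 * pi\<^sup>2 * \<kappa> ^ (2 * j) * lam_weight \<kappa> (\<alpha> + 1 + real j) k) +
    \<kappa> ^ (2 * N) * cm_weight \<kappa> (\<alpha> + real N) k"
proof (induction N)
  case (Suc N)
  have "cm_weight \<kappa> (\<alpha> + real N) k = 4 * pi\<^sup>2 * lam_weight \<kappa> (\<alpha> + 1 + real N) k + \<kappa>\<^sup>2 * cm_weight \<kappa> (\<alpha> + real (Suc N)) k"
    using cm_weight_rec[OF assms, of "\<alpha> + real N" k] by (simp add: add_ac)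
  with Suc show ?case by (simp add: algebra_simps power2_eq_square)
qed simp

text \<open>A geometric sequence with ratio the square of \<kappa>/\<open>lam_min \<kappa>\<close>.
  As the bound does not depend on k, it serves the pointwise series and the spectral forms
  alike.\<close>

lemma cm_weight_ratio_tendsto:
  assumes "0 < \<kappa>"
  shows "(\<lambda>N. \<kappa> ^ (2 * N) * lam_min \<kappa> powr (-2 * (\<alpha> + real N))) \<longlonglongrightarrow> 0"
proof -
  define L where "L = lam_min \<kappa>"
  have L: "\<kappa> < L" "0 < L" using lam_min_gt[OF assms] assms by (simp_all add: L_def)
  have "\<kappa> ^ (2 * N) * L powr (-2 * (\<alpha> + real N)) = L powr (-2 * \<alpha>) * ((\<kappa> / L)\<^sup>2) ^ N" for N
  proof -
    have "L powr (-2 * (\<alpha> + real N)) = L powr (-2 * \<alpha>) * L powr (- real (2 * N))"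
      by (simp add: powr_add[symmetric] algebra_simps)
    also have "L powr (- real (2 * N)) = 1 / L ^ (2 * N)"
      using L(2) by (simp add: powr_minus powr_realpow divide_inverse del: of_nat_mult)
    finally show ?thesis by (simp add: power_divide power_mult)
  qed
  moreover have "(\<lambda>N. L powr (-2 * \<alpha>) * ((\<kappa> / L)\<^sup>2) ^ N) \<longlonglongrightarrow> L powr (-2 * \<alpha>) * 0"
    using L assms by (intro tendsto_mult tendsto_const LIMSEQ_power_zero) (simp add: power_less_one_iff abs_square_less_1)
  ultimately show ?thesis by (simp add: L_def)
qed

lemma cm_weight_sums:
  assumes "0 < \<kappa>"
  shows "(\<lambda>j. 4 * pi\<^sup>2 * \<kappa> ^ (2 * j) * lam_weight \<kappa> (\<alpha> + 1 + real j) k) sums cm_weight \<kappa> \<alpha> k"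
proof -
  \<comment> \<open>\<alpha> may be negative here, while the uniform bound on the weights asks for a
    nonnegative exponent; after J steps of the recursion it is available.\<close>
  obtain J where J: "0 \<le> \<alpha> + real J" by (metis add.commute diff_le_eq diff_0 real_arch_simple)
  have lim: "(\<lambda>N. \<kappa> ^ (2 * N) * cm_weight \<kappa> (\<alpha> + real N) k) \<longlonglongrightarrow> 0"
  proof (rule tendsto_sandwich[OF _ _ tendsto_const cm_weight_ratio_tendsto[OF assms, of \<alpha>]])
    show "\<forall>\<^sub>F N in sequentially. 0 \<le> \<kappa> ^ (2 * N) * cm_weight \<kappa> (\<alpha> + real N) k"
      using assms by simp
    show "\<forall>\<^sub>F N in sequentially. \<kappa> ^ (2 * N) * cm_weight \<kappa> (\<alpha> + real N) k \<le> \<kappa> ^ (2 * N) * lam_min \<kappa> powr (-2 * (\<alpha> + real N))"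
      using eventually_ge_at_top[of J]
    proof eventually_elim
      case (elim N)
      show ?case
        using J elim assms by (intro mult_left_mono cm_weight_le) simp_all
    qed
  qed
  have "(\<lambda>N. cm_weight \<kappa> \<alpha> k - \<kappa> ^ (2 * N) * cm_weight \<kappa> (\<alpha> + real N) k) \<longlonglongrightarrow> cm_weight \<kappa> \<alpha> k - 0"
    by (intro tendsto_diff tendsto_const lim)
  moreover have "cm_weight \<kappa> \<alpha> k - \<kappa> ^ (2 * N) * cm_weight \<kappa> (\<alpha> + real N) k =
      (\<Sum>j<N. 4 * pi\<^sup>2 * \<kappa> ^ (2 * j) * lam_weight \<kappa> (\<alpha> + 1 + real j) k)" for N
    using cm_weight_expand[OF assms, of \<alpha> k N] by simp
  ultimately show ?thesis by (simp add: sums_def)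
qed

section \<open>Expansion of the diagonalised covariance\<close>

definition spectral_form :: "(int^'d::finite \<Rightarrow> real) \<Rightarrow> (real^'d \<Rightarrow> complex) \<Rightarrow> (real^'d \<Rightarrow> complex) \<Rightarrow> complex" where
  "spectral_form m \<phi> \<psi> = (\<Sum>\<^sub>\<infinity>k. complex_of_real (m k) * (char_coeff \<phi> k * cnj (char_coeff \<psi> k)))"

lemma spectral_form_has_sum:
  assumes "\<phi> \<in> test_functions" "\<psi> \<in> test_functions" "\<And>k. 0 \<le> m k" "\<And>k. m k \<le> B"
  shows "((\<lambda>k. complex_of_real (m k) * (char_coeff \<phi> k * cnj (char_coeff \<psi> k))) has_sum spectral_form m \<phi> \<psi>) UNIV"
  unfolding spectral_form_def
  using abs_summable_summable[OF spectral_summable[OF assms(1,2), of m B]] assms(3,4) by (intro has_sum_infsum) blast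

lemma cmod_spectral_form_le:
  assumes "\<phi> \<in> test_functions" "\<psi> \<in> test_functions" "\<And>k. 0 \<le> m k" "\<And>k. m k \<le> B"
  shows "cmod (spectral_form m \<phi> \<psi>) \<le> B * (\<Sum>\<^sub>\<infinity>k. cmod (char_coeff \<phi> k * cnj (char_coeff \<psi> k)))"
proof -
  have s1: "(\<lambda>k. cmod (char_coeff \<phi> k * cnj (char_coeff \<psi> k))) summable_on UNIV"
    using spectral_summable[OF assms(1,2), of "\<lambda>_. 1" 1] by simp
  have "cmod (spectral_form m \<phi> \<psi>) \<le> (\<Sum>\<^sub>\<infinity>k. cmod (complex_of_real (m k) * (char_coeff \<phi> k * cnj (char_coeff \<psi> k))))"
    unfolding spectral_form_def by (rule norm_infsum_bound[OF spectral_summable[OF assms]])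
  also have "\<dots> \<le> (\<Sum>\<^sub>\<infinity>k. B * cmod (char_coeff \<phi> k * cnj (char_coeff \<psi> k)))"
  proof (rule infsum_mono[OF spectral_summable[OF assms] summable_on_cmult_right[OF s1]])
    show "cmod (complex_of_real (m k) * (char_coeff \<phi> k * cnj (char_coeff \<psi> k))) \<le> B * cmod (char_coeff \<phi> k * cnj (char_coeff \<psi> k))" for k
      unfolding norm_mult[of "of_real _"] norm_of_real using assms(3,4)[of k] by (intro mult_right_mono) auto
  qed
  also have "\<dots> = B * (\<Sum>\<^sub>\<infinity>k. cmod (char_coeff \<phi> k * cnj (char_coeff \<psi> k)))"
    by (rule infsum_cmult_right) (use s1 in blast)
  finally show ?thesis .
qed

lemma has_sum_finite_sum:
  fixes f :: "'j \<Rightarrow> 'i \<Rightarrow> 'b::{topological_comm_monoid_add}"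
  assumes "\<And>j. j \<in> J \<Longrightarrow> (f j has_sum s j) A"
  shows "((\<lambda>k. \<Sum>j\<in>J. f j k) has_sum (\<Sum>j\<in>J. s j)) A"
  using assms by (induction J rule: infinite_finite_induct) (auto intro: has_sum_add)

text \<open>For each N the finite expansion is summed over k; the remainder is then at most a null
  sequence times the absolute sum of the coefficient products. No two infinite sums have to be
  interchanged.\<close>

lemma cm_spectral_form_expand:
  fixes \<phi> \<psi> :: "real^'d::finite \<Rightarrow> complex"
  assumes \<kappa>: "0 < \<kappa>" and \<alpha>: "0 \<le> \<alpha>" and \<phi>: "\<phi> \<in> test_functions" and \<psi>: "\<psi> \<in> test_functions"
  shows "(\<lambda>j. complex_of_real (4 * pi\<^sup>2 * \<kappa> ^ (2 * j)) * spectral_form (lam_weight \<kappa> (\<alpha> + 1 + real j)) \<phi> \<psi>)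
    sums spectral_form (cm_weight \<kappa> \<alpha>) \<phi> \<psi>"
proof -
  define s where "s = (\<Sum>\<^sub>\<infinity>k. cmod (char_coeff \<phi> k * cnj (char_coeff \<psi> k)))"
  have lw: "((\<lambda>k. complex_of_real (lam_weight \<kappa> (\<alpha> + 1 + real j) k) * (char_coeff \<phi> k * cnj (char_coeff \<psi> k)))
      has_sum spectral_form (lam_weight \<kappa> (\<alpha> + 1 + real j)) \<phi> \<psi>) UNIV" for j
    using \<alpha> by (intro spectral_form_has_sum[OF \<phi> \<psi> _ lam_weight_le[OF \<kappa>]]) auto
  have cw: "((\<lambda>k. complex_of_real (cm_weight \<kappa> (\<alpha> + real N) k) * (char_coeff \<phi> k * cnj (char_coeff \<psi> k)))
      has_sum spectral_form (cm_weight \<kappa> (\<alpha> + real N)) \<phi> \<psi>) UNIV" for N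
    using \<alpha> by (intro spectral_form_has_sum[OF \<phi> \<psi> _ cm_weight_le[OF \<kappa>]]) auto
  have eq: "spectral_form (cm_weight \<kappa> \<alpha>) \<phi> \<psi> =
      (\<Sum>j<N. complex_of_real (4 * pi\<^sup>2 * \<kappa> ^ (2 * j)) * spectral_form (lam_weight \<kappa> (\<alpha> + 1 + real j)) \<phi> \<psi>) +
      complex_of_real (\<kappa> ^ (2 * N)) * spectral_form (cm_weight \<kappa> (\<alpha> + real N)) \<phi> \<psi>" for N
  proof -
    have "((\<lambda>k. (\<Sum>j<N. complex_of_real (4 * pi\<^sup>2 * \<kappa> ^ (2 * j)) * (complex_of_real (lam_weight \<kappa> (\<alpha> + 1 + real j) k) * (char_coeff \<phi> k * cnj (char_coeff \<psi> k))))
        + complex_of_real (\<kappa> ^ (2 * N)) * (complex_of_real (cm_weight \<kappa> (\<alpha> + real N) k) * (char_coeff \<phi> k * cnj (char_coeff \<psi> k))))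
      has_sum ((\<Sum>j<N. complex_of_real (4 * pi\<^sup>2 * \<kappa> ^ (2 * j)) * spectral_form (lam_weight \<kappa> (\<alpha> + 1 + real j)) \<phi> \<psi>) +
      complex_of_real (\<kappa> ^ (2 * N)) * spectral_form (cm_weight \<kappa> (\<alpha> + real N)) \<phi> \<psi>)) UNIV"
      by (intro has_sum_add has_sum_finite_sum has_sum_cmult_right lw cw)
    moreover have "(\<Sum>j<N. complex_of_real (4 * pi\<^sup>2 * \<kappa> ^ (2 * j)) * (complex_of_real (lam_weight \<kappa> (\<alpha> + 1 + real j) k) * z))
        + complex_of_real (\<kappa> ^ (2 * N)) * (complex_of_real (cm_weight \<kappa> (\<alpha> + real N) k) * z) = complex_of_real (cm_weight \<kappa> \<alpha> k) * z" for k :: "int^'d" and z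
      by (subst cm_weight_expand[OF \<kappa>, of \<alpha> k N]) (simp add: sum_distrib_left sum_distrib_right algebra_simps)
    ultimately show ?thesis
      by (simp only: spectral_form_def[of "cm_weight \<kappa> \<alpha>"] infsumI)
  qed
  have "(\<lambda>N. complex_of_real (\<kappa> ^ (2 * N)) * spectral_form (cm_weight \<kappa> (\<alpha> + real N)) \<phi> \<psi>) \<longlonglongrightarrow> 0"
  proof (rule Lim_null_comparison)
    show "(\<lambda>N. \<kappa> ^ (2 * N) * lam_min \<kappa> powr (-2 * (\<alpha> + real N)) * s) \<longlonglongrightarrow> 0"
      using tendsto_mult[OF cm_weight_ratio_tendsto[OF \<kappa>, of \<alpha>] tendsto_const[of s]] by simp
    show "\<forall>\<^sub>F N in sequentially. norm (complex_of_real (\<kappa> ^ (2 * N)) * spectral_form (cm_weight \<kappa> (\<alpha> + real N)) \<phi> \<psi>)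
        \<le> \<kappa> ^ (2 * N) * lam_min \<kappa> powr (-2 * (\<alpha> + real N)) * s"
    proof (intro always_eventually allI)
      fix N
      have "cmod (spectral_form (cm_weight \<kappa> (\<alpha> + real N)) \<phi> \<psi>) \<le> lam_min \<kappa> powr (-2 * (\<alpha> + real N)) * s"
        unfolding s_def using \<alpha> by (intro cmod_spectral_form_le[OF \<phi> \<psi> _ cm_weight_le[OF \<kappa>]]) auto
      then show "norm (complex_of_real (\<kappa> ^ (2 * N)) * spectral_form (cm_weight \<kappa> (\<alpha> + real N)) \<phi> \<psi>)
        \<le> \<kappa> ^ (2 * N) * lam_min \<kappa> powr (-2 * (\<alpha> + real N)) * s"
        using \<kappa> by (simp add: norm_mult norm_power mult.assoc mult_left_mono)
    qed
  qed
  then have "(\<lambda>N. spectral_form (cm_weight \<kappa> \<alpha>) \<phi> \<psi> - complex_of_real (\<kappa> ^ (2 * N)) * spectral_form (cm_weight \<kappa> (\<alpha> + real N)) \<phi> \<psi>) \<longlonglongrightarrow> spectral_form (cm_weight \<kappa> \<alpha>) \<phi> \<psi> - 0"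
    by (intro tendsto_diff tendsto_const)
  moreover have "spectral_form (cm_weight \<kappa> \<alpha>) \<phi> \<psi> - complex_of_real (\<kappa> ^ (2 * N)) * spectral_form (cm_weight \<kappa> (\<alpha> + real N)) \<phi> \<psi> =
      (\<Sum>j<N. complex_of_real (4 * pi\<^sup>2 * \<kappa> ^ (2 * j)) * spectral_form (lam_weight \<kappa> (\<alpha> + 1 + real j)) \<phi> \<psi>)" for N
    by (subst (1) eq[of N]) simp
  ultimately show ?thesis by (simp add: sums_def)
qed

lemma stationary_gerf_facts:
  assumes "stationary_gerf M Z \<mu>"
  shows "prob_space M"
    and "\<And>\<phi>. \<phi> \<in> test_functions \<Longrightarrow> Z \<phi> \<in> borel_measurable M"
    and "\<And>\<phi>. \<phi> \<in> test_functions \<Longrightarrow> integrable M (\<lambda>\<omega>. (cmod (Z \<phi> \<omega>))\<^sup>2)"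
    and "\<And>\<phi> \<psi> a b. \<phi> \<in> test_functions \<Longrightarrow> \<psi> \<in> test_functions \<Longrightarrow>
        AE \<omega> in M. Z (\<lambda>x. a * \<phi> x + b * \<psi> x) \<omega> = a * Z \<phi> \<omega> + b * Z \<psi> \<omega>"
    and "\<And>\<phi>. \<phi> \<in> test_functions \<Longrightarrow> (\<And>x. \<phi> x \<in> \<real>) \<Longrightarrow> AE \<omega> in M. Z \<phi> \<omega> \<in> \<real>"
    and "\<And>\<phi>. \<phi> \<in> test_functions \<Longrightarrow> (LINT \<omega>|M. Z \<phi> \<omega>) = 0"
    and "\<And>\<phi> \<psi>. \<phi> \<in> test_functions \<Longrightarrow> \<psi> \<in> test_functions \<Longrightarrow>
        (LINT \<omega>|M. Z \<phi> \<omega> * cnj (Z \<psi> \<omega>)) = spectral_form (\<lambda>k. measure \<mu> {k}) \<phi> \<psi>"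
proof -
  have g: "gerf M Z" and c: "has_covariance_distribution M Z (spectral_distribution \<mu>)"
    using assms by (simp_all add: stationary_gerf_def)
  show "prob_space M"
    and "\<And>\<phi>. \<phi> \<in> test_functions \<Longrightarrow> Z \<phi> \<in> borel_measurable M"
    and "\<And>\<phi>. \<phi> \<in> test_functions \<Longrightarrow> integrable M (\<lambda>\<omega>. (cmod (Z \<phi> \<omega>))\<^sup>2)"
    and "\<And>\<phi> \<psi> a b. \<phi> \<in> test_functions \<Longrightarrow> \<psi> \<in> test_functions \<Longrightarrow>
        AE \<omega> in M. Z (\<lambda>x. a * \<phi> x + b * \<psi> x) \<omega> = a * Z \<phi> \<omega> + b * Z \<psi> \<omega>"
    and "\<And>\<phi>. \<phi> \<in> test_functions \<Longrightarrow> (\<And>x. \<phi> x \<in> \<real>) \<Longrightarrow> AE \<omega> in M. Z \<phi> \<omega> \<in> \<real>"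
    and m: "\<And>\<phi>. \<phi> \<in> test_functions \<Longrightarrow> (LINT \<omega>|M. Z \<phi> \<omega>) = 0"
    using g unfolding gerf_def by blast+
  show "(LINT \<omega>|M. Z \<phi> \<omega> * cnj (Z \<psi> \<omega>)) = spectral_form (\<lambda>k. measure \<mu> {k}) \<phi> \<psi>"
    if "\<phi> \<in> test_functions" "\<psi> \<in> test_functions" for \<phi> \<psi>
    using c that m unfolding has_covariance_distribution_def covariance_def spectral_form_def
    by (simp add: spectral_distribution_conv)
qed

section \<open>Reading off the spectral measure on characters\<close>

lemma covariance_eq_inner:
  assumes "stationary_gerf M Z \<mu>" "\<phi> \<in> test_functions" "\<psi> \<in> test_functions"
  shows "covariance M (Z \<phi>) (Z \<psi>) = spectral_form (\<lambda>k. measure \<mu> {k}) \<phi> \<psi>"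
  using stationary_gerf_facts(6,7)[OF assms(1)] assms(2,3) by (simp add: covariance_def)

text \<open>A character sees a single lattice point, so variances of characters reveal the point
  masses. The sign comes from the convention of \<open>char_coeff\<close>.\<close>

lemma spectral_form_character:
  "spectral_form m (character l) (character l) = complex_of_real (m (- l))"
proof -
  have "complex_of_real (m k) * (char_coeff (character l) k * cnj (char_coeff (character l) k)) =
      (if k = - l then complex_of_real (m (- l)) else 0)" for k
    by (auto simp: char_coeff_character minus_equation_iff)
  then have "spectral_form m (character l) (character l) = (\<Sum>\<^sub>\<infinity>k. if k = - l then complex_of_real (m (- l)) else 0)"
    by (simp add: spectral_form_def)
  also have "\<dots> = (\<Sum>\<^sub>\<infinity>k\<in>{- l}. complex_of_real (m (- l)))"
    by (rule infsum_cong_neutral) auto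
  finally show ?thesis by simp
qed

lemma fourier_multiplier_character: "fourier_multiplier m (character l) = (\<lambda>x. complex_of_real (m l) * character l x)"
proof
  fix x
  have fc: "fourier_coeff (character l) k = (if k = l then 1 else 0)" for k
    unfolding fourier_coeff_def torus_integral_character_mult by auto
  have "fourier_multiplier m (character l) x = (\<Sum>\<^sub>\<infinity>k. if k = l then complex_of_real (m l) * character l x else 0)"
    unfolding fourier_multiplier_def fc by (intro infsum_cong) auto
  also have "\<dots> = (\<Sum>\<^sub>\<infinity>k\<in>{l}. complex_of_real (m l) * character l x)"
    by (rule infsum_cong_neutral) auto
  finally show "fourier_multiplier m (character l) x = complex_of_real (m l) * character l x" by simp
qed

lemma torus_conv_character: "torus_conv (character l) (conj_reflect (character l)) = character l"
proof
  fix x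
  have "character l (x - y) * conj_reflect (character l) y = character l x" for y
  proof -
    have "character l (x - y) * conj_reflect (character l) y = character l (x - y) * character l y"
      by (simp add: conj_reflect_def character_minus)
    then show ?thesis by (simp flip: character_add)
  qed
  then show "torus_conv (character l) (conj_reflect (character l)) x = character l x"
    by (simp add: torus_conv_def torus_integral_tor tor.prob_space)
qed

lemma laplacian_character:
  "laplacian (character l) x = - complex_of_real (4 * pi\<^sup>2 * (norm (lattice_vec l))\<^sup>2) * character l x"
proof -
  have "laplacian (character l) x = (\<Sum>i\<in>UNIV. - complex_of_real (4 * pi\<^sup>2 * (real_of_int (l $ i))\<^sup>2) * character l x)"
    unfolding laplacian_def partials_character
    by (intro sum.cong refl) (simp add: power2_eq_square algebra_simps)
  also have "\<dots> = - complex_of_real (4 * pi\<^sup>2 * (\<Sum>i\<in>UNIV. (real_of_int (l $ i))\<^sup>2)) * character l x"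
    by (simp add: sum_distrib_left sum_distrib_right sum_negf)
  finally show ?thesis by (simp add: norm_lattice_vec_sq)
qed

text \<open>\<open>character l\<close> is an eigenfunction of the Laplacian, so the defining
  equation fixes the value for l \<noteq> 0. At l = 0 the eigenvalue vanishes and the mean-zero
  condition supplies the value.\<close>

lemma green_distribution_character:
  assumes "green_distribution T"
  shows "T (character l) = (if l = 0 then 0 else complex_of_real (1 / (4 * pi\<^sup>2 * (norm (lattice_vec l))\<^sup>2)))"
proof (cases "l = 0")
  case True
  have "T (\<lambda>x. 1) = 0" using assms by (simp add: green_distribution_def)
  moreover have "character l = (\<lambda>x. 1)" using True by (simp add: fun_eq_iff)
  ultimately show ?thesis using True by simp
next
  case False
  define c where "c = 4 * pi\<^sup>2 * (norm (lattice_vec l))\<^sup>2"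
  have c: "c > 0" using norm_lattice_vec_ge_1[OF False] by (auto simp: c_def intro!: mult_pos_pos zero_less_power)
  have lin: "T (\<lambda>x. a * \<phi> x + b * \<psi> x) = a * T \<phi> + b * T \<psi>" if "\<phi> \<in> test_functions" "\<psi> \<in> test_functions" for \<phi> \<psi> a b
    using assms that unfolding green_distribution_def distribution_def by blast
  have "T (\<lambda>x. - laplacian (character l) x) = character l 0 - torus_integral (character l)"
    using assms by (simp add: green_distribution_def)
  moreover have "(\<lambda>x. - laplacian (character l) x) = (\<lambda>x. complex_of_real c * character l x + 0 * character l x)"
    by (simp add: laplacian_character c_def fun_eq_iff)
  ultimately have "complex_of_real c * T (character l) = 1"
    using lin[of "character l" "character l" "complex_of_real c" 0] False by (simp add: torus_integral_tor integral_character)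
  then show ?thesis
    using False c unfolding c_def[symmetric] by (simp add: field_simps)
qed

text \<open>Both sides of the equation are tested on the character with index -k. There the
  multiplier is the scalar lambda(k)^\<alpha>, so lambda(k)^(2 \<alpha>) times the mass at k equals
  4 pi^2 times the Green distribution, that is |k|^(-2), or 0 at k = 0.\<close>

lemma canonical_matern_spectral:
  fixes u :: "(real^'d::finite \<Rightarrow> complex) \<Rightarrow> 'a \<Rightarrow> complex"
  assumes cm: "canonical_matern \<kappa> \<alpha> N G M u" and \<kappa>: "0 < \<kappa>"
  obtains \<mu> where "stationary_gerf M u \<mu>" "\<And>k. measure \<mu> {k} = cm_weight \<kappa> \<alpha> k"
proof -
  obtain \<mu> where \<mu>: "stationary_gerf M u \<mu>" using cm by (auto simp: canonical_matern_def)
  obtain T where T: "green_distribution T" "has_covariance_distribution N G (\<lambda>\<phi>. complex_of_real (4 * pi\<^sup>2) * T \<phi>)"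
    using cm by (auto simp: canonical_matern_def canonical_field_def)
  have eq: "second_order_eq M (field_multiplier (\<lambda>k. lam \<kappa> k powr \<alpha>) u) N G"
    using cm by (simp add: canonical_matern_def)
  interpret prob_space M by (rule stationary_gerf_facts(1)[OF \<mu>])
  have "measure \<mu> {k} = cm_weight \<kappa> \<alpha> k" for k
  proof -
    let ?e = "character (- k)" and ?l = "lam \<kappa> k powr \<alpha>"
    \<comment> \<open>The void summand brings the scalar multiple into the two-term form of the
      linearity clause.\<close>
    have "field_multiplier (\<lambda>k. lam \<kappa> k powr \<alpha>) u ?e = u (\<lambda>x. complex_of_real ?l * ?e x + 0 * ?e x)"
      by (simp add: field_multiplier_def fourier_multiplier_character)
    then have ae: "AE \<omega> in M. field_multiplier (\<lambda>k. lam \<kappa> k powr \<alpha>) u ?e \<omega> = complex_of_real ?l * u ?e \<omega>"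
      using stationary_gerf_facts(4)[OF \<mu>, of ?e ?e "complex_of_real ?l" 0] by simp
    have [measurable]: "u ?e \<in> borel_measurable M" "field_multiplier (\<lambda>k. lam \<kappa> k powr \<alpha>) u ?e \<in> borel_measurable M"
      using stationary_gerf_facts(2)[OF \<mu>] test_scale[OF character_test]
      by (auto simp: field_multiplier_def fourier_multiplier_character)
    have mean: "(LINT \<omega>|M. field_multiplier (\<lambda>k. lam \<kappa> k powr \<alpha>) u ?e \<omega>) = 0"
      unfolding field_multiplier_def fourier_multiplier_character
      by (rule stationary_gerf_facts(6)[OF \<mu> test_scale[OF character_test]])
    have "covariance M (field_multiplier (\<lambda>k. lam \<kappa> k powr \<alpha>) u ?e) (field_multiplier (\<lambda>k. lam \<kappa> k powr \<alpha>) u ?e) =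
        (LINT \<omega>|M. complex_of_real (?l\<^sup>2) * (u ?e \<omega> * cnj (u ?e \<omega>)))"
      unfolding covariance_def mean
      by (rule integral_cong_AE) (use ae in \<open>auto elim!: eventually_mono simp: power2_eq_square\<close>)
    also have "\<dots> = complex_of_real (?l\<^sup>2 * measure \<mu> {k})"
      using stationary_gerf_facts(7)[OF \<mu>, of ?e ?e] by (simp add: spectral_form_character)
    finally have 1: "covariance N (G ?e) (G ?e) = complex_of_real (?l\<^sup>2 * measure \<mu> {k})"
      using eq unfolding second_order_eq_def by simp
    have "covariance N (G ?e) (G ?e) = complex_of_real (4 * pi\<^sup>2) * T ?e"
      using T(2) unfolding has_covariance_distribution_def by (simp add: torus_conv_character)
    also have "\<dots> = complex_of_real (if k = 0 then 0 else norm (lattice_vec k) powr (-2))"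
    proof (cases "k = 0")
      case False
      have "norm (lattice_vec k) powr (-2) = 1 / (norm (lattice_vec k))\<^sup>2"
        using norm_lattice_vec_ge_1[OF False] by (simp add: powr_minus divide_inverse)
      then show ?thesis
        using False unfolding green_distribution_character[OF T(1)] by (simp add: lattice_vec_uminus)
    qed (simp add: green_distribution_character[OF T(1)])
    finally have "?l\<^sup>2 * measure \<mu> {k} = (if k = 0 then 0 else norm (lattice_vec k) powr (-2))"
      unfolding 1 of_real_eq_iff .
    moreover have "?l\<^sup>2 = lam \<kappa> k powr (2 * \<alpha>)" "lam \<kappa> k powr (2 * \<alpha>) \<noteq> 0"
      using less_imp_neq[OF lam_pos[OF \<kappa>, of k]] by (auto simp: power2_eq_square powr_add[symmetric])
    ultimately have "measure \<mu> {k} = (if k = 0 then 0 else norm (lattice_vec k) powr (-2)) / lam \<kappa> k powr (2 * \<alpha>)"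
      by (simp add: eq_divide_eq mult.commute)
    then show ?thesis
      by (simp add: cm_weight_def powr_minus divide_inverse)
  qed
  with \<mu> that show thesis by blast
qed

section \<open>Independent Matern families and their series\<close>

lemma field_algebra_le:
  fixes Z :: "(real^'d::finite \<Rightarrow> complex) \<Rightarrow> 'a \<Rightarrow> complex"
  assumes G: "G \<subseteq> Pow (space M)"
    and Z: "\<And>\<phi>. \<phi> \<in> test_functions \<Longrightarrow> Z \<phi> \<in> borel_measurable (sigma (space M) G)"
  shows "field_algebra M Z \<subseteq> sigma_sets (space M) G"
  unfolding field_algebra_def
proof (rule sigma_sets_mono, safe)
  fix \<phi> :: "real^'d \<Rightarrow> complex" and A :: "complex set"
  assume "\<phi> \<in> test_functions" "A \<in> sets borel"
  then show "Z \<phi> -` A \<inter> space M \<in> sigma_sets (space M) G"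
    using measurable_sets[OF Z, of \<phi> A] G by (simp add: space_measure_of sets_measure_of)
qed

lemma field_algebra_measurable:
  assumes "\<phi> \<in> test_functions" "field_algebra M Z \<subseteq> G" "G \<subseteq> Pow (space M)"
  shows "Z \<phi> \<in> borel_measurable (sigma (space M) G)"
proof (rule measurableI)
  fix A :: "complex set" assume "A \<in> sets borel"
  then have "Z \<phi> -` A \<inter> space M \<in> field_algebra M Z"
    unfolding field_algebra_def using assms(1) by (intro sigma_sets.Basic) blast
  then show "Z \<phi> -` A \<inter> space (sigma (space M) G) \<in> sets (sigma (space M) G)"
    using assms(2,3) by (auto simp: space_measure_of sets_measure_of intro: sigma_sets.Basic)
qed simp

lemma field_algebra_space: "field_algebra M Z \<subseteq> Pow (space M)"
proof (intro subsetI PowI)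
  fix A x assume "A \<in> field_algebra M Z" "x \<in> A"
  moreover have "{Z \<phi> -` A \<inter> space M | \<phi> A. \<phi> \<in> test_functions \<and> A \<in> sets borel} \<subseteq> Pow (space M)" by blast
  ultimately show "x \<in> space M"
    unfolding field_algebra_def by (meson sigma_sets_into_sp subsetD)
qed

lemma Int_stable_field_algebra: "Int_stable (field_algebra M Z)"
proof -
  have "sigma_algebra (space M) (field_algebra M Z)"
    unfolding field_algebra_def by (rule sigma_algebra_sigma_sets) auto
  then interpret sigma_algebra "space M" "field_algebra M Z" .
  show ?thesis by (auto simp: Int_stable_def)
qed

lemma (in prob_space) indep_sets_inj:
  assumes "indep_sets F UNIV" "inj f"
  shows "indep_sets (\<lambda>n. F (f n)) UNIV"
proof (rule indep_setsI)
  show "F (f i) \<subseteq> events" for i using assms(1) by (auto simp: indep_sets_def)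
next
  fix A J assume J: "J \<noteq> {}" "J \<subseteq> UNIV" "finite J" and A: "\<forall>j\<in>J. A j \<in> F (f j)"
  have inv: "inv f (f j) = j" for j using assms(2) by simp
  have "prob (\<Inter>i\<in>f ` J. A (inv f i)) = (\<Prod>i\<in>f ` J. prob (A (inv f i)))"
    by (rule indep_setsD[OF assms(1)]) (use J A inv in auto)
  then show "prob (\<Inter>j\<in>J. A j) = (\<Prod>j\<in>J. prob (A j))"
    using assms(2) by (simp add: inv prod.reindex inj_on_def inj_def image_image)
qed

lemma (in prob_space) iid_normal_subfamily:
  assumes iv: "indep_vars (\<lambda>_. borel) \<zeta> UNIV" and n: "\<And>i. distr M borel (\<zeta> i) = std_normal_distribution"
    and f: "inj f"
  shows "iid_normal M (\<lambda>n. \<zeta> (f n))"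
proof -
  have "indep_vars (\<lambda>_. borel) (\<lambda>n. \<zeta> (f n)) UNIV"
    using iv indep_sets_inj[OF _ f, of "\<lambda>i. {\<zeta> i -` A \<inter> space M |A. A \<in> sets borel}"]
    by (simp add: indep_vars_def2)
  then show ?thesis by unfold_locales (use n in auto)
qed

text \<open>One sequence of independent standard normals carries all fields: its indices are cut
  into infinitely many disjoint infinite blocks, and field j is the random series over block j. The
  condition on \<nu> makes all exponents nonnegative and thus the weights bounded.\<close>

lemma exists_independent_matern_family:
  assumes \<kappa>: "0 < \<kappa>" and \<nu>: "0 \<le> \<nu> + real CARD('d::finite) / 2"
  shows "\<exists>(P :: (nat \<Rightarrow> real) measure) (X :: nat \<Rightarrow> (real^'d \<Rightarrow> complex) \<Rightarrow> (nat \<Rightarrow> real) \<Rightarrow> complex).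
    independent_matern_family \<kappa> \<nu> P X"
proof -
  define P where "P = (\<Pi>\<^sub>M i\<in>(UNIV::nat set). std_normal_distribution)"
  have sp: "prob_space std_normal_distribution"
    by (rule prob_space_normal_density) simp
  interpret P: prob_space P
    unfolding P_def by (rule prob_space_PiM) (rule sp)
  define \<zeta> where "\<zeta> i \<omega> = (\<omega> i :: real)" for i :: nat and \<omega>
  have setsP: "sets P = sets (\<Pi>\<^sub>M i\<in>(UNIV::nat set). borel)"
    unfolding P_def by (rule sets_PiM_cong) auto
  have \<zeta>m [measurable]: "\<zeta> i \<in> borel_measurable P" for i
    unfolding \<zeta>_def measurable_cong_sets[OF setsP refl] by measurable
  have norm: "distr P borel (\<zeta> i) = std_normal_distribution" for i
  proof -
    have "distr P borel (\<zeta> i) = distr P std_normal_distribution (\<lambda>\<omega>. \<omega> i)"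
      by (rule distr_cong) (simp_all add: \<zeta>_def)
    also have "\<dots> = std_normal_distribution"
      unfolding P_def by (rule distr_PiM_component) (simp_all add: sp)
    finally show ?thesis .
  qed
  have iv: "P.indep_vars (\<lambda>_. borel) \<zeta> UNIV"
  proof (subst P.indep_vars_iff_distr_eq_PiM')
    have "distr P (\<Pi>\<^sub>M i\<in>(UNIV::nat set). borel) (\<lambda>x. \<lambda>i\<in>UNIV. \<zeta> i x) = distr P P (\<lambda>x. x)"
      by (rule distr_cong) (simp_all add: setsP \<zeta>_def restrict_def)
    also have "\<dots> = P" by (rule distr_id)
    finally show "distr P (\<Pi>\<^sub>M i\<in>(UNIV::nat set). borel) (\<lambda>x. \<lambda>i\<in>UNIV. \<zeta> i x) = (\<Pi>\<^sub>M i\<in>(UNIV::nat set). distr P borel (\<zeta> i))"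
      unfolding norm P_def[symmetric] .
  qed simp_all
  \<comment> \<open>The pairing bijection of the natural numbers provides the disjoint
    blocks.\<close>
  define \<xi> where "\<xi> j = (\<lambda>n. \<zeta> (prod_encode (j, n)))" for j
  have iid: "iid_normal P (\<xi> j)" for j
    unfolding \<xi>_def by (rule P.iid_normal_subfamily[OF iv norm]) (simp add: inj_def)
  define a where "a j k = sqrt (lam_weight \<kappa> (\<nu> + real j + real CARD('d) / 2) k)" for j and k :: "int^'d"
  define X where "X j = gauss_series (a j) (\<xi> j)" for j
  have X: "stationary_gerf P (X j) (mu_perp \<kappa> (\<nu> + real j))" "gaussian_gerf P (X j)" for j
  proof -
    have a: "0 \<le> a j k" "a j k \<le> sqrt (lam_min \<kappa> powr (-2 * (\<nu> + real j + real CARD('d) / 2)))" "a j (- k) = a j k"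
      "emeasure (mu_perp \<kappa> (\<nu> + real j)) {k} = ennreal ((a j k)\<^sup>2)" for k
      using lam_weight_le[OF \<kappa>, of "\<nu> + real j + real CARD('d) / 2" k] \<nu>
      by (simp_all add: a_def emeasure_mu) (simp add: lam_weight_def)
    show "stationary_gerf P (X j) (mu_perp \<kappa> (\<nu> + real j))"
      unfolding X_def by (rule iid_normal.gauss_series_field(1)[OF iid a(1-3) sets_mu(2) a(4)])
    show "gaussian_gerf P (X j)"
      unfolding X_def by (rule iid_normal.gauss_series_field(2)[OF iid a(1-3) sets_mu(2) a(4)])
  qed
  define E where "E i = {\<zeta> i -` A \<inter> space P |A. A \<in> sets borel}" for i
  have Esp: "E i \<subseteq> Pow (space P)" for i by (auto simp: E_def)
  \<comment> \<open>Grouping independent generators over disjoint index blocks yields independent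
    sigma-algebras.\<close>
  have "P.indep_sets (\<lambda>j. sigma_sets (space P) (\<Union>i\<in>range (\<lambda>n. prod_encode (j, n)). E i)) UNIV"
  proof (rule P.indep_sets_collect_sigma)
    show "P.indep_sets E (\<Union>j\<in>UNIV. range (\<lambda>n. prod_encode (j, n)))"
      using iv unfolding P.indep_vars_def2 E_def by (auto intro: P.indep_sets_mono_index[rotated])
    show "Int_stable (E i)" for i
      unfolding E_def Int_stable_def
    proof safe
      fix A B :: "real set" assume "A \<in> sets borel" "B \<in> sets borel"
      then show "\<exists>C. (\<zeta> i -` A \<inter> space P) \<inter> (\<zeta> i -` B \<inter> space P) = \<zeta> i -` C \<inter> space P \<and> C \<in> sets borel"
        by (intro exI[of _ "A \<inter> B"]) auto
    qed
    show "disjoint_family_on (\<lambda>j. range (\<lambda>n. prod_encode (j, n))) UNIV"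
      by (auto simp: disjoint_family_on_def)
  qed
  then have "P.indep_sets (\<lambda>j. field_algebra P (X j)) UNIV"
  proof (rule P.indep_sets_mono_sets)
    fix j
    let ?G = "\<Union>i\<in>range (\<lambda>n. prod_encode (j, n)). E i"
    have G: "?G \<subseteq> Pow (space P)" using Esp by blast
    have "\<xi> j n \<in> borel_measurable (sigma (space P) ?G)" for n
    proof (rule measurableI)
      fix A :: "real set" assume "A \<in> sets borel"
      then have "\<xi> j n -` A \<inter> space P \<in> ?G" by (auto simp: E_def \<xi>_def)
      then show "\<xi> j n -` A \<inter> space (sigma (space P) ?G) \<in> sets (sigma (space P) ?G)"
        using G by (simp add: space_measure_of sets_measure_of)
    qed simp
    \<comment> \<open>Since the series is a pointwise sum, it is measurable for the algebra of its
      own block exactly, and no null sets have to be adjoined.\<close>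
    then show "field_algebra P (X j) \<subseteq> sigma_sets (space P) ?G"
      by (intro field_algebra_le[OF G]) (simp add: X_def gauss_series_def[abs_def])
  qed
  then have "independent_matern_family \<kappa> \<nu> P X"
    unfolding independent_matern_family_def independent_fields_def matern_perp_def
    using X P.prob_space_axioms by blast
  then show ?thesis by blast
qed

lemma (in prob_space) independent_fields_indep_var:
  fixes X :: "nat \<Rightarrow> (real^'d::finite \<Rightarrow> complex) \<Rightarrow> 'a \<Rightarrow> complex"
  assumes ind: "independent_fields M X UNIV" and "i \<noteq> j"
    and \<phi>: "\<phi> \<in> test_functions" "\<psi> \<in> test_functions"
    and [measurable]: "X i \<phi> \<in> borel_measurable M" "X j \<psi> \<in> borel_measurable M"
  shows "indep_var borel (X i \<phi>) borel (X j \<psi>)"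
proof -
  have isets: "indep_sets (\<lambda>i. field_algebra M (X i)) UNIV"
    using ind by (simp add: independent_fields_def)
  have sub: "sigma_sets (space M) {X i \<phi> -` A \<inter> space M |A. A \<in> sets borel} \<subseteq> field_algebra M (X i)"
    if "\<phi> \<in> test_functions" for i and \<phi> :: "real^'d \<Rightarrow> complex"
    unfolding field_algebra_def by (rule sigma_sets_mono') (use that in blast)
  have "prob (a \<inter> b) = prob a * prob b" if "a \<in> field_algebra M (X i)" "b \<in> field_algebra M (X j)" for a b
    using indep_setsD[OF isets, of "{i, j}" "\<lambda>k. if k = i then a else b"] that \<open>i \<noteq> j\<close>
    by (auto simp: Int_commute)
  then show ?thesis
    unfolding indep_var_eq indep_sets2_eq using sub[OF \<phi>(1), of i] sub[OF \<phi>(2), of j] isets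
    by (auto simp: indep_sets_def subset_iff)
qed

lemma (in prob_space) independent_fields_indep_vars:
  assumes ind: "independent_fields M X UNIV" and \<phi>: "\<phi> \<in> test_functions"
    and [measurable]: "\<And>j. X j \<phi> \<in> borel_measurable M"
  shows "indep_vars (\<lambda>_. borel) (\<lambda>j. X j \<phi>) UNIV"
  unfolding indep_vars_def
proof (intro conjI ballI)
  have "indep_sets (\<lambda>i. field_algebra M (X i)) UNIV"
    using ind by (simp add: independent_fields_def)
  then show "indep_sets (\<lambda>i. sigma_sets (space M) {X i \<phi> -` A \<inter> space M |A. A \<in> sets borel}) UNIV"
    by (rule indep_sets_mono_sets) (unfold field_algebra_def, rule sigma_sets_mono', use \<phi> in blast)
qed simp

locale matern_series =
  fixes \<kappa> \<alpha> c :: real and P :: "'b measure" and X :: "nat \<Rightarrow> (real^'d::finite \<Rightarrow> complex) \<Rightarrow> 'b \<Rightarrow> complex"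
  assumes \<kappa>: "0 < \<kappa>" and \<alpha>: "0 \<le> \<alpha>" and c: "0 \<le> c"
    and fam: "independent_matern_family \<kappa> (\<alpha> + 1 - real CARD('d) / 2) P X"
begin

sublocale prob_space P
  using fam by (simp add: independent_matern_family_def)

lemma X_stationary: "stationary_gerf P (X j) (mu_perp \<kappa> (\<alpha> + 1 - real CARD('d) / 2 + real j))"
  and X_gaussian: "gaussian_gerf P (X j)"
  using fam by (simp_all add: independent_matern_family_def matern_perp_def)

lemmas X_facts = stationary_gerf_facts[OF X_stationary]

lemma X_inner:
  assumes "\<phi> \<in> test_functions" "\<psi> \<in> test_functions"
  shows "(LINT \<omega>|P. X j \<phi> \<omega> * cnj (X j \<psi> \<omega>)) = spectral_form (lam_weight \<kappa> (\<alpha> + 1 + real j)) \<phi> \<psi>"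
  unfolding X_facts(7)[OF assms] by (simp add: measure_mu add.assoc)

lemma X_inner_0:
  assumes "\<phi> \<in> test_functions" "\<psi> \<in> test_functions" "i \<noteq> j"
  shows "(LINT \<omega>|P. X i \<phi> \<omega> * cnj (X j \<psi> \<omega>)) = 0"
proof -
  have ind: "independent_fields P X UNIV" using fam by (simp add: independent_matern_family_def)
  have "indep_var borel (X i \<phi>) borel (cnj \<circ> X j \<psi>)"
    using indep_var_compose[OF independent_fields_indep_var[OF ind assms(3,1,2) X_facts(2)[OF assms(1)] X_facts(2)[OF assms(2)]],
        of "\<lambda>x. x" borel cnj borel] by (simp add: comp_def)
  then have "(LINT \<omega>|P. X i \<phi> \<omega> * cnj (X j \<psi> \<omega>)) = (LINT \<omega>|P. X i \<phi> \<omega>) * (LINT \<omega>|P. cnj (X j \<psi> \<omega>))"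
    using indep_var_lebesgue_integral[of "X i \<phi>" "cnj \<circ> X j \<psi>"]
      integrable_l2[OF X_facts(2,3)[OF assms(1)]] integrable_l2[OF X_facts(2,3)[OF assms(2)]]
    by (simp add: comp_def)
  then show ?thesis using X_facts(6)[OF assms(1)] by simp
qed

definition Y :: "(real^'d \<Rightarrow> complex) \<Rightarrow> nat \<Rightarrow> 'b \<Rightarrow> complex" where
  "Y \<phi> j \<omega> = complex_of_real (c * \<kappa> ^ j) * X j \<phi> \<omega>"

definition S :: "(real^'d \<Rightarrow> complex) \<Rightarrow> 'b \<Rightarrow> complex" where
  "S \<phi> \<omega> = (\<Sum>j. Y \<phi> j \<omega>)"

lemma Y_measurable: "\<phi> \<in> test_functions \<Longrightarrow> Y \<phi> j \<in> borel_measurable P"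
  using X_facts(2) unfolding Y_def[abs_def] by simp

text \<open>The variance of the j-th field is at most \<open>lam_min \<kappa>\<close> to the power
  -2(\<alpha> + 1 + j) times the squared sup norm of \<phi>. Against the factor \<kappa>^j this
  leaves L^2 norms that decay like powers of \<kappa>/\<open>lam_min \<kappa>\<close>.\<close>

lemma Y_dominated:
  assumes \<phi>: "\<phi> \<in> test_functions"
  shows "l2_dominated P (Y \<phi>)"
proof -
  obtain C where C: "0 \<le> C" "\<And>x. cmod (\<phi> x) \<le> C" using test_bounded[OF \<phi>] by metis
  define L where "L = lam_min \<kappa>"
  have L: "\<kappa> < L" "0 < L" using lam_min_gt[OF \<kappa>] \<kappa> by (simp_all add: L_def)
  define w where "w j = c * C * L powr (- (\<alpha> + 1)) * (\<kappa> / L) ^ j" for j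
  have sq: "(\<lambda>\<omega>. (cmod (Y \<phi> j \<omega>))\<^sup>2) = (\<lambda>\<omega>. (c * \<kappa> ^ j)\<^sup>2 * (cmod (X j \<phi> \<omega>))\<^sup>2)" for j
    using \<kappa> by (simp add: Y_def norm_mult power_mult_distrib norm_power fun_eq_iff)
  have X2: "(LINT \<omega>|P. (cmod (X j \<phi> \<omega>))\<^sup>2) \<le> L powr (-2 * (\<alpha> + 1 + real j)) * C\<^sup>2" for j
  proof -
    have "complex_of_real (LINT \<omega>|P. (cmod (X j \<phi> \<omega>))\<^sup>2) = (LINT \<omega>|P. X j \<phi> \<omega> * cnj (X j \<phi> \<omega>))"
      by (simp only: integral_complex_of_real[symmetric] complex_norm_square)
    then have "(LINT \<omega>|P. (cmod (X j \<phi> \<omega>))\<^sup>2) = Re (spectral_form (lam_weight \<kappa> (\<alpha> + 1 + real j)) \<phi> \<phi>)"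
      unfolding X_inner[OF \<phi> \<phi>] by (metis Re_complex_of_real)
    also have "\<dots> \<le> L powr (-2 * (\<alpha> + 1 + real j)) * C\<^sup>2"
      unfolding spectral_form_def L_def using \<alpha>
      by (intro spectral_form_le[OF \<phi> C(2)] lam_weight_le[OF \<kappa>]) simp_all
    finally show ?thesis .
  qed
  have w2: "(c * \<kappa> ^ j)\<^sup>2 * (L powr (-2 * (\<alpha> + 1 + real j)) * C\<^sup>2) = (w j)\<^sup>2" for j
  proof -
    have "L powr (-2 * (\<alpha> + 1 + real j)) = (L powr (- (\<alpha> + 1 + real j)))\<^sup>2"
      by (simp add: power2_eq_square powr_add[symmetric] algebra_simps)
    also have "L powr (- (\<alpha> + 1 + real j)) = L powr (- (\<alpha> + 1)) * L powr (- real j)"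
      by (simp add: powr_add[symmetric])
    also have "L powr (- real j) = 1 / L ^ j"
      using L by (simp add: powr_minus powr_realpow divide_inverse)
    finally show ?thesis by (simp add: w_def power_mult_distrib power_divide)
  qed
  show ?thesis
  proof (rule l2_dominatedI[where w = w])
    show "integrable P (\<lambda>\<omega>. (cmod (Y \<phi> j \<omega>))\<^sup>2)" for j
      unfolding sq by (intro integrable_mult_right X_facts(3)[OF \<phi>])
    show "(LINT \<omega>|P. (cmod (Y \<phi> j \<omega>))\<^sup>2) \<le> (w j)\<^sup>2" for j
      unfolding sq w2[symmetric] integral_mult_right_zero by (intro mult_left_mono X2) simp
    show "0 \<le> w j" for j using c C L \<kappa> by (simp add: w_def)
    show "summable w"
      unfolding w_def using L \<kappa> by (intro summable_mult summable_geometric) simp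
  qed (rule Y_measurable[OF \<phi>])
qed

lemma S_measurable: "\<phi> \<in> test_functions \<Longrightarrow> S \<phi> \<in> borel_measurable P"
  using l2_dominated_sum_measurable[OF Y_dominated] unfolding S_def[abs_def] .

lemma AE_Y_summable:
  assumes "\<phi> \<in> test_functions"
  shows "AE \<omega> in P. summable (\<lambda>j. Y \<phi> j \<omega>)"
  using Y_dominated[OF assms] unfolding l2_dominated_def by (auto elim!: eventually_mono dest: summable_norm_cancel)

text \<open>Independent centred fields are orthogonal, so the covariance of a partial sum is the
  partial sum of the covariances, and its limit is known from
  \<open>cm_spectral_form_expand\<close>. For c = 2 pi the prefactor is 1.\<close>

lemma S_inner:
  assumes \<phi>: "\<phi> \<in> test_functions" and \<psi>: "\<psi> \<in> test_functions"
  shows "(LINT \<omega>|P. S \<phi> \<omega> * cnj (S \<psi> \<omega>)) = complex_of_real (c\<^sup>2 / (4 * pi\<^sup>2)) * spectral_form (cm_weight \<kappa> \<alpha>) \<phi> \<psi>"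
    and S_inner_sums: "(\<lambda>j. complex_of_real ((c * \<kappa> ^ j)\<^sup>2) * spectral_form (lam_weight \<kappa> (\<alpha> + 1 + real j)) \<phi> \<psi>)
      sums (LINT \<omega>|P. S \<phi> \<omega> * cnj (S \<psi> \<omega>))"
proof -
  have part: "(LINT \<omega>|P. (\<Sum>j<N. Y \<phi> j \<omega>) * cnj (\<Sum>j<N. Y \<psi> j \<omega>)) =
      (\<Sum>j<N. complex_of_real ((c * \<kappa> ^ j)\<^sup>2) * spectral_form (lam_weight \<kappa> (\<alpha> + 1 + real j)) \<phi> \<psi>)" for N
  proof -
    let ?d = "\<lambda>i j. complex_of_real ((c * \<kappa> ^ i) * (c * \<kappa> ^ j))"
    have int: "integrable P (\<lambda>\<omega>. X i \<phi> \<omega> * cnj (X j \<psi> \<omega>))" for i j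
      by (rule integrable_l2_mult(2)[OF X_facts(2)[OF \<phi>] X_facts(2)[OF \<psi>] X_facts(3)[OF \<phi>] X_facts(3)[OF \<psi>]])
    have "(LINT \<omega>|P. (\<Sum>j<N. Y \<phi> j \<omega>) * cnj (\<Sum>j<N. Y \<psi> j \<omega>)) =
        (LINT \<omega>|P. (\<Sum>i<N. \<Sum>j<N. ?d i j * (X i \<phi> \<omega> * cnj (X j \<psi> \<omega>))))"
      by (intro Bochner_Integration.integral_cong refl) (simp add: Y_def sum_product mult_ac)
    also have "\<dots> = (\<Sum>i<N. \<Sum>j<N. ?d i j * (LINT \<omega>|P. X i \<phi> \<omega> * cnj (X j \<psi> \<omega>)))"
      by (simp only: Bochner_Integration.integral_sum Bochner_Integration.integrable_sum integrable_mult_right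
          int integral_mult_right_zero)
    also have "\<dots> = (\<Sum>i<N. \<Sum>j<N. if j = i then ?d i i * spectral_form (lam_weight \<kappa> (\<alpha> + 1 + real i)) \<phi> \<psi> else 0)"
      using X_inner[OF \<phi> \<psi>] X_inner_0[OF \<phi> \<psi>] by (intro sum.cong refl) auto
    also have "\<dots> = (\<Sum>i<N. ?d i i * spectral_form (lam_weight \<kappa> (\<alpha> + 1 + real i)) \<phi> \<psi>)"
      by (intro sum.cong refl) simp
    finally show ?thesis by (simp only: power2_eq_square)
  qed
  have lim: "(\<lambda>N. \<Sum>j<N. complex_of_real ((c * \<kappa> ^ j)\<^sup>2) * spectral_form (lam_weight \<kappa> (\<alpha> + 1 + real j)) \<phi> \<psi>)
      \<longlonglongrightarrow> (LINT \<omega>|P. S \<phi> \<omega> * cnj (S \<psi> \<omega>))"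
    using l2_dominated_inner_limit[OF Y_dominated[OF \<phi>] Y_dominated[OF \<psi>]] unfolding part S_def .
  then show "(\<lambda>j. complex_of_real ((c * \<kappa> ^ j)\<^sup>2) * spectral_form (lam_weight \<kappa> (\<alpha> + 1 + real j)) \<phi> \<psi>)
      sums (LINT \<omega>|P. S \<phi> \<omega> * cnj (S \<psi> \<omega>))"
    by (simp add: sums_def)
  have "(\<lambda>j. complex_of_real (c\<^sup>2 / (4 * pi\<^sup>2)) * (complex_of_real (4 * pi\<^sup>2 * \<kappa> ^ (2 * j)) * spectral_form (lam_weight \<kappa> (\<alpha> + 1 + real j)) \<phi> \<psi>))
      sums (complex_of_real (c\<^sup>2 / (4 * pi\<^sup>2)) * spectral_form (cm_weight \<kappa> \<alpha>) \<phi> \<psi>)"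
    by (rule sums_mult[OF cm_spectral_form_expand[OF \<kappa> \<alpha> \<phi> \<psi>]])
  moreover have "complex_of_real (c\<^sup>2 / (4 * pi\<^sup>2)) * (complex_of_real (4 * pi\<^sup>2 * \<kappa> ^ (2 * j)) * z) = complex_of_real ((c * \<kappa> ^ j)\<^sup>2) * z" for j z
  proof -
    have "c\<^sup>2 / (4 * pi\<^sup>2) * (4 * pi\<^sup>2 * \<kappa> ^ (2 * j)) = (c * \<kappa> ^ j)\<^sup>2"
      by (simp add: power_mult_distrib power_mult[symmetric] mult.commute)
    then show ?thesis by (simp only: mult.assoc[symmetric] of_real_mult[symmetric])
  qed
  ultimately show "(LINT \<omega>|P. S \<phi> \<omega> * cnj (S \<psi> \<omega>)) = complex_of_real (c\<^sup>2 / (4 * pi\<^sup>2)) * spectral_form (cm_weight \<kappa> \<alpha>) \<phi> \<psi>"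
    using lim by (simp only: sums_def LIMSEQ_unique)
qed

definition S_weight :: "int^'d \<Rightarrow> real" where
  "S_weight k = c\<^sup>2 / (4 * pi\<^sup>2) * cm_weight \<kappa> \<alpha> k"

lemma S_stationary: "stationary_gerf P S (point_measure UNIV (\<lambda>k. ennreal (S_weight k)))"
proof (rule stationary_gerfI[where m = S_weight and B = "c\<^sup>2 / (4 * pi\<^sup>2) * lam_min \<kappa> powr (-2 * \<alpha>)"])
  show "prob_space P" by (rule prob_space_axioms)
  show "S \<phi> \<in> borel_measurable P" if "\<phi> \<in> test_functions" for \<phi> by (rule S_measurable[OF that])
  show "integrable P (\<lambda>\<omega>. (cmod (S \<phi> \<omega>))\<^sup>2)" if "\<phi> \<in> test_functions" for \<phi>
    unfolding S_def by (rule l2_dominated_square_integrable(1)[OF Y_dominated[OF that]])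
  show "AE \<omega> in P. S (\<lambda>x. a * \<phi> x + b * \<psi> x) \<omega> = a * S \<phi> \<omega> + b * S \<psi> \<omega>"
    if \<phi>: "\<phi> \<in> test_functions" and \<psi>: "\<psi> \<in> test_functions" for \<phi> \<psi> a b
  proof -
    \<comment> \<open>Each field is linear only almost surely; there are countably many of them, so
      one null set serves all j.\<close>
    have "AE \<omega> in P. \<forall>j. X j (\<lambda>x. a * \<phi> x + b * \<psi> x) \<omega> = a * X j \<phi> \<omega> + b * X j \<psi> \<omega>"
      unfolding AE_all_countable using X_facts(4)[OF \<phi> \<psi>] by blast
    with AE_Y_summable[OF \<phi>] AE_Y_summable[OF \<psi>] show ?thesis
    proof eventually_elim
      case (elim \<omega>)
      then have "Y (\<lambda>x. a * \<phi> x + b * \<psi> x) j \<omega> = a * Y \<phi> j \<omega> + b * Y \<psi> j \<omega>" for j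
        by (simp add: Y_def algebra_simps)
      then show ?case
        using elim by (simp add: S_def suminf_add[symmetric] suminf_mult summable_mult)
    qed
  qed
  show "AE \<omega> in P. S \<phi> \<omega> \<in> \<real>" if \<phi>: "\<phi> \<in> test_functions" and real: "\<And>x. \<phi> x \<in> \<real>" for \<phi>
  proof -
    have "AE \<omega> in P. \<forall>j. X j \<phi> \<omega> \<in> \<real>"
      unfolding AE_all_countable using X_facts(5)[OF \<phi> real] by blast
    with AE_Y_summable[OF \<phi>] show ?thesis
    proof eventually_elim
      case (elim \<omega>)
      then have "Im (Y \<phi> j \<omega>) = 0" for j by (simp add: Y_def complex_is_Real_iff)
      then have "Im (\<Sum>j. Y \<phi> j \<omega>) = 0" using Im_suminf[OF elim(1)] by simp
      then show ?case by (simp add: S_def complex_is_Real_iff)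
    qed
  qed
  show "(LINT \<omega>|P. S \<phi> \<omega>) = 0" if \<phi>: "\<phi> \<in> test_functions" for \<phi>
  proof -
    have "(LINT \<omega>|P. (\<Sum>j<N. Y \<phi> j \<omega>)) = 0" for N
      unfolding Y_def using integrable_l2[OF X_facts(2,3)[OF \<phi>]] X_facts(6)[OF \<phi>]
      by (simp add: Bochner_Integration.integral_sum)
    then show ?thesis
      using l2_dominated_mean_limit[OF Y_dominated[OF \<phi>]] unfolding S_def by (simp add: LIMSEQ_const_iff)
  qed
  show "(LINT \<omega>|P. S \<phi> \<omega> * cnj (S \<psi> \<omega>)) = (\<Sum>\<^sub>\<infinity>k. complex_of_real (S_weight k) * (char_coeff \<phi> k * cnj (char_coeff \<psi> k)))"
    if \<phi>: "\<phi> \<in> test_functions" and \<psi>: "\<psi> \<in> test_functions" for \<phi> \<psi>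
  proof -
    have "((\<lambda>k. complex_of_real (c\<^sup>2 / (4 * pi\<^sup>2)) * (complex_of_real (cm_weight \<kappa> \<alpha> k) * (char_coeff \<phi> k * cnj (char_coeff \<psi> k))))
        has_sum complex_of_real (c\<^sup>2 / (4 * pi\<^sup>2)) * spectral_form (cm_weight \<kappa> \<alpha>) \<phi> \<psi>) UNIV"
      by (intro has_sum_cmult_right spectral_form_has_sum[OF \<phi> \<psi> _ cm_weight_le[OF \<kappa> \<alpha>]]) simp
    then show ?thesis
      unfolding S_inner[OF \<phi> \<psi>] S_weight_def of_real_mult mult.assoc by (simp only: infsumI)
  qed
  show "0 \<le> S_weight k" for k by (simp add: S_weight_def)
  show "S_weight k \<le> c\<^sup>2 / (4 * pi\<^sup>2) * lam_min \<kappa> powr (-2 * \<alpha>)" for k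
    unfolding S_weight_def by (intro mult_left_mono cm_weight_le \<kappa> \<alpha>) simp
qed (simp_all add: sets_point_measure emeasure_point_measure_singleton)

lemma S_l2_limit:
  assumes \<phi>: "\<phi> \<in> test_functions"
  shows "(\<lambda>n. l2_norm P (\<lambda>\<omega>. (\<Sum>j<n. complex_of_real (c * \<kappa> ^ j) * X j \<phi> \<omega>) - S \<phi> \<omega>)) \<longlonglongrightarrow> 0"
proof -
  have "(\<lambda>n. sqrt (LINT \<omega>|P. (cmod ((\<Sum>j<n. Y \<phi> j \<omega>) - (\<Sum>j. Y \<phi> j \<omega>)))\<^sup>2)) \<longlonglongrightarrow> sqrt 0"
    by (intro tendsto_real_sqrt l2_dominated_norm_limit Y_dominated \<phi>)
  then show ?thesis by (simp add: l2_norm_def S_def Y_def)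
qed

text \<open>Only the individual fields are Gaussian; the law of the sum comes from independence,
  which factorises the characteristic functions of the partial sums. The variances in the exponent
  add up to that of S.\<close>

lemma S_char:
  assumes \<phi>: "\<phi> \<in> test_functions" "\<And>x. \<phi> x \<in> \<real>"
  shows "(LINT \<omega>|P. iexp (t * Re (S \<phi> \<omega>))) =
    of_real (exp (- (t\<^sup>2 * Re (LINT \<omega>|P. S \<phi> \<omega> * cnj (S \<phi> \<omega>))) / 2))"
proof (rule LIMSEQ_unique)
  have [measurable]: "X j \<phi> \<in> borel_measurable P" for j by (rule X_facts(2)[OF \<phi>(1)])
  have [measurable]: "S \<phi> \<in> borel_measurable P" by (rule S_measurable[OF \<phi>(1)])
  define v where "v j = Re (spectral_form (lam_weight \<kappa> (\<alpha> + 1 + real j)) \<phi> \<phi>)" for j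
  have ReY: "Re (Y \<phi> j \<omega>) = c * \<kappa> ^ j * Re (X j \<phi> \<omega>)" for j \<omega> by (simp add: Y_def)
  have ind: "independent_fields P X UNIV" using fam by (simp add: independent_matern_family_def)
  have iv: "indep_vars (\<lambda>_. borel) (\<lambda>j \<omega>. c * \<kappa> ^ j * Re (X j \<phi> \<omega>)) {..<N}" for N
    by (rule indep_vars_compose2[OF indep_vars_subset[OF independent_fields_indep_vars[OF ind \<phi>(1)]],
        of "{..<N}" "\<lambda>j z. c * \<kappa> ^ j * Re z" "\<lambda>_. borel"]) simp_all
  have ch: "char (distr P borel (\<lambda>\<omega>. c * \<kappa> ^ j * Re (X j \<phi> \<omega>))) t = of_real (exp (- (t\<^sup>2 * ((c * \<kappa> ^ j)\<^sup>2 * v j)) / 2))" for j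
  proof -
    have sq: "AE \<omega> in P. (Re (X j \<phi> \<omega>))\<^sup>2 = (cmod (X j \<phi> \<omega>))\<^sup>2"
      using X_facts(5)[OF \<phi>] by eventually_elim (simp add: complex_is_Real_iff cmod_power2)
    have "complex_of_real (LINT \<omega>|P. (cmod (X j \<phi> \<omega>))\<^sup>2) = (LINT \<omega>|P. X j \<phi> \<omega> * cnj (X j \<phi> \<omega>))"
      by (simp only: integral_complex_of_real[symmetric] complex_norm_square)
    then have "(LINT \<omega>|P. (cmod (X j \<phi> \<omega>))\<^sup>2) = v j"
      unfolding X_inner[OF \<phi>(1) \<phi>(1)] v_def by (metis Re_complex_of_real)
    then have var: "(LINT \<omega>|P. (Re (X j \<phi> \<omega>))\<^sup>2) = v j"
      using integral_cong_AE[OF _ _ sq] by simp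
    have mean: "(LINT \<omega>|P. Re (X j \<phi> \<omega>)) = 0"
      using integral_Re[OF integrable_l2[OF X_facts(2,3)[OF \<phi>(1)]]] X_facts(6)[OF \<phi>(1)] by simp
    have g: "gaussian_rv P (\<lambda>\<omega>. Re (X j \<phi> \<omega>))"
      using X_gaussian \<phi> by (simp add: gaussian_gerf_def)
    have "char (distr P borel (\<lambda>\<omega>. c * \<kappa> ^ j * Re (X j \<phi> \<omega>))) t = (LINT \<omega>|P. iexp ((t * (c * \<kappa> ^ j)) * Re (X j \<phi> \<omega>)))"
      by (subst expectation_char[symmetric]) (simp_all add: mult.assoc)
    also have "\<dots> = of_real (exp (- ((t * (c * \<kappa> ^ j))\<^sup>2 * v j) / 2))"
      by (rule gaussian_rv_char_moments(1)[OF g mean var])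
    finally show ?thesis by (simp add: power_mult_distrib mult.assoc)
  qed
  have part: "(LINT \<omega>|P. iexp (t * Re (\<Sum>j<N. Y \<phi> j \<omega>))) = of_real (exp (- (t\<^sup>2 * (\<Sum>j<N. (c * \<kappa> ^ j)\<^sup>2 * v j)) / 2))" for N
  proof -
    have "(LINT \<omega>|P. iexp (t * Re (\<Sum>j<N. Y \<phi> j \<omega>))) = char (distr P borel (\<lambda>\<omega>. \<Sum>j<N. c * \<kappa> ^ j * Re (X j \<phi> \<omega>))) t"
      by (subst expectation_char[symmetric]) (simp_all add: ReY)
    also have "\<dots> = (\<Prod>j<N. of_real (exp (- (t\<^sup>2 * ((c * \<kappa> ^ j)\<^sup>2 * v j)) / 2)))"
      by (simp only: char_distr_sum[OF iv] ch)
    also have "\<dots> = of_real (exp (\<Sum>j<N. - (t\<^sup>2 * ((c * \<kappa> ^ j)\<^sup>2 * v j)) / 2))"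
      by (simp add: exp_sum)
    also have "(\<Sum>j<N. - (t\<^sup>2 * ((c * \<kappa> ^ j)\<^sup>2 * v j)) / 2) = - (t\<^sup>2 * (\<Sum>j<N. (c * \<kappa> ^ j)\<^sup>2 * v j)) / 2"
      by (simp add: sum_distrib_left sum_negf sum_divide_distrib[symmetric])
    finally show ?thesis .
  qed
  show "(\<lambda>N. LINT \<omega>|P. iexp (t * Re (\<Sum>j<N. Y \<phi> j \<omega>))) \<longlonglongrightarrow> (LINT \<omega>|P. iexp (t * Re (S \<phi> \<omega>)))"
  proof (rule integral_dominated_convergence[where w = "\<lambda>_. 1"])
    show "AE \<omega> in P. (\<lambda>N. iexp (t * Re (\<Sum>j<N. Y \<phi> j \<omega>))) \<longlonglongrightarrow> iexp (t * Re (S \<phi> \<omega>))"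
      using l2_dominated_sums[OF Y_dominated[OF \<phi>(1)]]
    proof eventually_elim
      case (elim \<omega>)
      then show ?case unfolding S_def by (intro tendsto_intros)
    qed
    show "(\<lambda>\<omega>. iexp (t * Re (\<Sum>j<N. Y \<phi> j \<omega>))) \<in> borel_measurable P" for N
      using Y_measurable[OF \<phi>(1)] by measurable
  qed simp_all
  have "(\<lambda>j. Re (complex_of_real ((c * \<kappa> ^ j)\<^sup>2) * spectral_form (lam_weight \<kappa> (\<alpha> + 1 + real j)) \<phi> \<phi>)) sums
      Re (LINT \<omega>|P. S \<phi> \<omega> * cnj (S \<phi> \<omega>))"
    by (rule sums_Re[OF S_inner_sums[OF \<phi>(1) \<phi>(1)]])
  then have "(\<lambda>j. (c * \<kappa> ^ j)\<^sup>2 * v j) sums Re (LINT \<omega>|P. S \<phi> \<omega> * cnj (S \<phi> \<omega>))"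
    by (simp add: v_def del: of_real_power of_real_mult)
  then have "(\<lambda>N. exp (- (t\<^sup>2 * (\<Sum>j<N. (c * \<kappa> ^ j)\<^sup>2 * v j)) / 2)) \<longlonglongrightarrow>
      exp (- (t\<^sup>2 * Re (LINT \<omega>|P. S \<phi> \<omega> * cnj (S \<phi> \<omega>))) / 2)"
    unfolding sums_def by (intro tendsto_intros) auto
  then show "(\<lambda>N. LINT \<omega>|P. iexp (t * Re (\<Sum>j<N. Y \<phi> j \<omega>))) \<longlonglongrightarrow>
      of_real (exp (- (t\<^sup>2 * Re (LINT \<omega>|P. S \<phi> \<omega> * cnj (S \<phi> \<omega>))) / 2))"
    unfolding part by (rule tendsto_of_real)
qed

end

section \<open>Dyadic frequency blocks\<close>

text \<open>Dyadic annuli of the sup norm: for m > 0 the largest component lies above 2^(m-1) and is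
  at most 2^m. Shell 0 is the whole box of radius 1, with the origin, so the first N + 1 shells
  exactly fill the box of radius 2^N.\<close>

definition shell :: "nat \<Rightarrow> (int^'d::finite) set" where
  "shell m = int_box (2 ^ m) - (if m = 0 then {} else int_box (2 ^ (m - 1)))"

lemma finite_shell [simp]: "finite (shell m)"
  by (simp add: shell_def)

lemma int_box_uminus: "- k \<in> int_box n \<longleftrightarrow> k \<in> int_box n"
  by (simp add: int_box_def)

lemma shell_uminus: "- k \<in> shell m \<longleftrightarrow> k \<in> shell m"
  by (simp add: shell_def int_box_uminus)

lemma int_box_mono: "m \<le> n \<Longrightarrow> int_box m \<subseteq> int_box n"
proof
  fix k assume "m \<le> n" "k \<in> int_box m"
  then have "\<bar>k $ i\<bar> \<le> int n" for i
    unfolding int_box_def by (auto intro: order_trans[of _ "int m"])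
  then show "k \<in> int_box n" by (simp add: int_box_def)
qed

lemma shell_component: "k \<in> shell m \<Longrightarrow> \<bar>real_of_int (k $ i)\<bar> \<le> 2 ^ m"
proof -
  assume "k \<in> shell m"
  then have "\<bar>k $ i\<bar> \<le> int (2 ^ m)" by (auto simp: shell_def int_box_def)
  then have "real_of_int \<bar>k $ i\<bar> \<le> real_of_int (int (2 ^ m))" by (simp only: of_int_le_iff)
  then show ?thesis by simp
qed

lemma shell_norm: "k \<in> shell m \<Longrightarrow> k \<noteq> 0 \<Longrightarrow> 2 ^ m / 2 \<le> norm (lattice_vec k)"
proof (cases m)
  case 0
  assume "k \<noteq> 0"
  then show ?thesis using norm_lattice_vec_ge_1[of k] 0 by simp
next
  case (Suc j)
  assume "k \<in> shell m"
  then obtain i where "int (2 ^ j) < \<bar>k $ i\<bar>" using Suc by (auto simp: shell_def int_box_def not_le)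
  then have "real_of_int (int (2 ^ j)) < real_of_int \<bar>k $ i\<bar>" by (simp only: of_int_less_iff)
  then have "2 ^ j < \<bar>lattice_vec k $ i\<bar>" by simp
  also have "\<dots> \<le> norm (lattice_vec k)" by (rule component_le_norm_cart)
  finally show ?thesis using Suc by simp
qed

lemma card_shell: "real (card (shell m :: (int^'d::finite) set)) \<le> (3 * 2 ^ m) ^ CARD('d)"
proof -
  have "card (shell m :: (int^'d) set) \<le> card (int_box (2 ^ m) :: (int^'d) set)"
    by (intro card_mono) (auto simp: shell_def)
  also have "\<dots> = (2 * 2 ^ m + 1) ^ CARD('d)" by (rule card_int_box)
  also have "\<dots> \<le> (3 * 2 ^ m) ^ CARD('d)" by (intro power_mono) auto
  finally have "real (card (shell m :: (int^'d) set)) \<le> real ((3 * 2 ^ m) ^ CARD('d))" by (simp only: of_nat_le_iff)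
  then show ?thesis by simp
qed

lemma sum_shells:
  fixes f :: "int^'d::finite \<Rightarrow> 'b::comm_monoid_add"
  shows "(\<Sum>m<Suc N. \<Sum>k\<in>shell m. f k) = (\<Sum>k\<in>int_box (2 ^ N). f k)"
proof (induction N)
  case (Suc N)
  have "(int_box (2 ^ Suc N) :: (int^'d) set) = int_box (2 ^ N) \<union> shell (Suc N)"
    using int_box_mono[of "2 ^ N" "2 ^ Suc N"] by (auto simp: shell_def)
  moreover have "(int_box (2 ^ N) :: (int^'d) set) \<inter> shell (Suc N) = {}" by (auto simp: shell_def)
  ultimately have "(\<Sum>k\<in>int_box (2 ^ Suc N). f k) = (\<Sum>k\<in>int_box (2 ^ N). f k) + (\<Sum>k\<in>shell (Suc N). f k)"
    by (simp add: sum.union_disjoint)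
  then show ?case using Suc by simp
qed (simp add: shell_def)

lemma filterlim_int_box: "filterlim (\<lambda>N. int_box (2 ^ N)) (finite_subsets_at_top (UNIV :: (int^'d::finite) set)) sequentially"
  unfolding filterlim_finite_subsets_at_top
proof (intro allI impI)
  fix X :: "(int^'d) set" assume "finite X \<and> X \<subseteq> UNIV"
  then obtain n where n: "X \<subseteq> int_box n" using finite_subset_int_box by blast
  show "\<forall>\<^sub>F N in sequentially. finite (int_box (2 ^ N) :: (int^'d) set) \<and> X \<subseteq> int_box (2 ^ N) \<and> (int_box (2 ^ N) :: (int^'d) set) \<subseteq> UNIV"
    using eventually_ge_at_top[of n]
  proof eventually_elim
    case (elim N)
    have "n \<le> 2 ^ N" using elim less_exp[of N] by linarith
    then show ?case using n int_box_mono[of n "2 ^ N"] by auto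
  qed
qed

lemma char_factor_uminus: "char_factor (- k) is = cnj (char_factor k is)"
  by (induction "is") simp_all

lemma cmod_char_factor_le:
  assumes "k \<in> shell m"
  shows "cmod (char_factor k is) \<le> (2 * pi * 2 ^ m) ^ length is"
proof (induction "is")
  case (Cons i js)
  have "cmod (2 * pi * \<i> * of_int (k $ i)) \<le> 2 * pi * 2 ^ m"
    using shell_component[OF assms, of i] by (simp add: norm_mult)
  from mult_mono[OF this Cons] show ?case by (simp add: norm_mult)
qed simp

text \<open>A chord of the unit circle is no longer than its arc, and on the shell each component of
  k is at most 2^m.\<close>

lemma character_lipschitz:
  fixes k :: "int^'d::finite"
  assumes "k \<in> shell m" "\<And>i. \<bar>x $ i - y $ i\<bar> \<le> \<delta>"
  shows "cmod (character k x - character k y) \<le> 2 * pi * (real CARD('d) * 2 ^ m * \<delta>)"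
proof -
  have cis: "cmod (cis a - cis b) \<le> \<bar>a - b\<bar>" for a b
  proof -
    have "cis a - cis b = cis b * (exp (\<i> * of_real (a - b)) - 1)"
      unfolding cis_conv_exp[symmetric] right_diff_distrib cis_mult by simp
    then have "cmod (cis a - cis b) = 2 * \<bar>sin ((a - b) / 2)\<bar>"
      by (simp only: norm_mult norm_cis dist_exp_i_1 mult_1)
    then show ?thesis using abs_sin_x_le_abs_x[of "(a - b) / 2"] by simp
  qed
  have "\<bar>lattice_vec k \<bullet> (x - y)\<bar> \<le> (\<Sum>i\<in>(UNIV::'d set). 2 ^ m * \<delta>)"
    unfolding inner_vec_def
  proof (rule order_trans[OF sum_abs sum_mono])
    fix i
    show "\<bar>lattice_vec k $ i \<bullet> (x - y) $ i\<bar> \<le> 2 ^ m * \<delta>"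
      using mult_mono[OF shell_component[OF assms(1), of i] assms(2)[of i]] by (simp add: abs_mult)
  qed
  then have "\<bar>lattice_vec k \<bullet> (x - y)\<bar> \<le> real CARD('d) * 2 ^ m * \<delta>" by simp
  then have "2 * pi * \<bar>lattice_vec k \<bullet> (x - y)\<bar> \<le> 2 * pi * (real CARD('d) * 2 ^ m * \<delta>)"
    by (intro mult_left_mono) auto
  moreover have "\<bar>2 * pi * (lattice_vec k \<bullet> x) - 2 * pi * (lattice_vec k \<bullet> y)\<bar> = 2 * pi * \<bar>lattice_vec k \<bullet> (x - y)\<bar>"
    by (simp add: inner_diff_right right_diff_distrib[symmetric] abs_mult)
  ultimately show ?thesis
    unfolding character_def using cis[of "2 * pi * (lattice_vec k \<bullet> x)" "2 * pi * (lattice_vec k \<bullet> y)"] by linarith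
qed

text \<open>Takes the place of a Borel-Cantelli argument: the sum of the Z m has finite expectation,
  so it is almost surely finite, and its value bounds every term.\<close>

lemma (in prob_space) AE_bounded_of_summable_expectation:
  fixes Z :: "nat \<Rightarrow> 'a \<Rightarrow> real"
  assumes int: "\<And>m. integrable M (Z m)" and nonneg: "\<And>m \<omega>. 0 \<le> Z m \<omega>"
    and le: "\<And>m. (LINT \<omega>|M. Z m \<omega>) \<le> c m" and c: "summable c"
  shows "AE \<omega> in M. \<exists>K. \<forall>m. Z m \<omega> \<le> K"
proof -
  have [measurable]: "Z m \<in> borel_measurable M" for m using int by blast
  have c0: "0 \<le> c m" for m
    using order_trans[OF Bochner_Integration.integral_nonneg[OF nonneg] le] .
  have "(\<integral>\<^sup>+\<omega>. (\<Sum>m. ennreal (Z m \<omega>)) \<partial>M) = (\<Sum>m. \<integral>\<^sup>+\<omega>. ennreal (Z m \<omega>) \<partial>M)"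
    by (intro nn_integral_suminf) measurable
  also have "\<dots> \<le> (\<Sum>m. ennreal (c m))"
  proof (intro suminf_le summableI)
    fix m
    show "(\<integral>\<^sup>+\<omega>. ennreal (Z m \<omega>) \<partial>M) \<le> ennreal (c m)"
      using le[of m] by (subst nn_integral_eq_integral[OF int]) (auto simp: nonneg intro: ennreal_leI)
  qed
  also have "\<dots> = ennreal (suminf c)" by (rule suminf_ennreal2[OF c0 c])
  finally have "(\<integral>\<^sup>+\<omega>. (\<Sum>m. ennreal (Z m \<omega>)) \<partial>M) \<noteq> \<infinity>" by (auto simp: top_unique)
  then have "AE \<omega> in M. (\<Sum>m. ennreal (Z m \<omega>)) \<noteq> \<infinity>" by (intro nn_integral_PInf_AE) auto
  then show ?thesis
  proof eventually_elim
    case (elim \<omega>)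
    then have s: "summable (\<lambda>m. Z m \<omega>)"
      using nonneg by (intro summable_suminf_not_top) auto
    have "Z m \<omega> \<le> (\<Sum>m. Z m \<omega>)" for m
      using sum_le_suminf[OF s, of "{m}"] nonneg by simp
    then show ?case by blast
  qed
qed

lemma char_coeff_trig:
  assumes "finite F"
  shows "char_coeff (\<lambda>x. \<Sum>k\<in>F. c k * character (- k) x) l = (if l \<in> F then c l else 0)"
proof -
  have "char_coeff (\<lambda>x. \<Sum>k\<in>F. c k * character (- k) x) l = (\<Sum>k\<in>F. c k * char_coeff (character (- k)) l)"
    by (rule char_coeff_sum) simp
  also have "\<dots> = (\<Sum>k\<in>F. if k = l then c l else 0)"
    by (intro sum.cong refl) (simp add: char_coeff_character)
  finally show ?thesis using assms by simp
qed

lemma spectral_form_finite_support: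
  assumes "finite F" "\<And>k. k \<notin> F \<Longrightarrow> char_coeff \<phi> k = 0"
  shows "spectral_form m \<phi> \<phi> = of_real (\<Sum>k\<in>F. m k * (cmod (char_coeff \<phi> k))\<^sup>2)"
proof -
  have "spectral_form m \<phi> \<phi> = (\<Sum>\<^sub>\<infinity>k\<in>F. complex_of_real (m k) * (char_coeff \<phi> k * cnj (char_coeff \<phi> k)))"
    unfolding spectral_form_def by (rule infsum_cong_neutral) (use assms in auto)
  also have "\<dots> = (\<Sum>k\<in>F. complex_of_real (m k) * (char_coeff \<phi> k * cnj (char_coeff \<phi> k)))"
    using assms(1) by simp
  also have "\<dots> = (\<Sum>k\<in>F. complex_of_real (m k * (cmod (char_coeff \<phi> k))\<^sup>2))"
    by (simp only: of_real_mult complex_norm_square)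
  finally show ?thesis by (simp only: of_real_sum)
qed

section \<open>Random Fourier coefficients and moments of frequency blocks\<close>

locale cm_field =
  fixes \<kappa> \<alpha> :: real and M :: "'a measure" and u :: "(real^'d::finite \<Rightarrow> complex) \<Rightarrow> 'a \<Rightarrow> complex"
    and \<mu> :: "(int^'d) measure"
  assumes \<kappa>: "0 < \<kappa>" and \<alpha>: "0 \<le> \<alpha>" and gaussian: "gaussian_gerf M u" and stationary: "stationary_gerf M u \<mu>"
    and weight: "\<And>k. measure \<mu> {k} = cm_weight \<kappa> \<alpha> k"
begin

sublocale prob_space M
  by (rule stationary_gerf_facts(1)[OF stationary])

lemmas u_measurable = stationary_gerf_facts(2)[OF stationary]
lemmas u_l2 = stationary_gerf_facts(3)[OF stationary]
lemmas u_linear = stationary_gerf_facts(4)[OF stationary]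
lemmas u_real = stationary_gerf_facts(5)[OF stationary]
lemmas u_mean = stationary_gerf_facts(6)[OF stationary]

lemma u_inner:
  "\<phi> \<in> test_functions \<Longrightarrow> \<psi> \<in> test_functions \<Longrightarrow>
    (LINT \<omega>|M. u \<phi> \<omega> * cnj (u \<psi> \<omega>)) = spectral_form (cm_weight \<kappa> \<alpha>) \<phi> \<psi>"
  using stationary_gerf_facts(7)[OF stationary] by (simp add: weight)

lemma u_norm:
  assumes "\<phi> \<in> test_functions"
  shows "(LINT \<omega>|M. (cmod (u \<phi> \<omega>))\<^sup>2) = Re (spectral_form (cm_weight \<kappa> \<alpha>) \<phi> \<phi>)"
proof -
  have "complex_of_real (LINT \<omega>|M. (cmod (u \<phi> \<omega>))\<^sup>2) = (LINT \<omega>|M. u \<phi> \<omega> * cnj (u \<phi> \<omega>))"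
    by (simp only: integral_complex_of_real[symmetric] complex_norm_square)
  then show ?thesis unfolding u_inner[OF assms assms] by (metis Re_complex_of_real)
qed

lemma u_gaussian:
  assumes \<phi>: "\<phi> \<in> test_functions" "\<And>x. \<phi> x \<in> \<real>" and v: "v = Re (spectral_form (cm_weight \<kappa> \<alpha>) \<phi> \<phi>)"
  shows "(LINT \<omega>|M. iexp (t * Re (u \<phi> \<omega>))) = of_real (exp (- (t\<^sup>2 * v) / 2))"
    and "integrable M (\<lambda>\<omega>. (Re (u \<phi> \<omega>)) ^ (2 * q))"
    and "(LINT \<omega>|M. (Re (u \<phi> \<omega>)) ^ (2 * q)) = fact (2 * q) / (2 ^ q * fact q) * v ^ q"
proof -
  have [measurable]: "u \<phi> \<in> borel_measurable M" by (rule u_measurable[OF \<phi>(1)])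
  have sq: "AE \<omega> in M. (Re (u \<phi> \<omega>))\<^sup>2 = (cmod (u \<phi> \<omega>))\<^sup>2"
    using u_real[OF \<phi>] by eventually_elim (simp add: complex_is_Real_iff cmod_power2)
  have var: "(LINT \<omega>|M. (Re (u \<phi> \<omega>))\<^sup>2) = v"
    unfolding v u_norm[OF \<phi>(1), symmetric] by (rule integral_cong_AE) (use sq in simp_all)
  have mean: "(LINT \<omega>|M. Re (u \<phi> \<omega>)) = 0"
    using integral_Re[OF integrable_l2[OF u_measurable[OF \<phi>(1)] u_l2[OF \<phi>(1)]]] u_mean[OF \<phi>(1)] by simp
  have g: "gaussian_rv M (\<lambda>\<omega>. Re (u \<phi> \<omega>))"
    using gaussian \<phi> by (simp add: gaussian_gerf_def)
  show "(LINT \<omega>|M. iexp (t * Re (u \<phi> \<omega>))) = of_real (exp (- (t\<^sup>2 * v) / 2))"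
    and "integrable M (\<lambda>\<omega>. (Re (u \<phi> \<omega>)) ^ (2 * q))"
    and "(LINT \<omega>|M. (Re (u \<phi> \<omega>)) ^ (2 * q)) = fact (2 * q) / (2 ^ q * fact q) * v ^ q"
    by (rule gaussian_rv_char_moments[OF g mean var])+
qed

lemma u_sum:
  assumes "\<And>j. j \<in> I \<Longrightarrow> \<phi> j \<in> test_functions"
  shows "AE \<omega> in M. u (\<lambda>x. \<Sum>j\<in>I. c j * \<phi> j x) \<omega> = (\<Sum>j\<in>I. c j * u (\<phi> j) \<omega>)"
  using assms
proof (induction I rule: infinite_finite_induct)
  case (insert j I)
  have "AE \<omega> in M. u (\<lambda>x. c j * \<phi> j x + 1 * (\<Sum>j\<in>I. c j * \<phi> j x)) \<omega> =
      c j * u (\<phi> j) \<omega> + 1 * u (\<lambda>x. \<Sum>j\<in>I. c j * \<phi> j x) \<omega>"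
    using insert.prems by (intro u_linear test_sum) auto
  moreover have "AE \<omega> in M. u (\<lambda>x. \<Sum>j\<in>I. c j * \<phi> j x) \<omega> = (\<Sum>j\<in>I. c j * u (\<phi> j) \<omega>)"
    using insert by blast
  ultimately show ?case
    by eventually_elim (use insert.hyps in simp)
next
  case empty
  show ?case using u_linear[OF test_zero test_zero, of 0 0] by simp
next
  case (infinite I)
  show ?case using u_linear[OF test_zero test_zero, of 0 0] infinite by simp
qed

text \<open>This is \<nu> + 1. A shell has about 2^(md) points of weight about 2^(-2m(\<alpha> +
  1)), so the variance of a block is of order 2^(-2mr) with this r.\<close>

definition regularity :: real where
  "regularity = \<alpha> + 1 - real CARD('d) / 2"

definition coeff :: "int^'d \<Rightarrow> 'a \<Rightarrow> complex" where
  "coeff k \<omega> = u (character (- k)) \<omega>"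

text \<open>The termwise derivative of the m-th dyadic piece of the Fourier series of u; it is
  complex by type and real almost surely.\<close>

definition block :: "nat \<Rightarrow> 'd list \<Rightarrow> real^'d \<Rightarrow> 'a \<Rightarrow> complex" where
  "block m is x \<omega> = (\<Sum>k\<in>shell m. char_factor k is * coeff k \<omega> * character k x)"

lemma coeff_measurable [measurable]: "coeff k \<in> borel_measurable M"
  using u_measurable[OF character_test, of "- k"] by (simp add: coeff_def[abs_def])

lemma block_measurable [measurable]: "block m is x \<in> borel_measurable M"
  unfolding block_def[abs_def] by measurable

lemma block_periodic: "periodic (\<lambda>x. block m is x \<omega>)"
  by (simp add: periodic_def block_def)

lemma coeff_norm: "integrable M (\<lambda>\<omega>. (cmod (coeff k \<omega>))\<^sup>2)" "(LINT \<omega>|M. (cmod (coeff k \<omega>))\<^sup>2) = cm_weight \<kappa> \<alpha> k"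
  unfolding coeff_def using u_l2[OF character_test] u_norm[OF character_test, of "- k"]
  by (simp_all add: spectral_form_character)

lemma cm_weight_shell:
  assumes "k \<in> shell m"
  shows "cm_weight \<kappa> \<alpha> k \<le> (2 ^ m / 2) powr (-2 * (\<alpha> + 1))"
proof (cases "k = 0")
  case False
  define n where "n = norm (lattice_vec k)"
  have n: "1 \<le> n" "2 ^ m / 2 \<le> n" using norm_lattice_vec_ge_1[OF False] shell_norm[OF assms False] by (simp_all add: n_def)
  have "n \<le> lam \<kappa> k"
  proof -
    have "n\<^sup>2 \<le> 4 * pi\<^sup>2 * n\<^sup>2"
    proof -
      have "1 \<le> 4 * pi\<^sup>2" using power_mono[of 2 pi 2] pi_ge_two by simp
      from mult_right_mono[OF this, of "n\<^sup>2"] show ?thesis by simp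
    qed
    also have "\<dots> \<le> (lam \<kappa> k)\<^sup>2" unfolding lam_sq n_def by simp
    finally show ?thesis by (rule power2_le_imp_le) (simp add: less_imp_le[OF lam_pos[OF \<kappa>]])
  qed
  then have "lam \<kappa> k powr (-2 * \<alpha>) \<le> n powr (-2 * \<alpha>)"
    using n \<alpha> by (intro powr_mono2') auto
  then have "cm_weight \<kappa> \<alpha> k \<le> n powr (-2) * n powr (-2 * \<alpha>)"
    using False by (simp add: cm_weight_def n_def mult_left_mono)
  also have "\<dots> = n powr (-2 * (\<alpha> + 1))" by (simp add: powr_add[symmetric] algebra_simps)
  also have "\<dots> \<le> (2 ^ m / 2) powr (-2 * (\<alpha> + 1))"
    using n \<alpha> by (intro powr_mono2') auto
  finally show ?thesis .
qed (simp add: cm_weight_def)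

text \<open>The three factors come from the derivatives of the characters, from the number of points
  in a shell, and from the lower bound 2^m/2 for the norm of a nonzero frequency in it.\<close>

definition block_const :: "nat \<Rightarrow> real" where
  "block_const l = (2 * pi) ^ (2 * l) * 3 ^ CARD('d) * 2 powr (2 * (\<alpha> + 1))"

lemma block_variance:
  "(\<Sum>k\<in>(shell m :: (int^'d) set). cm_weight \<kappa> \<alpha> k * (cmod (char_factor k is))\<^sup>2) \<le>
    block_const (length is) * 2 powr (2 * real m * (real (length is) - regularity))"
proof -
  let ?l = "length is"
  have "(\<Sum>k\<in>(shell m :: (int^'d) set). cm_weight \<kappa> \<alpha> k * (cmod (char_factor k is))\<^sup>2) \<le>
      (\<Sum>k\<in>(shell m :: (int^'d) set). (2 ^ m / 2) powr (-2 * (\<alpha> + 1)) * ((2 * pi * 2 ^ m) ^ ?l)\<^sup>2)"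
    by (intro sum_mono mult_mono cm_weight_shell power_mono cmod_char_factor_le) auto
  also have "\<dots> = real (card (shell m :: (int^'d) set)) * ((2 ^ m / 2) powr (-2 * (\<alpha> + 1)) * ((2 * pi * 2 ^ m) ^ ?l)\<^sup>2)"
    by simp
  also have "\<dots> \<le> (3 * 2 ^ m) ^ CARD('d) * ((2 ^ m / 2) powr (-2 * (\<alpha> + 1)) * ((2 * pi * 2 ^ m) ^ ?l)\<^sup>2)"
    by (intro mult_right_mono card_shell) auto
  also have "\<dots> = block_const ?l * 2 powr (2 * real m * (real ?l - regularity))"
  proof -
    have p: "(2::real) ^ n = 2 powr real n" for n by (simp add: powr_realpow)
    have "(2 ^ m / 2) powr (-2 * (\<alpha> + 1)) = (2::real) powr (real m * (-2 * (\<alpha> + 1))) * 2 powr (2 * (\<alpha> + 1))"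
    proof -
      have "(2 ^ m / 2 :: real) = 2 powr (real m - 1)" by (simp add: powr_diff p)
      then show ?thesis by (simp add: powr_powr powr_add[symmetric] algebra_simps)
    qed
    moreover have "(3 * 2 ^ m :: real) ^ CARD('d) = 3 ^ CARD('d) * 2 powr (real m * real CARD('d))"
      by (simp add: power_mult_distrib powr_powr[symmetric] p powr_realpow[symmetric] flip: powr_realpow)
    moreover have "((2 * pi * 2 ^ m) ^ ?l)\<^sup>2 = (2 * pi) ^ (2 * ?l) * 2 powr (real m * (2 * real ?l))"
    proof -
      have "((2 * pi * 2 ^ m) ^ ?l)\<^sup>2 = (2 * pi) ^ (2 * ?l) * 2 ^ (m * (2 * ?l))"
        by (simp add: power_mult_distrib power_mult[symmetric] mult_ac)
      then show ?thesis by (simp only: p of_nat_mult of_nat_numeral)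
    qed
    ultimately have "(3 * 2 ^ m) ^ CARD('d) * ((2 ^ m / 2) powr (-2 * (\<alpha> + 1)) * ((2 * pi * 2 ^ m) ^ ?l)\<^sup>2) =
        block_const ?l * (2 powr (real m * real CARD('d)) * 2 powr (real m * (-2 * (\<alpha> + 1))) * 2 powr (real m * (2 * real ?l)))"
      by (simp add: block_const_def mult_ac)
    also have "2 powr (real m * real CARD('d)) * 2 powr (real m * (-2 * (\<alpha> + 1))) * 2 powr (real m * (2 * real ?l)) =
        (2::real) powr (2 * real m * (real ?l - regularity))"
      by (simp add: powr_add[symmetric] regularity_def algebra_simps)
    finally show ?thesis .
  qed
  finally show ?thesis .
qed

text \<open>For fixed x the block is almost surely the pairing of u with a trigonometric polynomial.
  That polynomial is real because the shell is symmetric and its coefficients satisfy the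
  conjugation rule, so the even moments are those of a centred Gaussian with the variance just
  bounded.\<close>

lemma block_moment:
  "integrable M (\<lambda>\<omega>. (Re (block m is x \<omega>)) ^ (2 * q))"
  "(LINT \<omega>|M. (Re (block m is x \<omega>)) ^ (2 * q)) \<le>
    fact (2 * q) / (2 ^ q * fact q) * block_const (length is) ^ q * 2 powr (2 * real q * real m * (real (length is) - regularity))"
proof -
  define c where "c k = char_factor k is * character k x" for k :: "int^'d"
  define \<psi> where "\<psi> = (\<lambda>y. \<Sum>k\<in>shell m. c k * character (- k) y)"
  have \<psi>: "\<psi> \<in> test_functions" unfolding \<psi>_def by (rule test_sum) simp
  have re: "\<psi> y \<in> \<real>" for y
  proof -
    have "(\<Sum>k\<in>shell m. c k * character (- k) y) = (\<Sum>k\<in>shell m. c (- k) * character (- (- k)) y)"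
      by (rule sum.reindex_bij_witness[of _ uminus uminus]) (auto simp: shell_uminus)
    also have "\<dots> = cnj (\<Sum>k\<in>shell m. c k * character (- k) y)"
      by (simp add: c_def char_factor_uminus character_uminus)
    finally show ?thesis by (simp add: \<psi>_def Reals_cnj_iff)
  qed
  have coeffs: "char_coeff \<psi> k = (if k \<in> shell m then c k else 0)" for k
    unfolding \<psi>_def by (rule char_coeff_trig) simp
  define v where "v = (\<Sum>k\<in>shell m. cm_weight \<kappa> \<alpha> k * (cmod (char_factor k is))\<^sup>2)"
  have "spectral_form (cm_weight \<kappa> \<alpha>) \<psi> \<psi> = of_real (\<Sum>k\<in>shell m. cm_weight \<kappa> \<alpha> k * (cmod (char_coeff \<psi> k))\<^sup>2)"
    by (rule spectral_form_finite_support) (simp_all add: coeffs)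
  also have "(\<Sum>k\<in>shell m. cm_weight \<kappa> \<alpha> k * (cmod (char_coeff \<psi> k))\<^sup>2) = v"
    unfolding v_def by (intro sum.cong refl) (simp add: coeffs c_def norm_mult)
  finally have v: "v = Re (spectral_form (cm_weight \<kappa> \<alpha>) \<psi> \<psi>)" by simp
  have v0: "0 \<le> v" unfolding v_def by (intro sum_nonneg) simp
  have ae: "AE \<omega> in M. (Re (block m is x \<omega>)) ^ (2 * q) = (Re (u \<psi> \<omega>)) ^ (2 * q)"
  proof -
    have "AE \<omega> in M. u \<psi> \<omega> = (\<Sum>k\<in>shell m. c k * u (character (- k)) \<omega>)"
      unfolding \<psi>_def by (rule u_sum) simp
    then show ?thesis
      by eventually_elim (simp add: block_def coeff_def c_def mult_ac)
  qed
  note g = u_gaussian(2,3)[OF \<psi> re v, of q]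
  have [measurable]: "u \<psi> \<in> borel_measurable M" by (rule u_measurable[OF \<psi>])
  show "integrable M (\<lambda>\<omega>. (Re (block m is x \<omega>)) ^ (2 * q))"
    using g(1) integrable_cong_AE[OF _ _ ae] by simp
  have "(LINT \<omega>|M. (Re (block m is x \<omega>)) ^ (2 * q)) = fact (2 * q) / (2 ^ q * fact q) * v ^ q"
    using g(2) integral_cong_AE[OF _ _ ae] by simp
  also have "\<dots> \<le> fact (2 * q) / (2 ^ q * fact q) * (block_const (length is) * 2 powr (2 * real m * (real (length is) - regularity))) ^ q"
    using block_variance[of "is" m] v0 by (intro mult_left_mono power_mono) (simp_all add: v_def)
  also have "\<dots> = fact (2 * q) / (2 ^ q * fact q) * block_const (length is) ^ q * 2 powr (2 * real q * real m * (real (length is) - regularity))"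
  proof -
    have "(2 powr (2 * real m * (real (length is) - regularity))) ^ q = (2::real) powr (2 * real q * real m * (real (length is) - regularity))"
      by (simp add: powr_realpow[symmetric] powr_powr mult_ac)
    then show ?thesis by (simp add: power_mult_distrib mult.assoc)
  qed
  finally show "(LINT \<omega>|M. (Re (block m is x \<omega>)) ^ (2 * q)) \<le>
    fact (2 * q) / (2 ^ q * fact q) * block_const (length is) ^ q * 2 powr (2 * real q * real m * (real (length is) - regularity))" .
qed

end

section \<open>Uniform bounds and Hoelder continuity\<close>

text \<open>Both end points of each unit interval are included, so every point of the cube has a
  grid point within 1/n in each coordinate.\<close>

definition grid :: "nat \<Rightarrow> (real^'d::finite) set" where
  "grid n = (\<lambda>p. \<chi> i. real (p i) / real n) ` PiE UNIV (\<lambda>_. {0..n})"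

lemma finite_grid: "finite (grid n)"
  unfolding grid_def by (intro finite_imageI finite_PiE) auto

lemma card_grid: "card (grid n :: (real^'d::finite) set) \<le> (n + 1) ^ CARD('d)"
proof -
  have "card (grid n :: (real^'d) set) \<le> card (PiE (UNIV::'d set) (\<lambda>_. {0..n}))"
    unfolding grid_def by (intro card_image_le finite_PiE) auto
  then show ?thesis by (simp add: card_PiE)
qed

lemma grid_approx:
  assumes "0 < n"
  obtains g where "g \<in> grid n" "\<And>i. \<bar>wrap x $ i - g $ i\<bar> \<le> 1 / real n"
proof -
  define p where "p i = nat \<lfloor>frac (x $ i) * real n\<rfloor>" for i
  have p: "real (p i) \<le> frac (x $ i) * real n" "frac (x $ i) * real n < real (p i) + 1" for i
  proof -
    have "0 \<le> frac (x $ i) * real n" by simp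
    then show "real (p i) \<le> frac (x $ i) * real n" "frac (x $ i) * real n < real (p i) + 1"
      unfolding p_def by linarith+
  qed
  have pn: "p i \<le> n" for i
  proof -
    have "frac (x $ i) * real n \<le> 1 * real n"
      by (intro mult_right_mono) (simp_all add: less_imp_le[OF frac_lt_1])
    with p(1)[of i] show ?thesis by simp
  qed
  have "(\<chi> i. real (p i) / real n) \<in> grid n"
    unfolding grid_def using pn by (intro imageI) auto
  moreover have "\<bar>wrap x $ i - (\<chi> i. real (p i) / real n) $ i\<bar> \<le> 1 / real n" for i
  proof -
    have "0 \<le> (frac (x $ i) * real n - real (p i)) / real n" "(frac (x $ i) * real n - real (p i)) / real n \<le> 1 / real n"
      using p[of i] assms by (auto intro!: divide_right_mono)
    moreover have "(frac (x $ i) * real n - real (p i)) / real n = frac (x $ i) - real (p i) / real n"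
      using assms by (simp add: diff_divide_distrib)
    ultimately show ?thesis by (simp add: wrap_def)
  qed
  ultimately show thesis using that by blast
qed

lemma summable_half_power: "summable (\<lambda>m. C * (1/2 :: real) ^ m)"
  by (intro summable_mult summable_geometric) simp

lemma powr_neg_nat_le: "b \<le> -1 \<Longrightarrow> (2::real) powr (real m * b) \<le> (1/2) ^ m"
proof -
  assume "b \<le> -1"
  then have "real m * b \<le> - real m" using mult_left_mono[of b "-1" "real m"] by simp
  then have "(2::real) powr (real m * b) \<le> 2 powr (- real m)" by (intro powr_mono) simp_all
  also have "\<dots> = (1/2) ^ m" by (simp add: powr_minus powr_realpow power_inverse inverse_eq_divide power_one_over)
  finally show ?thesis .
qed

context cm_field
begin

text \<open>A crude bound, needed only for the Lipschitz constant of a block: a shell has at most of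
  order 2^(md) coefficients with uniformly bounded first moments, and the additional factor 2^m in
  the denominator makes the expectations summable.\<close>

lemma coeff_sum_bound:
  "AE \<omega> in M. \<exists>K. \<forall>m. (\<Sum>k\<in>shell m. cmod (coeff k \<omega>)) / 2 ^ (m * (CARD('d) + 1)) \<le> K"
proof (rule AE_bounded_of_summable_expectation)
  define W where "W = 1 + lam_min \<kappa> powr (-2 * \<alpha>)"
  have W0: "0 \<le> W" by (simp add: W_def)
  have ic: "integrable M (\<lambda>\<omega>. cmod (coeff k \<omega>))" for k
    using integrable_l2[OF coeff_measurable coeff_norm(1)] by (rule integrable_norm)
  have ec: "(LINT \<omega>|M. cmod (coeff k \<omega>)) \<le> W" for k
  proof -
    have "(LINT \<omega>|M. cmod (coeff k \<omega>)) \<le> (LINT \<omega>|M. 1 + (cmod (coeff k \<omega>))\<^sup>2)"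
    proof (intro integral_mono ic)
      show "integrable M (\<lambda>\<omega>. 1 + (cmod (coeff k \<omega>))\<^sup>2)" using coeff_norm(1) by simp
      show "cmod (coeff k \<omega>) \<le> 1 + (cmod (coeff k \<omega>))\<^sup>2" for \<omega>
      proof -
        have "cmod (coeff k \<omega>) \<le> 2 * cmod (coeff k \<omega>)" by simp
        also have "\<dots> \<le> 1 + (cmod (coeff k \<omega>))\<^sup>2"
          using sum_squares_bound[of 1 "cmod (coeff k \<omega>)"] by simp
        finally show ?thesis .
      qed
    qed
    also have "\<dots> = 1 + cm_weight \<kappa> \<alpha> k" using coeff_norm[of k] by (simp add: prob_space)
    also have "\<dots> \<le> W" unfolding W_def using cm_weight_le[OF \<kappa> \<alpha>, of k] by simp
    finally show ?thesis .
  qed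
  show "integrable M (\<lambda>\<omega>. (\<Sum>k\<in>shell m. cmod (coeff k \<omega>)) / 2 ^ (m * (CARD('d) + 1)))" for m
    using ic by simp
  show "0 \<le> (\<Sum>k\<in>shell m. cmod (coeff k \<omega>)) / 2 ^ (m * (CARD('d) + 1))" for m \<omega>
    by (simp add: sum_nonneg)
  show "(LINT \<omega>|M. (\<Sum>k\<in>shell m. cmod (coeff k \<omega>)) / 2 ^ (m * (CARD('d) + 1))) \<le> (3 ^ CARD('d) * W) * (1/2) ^ m" for m
  proof -
    have "(LINT \<omega>|M. (\<Sum>k\<in>shell m. cmod (coeff k \<omega>)) / 2 ^ (m * (CARD('d) + 1))) =
        (\<Sum>k\<in>shell m. LINT \<omega>|M. cmod (coeff k \<omega>)) / 2 ^ (m * (CARD('d) + 1))"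
      using ic by (simp add: Bochner_Integration.integral_sum)
    also have "\<dots> \<le> (real (card (shell m :: (int^'d) set)) * W) / 2 ^ (m * (CARD('d) + 1))"
      using sum_bounded_above[of "shell m" "\<lambda>k. LINT \<omega>|M. cmod (coeff k \<omega>)" W, OF ec]
      by (intro divide_right_mono) simp_all
    also have "\<dots> \<le> ((3 * 2 ^ m) ^ CARD('d) * W) / 2 ^ (m * (CARD('d) + 1))"
      by (intro divide_right_mono mult_right_mono card_shell W0) simp
    also have "\<dots> = (3 ^ CARD('d) * W) * (1/2) ^ m"
      by (simp add: power_mult_distrib power_mult power_add power_divide)
    finally show ?thesis .
  qed
qed (rule summable_half_power)

lemma block_grid_bound:
  assumes "0 < \<epsilon>"
  shows "AE \<omega> in M. \<exists>K\<ge>0. \<forall>m. \<forall>x\<in>grid (2 ^ (A * m)).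
    \<bar>Re (block m is x \<omega>)\<bar> \<le> K * 2 powr (real m * (real (length is) - regularity + \<epsilon>))"
proof -
  define b where "b = real (length is) - regularity"
  \<comment> \<open>Makes A d - 2q\<epsilon> at most -1, so that the expectations are dominated by a
    multiple of (1/2)^m.\<close>
  obtain q :: nat where q: "(real A * real CARD('d) + 1) / (2 * \<epsilon>) \<le> real q" using real_arch_simple by blast
  have q': "real A * real CARD('d) - 2 * real q * \<epsilon> \<le> -1"
    using q assms by (simp add: divide_le_eq algebra_simps)
  have q1: "0 < q"
  proof (rule ccontr)
    assume "\<not> 0 < q"
    then have "real A * real CARD('d) \<le> -1" using q' by simp
    moreover have "0 \<le> real A * real CARD('d)" by simp
    ultimately show False by linarith
  qed
  define C where "C = fact (2 * q) / (2 ^ q * fact q) * block_const (length is) ^ q"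
  have C0: "0 \<le> C" by (simp add: C_def block_const_def)
  define w where "w m = 2 powr (real m * (b + \<epsilon>))" for m
  have w0: "w m > 0" for m by (simp add: w_def)
  define Z where "Z m \<omega> = (\<Sum>x\<in>grid (2 ^ (A * m)). (Re (block m is x \<omega>)) ^ (2 * q)) / w m ^ (2 * q)" for m \<omega>
  have Zt: "(Re (block m is x \<omega>)) ^ (2 * q) / w m ^ (2 * q) \<le> Z m \<omega>" if "x \<in> grid (2 ^ (A * m))" for m x \<omega>
    unfolding Z_def using w0[of m]
    by (intro divide_right_mono member_le_sum[OF that _ finite_grid]) (auto simp: power_mult)
  have "AE \<omega> in M. \<exists>K. \<forall>m. Z m \<omega> \<le> K"
  proof (rule AE_bounded_of_summable_expectation)
    show "integrable M (Z m)" for m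
      unfolding Z_def using block_moment(1) by simp
    show "0 \<le> Z m \<omega>" for m \<omega>
      unfolding Z_def using w0[of m] by (intro divide_nonneg_nonneg sum_nonneg) (auto simp: power_mult)
    show "(LINT \<omega>|M. Z m \<omega>) \<le> (2 ^ CARD('d) * C) * (1/2) ^ m" for m
    proof -
      have "(LINT \<omega>|M. Z m \<omega>) = (\<Sum>x\<in>grid (2 ^ (A * m)). LINT \<omega>|M. (Re (block m is x \<omega>)) ^ (2 * q)) / w m ^ (2 * q)"
        unfolding Z_def using block_moment(1) by (simp add: Bochner_Integration.integral_sum)
      also have "\<dots> \<le> (real (card (grid (2 ^ (A * m)) :: (real^'d) set)) * (C * 2 powr (2 * real q * real m * b))) / w m ^ (2 * q)"
        using w0[of m] block_moment(2)[of m "is" _ q] unfolding C_def b_def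
        by (intro divide_right_mono sum_bounded_above) (auto simp: less_imp_le)
      also have "\<dots> \<le> ((2 * 2 ^ (A * m)) ^ CARD('d) * (C * 2 powr (2 * real q * real m * b))) / w m ^ (2 * q)"
      proof (intro divide_right_mono mult_right_mono)
        have "card (grid (2 ^ (A * m)) :: (real^'d) set) \<le> (2 ^ (A * m) + 1) ^ CARD('d)" by (rule card_grid)
        also have "\<dots> \<le> (2 * 2 ^ (A * m)) ^ CARD('d)" by (intro power_mono) auto
        finally have "real (card (grid (2 ^ (A * m)) :: (real^'d) set)) \<le> real ((2 * 2 ^ (A * m)) ^ CARD('d))" by (simp only: of_nat_le_iff)
        then show "real (card (grid (2 ^ (A * m)) :: (real^'d) set)) \<le> (2 * 2 ^ (A * m)) ^ CARD('d)" by simp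
      qed (use C0 w0[of m] in \<open>auto simp: less_imp_le\<close>)
      also have "\<dots> = 2 ^ CARD('d) * C * 2 powr (real m * (real A * real CARD('d) - 2 * real q * \<epsilon>))"
      proof -
        have "(2 * 2 ^ (A * m) :: real) ^ CARD('d) = 2 ^ CARD('d) * 2 powr (real m * (real A * real CARD('d)))"
          by (simp add: power_mult_distrib powr_realpow[symmetric] powr_powr mult_ac)
        moreover have "w m ^ (2 * q) = 2 powr (2 * real q * real m * b) * 2 powr (real m * (2 * real q * \<epsilon>))"
          unfolding w_def by (simp add: powr_realpow[symmetric] powr_powr powr_add[symmetric] algebra_simps)
        moreover have "2 powr (real m * (real A * real CARD('d) - 2 * real q * \<epsilon>)) =
            (2::real) powr (real m * (real A * real CARD('d))) / 2 powr (real m * (2 * real q * \<epsilon>))"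
          by (simp add: powr_diff[symmetric] right_diff_distrib)
        ultimately show ?thesis by simp
      qed
      also have "\<dots> \<le> (2 ^ CARD('d) * C) * (1/2) ^ m"
        using C0 by (intro mult_left_mono powr_neg_nat_le q') simp
      finally show ?thesis .
    qed
  qed (rule summable_half_power)
  then show ?thesis
  proof eventually_elim
    case (elim \<omega>)
    then obtain K where K: "\<And>m. Z m \<omega> \<le> K" by blast
    \<comment> \<open>With K' \<ge> 1 one has K' \<le> K'^(2q), so the 2q-th root can be taken
      without carrying a fractional power.\<close>
    define K' where "K' = max 1 K"
    have "\<bar>Re (block m is x \<omega>)\<bar> \<le> K' * w m" if x: "x \<in> grid (2 ^ (A * m))" for m x
    proof (rule power_le_imp_le_base[where n = "2 * q - 1"])
      have "(Re (block m is x \<omega>)) ^ (2 * q) / w m ^ (2 * q) \<le> K'"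
        using Zt[OF x, of \<omega>] K[of m] by (simp add: K'_def)
      also have "\<dots> \<le> K' ^ (2 * q)" using q1 by (intro self_le_power) (auto simp: K'_def)
      finally have "(Re (block m is x \<omega>)) ^ (2 * q) \<le> (K' * w m) ^ (2 * q)"
        using w0[of m] by (simp add: divide_le_eq power_mult_distrib)
      then show "\<bar>Re (block m is x \<omega>)\<bar> ^ Suc (2 * q - 1) \<le> (K' * w m) ^ Suc (2 * q - 1)"
        using q1 by (simp add: power_even_abs)
    qed (use w0[of m] in \<open>simp add: K'_def\<close>)
    then show ?case
      unfolding w_def b_def by (intro exI[of _ K']) (auto simp: K'_def)
  qed
qed

lemma block_lipschitz:
  assumes "\<And>i. \<bar>x $ i - y $ i\<bar> \<le> \<delta>" "0 \<le> \<delta>"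
  shows "cmod (block m is x \<omega> - block m is y \<omega>) \<le>
    (2 * pi * 2 ^ m) ^ length is * (2 * pi * (real CARD('d) * 2 ^ m * \<delta>)) * (\<Sum>k\<in>shell m. cmod (coeff k \<omega>))"
proof -
  have "block m is x \<omega> - block m is y \<omega> = (\<Sum>k\<in>shell m. char_factor k is * coeff k \<omega> * (character k x - character k y))"
    by (simp add: block_def right_diff_distrib sum_subtractf)
  also have "cmod \<dots> \<le> (\<Sum>k\<in>shell m. (2 * pi * 2 ^ m) ^ length is * (2 * pi * (real CARD('d) * 2 ^ m * \<delta>)) * cmod (coeff k \<omega>))"
  proof (rule order_trans[OF norm_sum sum_mono])
    fix k :: "int^'d" assume k: "k \<in> shell m"
    have "cmod (char_factor k is) * cmod (character k x - character k y) \<le>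
        (2 * pi * 2 ^ m) ^ length is * (2 * pi * (real CARD('d) * 2 ^ m * \<delta>))"
      by (intro mult_mono cmod_char_factor_le[OF k] character_lipschitz[OF k assms(1)]) auto
    from mult_right_mono[OF this, of "cmod (coeff k \<omega>)"]
    show "cmod (char_factor k is * coeff k \<omega> * (character k x - character k y)) \<le>
        (2 * pi * 2 ^ m) ^ length is * (2 * pi * (real CARD('d) * 2 ^ m * \<delta>)) * cmod (coeff k \<omega>)"
      by (simp add: norm_mult mult_ac)
  qed
  finally show ?thesis by (simp add: sum_distrib_left)
qed

text \<open>Between grid points the block varies by at most its Lipschitz constant times the mesh.
  The former grows polynomially in 2^m, so a mesh 2^(-Am) with A large enough keeps the error below
  the bound already known on the grid.\<close>

lemma block_sup_bound:
  assumes "0 < \<epsilon>"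
  shows "AE \<omega> in M. \<exists>K\<ge>0. \<forall>m x. \<bar>Re (block m is x \<omega>)\<bar> \<le> K * 2 powr (real m * (real (length is) - regularity + \<epsilon>))"
proof -
  let ?l = "length is"
  \<comment> \<open>The derivatives and the Lipschitz estimate cost 2^(m(l+1)), the coefficient sum
    costs 2^(m(d+1)); together with the mesh the exponent is m(l + d + 2 - A), which must not exceed
    m(l - r).\<close>
  define A :: nat where "A = nat \<lceil>real CARD('d) + 2 + regularity\<rceil>"
  have A: "real CARD('d) + 2 + regularity \<le> real A" unfolding A_def by linarith
  show ?thesis
    using block_grid_bound[OF assms, of A "is"] coeff_sum_bound
  proof eventually_elim
    case (elim \<omega>)
    then obtain K where K: "0 \<le> K" "\<And>m x. x \<in> grid (2 ^ (A * m)) \<Longrightarrow>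
        \<bar>Re (block m is x \<omega>)\<bar> \<le> K * 2 powr (real m * (real ?l - regularity + \<epsilon>))" by blast
    from elim obtain L where L: "\<And>m. (\<Sum>k\<in>shell m. cmod (coeff k \<omega>)) / 2 ^ (m * (CARD('d) + 1)) \<le> L" by blast
    have L0: "0 \<le> L" using order_trans[OF _ L[of 0]] by (simp add: sum_nonneg)
    define D where "D = (2 * pi) ^ ?l * (2 * pi * real CARD('d)) * L"
    have D0: "0 \<le> D" using L0 by (simp add: D_def)
    have "\<bar>Re (block m is x \<omega>)\<bar> \<le> (K + D) * 2 powr (real m * (real ?l - regularity + \<epsilon>))" for m x
    proof -
      obtain g where g: "g \<in> grid (2 ^ (A * m))" "\<And>i. \<bar>wrap x $ i - g $ i\<bar> \<le> 1 / real (2 ^ (A * m))"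
        using grid_approx[of "2 ^ (A * m)" x] by auto
      have "\<bar>Re (block m is (wrap x) \<omega>) - Re (block m is g \<omega>)\<bar> \<le> cmod (block m is (wrap x) \<omega> - block m is g \<omega>)"
        using abs_Re_le_cmod[of "block m is (wrap x) \<omega> - block m is g \<omega>"] by simp
      also have "\<dots> \<le> (2 * pi * 2 ^ m) ^ ?l * (2 * pi * (real CARD('d) * 2 ^ m * (1 / real (2 ^ (A * m))))) * (\<Sum>k\<in>shell m. cmod (coeff k \<omega>))"
        by (rule block_lipschitz[OF g(2)]) simp
      also have "\<dots> \<le> (2 * pi * 2 ^ m) ^ ?l * (2 * pi * (real CARD('d) * 2 ^ m * (1 / real (2 ^ (A * m))))) * (L * 2 ^ (m * (CARD('d) + 1)))"
        using L[of m] by (intro mult_left_mono) (simp_all add: divide_le_eq)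
      also have "\<dots> = D * 2 powr (real m * (real ?l + 2 + real CARD('d) - real A))"
      proof -
        have p: "(2::real) ^ n = 2 powr real n" for n by (simp add: powr_realpow)
        have "(2 * pi * 2 ^ m) ^ ?l * (2 * pi * (real CARD('d) * 2 ^ m * (1 / real (2 ^ (A * m))))) * (L * 2 ^ (m * (CARD('d) + 1))) =
            D * (2 ^ (m * ?l) * 2 ^ m * 2 ^ (m * (CARD('d) + 1)) / 2 ^ (A * m))"
          by (simp add: D_def power_mult_distrib power_mult[symmetric] mult_ac)
        also have "2 ^ (m * ?l) * 2 ^ m * 2 ^ (m * (CARD('d) + 1)) / 2 ^ (A * m) =
            (2::real) powr (real m * (real ?l + 2 + real CARD('d) - real A))"
          unfolding p by (simp only: powr_add[symmetric] powr_diff[symmetric]) (simp add: algebra_simps)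
        finally show ?thesis .
      qed
      also have "\<dots> \<le> D * 2 powr (real m * (real ?l - regularity + \<epsilon>))"
      proof -
        have "real m * (real ?l + 2 + real CARD('d) - real A) \<le> real m * (real ?l - regularity + \<epsilon>)"
          using A assms by (intro mult_left_mono) auto
        then show ?thesis using D0 by (intro mult_left_mono) simp_all
      qed
      finally have "\<bar>Re (block m is (wrap x) \<omega>)\<bar> \<le> (K + D) * 2 powr (real m * (real ?l - regularity + \<epsilon>))"
        using K(2)[OF g(1)] by (simp add: distrib_right)
      then show ?thesis using periodic_wrap[OF block_periodic[of m "is" \<omega>], of x] by simp
    qed
    then show ?case using K(1) D0 by (intro exI[of _ "K + D"]) simp
  qed
qed

end

section \<open>A Hoelder criterion for dyadic series\<close>

lemma interpolation_bound:
  assumes "0 \<le> (D::real)" "D \<le> P" "D \<le> Q" "0 \<le> \<gamma>" "\<gamma> \<le> 1"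
  shows "D \<le> P powr (1 - \<gamma>) * Q powr \<gamma>"
proof (cases "D = 0")
  case False
  then have "D = D powr (1 - \<gamma>) * D powr \<gamma>" using assms(1) by (simp add: powr_add[symmetric])
  also have "\<dots> \<le> P powr (1 - \<gamma>) * Q powr \<gamma>"
    using assms by (intro mult_mono powr_mono2) auto
  finally show ?thesis .
qed (use assms in simp)

text \<open>Moves from y to x one coordinate at a time and applies the mean value theorem on each
  segment; partial derivatives suffice, and total differentiability never enters.\<close>

lemma coordinatewise_lipschitz:
  fixes g :: "real^'d::finite \<Rightarrow> real"
  assumes d: "\<And>i x. ((\<lambda>t. g (x + t *\<^sub>R axis i 1)) has_vector_derivative g' i x) (at 0)"
    and B: "\<And>i x. \<bar>g' i x\<bar> \<le> B"
  shows "\<bar>g x - g y\<bar> \<le> B * (real CARD('d) * norm (x - y))"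
proof -
  have B0: "0 \<le> B" using B[of undefined 0] by linarith
  have step: "\<bar>g (x + h *\<^sub>R axis i 1) - g x\<bar> \<le> B * \<bar>h\<bar>" for x h i
  proof -
    have "norm (g (x + h *\<^sub>R axis i 1) - g (x + 0 *\<^sub>R axis i 1)) \<le> B * norm (h - 0)"
      by (rule differentiable_bound[where f' = "\<lambda>s t. t *\<^sub>R g' i (x + s *\<^sub>R axis i 1)" and S = UNIV])
        (use line_derivative[OF d] B in \<open>auto simp: has_vector_derivative_def mult.commute[of B] abs_mult intro!: onorm_le mult_left_mono\<close>)
    then show ?thesis by simp
  qed
  have "\<bar>g x - g y\<bar> \<le> (\<Sum>i\<in>J. B * \<bar>x $ i - y $ i\<bar>)" if "finite J" "\<And>i. i \<notin> J \<Longrightarrow> x $ i = y $ i" for J x y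
    using that
  proof (induction J arbitrary: y rule: finite_induct)
    case empty
    then have "x = y" by (simp add: vec_eq_iff)
    then show ?case by simp
  next
    case (insert j J)
    define z where "z = y + (x $ j - y $ j) *\<^sub>R axis j 1"
    have zc: "z $ i = (if i = j then x $ j else y $ i)" for i by (simp add: z_def axis_def)
    have "\<bar>g x - g z\<bar> \<le> (\<Sum>i\<in>J. B * \<bar>x $ i - z $ i\<bar>)"
      using insert.prems by (intro insert.IH) (auto simp: zc)
    also have "\<dots> = (\<Sum>i\<in>J. B * \<bar>x $ i - y $ i\<bar>)"
      using insert.hyps by (intro sum.cong refl) (auto simp: zc)
    finally have "\<bar>g x - g z\<bar> \<le> (\<Sum>i\<in>J. B * \<bar>x $ i - y $ i\<bar>)" .
    moreover have "\<bar>g z - g y\<bar> \<le> B * \<bar>x $ j - y $ j\<bar>" unfolding z_def by (rule step)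
    ultimately show ?case using insert.hyps by simp
  qed
  from this[of UNIV x y] have "\<bar>g x - g y\<bar> \<le> (\<Sum>i\<in>UNIV. B * \<bar>x $ i - y $ i\<bar>)" by simp
  also have "\<dots> \<le> (\<Sum>i\<in>(UNIV::'d set). B * norm (x - y))"
    using component_le_norm_cart[of "x - y"] B0 by (intro sum_mono mult_left_mono) auto
  finally show ?thesis by (simp add: mult_ac)
qed

lemma summable_powr_geometric: "b < 0 \<Longrightarrow> summable (\<lambda>m. C * (2::real) powr (real m * b))"
proof -
  assume "b < 0"
  have "(2::real) powr (real m * b) = (2 powr b) ^ m" for m
    by (simp add: powr_realpow[symmetric] powr_powr mult.commute)
  moreover have "(2::real) powr b < 1" using \<open>b < 0\<close> by (simp add: powr_less_one)
  ultimately show ?thesis by (simp add: summable_mult summable_geometric)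
qed

text \<open>Below order s the bounds decay geometrically, so the series may be differentiated
  termwise. At the top order n each block is estimated by its sup bound and by its Lipschitz bound;
  interpolation with exponent \<gamma> gives the rate n + \<gamma> - s + \<epsilon>, which is
  negative.\<close>

lemma holder_series:
  fixes p :: "'d::finite list \<Rightarrow> nat \<Rightarrow> real^'d \<Rightarrow> real"
  assumes d: "\<And>is m i x. ((\<lambda>t. p is m (x + t *\<^sub>R axis i 1)) has_vector_derivative p (i # is) m x) (at 0)"
    and B: "\<And>is \<epsilon>. 0 < \<epsilon> \<Longrightarrow> \<exists>K\<ge>0. \<forall>m x. \<bar>p is m x\<bar> \<le> K * 2 powr (real m * (real (length is) - s + \<epsilon>))"
  shows "(\<lambda>x. \<Sum>m. p [] m x) \<in> holder_loc_minus s"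
proof -
  define F where "F is x = (\<Sum>m. p is m x)" for "is" x
  have dom: "\<exists>K b. 0 \<le> K \<and> b < 0 \<and> (\<forall>m x. \<bar>p is m x\<bar> \<le> K * 2 powr (real m * b))" if "real (length is) < s" for "is"
  proof -
    let ?b = "real (length is) - s + (s - real (length is)) / 2"
    obtain K where "0 \<le> K" "\<And>m x. \<bar>p is m x\<bar> \<le> K * 2 powr (real m * ?b)"
      using B[of "(s - real (length is)) / 2" "is"] \<open>real (length is) < s\<close> by auto
    moreover have "?b < 0" using that by (simp add: field_simps)
    ultimately show ?thesis by blast
  qed
  have sm: "summable (\<lambda>m. p is m x)" if l: "real (length is) < s" for "is" x
  proof -
    obtain K b where "b < 0" "\<And>m. \<bar>p is m x\<bar> \<le> K * 2 powr (real m * b)" using dom[OF l] by blast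
    then show ?thesis by (intro summable_comparison_test'[OF summable_powr_geometric[of b K], of 0]) auto
  qed
  have der: "((\<lambda>t. F is (x + t *\<^sub>R axis i 1)) has_vector_derivative F (i # is) x) (at 0)"
    if l: "real (length is) + 1 < s" for "is" i x
  proof -
    obtain K b where Kb: "b < 0" "\<And>m x. \<bar>p (i # is) m x\<bar> \<le> K * 2 powr (real m * b)"
      using dom[of "i # is"] l by (auto simp: add.commute)
    have u: "uniformly_convergent_on UNIV (\<lambda>n t. \<Sum>m<n. p (i # is) m (x + t *\<^sub>R axis i 1))"
      using Kb by (intro Weierstrass_m_test'[OF _ summable_powr_geometric[of b K]]) auto
    have "((\<lambda>t. \<Sum>m. p is m (x + t *\<^sub>R axis i 1)) has_field_derivative (\<Sum>m. p (i # is) m (x + 0 *\<^sub>R axis i 1))) (at 0)"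
    proof (rule has_field_derivative_series'(2)[OF convex_UNIV _ u, of _ 0])
      show "((\<lambda>t. p is m (x + t *\<^sub>R axis i 1)) has_field_derivative p (i # is) m (x + t *\<^sub>R axis i 1)) (at t within UNIV)" for m t
        using line_derivative[OF d, of "is" m x i t] by (simp add: has_real_derivative_iff_has_vector_derivative)
      show "summable (\<lambda>m. p is m (x + 0 *\<^sub>R axis i 1))" using sm[of "is"] l by simp
    qed simp_all
    then show ?thesis by (simp add: F_def has_real_derivative_iff_has_vector_derivative)
  qed
  have "(\<lambda>x. \<Sum>m. p [] m x) \<in> holder_loc n \<gamma>" if \<gamma>: "0 \<le> \<gamma>" "\<gamma> \<le> 1" "real n + \<gamma> < s" for n \<gamma>
  proof -
    have derF: "((\<lambda>t. F is (x + t *\<^sub>R axis i 1)) has_vector_derivative F (i # is) x) (at 0)" if "length is < n" for "is" i x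
      using that \<gamma> by (intro der) linarith
    have holder: "\<exists>C. \<forall>x y. \<bar>F is x - F is y\<bar> \<le> C * norm (x - y) powr \<gamma>" if l: "length is = n" for "is"
    proof -
      define \<epsilon> where "\<epsilon> = (s - real n - \<gamma>) / 2"
      have \<epsilon>: "0 < \<epsilon>" "real n + \<gamma> - s + \<epsilon> < 0" using \<gamma> by (simp_all add: \<epsilon>_def field_simps)
      obtain K where K: "0 \<le> K" "\<And>m x. \<bar>p is m x\<bar> \<le> K * 2 powr (real m * (real n - s + \<epsilon>))"
        using B[OF \<epsilon>(1), of "is"] l by auto
      \<comment> \<open>Derivatives of order n + 1 may grow with m; they serve only as Lipschitz
        constants of single blocks and are never summed.\<close>
      have "\<forall>i. \<exists>L\<ge>0. \<forall>m x. \<bar>p (i # is) m x\<bar> \<le> L * 2 powr (real m * (real n + 1 - s + \<epsilon>))"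
        using B[OF \<epsilon>(1)] l by (metis add.commute length_Cons of_nat_Suc)
      then obtain L where L: "\<And>i. 0 \<le> L i" "\<And>i m x. \<bar>p (i # is) m x\<bar> \<le> L i * 2 powr (real m * (real n + 1 - s + \<epsilon>))"
        by metis
      define L' where "L' = (\<Sum>i\<in>UNIV. L i)"
      have L': "0 \<le> L'" "\<And>i. L i \<le> L'" unfolding L'_def using L(1) by (auto intro!: sum_nonneg member_le_sum)
      define C where "C = (2 * K) powr (1 - \<gamma>) * (L' * real CARD('d)) powr \<gamma>"
      have diff: "\<bar>p is m x - p is m y\<bar> \<le> C * norm (x - y) powr \<gamma> * 2 powr (real m * (real n + \<gamma> - s + \<epsilon>))" for m x y
      proof -
        have "\<bar>p is m x - p is m y\<bar> \<le> 2 * K * 2 powr (real m * (real n - s + \<epsilon>))"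
          using K(2)[of m x] K(2)[of m y] by linarith
        moreover have "\<bar>p is m x - p is m y\<bar> \<le> (L' * 2 powr (real m * (real n + 1 - s + \<epsilon>))) * (real CARD('d) * norm (x - y))"
        proof (rule coordinatewise_lipschitz[OF d])
          show "\<bar>p (i # is) m x\<bar> \<le> L' * 2 powr (real m * (real n + 1 - s + \<epsilon>))" for i x
            by (rule order_trans[OF L(2) mult_right_mono[OF L'(2)]]) simp
        qed
        ultimately have "\<bar>p is m x - p is m y\<bar> \<le> (2 * K * 2 powr (real m * (real n - s + \<epsilon>))) powr (1 - \<gamma>) *
            ((L' * 2 powr (real m * (real n + 1 - s + \<epsilon>))) * (real CARD('d) * norm (x - y))) powr \<gamma>"
          using \<gamma> by (intro interpolation_bound) auto
        also have "\<dots> = C * norm (x - y) powr \<gamma> * (2 powr (real m * (real n - s + \<epsilon>) * (1 - \<gamma>)) * 2 powr (real m * (real n + 1 - s + \<epsilon>) * \<gamma>))"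
          using K(1) L'(1) by (simp add: C_def powr_mult powr_powr mult_ac)
        also have "2 powr (real m * (real n - s + \<epsilon>) * (1 - \<gamma>)) * 2 powr (real m * (real n + 1 - s + \<epsilon>) * \<gamma>) =
            (2::real) powr (real m * (real n + \<gamma> - s + \<epsilon>))"
          by (simp add: powr_add[symmetric] algebra_simps)
        finally show ?thesis .
      qed
      have ln: "real (length is) < s" using l \<gamma> by simp
      have sg: "summable (\<lambda>m. 1 * (2::real) powr (real m * (real n + \<gamma> - s + \<epsilon>)))"
        by (rule summable_powr_geometric[OF \<epsilon>(2)])
      define G where "G = (\<Sum>m. (2::real) powr (real m * (real n + \<gamma> - s + \<epsilon>)))"
      have "\<bar>F is x - F is y\<bar> \<le> C * G * norm (x - y) powr \<gamma>" for x y
      proof -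
        have sd: "summable (\<lambda>m. C * norm (x - y) powr \<gamma> * 2 powr (real m * (real n + \<gamma> - s + \<epsilon>)))"
          using sg by (intro summable_mult) simp
        have "F is x - F is y = (\<Sum>m. p is m x - p is m y)"
          unfolding F_def by (rule suminf_diff[OF sm[OF ln] sm[OF ln]])
        also have "\<bar>\<dots>\<bar> \<le> (\<Sum>m. C * norm (x - y) powr \<gamma> * 2 powr (real m * (real n + \<gamma> - s + \<epsilon>)))"
          using norm_suminf_le[of "\<lambda>m. p is m x - p is m y", OF _ sd] diff by simp
        also have "\<dots> = C * norm (x - y) powr \<gamma> * G"
          unfolding G_def using sg by (intro suminf_mult) simp
        finally show ?thesis by (simp add: mult_ac)
      qed
      then show ?thesis by blast
    qed
    have P: "partials is (F []) = F is" if "length is \<le> n" for "is"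
      using that by (intro partials_family[of n F]) (auto intro: derF)
    have "has_partials n (F [])"
      by (rule has_partials_family) (rule derF)
    moreover have "\<exists>C. \<forall>is. length is = n \<longrightarrow> (\<forall>x\<in>K. \<forall>y\<in>K. \<bar>partials is (F []) x - partials is (F []) y\<bar> \<le> C * norm (x - y) powr \<gamma>)" for K :: "(real^'d) set"
    proof -
      have fin: "finite {is :: 'd list. length is = n}"
        using finite_lists_length_eq[of "UNIV :: 'd set" n] by simp
      have "\<forall>is. \<exists>C. length is = n \<longrightarrow> (\<forall>x y. \<bar>F is x - F is y\<bar> \<le> C * norm (x - y) powr \<gamma>)" using holder by blast
      then obtain C where C: "\<And>is x y. length is = n \<Longrightarrow> \<bar>F is x - F is y\<bar> \<le> C is * norm (x - y) powr \<gamma>" by metis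
      \<comment> \<open>The local Hoelder class asks for one constant for all derivatives of order
        n; there are finitely many direction lists of that length.\<close>
      define C' where "C' = (\<Sum>is\<in>{is. length is = n}. \<bar>C is\<bar>)"
      have "\<bar>F is x - F is y\<bar> \<le> C' * norm (x - y) powr \<gamma>" if "length is = n" for "is" x y
      proof -
        have "C is \<le> C'" unfolding C'_def using member_le_sum[of "is" "{is. length is = n}" "\<lambda>is. \<bar>C is\<bar>"] that fin by simp
        then show ?thesis by (intro order_trans[OF C[OF that] mult_right_mono]) simp_all
      qed
      then show ?thesis using P by (intro exI[of _ C']) auto
    qed
    ultimately show ?thesis unfolding holder_loc_def by (simp add: F_def[abs_def])
  qed
  then show ?thesis unfolding holder_loc_minus_def by blast
qed

section \<open>Regular samples\<close>

context cm_field
begin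

text \<open>The functions e + f and i(e - f), for the conjugate characters e and f, are real; their
  pairings are therefore real, which yields one equation for the imaginary and one for the real
  parts.\<close>

lemma coeff_uminus: "AE \<omega> in M. \<forall>k. coeff (- k) \<omega> = cnj (coeff k \<omega>)"
  unfolding AE_all_countable
proof
  fix k :: "int^'d"
  let ?e = "character (- k)" and ?f = "character k"
  have r: "1 * ?e x + 1 * ?f x \<in> \<real>" "\<i> * ?e x + (- \<i>) * ?f x \<in> \<real>" for x
    by (simp_all add: character_uminus complex_is_Real_iff)
  have "AE \<omega> in M. u (\<lambda>x. 1 * ?e x + 1 * ?f x) \<omega> \<in> \<real>" "AE \<omega> in M. u (\<lambda>x. \<i> * ?e x + (- \<i>) * ?f x) \<omega> \<in> \<real>"
    by (rule u_real[OF test_linear[OF character_test character_test] r(1)],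
        rule u_real[OF test_linear[OF character_test character_test] r(2)])
  with u_linear[OF character_test character_test, of 1 "- k" 1 k] u_linear[OF character_test character_test, of \<i> "- k" "- \<i>" k]
  show "AE \<omega> in M. coeff (- k) \<omega> = cnj (coeff k \<omega>)"
  proof eventually_elim
    case (elim \<omega>)
    then have "Im (u ?e \<omega> + u ?f \<omega>) = 0" "Im (\<i> * u ?e \<omega> - \<i> * u ?f \<omega>) = 0"
      by (simp_all add: complex_is_Real_iff)
    then show ?case by (simp add: coeff_def complex_eq_iff)
  qed
qed

text \<open>The error is the pairing with a function whose coefficients vanish on the box and agree
  up to sign with those of \<phi> outside, so its variance is the tail of a convergent sum.\<close>

lemma truncation_limit:
  assumes \<phi>: "\<phi> \<in> test_functions"
  shows "(\<lambda>N. LINT \<omega>|M. (cmod ((\<Sum>k\<in>int_box (2 ^ N). char_coeff \<phi> k * coeff k \<omega>) - u \<phi> \<omega>))\<^sup>2) \<longlonglongrightarrow> 0"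
    and "integrable M (\<lambda>\<omega>. (cmod ((\<Sum>k\<in>int_box (2 ^ N). char_coeff \<phi> k * coeff k \<omega>) - u \<phi> \<omega>))\<^sup>2)"
proof -
  define a where "a k = cm_weight \<kappa> \<alpha> k * (cmod (char_coeff \<phi> k))\<^sup>2" for k
  define T where "T = (\<Sum>\<^sub>\<infinity>k. a k)"
  define f where "f F = (\<lambda>x. \<Sum>k\<in>F. char_coeff \<phi> k * character (- k) x)" for F
  define g where "g F = (\<lambda>x. 1 * f F x + (-1) * \<phi> x)" for F
  have f: "f F \<in> test_functions" for F unfolding f_def by (rule test_sum) simp
  have g: "g F \<in> test_functions" for F unfolding g_def by (rule test_linear[OF f \<phi>])
  have gc: "char_coeff (g F) k = (if k \<in> F then 0 else - char_coeff \<phi> k)" if "finite F" for F k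
    unfolding g_def char_coeff_linear[OF f \<phi>] unfolding f_def char_coeff_trig[OF that] by simp
  have ahs: "(a has_sum T) UNIV"
  proof -
    have "(\<lambda>k. cmod (complex_of_real (cm_weight \<kappa> \<alpha> k) * (char_coeff \<phi> k * cnj (char_coeff \<phi> k)))) summable_on UNIV"
      by (rule spectral_summable[OF \<phi> \<phi> _ cm_weight_le[OF \<kappa> \<alpha>]]) simp
    then have "a summable_on UNIV" by (simp add: a_def[abs_def] norm_mult power2_eq_square)
    then show ?thesis unfolding T_def by (rule has_sum_infsum)
  qed
  have norm: "(LINT \<omega>|M. (cmod (u (g F) \<omega>))\<^sup>2) = T - sum a F" if F: "finite F" for F
  proof -
    have "((\<lambda>k. - a k) has_sum (\<Sum>k\<in>F. - a k)) F" by (rule has_sum_finite[OF F])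
    then have "((\<lambda>k. if k \<in> F then - a k else 0) has_sum (\<Sum>k\<in>F. - a k)) UNIV"
      by (subst has_sum_cong_neutral[where T = F and g = "\<lambda>k. - a k"]) auto
    from has_sum_add[OF ahs this]
    have "((\<lambda>k. if k \<in> F then 0 else a k) has_sum (T - sum a F)) UNIV"
      by (simp add: sum_negf if_distrib cong: if_cong)
    then have "((\<lambda>k. complex_of_real (if k \<in> F then 0 else a k)) has_sum complex_of_real (T - sum a F)) UNIV"
      by (rule has_sum_of_real)
    moreover have "complex_of_real (if k \<in> F then 0 else a k) = complex_of_real (cm_weight \<kappa> \<alpha> k) * (char_coeff (g F) k * cnj (char_coeff (g F) k))" for k
      unfolding gc[OF F] a_def of_real_mult complex_norm_square by (simp add: complex_norm_square[symmetric])
    ultimately have "spectral_form (cm_weight \<kappa> \<alpha>) (g F) (g F) = complex_of_real (T - sum a F)"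
      unfolding spectral_form_def by (simp only: infsumI)
    then show ?thesis unfolding u_norm[OF g] by simp
  qed
  have ae: "AE \<omega> in M. (cmod (u (g F) \<omega>))\<^sup>2 = (cmod ((\<Sum>k\<in>F. char_coeff \<phi> k * coeff k \<omega>) - u \<phi> \<omega>))\<^sup>2" for F
  proof -
    have "AE \<omega> in M. u (f F) \<omega> = (\<Sum>k\<in>F. char_coeff \<phi> k * u (character (- k)) \<omega>)"
      unfolding f_def by (rule u_sum) simp
    moreover have "AE \<omega> in M. u (g F) \<omega> = 1 * u (f F) \<omega> + (-1) * u \<phi> \<omega>"
      unfolding g_def by (rule u_linear[OF f \<phi>])
    ultimately show ?thesis by eventually_elim (simp add: coeff_def)
  qed
  have [measurable]: "u \<phi> \<in> borel_measurable M" "u (g F) \<in> borel_measurable M" for F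
    by (rule u_measurable[OF \<phi>], rule u_measurable[OF g])
  show "integrable M (\<lambda>\<omega>. (cmod ((\<Sum>k\<in>int_box (2 ^ N). char_coeff \<phi> k * coeff k \<omega>) - u \<phi> \<omega>))\<^sup>2)"
    using u_l2[OF g] integrable_cong_AE[OF _ _ ae] by simp
  have "(\<lambda>N. T - sum a (int_box (2 ^ N))) \<longlonglongrightarrow> T - T"
    using filterlim_compose[OF ahs[unfolded has_sum_def] filterlim_int_box] by (intro tendsto_diff tendsto_const)
  moreover have "(LINT \<omega>|M. (cmod ((\<Sum>k\<in>int_box (2 ^ N). char_coeff \<phi> k * coeff k \<omega>) - u \<phi> \<omega>))\<^sup>2) = T - sum a (int_box (2 ^ N))" for N
    unfolding norm[OF finite_int_box, symmetric] by (rule integral_cong_AE) (use ae[of "int_box (2 ^ N)"] in \<open>auto elim!: eventually_mono\<close>)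
  ultimately show "(\<lambda>N. LINT \<omega>|M. (cmod ((\<Sum>k\<in>int_box (2 ^ N). char_coeff \<phi> k * coeff k \<omega>) - u \<phi> \<omega>))\<^sup>2) \<longlonglongrightarrow> 0"
    by simp
qed

text \<open>Summed at every \<omega>, with some unspecified value where the series diverges. Joint
  measurability and periodicity thus hold everywhere, not merely almost surely.\<close>

definition sample :: "real^'d \<Rightarrow> 'a \<Rightarrow> real" where
  "sample x \<omega> = (\<Sum>m. Re (block m [] x \<omega>))"

lemma sample_measurable: "(\<lambda>(x, \<omega>). sample x \<omega>) \<in> borel_measurable (borel \<Otimes>\<^sub>M M)"
  unfolding sample_def block_def by measurable

lemma block_deriv:
  "((\<lambda>t. Re (block m is (x + t *\<^sub>R axis i 1) \<omega>)) has_vector_derivative Re (block m (i # is) x \<omega>)) (at 0)"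
proof -
  have "((\<lambda>t. \<Sum>k\<in>shell m. (char_factor k is * coeff k \<omega>) * character k (x + t *\<^sub>R axis i 1)) has_vector_derivative
      (\<Sum>k\<in>shell m. 2 * pi * \<i> * of_int (k $ i) * (char_factor k is * coeff k \<omega>) * character k x)) (at 0)"
    by (intro has_vector_derivative_sum character_deriv)
  then have "((\<lambda>t. block m is (x + t *\<^sub>R axis i 1) \<omega>) has_vector_derivative block m (i # is) x \<omega>) (at 0)"
    by (simp add: block_def mult_ac)
  then show ?thesis by (rule bounded_linear.has_vector_derivative[OF bounded_linear_Re])
qed

lemma sample_regular: "AE \<omega> in M. (\<lambda>x. sample x \<omega>) \<in> holder_loc_minus regularity"
proof -
  \<comment> \<open>The bound holds almost surely for each margin; restricting to margins 1/(n+1)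
    and finite lists gives one null set for all of them.\<close>
  have "AE \<omega> in M. \<forall>is n. \<exists>K\<ge>0. \<forall>m x. \<bar>Re (block m is x \<omega>)\<bar> \<le> K * 2 powr (real m * (real (length is) - regularity + 1 / real (Suc n)))"
    unfolding AE_all_countable using block_sup_bound[of "1 / real (Suc _)"] by simp
  then show ?thesis
  proof eventually_elim
    case (elim \<omega>)
    show ?case
      unfolding sample_def
    proof (rule holder_series[OF block_deriv])
      fix "is" :: "'d list" and \<epsilon> :: real assume "0 < \<epsilon>"
      then obtain n where n: "1 / real (Suc n) < \<epsilon>" using nat_approx_posE by blast
      obtain K where K: "0 \<le> K" "\<And>m x. \<bar>Re (block m is x \<omega>)\<bar> \<le> K * 2 powr (real m * (real (length is) - regularity + 1 / real (Suc n)))"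
        using elim by blast
      have "\<bar>Re (block m is x \<omega>)\<bar> \<le> K * 2 powr (real m * (real (length is) - regularity + \<epsilon>))" for m x
      proof -
        have "2 powr (real m * (real (length is) - regularity + 1 / real (Suc n))) \<le> (2::real) powr (real m * (real (length is) - regularity + \<epsilon>))"
          using n by (intro powr_mono mult_left_mono) auto
        from mult_left_mono[OF this K(1)] K(2)[of m x] show ?thesis by linarith
      qed
      with K(1) show "\<exists>K\<ge>0. \<forall>m x. \<bar>Re (block m is x \<omega>)\<bar> \<le> K * 2 powr (real m * (real (length is) - regularity + \<epsilon>))"
        by blast
    qed
  qed
qed

text \<open>For positive regularity the block series converges uniformly, so integrating its partial
  sums against \<phi> converges to the pairing with the sample. These integrals are the truncations
  of the field, which tend to u \<phi> in L^2 and hence almost surely along a subsequence; the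
  limits agree.\<close>

lemma sample_pairing:
  assumes reg: "0 < regularity" and \<phi>: "\<phi> \<in> test_functions"
  shows "AE \<omega> in M. set_integrable lborel (cbox 0 One) (\<lambda>x. complex_of_real (sample x \<omega>) * \<phi> x) \<and>
    u \<phi> \<omega> = torus_integral (\<lambda>x. complex_of_real (sample x \<omega>) * \<phi> x)"
proof -
  define Z where "Z N \<omega> = (\<Sum>k\<in>int_box (2 ^ N). char_coeff \<phi> k * coeff k \<omega>)" for N \<omega>
  obtain r :: "nat \<Rightarrow> nat" where r: "strict_mono r" "AE \<omega> in M. (\<lambda>n. (cmod (Z (r n) \<omega> - u \<phi> \<omega>))\<^sup>2) \<longlonglongrightarrow> 0"
    using tendsto_L1_AE_subseq[of M "\<lambda>N \<omega>. (cmod (Z N \<omega> - u \<phi> \<omega>))\<^sup>2"] truncation_limit[OF \<phi>] unfolding Z_def by auto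
  obtain B where B: "0 \<le> B" "\<And>x. cmod (\<phi> x) \<le> B" using test_bounded[OF \<phi>] by metis
  have [measurable]: "\<phi> \<in> borel_measurable borel" by (rule test_measurable[OF \<phi>])
  define b where "b = - regularity / 2"
  have b: "b < 0" "real (length ([] :: 'd list)) - regularity + regularity / 2 = b" using reg by (simp_all add: b_def)
  have "AE \<omega> in M. \<exists>K\<ge>0. \<forall>m x. \<bar>Re (block m [] x \<omega>)\<bar> \<le> K * 2 powr (real m * b)"
    using block_sup_bound[of "regularity / 2" "[]"] reg unfolding b(2) by simp
  with r(2) coeff_uminus show ?thesis
  proof eventually_elim
    case (elim \<omega>)
    then obtain K where K: "0 \<le> K" "\<And>m x. \<bar>Re (block m [] x \<omega>)\<bar> \<le> K * 2 powr (real m * b)" by blast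
    have sK: "summable (\<lambda>m. K * 2 powr (real m * b))" by (rule summable_powr_geometric[OF b(1)])
    define G where "G = (\<Sum>m. K * 2 powr (real m * b))"
    \<comment> \<open>\<open>sample\<close> sums real parts; the conjugation rule for the
      coefficients shows that nothing is lost.\<close>
    have bR: "complex_of_real (Re (block m [] x \<omega>)) = block m [] x \<omega>" for m x
    proof -
      have "block m [] x \<omega> = (\<Sum>k\<in>shell m. coeff (- k) \<omega> * character (- k) x)"
        unfolding block_def by (rule sum.reindex_bij_witness[of _ uminus uminus]) (auto simp: shell_uminus)
      also have "\<dots> = cnj (block m [] x \<omega>)"
        using elim(2) by (simp add: block_def character_uminus)
      finally show ?thesis by (simp add: complex_eq_iff)
    qed
    have sb: "summable (\<lambda>m. Re (block m [] x \<omega>))" for x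
      using K(2) by (intro summable_comparison_test'[OF sK, of 0]) simp
    have [measurable]: "(\<lambda>x. block m [] x \<omega>) \<in> borel_measurable borel" for m
      unfolding block_def by measurable
    have [measurable]: "(\<lambda>x. sample x \<omega>) \<in> borel_measurable borel"
      unfolding sample_def by measurable
    have part: "\<bar>\<Sum>m<N. Re (block m [] x \<omega>)\<bar> \<le> G" for N x
    proof -
      have "\<bar>\<Sum>m<N. Re (block m [] x \<omega>)\<bar> \<le> (\<Sum>m<N. K * 2 powr (real m * b))"
        by (rule order_trans[OF sum_abs sum_mono]) (rule K(2))
      also have "\<dots> \<le> G" unfolding G_def using K(1) by (intro sum_le_suminf sK) auto
      finally show ?thesis .
    qed
    have G0: "0 \<le> G" using part[of 0 0] by simp
    have sG: "\<bar>sample x \<omega>\<bar> \<le> G" for x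
      unfolding sample_def using LIMSEQ_le_const2[OF tendsto_rabs[OF summable_LIMSEQ[OF sb[of x]]], of G] part[of x] by blast
    have int: "integrable tor (\<lambda>x. complex_of_real (sample x \<omega>) * \<phi> x)"
      by (rule integrable_tor_bounded[where B = "G * B"]) (auto simp: norm_mult intro!: mult_mono sG B G0)
    have partint: "(LINT x|tor. (\<Sum>m<Suc N. block m [] x \<omega>) * \<phi> x) = Z N \<omega>" for N
    proof -
      have "(LINT x|tor. (\<Sum>m<Suc N. block m [] x \<omega>) * \<phi> x) = (LINT x|tor. (\<Sum>k\<in>int_box (2 ^ N). coeff k \<omega> * (character k x * \<phi> x)))"
        unfolding block_def sum_shells by (intro Bochner_Integration.integral_cong refl) (simp add: sum_distrib_left mult_ac)
      also have "\<dots> = (\<Sum>k\<in>int_box (2 ^ N). coeff k \<omega> * char_coeff \<phi> k)"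
        unfolding char_coeff_tor using char_coeff_integrable[OF \<phi>] by (simp add: Bochner_Integration.integral_sum)
      finally show ?thesis by (simp add: Z_def mult.commute)
    qed
    have "(\<lambda>N. LINT x|tor. (\<Sum>m<Suc N. block m [] x \<omega>) * \<phi> x) \<longlonglongrightarrow> (LINT x|tor. complex_of_real (sample x \<omega>) * \<phi> x)"
    proof (rule integral_dominated_convergence[where w = "\<lambda>_. G * B"])
      show "(\<lambda>x. complex_of_real (sample x \<omega>) * \<phi> x) \<in> borel_measurable tor"
        "(\<lambda>x. (\<Sum>m<Suc N. block m [] x \<omega>) * \<phi> x) \<in> borel_measurable tor" for N
        by (rule measurable_tor, measurable)+
      show "AE x in tor. (\<lambda>N. (\<Sum>m<Suc N. block m [] x \<omega>) * \<phi> x) \<longlonglongrightarrow> complex_of_real (sample x \<omega>) * \<phi> x"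
      proof (rule AE_I2)
        fix x
        have "(\<lambda>N. complex_of_real (\<Sum>m<N. Re (block m [] x \<omega>)) * \<phi> x) \<longlonglongrightarrow> complex_of_real (sample x \<omega>) * \<phi> x"
          unfolding sample_def by (intro tendsto_intros summable_LIMSEQ sb)
        from LIMSEQ_Suc[OF this] show "(\<lambda>N. (\<Sum>m<Suc N. block m [] x \<omega>) * \<phi> x) \<longlonglongrightarrow> complex_of_real (sample x \<omega>) * \<phi> x"
          by (simp only: of_real_sum bR)
      qed
      show "AE x in tor. norm ((\<Sum>m<Suc N. block m [] x \<omega>) * \<phi> x) \<le> G * B" for N
      proof (rule AE_I2)
        fix x
        have "cmod (\<Sum>m<Suc N. block m [] x \<omega>) = \<bar>\<Sum>m<Suc N. Re (block m [] x \<omega>)\<bar>"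
          by (subst bR[symmetric]) (simp only: of_real_sum[symmetric] norm_of_real)
        then show "norm ((\<Sum>m<Suc N. block m [] x \<omega>) * \<phi> x) \<le> G * B"
          unfolding norm_mult using part[of x "Suc N"] by (intro mult_mono B G0) simp_all
      qed
    qed simp
    then have lim: "(\<lambda>N. Z N \<omega>) \<longlonglongrightarrow> (LINT x|tor. complex_of_real (sample x \<omega>) * \<phi> x)"
      by (simp only: partint)
    have "(\<lambda>n. sqrt ((cmod (Z (r n) \<omega> - u \<phi> \<omega>))\<^sup>2)) \<longlonglongrightarrow> sqrt 0"
      by (rule tendsto_real_sqrt[OF elim(1)])
    then have "(\<lambda>n. Z (r n) \<omega>) \<longlonglongrightarrow> u \<phi> \<omega>"
      by (simp add: tendsto_norm_zero_iff LIM_zero_iff)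
    moreover have "(\<lambda>n. Z (r n) \<omega>) \<longlonglongrightarrow> (LINT x|tor. complex_of_real (sample x \<omega>) * \<phi> x)"
      using LIMSEQ_subseq_LIMSEQ[OF lim r(1)] by (simp add: comp_def)
    ultimately have "u \<phi> \<omega> = (LINT x|tor. complex_of_real (sample x \<omega>) * \<phi> x)"
      by (rule LIMSEQ_unique)
    with int show ?case by (simp add: integrable_tor_iff torus_integral_tor)
  qed
qed

lemma has_regular_samples:
  assumes "0 < regularity"
  shows "has_samples M u (holder_loc_minus regularity)"
  unfolding has_samples_def
proof (intro exI conjI ballI allI)
  show "(\<lambda>(x, \<omega>). sample x \<omega>) \<in> borel_measurable (borel \<Otimes>\<^sub>M M)" by (rule sample_measurable)
  show "sample (x + lattice_vec k) \<omega> = sample x \<omega>" for x k \<omega>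
    by (simp add: sample_def block_def)
  show "AE \<omega> in M. (\<lambda>x. sample x \<omega>) \<in> holder_loc_minus regularity" by (rule sample_regular)
qed (rule sample_pairing[OF assms])

end

section \<open>Finite differences and test functions at a given scale\<close>

definition fdiff :: "real \<Rightarrow> 'd \<Rightarrow> (real^'d::finite \<Rightarrow> 'b::real_vector) \<Rightarrow> real^'d \<Rightarrow> 'b" where
  "fdiff h i f x = f (x + h *\<^sub>R axis i 1) - f x"

text \<open>The mean value theorem, once per difference. The induction applies the hypothesis to the
  chain of differences of g, which costs one derivative and one factor h.\<close>

lemma iterated_difference_bound:
  fixes g :: "nat \<Rightarrow> real \<Rightarrow> real"
  assumes "\<And>j t. j < n \<Longrightarrow> (g j has_real_derivative g (Suc j) t) (at t)" "0 \<le> h"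
    and "\<And>t. a \<le> t \<Longrightarrow> t \<le> a + real n * h \<Longrightarrow> \<bar>g n t\<bar> \<le> B"
  shows "\<bar>((\<lambda>f t. f (t + h) - f t) ^^ n) (g 0) a\<bar> \<le> h ^ n * B"
  using assms
proof (induction n arbitrary: g B)
  case 0
  then show ?case by simp
next
  case (Suc n)
  let ?D = "\<lambda>f t. f (t + h) - f t :: real"
  have "\<bar>(?D ^^ n) (?D (g 0)) a\<bar> \<le> h ^ n * (h * B)"
  proof (rule Suc.IH[of "\<lambda>j. ?D (g j)"])
    show "(?D (g j) has_real_derivative ?D (g (Suc j)) t) (at t)" if "j < n" for j t
    proof -
      have "((\<lambda>t. g j (t + h)) has_real_derivative g (Suc j) (t + h)) (at t)"
        using that by (intro DERIV_shift[THEN iffD1] Suc.prems(1)) simp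
      then show ?thesis
        by (rule DERIV_diff) (rule Suc.prems(1), use that in simp)
    qed
    show "0 \<le> h" by fact
    show "\<bar>?D (g n) t\<bar> \<le> h * B" if t: "a \<le> t" "t \<le> a + real n * h" for t
    proof (cases "h = 0")
      case False
      then have h: "0 < h" using Suc.prems(2) by simp
      then obtain z where z: "t < z" "z < t + h" "g n (t + h) - g n t = (t + h - t) * g (Suc n) z"
        using MVT2[of t "t + h" "g n" "g (Suc n)"] Suc.prems(1)[of n] by auto
      have "\<bar>g (Suc n) z\<bar> \<le> B"
        using z t by (intro Suc.prems(3)) (auto simp: algebra_simps)
      then show ?thesis using z(3) h by (simp add: abs_mult mult_left_mono)
    qed simp
  qed
  then show ?case by (simp add: funpow_Suc_right mult_ac del: funpow.simps)
qed

lemma funpow_fdiff_line: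
  "(fdiff h i ^^ n) f (x + t *\<^sub>R axis i 1) = ((\<lambda>f t. f (t + h) - f t) ^^ n) (\<lambda>t. f (x + t *\<^sub>R axis i 1)) t"
proof (induction n arbitrary: t)
  case (Suc n)
  have eq: "x + t *\<^sub>R axis i 1 + h *\<^sub>R axis i 1 = x + (t + h) *\<^sub>R axis i 1"
    by (simp add: scaleR_add_left)
  have "(fdiff h i ^^ Suc n) f y = (fdiff h i ^^ n) f (y + h *\<^sub>R axis i 1) - (fdiff h i ^^ n) f y" for y
    by (simp add: fdiff_def[of h i "(fdiff h i ^^ n) f"])
  then show ?case by (simp only: eq Suc) simp
qed simp

text \<open>Of the n + 1 differences, one is spent on the Hoelder continuity of the n-th derivative
  and yields h^\<gamma>; the other n are traded for derivatives and yield h^n.\<close>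

lemma holder_fdiff_bound:
  fixes f :: "real^'d::finite \<Rightarrow> real"
  assumes f: "f \<in> holder_loc n \<gamma>"
  obtains C where "0 \<le> C" "\<And>h x. 0 < h \<Longrightarrow> h \<le> 1 \<Longrightarrow> x \<in> cbox 0 One \<Longrightarrow>
    \<bar>(fdiff h i ^^ Suc n) f x\<bar> \<le> C * h ^ n * h powr \<gamma>"
proof -
  \<comment> \<open>Contains every point reached from the unit cube, whose norms are at most d, by n
    + 1 steps of length at most 1 along an axis. The constant of the Hoelder class depends on such a
    compact set.\<close>
  define K where "K = cball (0 :: real^'d) (real CARD('d) + real n + 1)"
  have hp: "has_partials n f" using f by (simp add: holder_loc_def)
  have "compact K" by (simp add: K_def)
  with f have "\<exists>C. \<forall>is. length is = n \<longrightarrow> (\<forall>x\<in>K. \<forall>y\<in>K. \<bar>partials is f x - partials is f y\<bar> \<le> C * norm (x - y) powr \<gamma>)"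
    by (simp add: holder_loc_def)
  then obtain C where C: "\<And>is x y. length is = n \<Longrightarrow> x \<in> K \<Longrightarrow> y \<in> K \<Longrightarrow>
      \<bar>partials is f x - partials is f y\<bar> \<le> C * norm (x - y) powr \<gamma>"
    by blast
  have "\<bar>(fdiff h i ^^ Suc n) f x\<bar> \<le> \<bar>C\<bar> * h ^ n * h powr \<gamma>" if h: "0 < h" "h \<le> 1" and x: "x \<in> cbox 0 One" for h x
  proof -
    define q where "q j t = partials (replicate j i) f (x + t *\<^sub>R axis i 1)" for j t
    define G where "G j t = q j (t + h) - q j t" for j t
    have dq: "(q j has_real_derivative q (Suc j) t) (at t)" if "j < n" for j t
      using line_derivative[OF has_partials_deriv[OF hp, of "replicate j i" _ i], of x t] that
      by (simp add: q_def[abs_def] has_real_derivative_iff_has_vector_derivative)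
    have dG: "(G j has_real_derivative G (Suc j) t) (at t)" if "j < n" for j t
    proof -
      have "((\<lambda>t. q j (t + h)) has_real_derivative q (Suc j) (t + h)) (at t)"
        by (rule DERIV_shift[THEN iffD1, OF dq[OF that]])
      then show ?thesis unfolding G_def[abs_def] using dq[OF that, of t] by (rule DERIV_diff)
    qed
    have nx: "norm x \<le> real CARD('d)"
    proof -
      have "norm x \<le> (\<Sum>j\<in>UNIV. \<bar>x $ j\<bar>)" by (rule norm_le_l1_cart)
      also have "\<dots> \<le> (\<Sum>j\<in>(UNIV :: 'd set). 1)"
        using x by (intro sum_mono) (auto simp: mem_box_cart)
      finally show ?thesis by simp
    qed
    have inK: "x + t *\<^sub>R axis i 1 \<in> K" if "0 \<le> t" "t \<le> real n + 1" for t
    proof -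
      have "norm (x + t *\<^sub>R axis i 1) \<le> norm x + norm (t *\<^sub>R axis i (1::real))" by (rule norm_triangle_ineq)
      then show ?thesis using nx that by (simp add: K_def norm_axis_1)
    qed
    have "\<bar>((\<lambda>f t. f (t + h) - f t) ^^ n) (G 0) 0\<bar> \<le> h ^ n * (\<bar>C\<bar> * h powr \<gamma>)"
    proof (rule iterated_difference_bound[where g = G, OF dG])
      fix t assume t: "0 \<le> t" "t \<le> 0 + real n * h"
      have "real n * h \<le> real n" using h mult_left_mono[of h 1 "real n"] by simp
      then have "x + t *\<^sub>R axis i 1 \<in> K" "x + (t + h) *\<^sub>R axis i 1 \<in> K"
        using t h by (auto intro!: inK)
      then have "\<bar>G n t\<bar> \<le> C * norm ((x + (t + h) *\<^sub>R axis i 1) - (x + t *\<^sub>R axis i 1)) powr \<gamma>"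
        unfolding G_def q_def by (intro C) simp_all
      also have "(x + (t + h) *\<^sub>R axis i 1) - (x + t *\<^sub>R axis i 1) = h *\<^sub>R axis i (1::real)"
        by (simp add: scaleR_add_left)
      also have "C * norm (h *\<^sub>R axis i (1::real)) powr \<gamma> \<le> \<bar>C\<bar> * h powr \<gamma>"
        using h by (simp add: norm_axis_1 mult_right_mono)
      finally show "\<bar>G n t\<bar> \<le> \<bar>C\<bar> * h powr \<gamma>" .
    qed (use h in simp_all)
    moreover have "(fdiff h i ^^ Suc n) f x = ((\<lambda>f t. f (t + h) - f t) ^^ n) (G 0) 0"
    proof -
      have "(fdiff h i ^^ Suc n) f (x + 0 *\<^sub>R axis i 1) = ((\<lambda>f t. f (t + h) - f t) ^^ Suc n) (q 0) 0"
        unfolding funpow_fdiff_line by (simp add: q_def[abs_def])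
      then show ?thesis by (simp add: funpow_Suc_right G_def[abs_def] del: funpow.simps)
    qed
    ultimately show ?thesis by (simp add: mult_ac)
  qed
  then show thesis using that[of "\<bar>C\<bar>"] by simp
qed

section \<open>Adjoints and Fourier symbols of difference operators\<close>

lemma test_translate:
  assumes "\<phi> \<in> test_functions"
  shows "(\<lambda>x. \<phi> (x + a)) \<in> test_functions"
proof -
  have 1: "((\<lambda>t. partials is \<phi> (x + t *\<^sub>R axis i 1 + a)) has_vector_derivative partials (i # is) \<phi> (x + a)) (at 0)" for "is" i x
  proof -
    have "x + t *\<^sub>R axis i 1 + a = (x + a) + t *\<^sub>R axis i 1" for t by simp
    then show ?thesis using smooth_deriv[OF test_smooth[OF assms], of "is" "x + a" i] by presburger
  qed
  have 2: "continuous_on UNIV (\<lambda>x. partials is \<phi> (x + a))" for "is"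
    by (rule continuous_on_compose2[OF smooth_continuous[OF test_smooth[OF assms]]]) (auto intro!: continuous_intros)
  have "smooth (\<lambda>x. \<phi> (x + a))"
    using smooth_family(1)[of "\<lambda>is x. partials is \<phi> (x + a)", OF 1 2] by simp
  moreover have "\<phi> (x + lattice_vec k + a) = \<phi> (x + a)" for x k
    using test_periodic[OF assms] unfolding periodic_def by (metis add.commute add.left_commute)
  ultimately show ?thesis by (simp add: test_functions_def)
qed

lemma test_fdiff: "\<phi> \<in> test_functions \<Longrightarrow> fdiff h i \<phi> \<in> test_functions"
  unfolding fdiff_def[abs_def] by (intro test_diff test_translate)

lemma test_fdiff_funpow: "\<phi> \<in> test_functions \<Longrightarrow> (fdiff h i ^^ n) \<phi> \<in> test_functions"
  by (induction n) (simp_all add: test_fdiff)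

lemma integral_translate_mult:
  fixes f :: "real^'d::finite \<Rightarrow> complex"
  assumes [measurable]: "f \<in> borel_measurable borel" and per: "periodic f" and f: "integrable tor f" and g: "g \<in> test_functions"
  shows "integrable tor (\<lambda>x. f (x + a))" "integrable tor (\<lambda>x. f x * g x)"
    and "(LINT x|tor. f (x + a) * g x) = (LINT x|tor. f x * g (x - a))"
proof -
  have [measurable]: "g \<in> borel_measurable borel" by (rule test_measurable[OF g])
  obtain B where B: "\<And>x. cmod (g x) \<le> B" using test_bounded[OF g] by metis
  show "integrable tor (\<lambda>x. f (x + a))" using integrable_tor_translate[of f a] per f by simp
  have i: "integrable tor (\<lambda>x. B * cmod (f x))" using f by simp
  show "integrable tor (\<lambda>x. f x * g x)"
  proof (rule Bochner_Integration.integrable_bound[OF i])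
    show "(\<lambda>x. f x * g x) \<in> borel_measurable tor" by (rule measurable_tor) measurable
    show "AE x in tor. norm (f x * g x) \<le> norm (B * cmod (f x))"
    proof (rule AE_I2)
      fix x
      have "0 \<le> B" using order_trans[OF norm_ge_zero B] .
      then show "norm (f x * g x) \<le> norm (B * cmod (f x))"
        using mult_right_mono[OF B[of x], of "cmod (f x)"] by (simp add: norm_mult mult.commute)
    qed
  qed
  have "(LINT x|tor. (\<lambda>x. f x * g (x - a)) (x + a)) = (LINT x|tor. f x * g (x - a))"
  proof (rule integral_tor_translate)
    show "(\<lambda>x. f x * g (x - a)) \<in> borel_measurable borel" by measurable
    show "periodic (\<lambda>x. f x * g (x - a))"
      using per test_periodic[OF test_translate[OF g, of "- a"]] by (simp add: periodic_def)
  qed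
  then show "(LINT x|tor. f (x + a) * g x) = (LINT x|tor. f x * g (x - a))" by simp
qed

lemma fdiff_regular:
  fixes f :: "real^'d::finite \<Rightarrow> complex"
  assumes "f \<in> borel_measurable borel" "periodic f" "integrable tor f"
  shows "(fdiff h i ^^ n) f \<in> borel_measurable borel \<and> periodic ((fdiff h i ^^ n) f) \<and> integrable tor ((fdiff h i ^^ n) f)"
proof (induction n)
  case (Suc n)
  define g where "g = (fdiff h i ^^ n) f"
  have [measurable]: "g \<in> borel_measurable borel" and g: "periodic g" "integrable tor g"
    using Suc by (auto simp: g_def)
  have "fdiff h i g \<in> borel_measurable borel" unfolding fdiff_def[abs_def] by measurable
  moreover have "periodic (fdiff h i g)"
    unfolding periodic_def fdiff_def
  proof (intro allI)
    fix x k
    have "g (x + lattice_vec k + h *\<^sub>R axis i 1) = g ((x + h *\<^sub>R axis i 1) + lattice_vec k)" by (simp add: add_ac)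
    then show "g (x + lattice_vec k + h *\<^sub>R axis i 1) - g (x + lattice_vec k) = g (x + h *\<^sub>R axis i 1) - g x"
      using g(1) by (simp only: periodic_def)
  qed
  moreover have "integrable tor (fdiff h i g)"
    unfolding fdiff_def[abs_def]
    by (intro Bochner_Integration.integrable_diff g(2) integral_translate_mult(1)[OF _ g test_zero]) simp
  ultimately show ?case by (simp add: g_def)
qed (use assms in simp)

text \<open>Summation by parts: by translation invariance the adjoint of the difference with step h
  is the difference with step -h. The function f need only be integrable, as for a sample
  path.\<close>

lemma integral_fdiff:
  fixes f :: "real^'d::finite \<Rightarrow> complex"
  assumes f: "f \<in> borel_measurable borel" "periodic f" "integrable tor f" and g: "g \<in> test_functions"
  shows "(LINT x|tor. (fdiff h i ^^ n) f x * g x) = (LINT x|tor. f x * (fdiff (- h) i ^^ n) g x)"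
  using g
proof (induction n arbitrary: g)
  case (Suc n)
  let ?f = "(fdiff h i ^^ n) f"
  have F: "?f \<in> borel_measurable borel" "periodic ?f" "integrable tor ?f" using fdiff_regular[OF f] by blast+
  have tf: "(\<lambda>x. ?f (x + a)) \<in> borel_measurable borel" "periodic (\<lambda>x. ?f (x + a))" for a
  proof -
    show "(\<lambda>x. ?f (x + a)) \<in> borel_measurable borel"
      by (rule measurable_compose[OF _ F(1)]) simp
    have "?f (x + lattice_vec k + a) = ?f ((x + a) + lattice_vec k)" for x k by (simp add: add_ac)
    then show "periodic (\<lambda>x. ?f (x + a))" using F(2) by (simp only: periodic_def simp_thms)
  qed
  have "(LINT x|tor. (fdiff h i ^^ Suc n) f x * g x) = (LINT x|tor. ?f (x + h *\<^sub>R axis i 1) * g x - ?f x * g x)"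
    by (simp add: fdiff_def left_diff_distrib)
  also have "\<dots> = (LINT x|tor. ?f (x + h *\<^sub>R axis i 1) * g x) - (LINT x|tor. ?f x * g x)"
    by (intro Bochner_Integration.integral_diff integral_translate_mult(2)[OF F Suc.prems]
        integral_translate_mult(2)[OF tf integral_translate_mult(1)[OF F test_zero] Suc.prems])
  also have "\<dots> = (LINT x|tor. ?f x * g (x - h *\<^sub>R axis i 1)) - (LINT x|tor. ?f x * g x)"
    by (simp only: integral_translate_mult(3)[OF F Suc.prems])
  also have "\<dots> = (LINT x|tor. ?f x * g (x + (- h *\<^sub>R axis i 1)) - ?f x * g x)"
    using integral_translate_mult(2)[OF F test_translate[OF Suc.prems, of "- h *\<^sub>R axis i 1"]] integral_translate_mult(2)[OF F Suc.prems]
    by (subst Bochner_Integration.integral_diff) simp_all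
  also have "\<dots> = (LINT x|tor. ?f x * fdiff (- h) i g x)"
    by (simp add: fdiff_def right_diff_distrib)
  also have "\<dots> = (LINT x|tor. f x * (fdiff (- h) i ^^ n) (fdiff (- h) i g) x)"
    by (rule Suc.IH[OF test_fdiff[OF Suc.prems]])
  finally show ?case by (simp add: funpow_Suc_right del: funpow.simps)
qed simp

text \<open>Translation multiplies each coefficient by a phase. Under the convention of
  \<open>char_coeff\<close> the step -h produces the phase with positive sign.\<close>

lemma char_coeff_fdiff:
  assumes "g \<in> test_functions"
  shows "char_coeff ((fdiff (- h) i ^^ n) g) k = (cis (2 * pi * (real_of_int (k $ i) * h)) - 1) ^ n * char_coeff g k"
proof (induction n)
  case (Suc n)
  let ?g = "(fdiff (- h) i ^^ n) g"
  have g: "?g \<in> test_functions" by (rule test_fdiff_funpow[OF assms])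
  have "char_coeff (fdiff (- h) i ?g) k = char_coeff (\<lambda>x. 1 * ?g (x + - h *\<^sub>R axis i 1) + (-1) * ?g x) k"
    by (simp add: fdiff_def[abs_def])
  also have "\<dots> = char_coeff (\<lambda>x. ?g (x + - h *\<^sub>R axis i 1)) k - char_coeff ?g k"
    by (subst char_coeff_linear[OF test_translate[OF g] g]) simp
  also have "char_coeff (\<lambda>x. ?g (x + - h *\<^sub>R axis i 1)) k = character k (h *\<^sub>R axis i 1) * char_coeff ?g k"
  proof -
    have "(LINT x|tor. character k (x + h *\<^sub>R axis i 1) * ?g x) = (LINT x|tor. character k x * ?g (x - h *\<^sub>R axis i 1))"
      by (rule integral_translate_mult(3)[OF _ _ _ g]) (simp_all add: periodic_def)
    moreover have "(LINT x|tor. character k (x + h *\<^sub>R axis i 1) * ?g x) = character k (h *\<^sub>R axis i 1) * (LINT x|tor. character k x * ?g x)"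
      by (simp add: character_add mult_ac flip: integral_mult_right_zero)
    ultimately show ?thesis by (simp add: char_coeff_tor)
  qed
  finally show ?case using Suc by (simp add: character_axis algebra_simps)
qed simp

section \<open>Fejer kernels and a window of frequencies\<close>

definition int_cube :: "int \<Rightarrow> nat \<Rightarrow> (int^'d::finite) set" where
  "int_cube l n = {k. \<forall>i. l \<le> k $ i \<and> k $ i < l + int n}"

lemma int_cube_bij: "bij_betw vec_lambda (PiE (UNIV :: 'd::finite set) (\<lambda>_. {l..<l + int n})) (int_cube l n :: (int^'d) set)"
  by (rule bij_betw_byWitness[where f' = vec_nth]) (auto simp: int_cube_def PiE_iff)

lemma finite_int_cube [simp]: "finite (int_cube l n)"
  using bij_betw_finite[OF int_cube_bij] by (simp add: finite_PiE)

lemma card_int_cube: "card (int_cube l n :: (int^'d::finite) set) = n ^ CARD('d)"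
  using bij_betw_same_card[OF int_cube_bij[of l n, where 'd = 'd]] by (simp add: card_PiE)

text \<open>The product Fejer kernel, as the normalised square of a Dirichlet-type sum. It is
  nonnegative with mass one, so pairing with it costs no more than a sup norm, and its Fourier
  coefficients are nonnegative.\<close>

definition fejer :: "nat \<Rightarrow> real^'d::finite \<Rightarrow> complex" where
  "fejer N x = of_real ((cmod (\<Sum>a\<in>int_cube 0 N. character a x))\<^sup>2 / real N ^ CARD('d))"

lemma fejer_expand:
  fixes x :: "real^'d::finite"
  shows "fejer N x = (\<Sum>p\<in>int_cube 0 N \<times> int_cube 0 N. of_real (1 / real N ^ CARD('d)) * character (fst p - snd p) x)"
proof -
  let ?Q = "int_cube 0 N :: (int^'d) set"
  have "fejer N x = of_real (1 / real N ^ CARD('d)) * ((\<Sum>a\<in>?Q. character a x) * cnj (\<Sum>a\<in>?Q. character a x))"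
    unfolding fejer_def complex_norm_square[symmetric] of_real_mult[symmetric] by simp
  also have "(\<Sum>a\<in>?Q. character a x) * cnj (\<Sum>a\<in>?Q. character a x) = (\<Sum>a\<in>?Q. \<Sum>b\<in>?Q. character (a - b) x)"
    by (simp add: sum_product character_add_index[of _ "- _", simplified] character_uminus)
  also have "\<dots> = (\<Sum>p\<in>?Q \<times> ?Q. character (fst p - snd p) x)"
    by (simp add: sum.cartesian_product case_prod_beta)
  finally show ?thesis by (simp add: sum_distrib_left)
qed

lemma fejer_test: "fejer N \<in> test_functions"
  unfolding fejer_expand[abs_def] by (rule test_sum) simp

text \<open>Expanding the square, the coefficient counts the pairs of points of the cube with
  difference k; they are parametrised by their first member.\<close>

lemma char_coeff_fejer:
  fixes k :: "int^'d::finite"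
  shows "char_coeff (fejer N) k = of_real (real (card {a \<in> int_cube 0 N. a + k \<in> int_cube 0 N}) / real N ^ CARD('d))"
proof -
  let ?Q = "int_cube 0 N :: (int^'d) set"
  let ?c = "complex_of_real (1 / real N ^ CARD('d))"
  have "char_coeff (fejer N) k = (\<Sum>p\<in>?Q \<times> ?Q. ?c * char_coeff (character (fst p - snd p)) k)"
    unfolding fejer_expand[abs_def] by (rule char_coeff_sum) simp
  also have "\<dots> = (\<Sum>p\<in>?Q \<times> ?Q. if p \<in> (\<lambda>a. (a, a + k)) ` {a \<in> ?Q. a + k \<in> ?Q} then ?c else 0)"
  proof (intro sum.cong refl)
    fix p assume "p \<in> ?Q \<times> ?Q"
    then have "(fst p - snd p = - k) = (p \<in> (\<lambda>a. (a, a + k)) ` {a \<in> ?Q. a + k \<in> ?Q})"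
      by (cases p) (auto simp: image_iff algebra_simps diff_eq_eq)
    then show "?c * char_coeff (character (fst p - snd p)) k = (if p \<in> (\<lambda>a. (a, a + k)) ` {a \<in> ?Q. a + k \<in> ?Q} then ?c else 0)"
      by (simp add: char_coeff_character)
  qed
  also have "\<dots> = (\<Sum>p\<in>(\<lambda>a. (a, a + k)) ` {a \<in> ?Q. a + k \<in> ?Q}. ?c)"
    by (rule sum.mono_neutral_cong_right) auto
  also have "\<dots> = (\<Sum>a\<in>{a \<in> ?Q. a + k \<in> ?Q}. ?c)"
    by (subst sum.reindex) (auto simp: inj_on_def)
  finally show ?thesis by simp
qed

text \<open>By positivity the mass of the modulus is the coefficient at 0, where every point of the
  cube is counted.\<close>

lemma fejer_mass:
  assumes "0 < N"
  shows "(LINT x|(tor :: (real^'d::finite) measure). cmod (fejer N x)) = 1" "integrable (tor :: (real^'d::finite) measure) (\<lambda>x. cmod (fejer N x))"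
proof -
  have cm: "complex_of_real (cmod (fejer N x)) = fejer N x" for x :: "real^'d"
    by (simp add: fejer_def norm_divide norm_power)
  show "integrable (tor :: (real^'d) measure) (\<lambda>x. cmod (fejer N x))"
    by (rule integrable_norm[OF test_integrable[OF fejer_test]])
  have "complex_of_real (LINT x|(tor :: (real^'d) measure). cmod (fejer N x)) = (LINT x|(tor :: (real^'d) measure). fejer N x)"
    unfolding integral_complex_of_real[symmetric] cm ..
  also have "\<dots> = char_coeff (fejer N) (0 :: int^'d)" by (simp add: char_coeff_tor)
  also have "\<dots> = 1" using assms by (simp add: char_coeff_fejer card_int_cube)
  finally show "(LINT x|(tor :: (real^'d) measure). cmod (fejer N x)) = 1" by simp
qed

text \<open>Adding a frequency of the window between R and 2R to a point of the cube of side 2R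
  stays within the cube of side 4R. At least (2R)^d of (4R)^d points are therefore counted.\<close>

lemma char_coeff_fejer_lower:
  fixes k :: "int^'d::finite"
  assumes "0 < R" "k \<in> int_cube (int R) R"
  shows "1 / 2 ^ CARD('d) \<le> cmod (char_coeff (fejer (4 * R)) k)"
proof -
  have "int_cube 0 (2 * R) \<subseteq> {a \<in> int_cube 0 (4 * R). a + k \<in> int_cube 0 (4 * R)}"
  proof
    fix a :: "int^'d" assume a: "a \<in> int_cube 0 (2 * R)"
    have "0 \<le> a $ i \<and> a $ i < 2 * int R" "int R \<le> k $ i \<and> k $ i < 2 * int R" for i
      using a assms(2) by (simp_all add: int_cube_def)
    then show "a \<in> {a \<in> int_cube 0 (4 * R). a + k \<in> int_cube 0 (4 * R)}"
      unfolding int_cube_def by simp (smt (verit))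
  qed
  then have "card (int_cube 0 (2 * R) :: (int^'d) set) \<le> card {a \<in> int_cube 0 (4 * R). a + k \<in> int_cube 0 (4 * R)}"
    by (intro card_mono) auto
  then have "(2 * R) ^ CARD('d) \<le> card {a \<in> int_cube 0 (4 * R). a + k \<in> int_cube 0 (4 * R)}"
    by (simp only: card_int_cube)
  then have "real ((2 * R) ^ CARD('d)) \<le> real (card {a \<in> int_cube 0 (4 * R). a + k \<in> int_cube 0 (4 * R)})"
    by (simp only: of_nat_le_iff)
  moreover have "cmod (char_coeff (fejer (4 * R)) k) =
      real (card {a \<in> int_cube 0 (4 * R). a + k \<in> int_cube 0 (4 * R)}) / real (4 * R) ^ CARD('d)"
    unfolding char_coeff_fejer norm_of_real by (intro abs_of_nonneg divide_nonneg_nonneg zero_le_power of_nat_0_le_iff)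
  ultimately have "real ((2 * R) ^ CARD('d)) / real (4 * R) ^ CARD('d) \<le> cmod (char_coeff (fejer (4 * R)) k)"
    by (simp only: divide_right_mono zero_le_power of_nat_0_le_iff)
  moreover have "real ((2 * R) ^ CARD('d)) / real (4 * R) ^ CARD('d) = 1 / 2 ^ CARD('d)"
    using assms(1) by (simp add: power_divide[symmetric] power_one_over)
  ultimately show ?thesis by simp
qed

text \<open>Explains the step 1/(4R): on the window the phase lies between pi/2 and pi, bounded away
  from the zeros of the symbol. The modulus is 2 sin(pi r/4) with r between 1 and 2, and comparison
  with sin(pi/6) = 1/2 suffices.\<close>

lemma cis_minus_1_lower:
  fixes k :: "int^'d::finite"
  assumes "0 < R" "k \<in> int_cube (int R) R"
  shows "1 \<le> cmod (cis (2 * pi * (real_of_int (k $ i) * (1 / (4 * real R)))) - 1)"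
proof -
  define r where "r = real_of_int (k $ i) / real R"
  have kr: "int R \<le> k $ i" "k $ i < 2 * int R" using assms(2) by (auto simp: int_cube_def)
  then have "real_of_int (int R) \<le> real_of_int (k $ i)" "real_of_int (k $ i) < real_of_int (2 * int R)"
    by (simp_all only: of_int_le_iff of_int_less_iff)
  then have r: "1 \<le> r" "r < 2" using assms(1) by (simp_all add: r_def le_divide_eq divide_less_eq)
  have "cmod (cis (2 * pi * (real_of_int (k $ i) * (1 / (4 * real R)))) - 1) = 2 * \<bar>sin (pi * r / 4)\<bar>"
    unfolding cis_conv_exp dist_exp_i_1 by (simp add: r_def mult_ac)
  also have "\<dots> \<ge> 2 * (1/2)"
  proof -
    have "sin (pi / 6) \<le> sin (pi * r / 4)"
      using r pi_gt_zero mult_left_mono[OF r(1), of pi] mult_strict_left_mono[OF r(2), of pi] by (intro sin_monotone_2pi_le) (auto simp: field_simps)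
    then show ?thesis by (simp add: sin_30)
  qed
  finally show ?thesis by simp
qed

lemma spectral_form_lower:
  assumes "\<phi> \<in> test_functions" "\<And>k. 0 \<le> m k" "\<And>k. m k \<le> B" "finite F"
  shows "(\<Sum>k\<in>F. m k * (cmod (char_coeff \<phi> k))\<^sup>2) \<le> Re (spectral_form m \<phi> \<phi>)"
proof -
  have "(\<lambda>k. cmod (complex_of_real (m k) * (char_coeff \<phi> k * cnj (char_coeff \<phi> k)))) summable_on UNIV"
    by (rule spectral_summable[OF assms(1,1,2,3)])
  then have s: "(\<lambda>k. m k * (cmod (char_coeff \<phi> k))\<^sup>2) summable_on UNIV"
    using assms(2) by (simp add: norm_mult power2_eq_square)
  have "((\<lambda>k. complex_of_real (m k * (cmod (char_coeff \<phi> k))\<^sup>2)) has_sum complex_of_real (\<Sum>\<^sub>\<infinity>k. m k * (cmod (char_coeff \<phi> k))\<^sup>2)) UNIV"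
    by (rule has_sum_of_real[OF has_sum_infsum[OF s]])
  then have "spectral_form m \<phi> \<phi> = complex_of_real (\<Sum>\<^sub>\<infinity>k. m k * (cmod (char_coeff \<phi> k))\<^sup>2)"
    unfolding spectral_form_def by (simp only: of_real_mult complex_norm_square infsumI)
  moreover have "(\<Sum>k\<in>F. m k * (cmod (char_coeff \<phi> k))\<^sup>2) \<le> (\<Sum>\<^sub>\<infinity>k. m k * (cmod (char_coeff \<phi> k))\<^sup>2)"
    using assms(2) by (intro finite_sum_le_infsum[OF s assms(4)]) auto
  ultimately show ?thesis by simp
qed

section \<open>Lower bound for the variance of the probes\<close>

context cm_field
begin

text \<open>On the window |k| is at most 2dR by the l1 norm, and |k| \<ge> 1 gives lambda(k) \<le>
  \<open>lam_min \<kappa>\<close> |k|; both powers in the weight have nonpositive exponents.\<close>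

lemma cm_weight_lower:
  fixes k :: "int^'d"
  assumes "0 < R" "k \<in> int_cube (int R) R"
  shows "lam_min \<kappa> powr (-2 * \<alpha>) * (2 * real CARD('d) * real R) powr (-2 * (\<alpha> + 1)) \<le> cm_weight \<kappa> \<alpha> k"
proof -
  define n where "n = norm (lattice_vec k)"
  define L where "L = lam_min \<kappa>"
  define Q where "Q = 2 * real CARD('d) * real R"
  have L0: "0 < L" using lam_min_gt[OF \<kappa>] \<kappa> by (simp add: L_def)
  have kr: "int R \<le> k $ i" "k $ i < 2 * int R" for i using assms(2) by (auto simp: int_cube_def)
  have k0: "k \<noteq> 0" using kr(1)[of undefined] assms(1) by auto
  have n1: "1 \<le> n" unfolding n_def by (rule norm_lattice_vec_ge_1[OF k0])
  have "n \<le> (\<Sum>i\<in>UNIV. \<bar>lattice_vec k $ i\<bar>)" unfolding n_def by (rule norm_le_l1_cart)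
  also have "\<dots> \<le> (\<Sum>i\<in>(UNIV :: 'd set). 2 * real R)"
  proof (rule sum_mono)
    fix i
    have "real_of_int (k $ i) < real_of_int (2 * int R)" "0 \<le> real_of_int (k $ i)"
      using kr[of i] by (simp_all only: of_int_less_iff of_int_0_le_iff)
    then show "\<bar>lattice_vec k $ i\<bar> \<le> 2 * real R" by simp
  qed
  finally have nQ: "n \<le> Q" by (simp add: Q_def)
  have lL: "lam \<kappa> k \<le> L * Q"
  proof (rule power2_le_imp_le)
    have "(lam \<kappa> k)\<^sup>2 \<le> L\<^sup>2 * n\<^sup>2"
    proof -
      have "1 * \<kappa>\<^sup>2 \<le> n\<^sup>2 * \<kappa>\<^sup>2" using n1 by (intro mult_right_mono) simp_all
      then show ?thesis by (simp add: lam_sq L_def lam_min_def n_def algebra_simps)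
    qed
    also have "\<dots> \<le> L\<^sup>2 * Q\<^sup>2" using nQ n1 by (intro mult_left_mono power_mono) auto
    finally show "(lam \<kappa> k)\<^sup>2 \<le> (L * Q)\<^sup>2" by (simp add: power_mult_distrib)
    show "0 \<le> L * Q" using L0 by (simp add: Q_def)
  qed
  have "(L * Q) powr (-2 * \<alpha>) \<le> lam \<kappa> k powr (-2 * \<alpha>)"
    using \<alpha> lL lam_pos[OF \<kappa>, of k] by (intro powr_mono2') auto
  moreover have "Q powr (-2) \<le> n powr (-2)"
    using nQ n1 by (intro powr_mono2') auto
  ultimately have "Q powr (-2) * (L * Q) powr (-2 * \<alpha>) \<le> n powr (-2) * lam \<kappa> k powr (-2 * \<alpha>)"
    by (intro mult_mono) auto
  moreover have "Q powr (-2) * (L * Q) powr (-2 * \<alpha>) = L powr (-2 * \<alpha>) * Q powr (-2 * (\<alpha> + 1))"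
  proof -
    have "Q powr (-2) * Q powr (-2 * \<alpha>) = Q powr (-2 * (\<alpha> + 1))" by (simp add: powr_add[symmetric] algebra_simps)
    then show ?thesis using L0 by (simp add: powr_mult Q_def mult_ac)
  qed
  ultimately show ?thesis using k0 by (simp add: cm_weight_def n_def L_def Q_def)
qed

text \<open>The R^d frequencies of the window each contribute a weight of at least order
  R^(-2(\<alpha> + 1)) times a squared coefficient bounded below, which makes R^(-2r) in total. All
  other frequencies contribute nonnegative terms and are discarded.\<close>

lemma probe_variance_lower:
  fixes i :: 'd
  obtains c where "0 < c" "\<And>R. 0 < R \<Longrightarrow>
    c * real R powr (-2 * regularity) \<le> Re (spectral_form (cm_weight \<kappa> \<alpha>) ((fdiff (- (1 / (4 * real R))) i ^^ n) (fejer (4 * R))) ((fdiff (- (1 / (4 * real R))) i ^^ n) (fejer (4 * R))))"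
proof -
  define c where "c = lam_min \<kappa> powr (-2 * \<alpha>) * (2 * real CARD('d)) powr (-2 * (\<alpha> + 1)) * (1 / 2 ^ CARD('d))\<^sup>2"
  have "0 < lam_min \<kappa>" using lam_min_gt[OF \<kappa>] \<kappa> by simp
  then have c0: "0 < c" by (simp add: c_def)
  have "c * real R powr (-2 * regularity) \<le> Re (spectral_form (cm_weight \<kappa> \<alpha>) ((fdiff (- (1 / (4 * real R))) i ^^ n) (fejer (4 * R))) ((fdiff (- (1 / (4 * real R))) i ^^ n) (fejer (4 * R))))"
    (is "_ \<le> Re (spectral_form _ ?\<psi> _)") if R: "0 < R" for R
  proof -
    have \<psi>: "?\<psi> \<in> test_functions" by (rule test_fdiff_funpow[OF fejer_test])
    define Q where "Q = (2 * real CARD('d) * real R) powr (-2 * (\<alpha> + 1))"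
    have "c * real R powr (-2 * regularity) = real R ^ CARD('d) * (lam_min \<kappa> powr (-2 * \<alpha>) * Q * (1 / 2 ^ CARD('d))\<^sup>2)"
    proof -
      have "real R ^ CARD('d) * real R powr (-2 * (\<alpha> + 1)) = real R powr (-2 * regularity)"
        using R by (simp add: powr_realpow[symmetric] powr_add[symmetric] regularity_def algebra_simps)
      moreover have "Q = (2 * real CARD('d)) powr (-2 * (\<alpha> + 1)) * real R powr (-2 * (\<alpha> + 1))"
        unfolding Q_def by (rule powr_mult)
      ultimately show ?thesis by (simp add: c_def mult_ac)
    qed
    also have "\<dots> = (\<Sum>k\<in>(int_cube (int R) R :: (int^'d) set). lam_min \<kappa> powr (-2 * \<alpha>) * Q * (1 / 2 ^ CARD('d))\<^sup>2)"
      by (simp add: card_int_cube)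
    also have "\<dots> \<le> (\<Sum>k\<in>(int_cube (int R) R :: (int^'d) set). cm_weight \<kappa> \<alpha> k * (cmod (char_coeff ?\<psi> k))\<^sup>2)"
    proof (intro sum_mono mult_mono)
      fix k :: "int^'d" assume k: "k \<in> int_cube (int R) R"
      show "lam_min \<kappa> powr (-2 * \<alpha>) * Q \<le> cm_weight \<kappa> \<alpha> k" unfolding Q_def by (rule cm_weight_lower[OF R k])
      have "1 * (1 / 2 ^ CARD('d)) \<le> cmod ((cis (2 * pi * (real_of_int (k $ i) * (1 / (4 * real R)))) - 1) ^ n) * cmod (char_coeff (fejer (4 * R)) k)"
        unfolding norm_power by (intro mult_mono char_coeff_fejer_lower[OF R k] one_le_power cis_minus_1_lower[OF R k]) simp_all
      then have "1 / 2 ^ CARD('d) \<le> cmod (char_coeff ?\<psi> k)"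
        unfolding char_coeff_fdiff[OF fejer_test] norm_mult by simp
      then show "(1 / 2 ^ CARD('d))\<^sup>2 \<le> (cmod (char_coeff ?\<psi> k))\<^sup>2" by (intro power_mono) auto
    qed auto
    also have "\<dots> \<le> Re (spectral_form (cm_weight \<kappa> \<alpha>) ?\<psi> ?\<psi>)"
      by (rule spectral_form_lower[OF \<psi> _ cm_weight_le[OF \<kappa> \<alpha>]]) simp_all
    finally show ?thesis .
  qed
  with c0 that show thesis by blast
qed

end

section \<open>Irregularity of samples\<close>

context cm_field
begin

lemma no_smoother_samples:
  assumes reg: "0 < regularity" and \<nu>: "regularity < \<nu>"
  shows "\<not> has_samples M u (holder_loc_minus \<nu>)"
proof
  assume "has_samples M u (holder_loc_minus \<nu>)"
  then obtain U where Um: "(\<lambda>(x, \<omega>). U x \<omega>) \<in> borel_measurable (borel \<Otimes>\<^sub>M M)"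
    and Up: "\<And>\<omega> x k. \<omega> \<in> space M \<Longrightarrow> U (x + lattice_vec k) \<omega> = U x \<omega>"
    and UF: "AE \<omega> in M. (\<lambda>x. U x \<omega>) \<in> holder_loc_minus \<nu>"
    and Ut: "\<And>\<phi>. \<phi> \<in> test_functions \<Longrightarrow> AE \<omega> in M.
           set_integrable lborel (cbox 0 One) (\<lambda>x. complex_of_real (U x \<omega>) * \<phi> x) \<and>
           u \<phi> \<omega> = torus_integral (\<lambda>x. complex_of_real (U x \<omega>) * \<phi> x)"
    unfolding has_samples_def by blast
  \<comment> \<open>The order of differentiability just below the regularity r. The probe takes n +
    1 differences, because a path with n derivatives and a Hoelder condition on the last one
    responds to n + 1 differences.\<close>
  define n where "n = nat \<lfloor>regularity\<rfloor>"
  have n: "real n \<le> regularity" "regularity < real n + 1" using reg unfolding n_def by linarith+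
  \<comment> \<open>The midpoint between r and the smaller of \<nu> and n + 1: it exceeds r, stays
    below \<nu>, and keeps the Hoelder exponent s' - n at most 1.\<close>
  define s' where "s' = (regularity + min \<nu> (real n + 1)) / 2"
  have s': "regularity < s'" "s' < \<nu>" "s' < real n + 1" using \<nu> n by (simp_all add: s'_def min_def)
  define \<gamma> where "\<gamma> = s' - real n"
  have \<gamma>: "0 \<le> \<gamma>" "\<gamma> \<le> 1" "real n + \<gamma> < \<nu>" using n s' by (simp_all add: \<gamma>_def)
  define i :: 'd where "i = undefined"
  define \<psi> where "\<psi> R = (fdiff (- (1 / (4 * real R))) i ^^ Suc n) (fejer (4 * R) :: real^'d \<Rightarrow> complex)" for R
  have \<psi>: "\<psi> R \<in> test_functions" for R unfolding \<psi>_def by (rule test_fdiff_funpow[OF fejer_test])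
  define v where "v R = Re (spectral_form (cm_weight \<kappa> \<alpha>) (\<psi> R) (\<psi> R))" for R
  obtain c where c: "0 < c" "\<And>R. 0 < R \<Longrightarrow> c * real R powr (-2 * regularity) \<le> v R"
    unfolding v_def \<psi>_def using probe_variance_lower[where i = i and n = "Suc n"] by blast
  have \<psi>real: "\<psi> R x \<in> \<real>" for R x
  proof -
    have gen: "(fdiff h i ^^ j) g x \<in> \<real>" if "\<And>x. g x \<in> \<real>" for h j x and g :: "real^'d \<Rightarrow> complex"
      by (induction j arbitrary: x) (simp_all add: that fdiff_def[of _ _ "(fdiff h i ^^ _) g"])
    show ?thesis unfolding \<psi>_def by (rule gen) (simp add: fejer_def)
  qed
  have v0: "0 < v (Suc r)" for r
  proof -
    have "0 < c * real (Suc r) powr (-2 * regularity)" using c(1) by simp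
    also have "\<dots> \<le> v (Suc r)" by (rule c(2)) simp
    finally show ?thesis .
  qed
  \<comment> \<open>After normalisation the value is the same for every probe; the index is shifted
    by one because R = 0 has no step 1/(4R).\<close>
  have char: "(LINT \<omega>|M. iexp ((1 / sqrt (v (Suc r))) * Re (u (\<psi> (Suc r)) \<omega>))) = of_real (exp (- 1 / 2))" for r
  proof -
    have "(1 / sqrt (v (Suc r)))\<^sup>2 * v (Suc r) = 1" using v0[of r] by (simp add: power_divide)
    then show ?thesis by (simp only: u_gaussian(1)[OF \<psi> \<psi>real v_def])
  qed
  have small: "AE \<omega> in M. (\<lambda>r. (1 / sqrt (v (Suc r))) * Re (u (\<psi> (Suc r)) \<omega>)) \<longlonglongrightarrow> 0"
  proof -
    have "AE \<omega> in M. \<forall>r. u (\<psi> (Suc r)) \<omega> = torus_integral (\<lambda>x. complex_of_real (U x \<omega>) * \<psi> (Suc r) x)"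
      unfolding AE_all_countable using Ut[OF \<psi>] by (auto elim!: eventually_mono)
    \<comment> \<open>The constant test function 1 turns the integrability clause into integrability
      of the path itself, which summation by parts requires.\<close>
    with AE_space UF Ut[OF character_test[of 0]] show ?thesis
    proof eventually_elim
      case (elim \<omega>)
      define f where "f x = U x \<omega>" for x
      have f: "f \<in> holder_loc n \<gamma>"
        using elim(2) \<gamma> unfolding holder_loc_minus_def f_def[abs_def] by blast
      have fm: "(\<lambda>x. complex_of_real (f x)) \<in> borel_measurable borel"
        using measurable_compose[OF measurable_Pair2'[OF elim(1)] Um] by (simp add: f_def)
      have fp: "periodic (\<lambda>x. complex_of_real (f x))"
        using Up[OF elim(1)] by (simp add: periodic_def f_def)
      have fi: "integrable tor (\<lambda>x. complex_of_real (f x))"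
        using elim(3) by (simp add: integrable_tor_iff f_def)
      obtain C where C: "0 \<le> C" "\<And>h x. 0 < h \<Longrightarrow> h \<le> 1 \<Longrightarrow> x \<in> cbox 0 One \<Longrightarrow>
          \<bar>(fdiff h i ^^ Suc n) f x\<bar> \<le> C * h ^ n * h powr \<gamma>"
        using holder_fdiff_bound[OF f] by blast
      have of_real_fdiff: "(fdiff h i ^^ j) (\<lambda>x. complex_of_real (f x)) x = of_real ((fdiff h i ^^ j) f x)" for h j x
        by (induction j arbitrary: x)
          (simp_all add: fdiff_def[of _ _ "(fdiff h i ^^ _) f"] fdiff_def[of _ _ "(fdiff h i ^^ _) (\<lambda>x. complex_of_real (f x))"])
      \<comment> \<open>The differences are moved from the kernel to the path, where they are at
        most C h^n h^\<gamma> = C h^s'; the kernel has mass one and h \<le> 1/R. C depends on the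
        path but not on R.\<close>
      have bound: "\<bar>Re (u (\<psi> R) \<omega>)\<bar> \<le> C * real R powr (- s')" if R: "R = Suc r" for R r
      proof -
        define h where "h = 1 / (4 * real R)"
        have h: "0 < h" "h \<le> 1" "h \<le> 1 / real R" using R by (auto simp: h_def field_simps)
        have "u (\<psi> R) \<omega> = (LINT x|tor. complex_of_real (f x) * (fdiff (- h) i ^^ Suc n) (fejer (4 * R)) x)"
          using elim(4) by (simp add: R torus_integral_tor f_def \<psi>_def h_def)
        also have "\<dots> = (LINT x|tor. (fdiff h i ^^ Suc n) (\<lambda>x. complex_of_real (f x)) x * fejer (4 * R) x)"
          by (rule integral_fdiff[OF fm fp fi fejer_test, symmetric])
        finally have eq: "u (\<psi> R) \<omega> = (LINT x|tor. complex_of_real ((fdiff h i ^^ Suc n) f x) * fejer (4 * R) x)"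
          by (simp only: of_real_fdiff)
        have ib: "integrable tor (\<lambda>x::real^'d. (C * h ^ n * h powr \<gamma>) * cmod (fejer (4 * R) x))"
          using fejer_mass(2)[of "4 * R", where 'd = 'd] R by (intro integrable_mult_right) simp
        have "cmod (u (\<psi> R) \<omega>) \<le> (LINT x|tor. cmod (complex_of_real ((fdiff h i ^^ Suc n) f x) * fejer (4 * R) x))"
          unfolding eq by (rule integral_norm_bound)
        also have "\<dots> \<le> (LINT x|(tor :: (real^'d) measure). (C * h ^ n * h powr \<gamma>) * cmod (fejer (4 * R) x))"
        proof (rule integral_mono')
          show "integrable tor (\<lambda>x::real^'d. (C * h ^ n * h powr \<gamma>) * cmod (fejer (4 * R) x))" by (rule ib)
          show "cmod (complex_of_real ((fdiff h i ^^ Suc n) f x) * fejer (4 * R) x) \<le> (C * h ^ n * h powr \<gamma>) * cmod (fejer (4 * R) x)"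
            if "x \<in> space tor" for x
            unfolding norm_mult norm_of_real using C(2)[OF h(1,2)] that by (intro mult_right_mono) (simp_all add: space_tor del: funpow.simps)
        qed (use C(1) h in simp)
        also have "\<dots> = C * h ^ n * h powr \<gamma>"
          using fejer_mass(1)[of "4 * R", where 'd = 'd] R by simp
        also have "\<dots> = C * h powr s'"
          using h(1) by (simp add: powr_realpow[symmetric] powr_add[symmetric] \<gamma>_def mult.assoc)
        also have "\<dots> \<le> C * (1 / real R) powr s'"
          using h s' reg C(1) by (intro mult_left_mono powr_mono2) auto
        also have "\<dots> = C * real R powr (- s')"
          using R by (simp add: powr_minus_divide powr_divide)
        finally show ?thesis using abs_Re_le_cmod[of "u (\<psi> R) \<omega>"] by linarith
      qed
      show ?case
      proof (rule Lim_null_comparison)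
        show "\<forall>\<^sub>F r in sequentially. norm ((1 / sqrt (v (Suc r))) * Re (u (\<psi> (Suc r)) \<omega>)) \<le> (C / sqrt c) * real (Suc r) powr (regularity - s')"
        proof (intro always_eventually allI)
          fix r
          let ?R = "real (Suc r)"
          have "sqrt c * ?R powr (- regularity) = sqrt (c * ?R powr (-2 * regularity))"
          proof -
            have "?R powr (-2 * regularity) = (?R powr (- regularity))\<^sup>2"
              by (simp add: power2_eq_square powr_add[symmetric])
            then show ?thesis by (simp add: real_sqrt_mult)
          qed
          also have "\<dots> \<le> sqrt (v (Suc r))" using c(2)[of "Suc r"] by simp
          finally have l: "sqrt c * ?R powr (- regularity) \<le> sqrt (v (Suc r))" .
          have p: "0 < sqrt c * ?R powr (- regularity)" using c(1) by simp
          have "norm ((1 / sqrt (v (Suc r))) * Re (u (\<psi> (Suc r)) \<omega>)) = \<bar>Re (u (\<psi> (Suc r)) \<omega>)\<bar> / sqrt (v (Suc r))"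
            using v0[of r] by (simp add: abs_mult)
          also have "\<dots> \<le> (C * ?R powr (- s')) / (sqrt c * ?R powr (- regularity))"
            using bound[OF refl, of r] C(1) p l by (intro frac_le) auto
          also have "\<dots> = (C / sqrt c) * ?R powr (regularity - s')"
            by (simp add: powr_diff powr_minus divide_inverse mult_ac)
          finally show "norm ((1 / sqrt (v (Suc r))) * Re (u (\<psi> (Suc r)) \<omega>)) \<le> (C / sqrt c) * ?R powr (regularity - s')" .
        qed
        have "(\<lambda>r. (C / sqrt c) * real (Suc r) powr (regularity - s')) \<longlonglongrightarrow> (C / sqrt c) * 0"
          using s'(1) by (intro tendsto_mult tendsto_const LIMSEQ_Suc tendsto_neg_powr filterlim_real_sequentially) simp_all
        then show "(\<lambda>r. (C / sqrt c) * real (Suc r) powr (regularity - s')) \<longlonglongrightarrow> 0" by simp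
      qed
    qed
  qed
  \<comment> \<open>Almost sure convergence to 0 forces these bounded expectations to 1, whereas
    each of them equals exp(-1/2).\<close>
  have "(\<lambda>r. LINT \<omega>|M. iexp ((1 / sqrt (v (Suc r))) * Re (u (\<psi> (Suc r)) \<omega>))) \<longlonglongrightarrow> (LINT \<omega>|M. 1)"
  proof (rule integral_dominated_convergence[where w = "\<lambda>_. 1"])
    show "AE \<omega> in M. (\<lambda>r. iexp ((1 / sqrt (v (Suc r))) * Re (u (\<psi> (Suc r)) \<omega>))) \<longlonglongrightarrow> 1"
      using small
    proof eventually_elim
      case (elim \<omega>)
      then have "(\<lambda>r. iexp ((1 / sqrt (v (Suc r))) * Re (u (\<psi> (Suc r)) \<omega>))) \<longlonglongrightarrow> iexp 0"
        by (intro tendsto_intros)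
      then show ?case by simp
    qed
    show "(\<lambda>\<omega>. iexp ((1 / sqrt (v (Suc r))) * Re (u (\<psi> (Suc r)) \<omega>))) \<in> borel_measurable M" for r
      using u_measurable[OF \<psi>] by measurable
  qed simp_all
  then have "(LINT \<omega>|M. (1::complex)) = of_real (exp (- 1 / 2))"
    unfolding char by (rule LIMSEQ_unique[OF tendsto_const, symmetric])
  then show False by (simp add: prob_space complex_eq_iff)
qed

end

text \<open>Real and imaginary parts of Z \<phi> are almost surely the pairings with the real and
  imaginary parts of \<phi>, so a real combination of them is the pairing with a single real \<eta>.
  Leaving h abstract lets two fields on different spaces be compared through the same h.\<close>

lemma joint_characteristic_function:
  fixes Z :: "(real^'d::finite \<Rightarrow> complex) \<Rightarrow> 'a \<Rightarrow> complex" and n :: nat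
  assumes Z: "stationary_gerf M Z \<mu>" and \<phi>: "\<And>i. i < n \<Longrightarrow> \<phi> i \<in> test_functions"
    and char: "\<And>\<eta>. \<eta> \<in> test_functions \<Longrightarrow> (\<And>x. \<eta> x \<in> \<real>) \<Longrightarrow>
      (LINT \<omega>|M. iexp (1 * Re (Z \<eta> \<omega>))) = h \<eta>"
  shows "(LINT \<omega>|M. iexp (\<Sum>i<n. a i * Re (Z (\<phi> i) \<omega>) + b i * Im (Z (\<phi> i) \<omega>))) =
    h (\<lambda>x. \<Sum>p\<in>{..<n} \<times> (UNIV :: bool set). complex_of_real (if snd p then a (fst p) else b (fst p)) *
        complex_of_real (if snd p then Re (\<phi> (fst p) x) else Im (\<phi> (fst p) x)))"
proof -
  note facts = stationary_gerf_facts[OF Z]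
  let ?I = "{..<n} \<times> (UNIV :: bool set)"
  let ?c = "\<lambda>p. complex_of_real (if snd p then a (fst p) else b (fst p))"
  let ?f = "\<lambda>p x. complex_of_real (if snd p then Re (\<phi> (fst p) x) else Im (\<phi> (fst p) x))"
  let ?\<eta> = "\<lambda>x. \<Sum>p\<in>?I. ?c p * ?f p x"
  have f: "?f p \<in> test_functions" if "p \<in> ?I" for p
    using test_Re[OF \<phi>] test_Im[OF \<phi>] that by (cases "snd p") auto
  have \<eta>: "?\<eta> \<in> test_functions" by (rule test_sum[OF f])
  have \<eta>r: "?\<eta> x \<in> \<real>" for x by (intro sum_in_Reals Reals_mult Reals_of_real)
  have lin: "AE \<omega> in M. Z (\<lambda>x. \<Sum>p\<in>J. ?c p * ?f p x) \<omega> = (\<Sum>p\<in>J. ?c p * Z (?f p) \<omega>)" if "J \<subseteq> ?I" "finite J" for J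
    using that(2,1)
  proof (induction J rule: finite_induct)
    case empty
    then show ?case using facts(4)[OF test_zero test_zero, of 0 0] by simp
  next
    case (insert p J)
    have "AE \<omega> in M. Z (\<lambda>x. ?c p * ?f p x + 1 * (\<Sum>p\<in>J. ?c p * ?f p x)) \<omega> =
        ?c p * Z (?f p) \<omega> + 1 * Z (\<lambda>x. \<Sum>p\<in>J. ?c p * ?f p x) \<omega>"
      using insert.prems by (intro facts(4) test_sum f) auto
    moreover have "AE \<omega> in M. Z (\<lambda>x. \<Sum>p\<in>J. ?c p * ?f p x) \<omega> = (\<Sum>p\<in>J. ?c p * Z (?f p) \<omega>)"
      using insert by blast
    ultimately show ?case by eventually_elim (use insert.hyps in simp)
  qed
  have parts: "AE \<omega> in M. Re (Z (\<phi> i) \<omega>) = Re (Z (?f (i, True)) \<omega>) \<and> Im (Z (\<phi> i) \<omega>) = Re (Z (?f (i, False)) \<omega>)" if "i < n" for i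
  proof -
    have t: "?f (i, True) \<in> test_functions" "?f (i, False) \<in> test_functions" using f[of "(i, True)"] f[of "(i, False)"] that by simp_all
    have eq: "\<phi> i = (\<lambda>x. 1 * ?f (i, True) x + \<i> * ?f (i, False) x)"
      by (simp add: fun_eq_iff complex_eq_iff)
    have "AE \<omega> in M. Z (\<phi> i) \<omega> = 1 * Z (?f (i, True)) \<omega> + \<i> * Z (?f (i, False)) \<omega>"
      by (subst eq) (rule facts(4)[OF t])
    moreover have "AE \<omega> in M. Z (?f (i, True)) \<omega> \<in> \<real>" by (rule facts(5)[OF t(1)]) simp
    moreover have "AE \<omega> in M. Z (?f (i, False)) \<omega> \<in> \<real>" by (rule facts(5)[OF t(2)]) simp
    ultimately show ?thesis by eventually_elim (simp add: complex_is_Real_iff)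
  qed
  have "AE \<omega> in M. \<forall>i\<in>{..<n}. Re (Z (\<phi> i) \<omega>) = Re (Z (?f (i, True)) \<omega>) \<and> Im (Z (\<phi> i) \<omega>) = Re (Z (?f (i, False)) \<omega>)"
    by (rule AE_finite_allI) (use parts in auto)
  moreover have "AE \<omega> in M. Z ?\<eta> \<omega> = (\<Sum>p\<in>?I. ?c p * Z (?f p) \<omega>)" by (rule lin) simp_all
  ultimately have ae: "AE \<omega> in M. (\<Sum>i<n. a i * Re (Z (\<phi> i) \<omega>) + b i * Im (Z (\<phi> i) \<omega>)) = Re (Z ?\<eta> \<omega>)"
  proof eventually_elim
    case (elim \<omega>)
    have "Re (Z ?\<eta> \<omega>) = (\<Sum>p\<in>?I. (if snd p then a (fst p) else b (fst p)) * Re (Z (?f p) \<omega>))"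
      unfolding elim(2) by simp
    also have "\<dots> = (\<Sum>i<n. \<Sum>t\<in>UNIV. (if t then a i else b i) * Re (Z (?f (i, t)) \<omega>))"
      unfolding sum.cartesian_product by (intro sum.cong refl) auto
    also have "\<dots> = (\<Sum>i<n. a i * Re (Z (\<phi> i) \<omega>) + b i * Im (Z (\<phi> i) \<omega>))"
      using elim(1) by (intro sum.cong refl) (simp add: UNIV_bool)
    finally show ?case by simp
  qed
  have [measurable]: "Z ?\<eta> \<in> borel_measurable M" by (rule facts(2)[OF \<eta>])
  have [measurable]: "Z (\<phi> i) \<in> borel_measurable M" if "i < n" for i by (rule facts(2)[OF \<phi>[OF that]])
  have "(LINT \<omega>|M. iexp (\<Sum>i<n. a i * Re (Z (\<phi> i) \<omega>) + b i * Im (Z (\<phi> i) \<omega>))) = (LINT \<omega>|M. iexp (1 * Re (Z ?\<eta> \<omega>)))"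
  proof (rule integral_cong_AE)
    have "(\<lambda>\<omega>. \<Sum>i<n. a i * Re (Z (\<phi> i) \<omega>) + b i * Im (Z (\<phi> i) \<omega>)) \<in> borel_measurable M"
      by (rule borel_measurable_sum) simp
    then show "(\<lambda>\<omega>. iexp (\<Sum>i<n. a i * Re (Z (\<phi> i) \<omega>) + b i * Im (Z (\<phi> i) \<omega>))) \<in> borel_measurable M"
      by measurable
    show "(\<lambda>\<omega>. iexp (1 * Re (Z ?\<eta> \<omega>))) \<in> borel_measurable M" by measurable
    show "AE \<omega> in M. iexp (\<Sum>i<n. a i * Re (Z (\<phi> i) \<omega>) + b i * Im (Z (\<phi> i) \<omega>)) = iexp (1 * Re (Z ?\<eta> \<omega>))"
      using ae by eventually_elim simp
  qed
  also have "\<dots> = h ?\<eta>" by (rule char[OF \<eta> \<eta>r])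
  finally show ?thesis .
qed

section \<open>The expansion of the canonical-Matern field\<close>

context matern_series
begin

lemma measure_S_weight: "measure (point_measure UNIV (\<lambda>k. ennreal (S_weight k))) {k} = S_weight k"
  by (simp add: measure_def emeasure_point_measure_singleton S_weight_def)

text \<open>Dropping the first field raises every smoothness by one, which is \<alpha> + 1 in place
  of \<alpha>, and moves one factor \<kappa> from the powers into the constant.\<close>

lemma tail: "matern_series \<kappa> (\<alpha> + 1) (2 * pi * \<kappa>) P (\<lambda>j. X (Suc j))"
proof unfold_locales
  have "matern_perp \<kappa> (\<alpha> + 1 - real CARD('d) / 2 + real (Suc j)) P (X (Suc j))" for j
    using fam unfolding independent_matern_family_def by blast
  then have "matern_perp \<kappa> (\<alpha> + 1 + 1 - real CARD('d) / 2 + real j) P (X (Suc j))" for j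
    by (simp add: algebra_simps)
  moreover have "independent_fields P (\<lambda>j. X (Suc j)) UNIV"
    using fam indep_sets_inj[of "\<lambda>j. field_algebra P (X j)" Suc]
    by (simp add: independent_matern_family_def independent_fields_def)
  ultimately show "independent_matern_family \<kappa> (\<alpha> + 1 + 1 - real CARD('d) / 2) P (\<lambda>j. X (Suc j))"
    using prob_space_axioms by (simp add: independent_matern_family_def)
qed (use \<kappa> \<alpha> in simp_all)

text \<open>The identity for R holds at every \<omega>, not just almost surely; hence R is
  measurable for the algebra generated by the fields with positive index, and that algebra is
  independent of the one of field 0.\<close>

lemma head_tail_independent:
  assumes R: "\<And>\<phi> \<omega>. R \<phi> \<omega> = (\<Sum>j. complex_of_real (b j) * X (Suc j) \<phi> \<omega>)"
  shows "independent_pair P (X 0) R"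
proof -
  define I where "I t = (if t then {0} else range Suc)" for t
  have "indep_sets (\<lambda>j. field_algebra P (X j)) (\<Union>t. I t)"
    by (rule indep_sets_mono_index[of _ UNIV])
      (use fam in \<open>simp_all add: independent_matern_family_def independent_fields_def\<close>)
  then have ind: "indep_sets (\<lambda>t. sigma_sets (space P) (\<Union>j\<in>I t. field_algebra P (X j))) UNIV"
    by (rule indep_sets_collect_sigma) (auto simp: Int_stable_field_algebra disjoint_family_on_def I_def)
  let ?G = "\<Union>j\<in>I False. field_algebra P (X j)"
  have G: "?G \<subseteq> Pow (space P)" using field_algebra_space by blast
  have "field_algebra P R \<subseteq> sigma_sets (space P) ?G"
  proof (rule field_algebra_le[OF G])
    fix \<phi> :: "real^'d \<Rightarrow> complex" assume \<phi>: "\<phi> \<in> test_functions"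
    have [measurable]: "X (Suc j) \<phi> \<in> borel_measurable (sigma (space P) ?G)" for j
      by (rule field_algebra_measurable[OF \<phi> _ G]) (auto simp: I_def)
    have "R \<phi> = (\<lambda>\<omega>. \<Sum>j. complex_of_real (b j) * X (Suc j) \<phi> \<omega>)" using R by blast
    then show "R \<phi> \<in> borel_measurable (sigma (space P) ?G)"
      by (simp only:) (rule borel_measurable_suminf, measurable)
  qed
  then show ?thesis
    unfolding independent_pair_def indep_set_def
    by (intro indep_sets_mono_sets[OF ind]) (auto simp: I_def split: bool.splits)
qed

text \<open>For |k| \<ge> 1 the quantity lambda(k)^2 lies between 4 pi^2 |k|^2 and (\<kappa>^2 + 4
  pi^2)|k|^2, so |k|^(-2) and lambda(k)^(-2) are comparable and the weight behaves like
  lambda(k)^(-2(\<alpha> + 1)).\<close>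

lemma S_of_smoothness:
  assumes "0 < c"
  shows "of_smoothness \<kappa> (\<alpha> + 1 - real CARD('d) / 2) P S"
  unfolding of_smoothness_def
proof (intro exI conjI allI impI)
  show "stationary_gerf P S (point_measure UNIV (\<lambda>k. ennreal (S_weight k)))" by (rule S_stationary)
  \<comment> \<open>The lower and upper constants are c^2/(4 pi^2) times the two bounds 4 pi^2 and
    \<kappa>^2 + 4 pi^2 for lambda(k)^2/|k|^2.\<close>
  show "0 < c\<^sup>2" "0 < c\<^sup>2 / (4 * pi\<^sup>2) * (\<kappa>\<^sup>2 + 4 * pi\<^sup>2)"
    using assms by (simp_all add: add_nonneg_pos)
  fix k :: "int^'d" assume k: "k \<noteq> 0"
  define n where "n = (norm (lattice_vec k))\<^sup>2"
  define l where "l = (lam \<kappa> k)\<^sup>2"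
  have n: "1 \<le> n" using norm_lattice_vec_ge_1[OF k] by (simp add: n_def)
  have l: "l = \<kappa>\<^sup>2 + 4 * pi\<^sup>2 * n" by (simp add: l_def n_def lam_sq)
  have pos: "0 < lam \<kappa> k" by (rule lam_pos[OF \<kappa>])
  have l0: "0 < l" using pos by (simp add: l_def)
  have w: "cm_weight \<kappa> \<alpha> k = (1 / n) * lam \<kappa> k powr (-2 * \<alpha>)"
    using k n by (simp add: cm_weight_def n_def powr_minus_divide norm_lattice_vec_ge_1)
  have e: "lam \<kappa> k powr (-2 * (\<alpha> + 1 - real CARD('d) / 2 + real CARD('d) / 2)) = (1 / l) * lam \<kappa> k powr (-2 * \<alpha>)"
  proof -
    have "lam \<kappa> k powr (-2 * (\<alpha> + 1)) = lam \<kappa> k powr (-2) * lam \<kappa> k powr (-2 * \<alpha>)"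
      by (simp add: powr_add[symmetric] algebra_simps)
    then show ?thesis using pos by (simp add: l_def powr_minus_divide)
  qed
  have "1 / l \<le> 1 / (4 * pi\<^sup>2) * (1 / n)"
    using n l by (simp add: frac_le)
  moreover have "\<kappa>\<^sup>2 * 1 \<le> \<kappa>\<^sup>2 * n" using n by (intro mult_left_mono) simp_all
  then have "1 / n \<le> (\<kappa>\<^sup>2 + 4 * pi\<^sup>2) * (1 / l)"
    using n l0 l by (simp add: field_simps)
  ultimately have "c\<^sup>2 * (1 / l) \<le> c\<^sup>2 * (1 / (4 * pi\<^sup>2) * (1 / n))"
      "c\<^sup>2 / (4 * pi\<^sup>2) * (1 / n) \<le> c\<^sup>2 / (4 * pi\<^sup>2) * ((\<kappa>\<^sup>2 + 4 * pi\<^sup>2) * (1 / l))"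
    by (intro mult_left_mono; simp)+
  from mult_right_mono[OF this(1), of "lam \<kappa> k powr (-2 * \<alpha>)"] mult_right_mono[OF this(2), of "lam \<kappa> k powr (-2 * \<alpha>)"]
  show "c\<^sup>2 * lam \<kappa> k powr (-2 * (\<alpha> + 1 - real CARD('d) / 2 + real CARD('d) / 2)) \<le> measure (point_measure UNIV (\<lambda>k. ennreal (S_weight k))) {k}"
    "measure (point_measure UNIV (\<lambda>k. ennreal (S_weight k))) {k} \<le> c\<^sup>2 / (4 * pi\<^sup>2) * (\<kappa>\<^sup>2 + 4 * pi\<^sup>2) * lam \<kappa> k powr (-2 * (\<alpha> + 1 - real CARD('d) / 2 + real CARD('d) / 2))"
    unfolding measure_S_weight unfolding S_weight_def e w by (simp_all add: mult_ac)
qed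

end

text \<open>The choice c = 2 pi makes the spectral weight of the sum equal to that of u. The field
  and the family may live on different probability spaces.\<close>

locale cm_field_series = cm_field \<kappa> \<alpha> M u \<mu> + series: matern_series \<kappa> \<alpha> "2 * pi" P X
  for \<kappa> \<alpha> :: real and M :: "'a measure" and u :: "(real^'d::finite \<Rightarrow> complex) \<Rightarrow> 'a \<Rightarrow> complex"
    and \<mu> :: "(int^'d) measure" and P :: "'b measure" and X :: "nat \<Rightarrow> (real^'d \<Rightarrow> complex) \<Rightarrow> 'b \<Rightarrow> complex"
begin

lemma S_weight_eq: "series.S_weight = cm_weight \<kappa> \<alpha>"
  by (rule ext) (simp add: series.S_weight_def power_mult_distrib)

lemma second_order: "second_order_eq M u P series.S"
proof -
  have "covariance M (u \<phi>) (u \<psi>) = covariance P (series.S \<phi>) (series.S \<psi>)"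
    if "\<phi> \<in> test_functions" "\<psi> \<in> test_functions" for \<phi> \<psi>
    unfolding covariance_eq_inner[OF stationary that] covariance_eq_inner[OF series.S_stationary that]
    by (simp only: series.measure_S_weight weight) (simp only: S_weight_eq)
  then show ?thesis
    unfolding second_order_eq_def
    using stationary_gerf_facts(6)[OF stationary] stationary_gerf_facts(6)[OF series.S_stationary] by simp
qed

text \<open>For a real test function both characteristic functions are the same Gaussian expression
  in the common spectral form; joint laws then follow from uniqueness in finite dimensions.\<close>

lemma law: "eq_in_law M u P series.S"
  unfolding eq_in_law_def
proof (intro allI impI)
  fix n :: nat and \<phi> :: "nat \<Rightarrow> real^'d \<Rightarrow> complex" assume "\<forall>i<n. \<phi> i \<in> test_functions"
  then have \<phi>: "\<phi> i \<in> test_functions" if "i < n" for i using that by blast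
  define h where "h \<eta> = complex_of_real (exp (- (1\<^sup>2 * Re (spectral_form (cm_weight \<kappa> \<alpha>) \<eta> \<eta>)) / 2))" for \<eta> :: "real^'d \<Rightarrow> complex"
  have 1: "(LINT \<omega>|M. iexp (1 * Re (u \<eta> \<omega>))) = h \<eta>" if "\<eta> \<in> test_functions" "\<And>x. \<eta> x \<in> \<real>" for \<eta>
    unfolding h_def by (rule u_gaussian(1)[OF that refl])
  have 2: "(LINT \<omega>|P. iexp (1 * Re (series.S \<eta> \<omega>))) = h \<eta>" if "\<eta> \<in> test_functions" "\<And>x. \<eta> x \<in> \<real>" for \<eta>
    unfolding h_def series.S_char[OF that] series.S_inner[OF that(1,1)] by (simp add: power_mult_distrib)
  show "distr M (\<Pi>\<^sub>M i\<in>{..<n}. borel) (\<lambda>\<omega>. \<lambda>i\<in>{..<n}. u (\<phi> i) \<omega>) =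
      distr P (\<Pi>\<^sub>M i\<in>{..<n}. borel) (\<lambda>\<omega>. \<lambda>i\<in>{..<n}. series.S (\<phi> i) \<omega>)"
  proof (rule complex_char_unique_PiM)
    show "prob_space M" "prob_space P" by (rule prob_space_axioms series.prob_space_axioms)+
    show "u (\<phi> i) \<in> borel_measurable M" "series.S (\<phi> i) \<in> borel_measurable P" if "i < n" for i
      by (rule u_measurable[OF \<phi>[OF that]] series.S_measurable[OF \<phi>[OF that]])+
    show "(LINT \<omega>|M. iexp (\<Sum>i<n. a i * Re (u (\<phi> i) \<omega>) + b i * Im (u (\<phi> i) \<omega>))) =
        (LINT \<omega>|P. iexp (\<Sum>i<n. a i * Re (series.S (\<phi> i) \<omega>) + b i * Im (series.S (\<phi> i) \<omega>)))" for a b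
      using joint_characteristic_function[OF stationary \<phi> 1, where n = n and a = a and b = b]
        joint_characteristic_function[OF series.S_stationary \<phi> 2, where n = n and a = a and b = b] by simp
  qed
qed

lemma series_expansion:
  "gerf P series.S" "l2_series P (\<lambda>j \<phi> \<omega>. complex_of_real (2 * pi * \<kappa> ^ j) * X j \<phi> \<omega>) series.S"
  using series.S_stationary series.S_l2_limit by (simp_all add: stationary_gerf_def l2_series_def)

lemma head_tail:
  "\<exists>R. l2_series P (\<lambda>j \<phi> \<omega>. complex_of_real (2 * pi * \<kappa> ^ Suc j) * X (Suc j) \<phi> \<omega>) R \<and>
     independent_pair P (X 0) R \<and> of_smoothness \<kappa> (\<alpha> + 2 - real CARD('d) / 2) P R \<and>
     second_order_eq M u P (\<lambda>\<phi> \<omega>. complex_of_real (2 * pi) * X 0 \<phi> \<omega> + R \<phi> \<omega>)"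
proof -
  interpret tail: matern_series \<kappa> "\<alpha> + 1" "2 * pi * \<kappa>" P "\<lambda>j. X (Suc j)" by (rule series.tail)
  let ?W = "\<lambda>\<phi> \<omega>. complex_of_real (2 * pi) * X 0 \<phi> \<omega> + tail.S \<phi> \<omega>"
  \<comment> \<open>Splitting off the first term requires convergence and so holds almost surely;
    means and covariances do not see the exceptional set.\<close>
  have split: "AE \<omega> in P. ?W \<phi> \<omega> = series.S \<phi> \<omega>" if "\<phi> \<in> test_functions" for \<phi>
    using series.AE_Y_summable[OF that]
  proof eventually_elim
    case (elim \<omega>)
    have "(\<Sum>j. series.Y \<phi> j \<omega>) = (\<Sum>j. series.Y \<phi> (Suc j) \<omega>) + series.Y \<phi> 0 \<omega>"
      using suminf_split_head[OF elim] by simp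
    then show ?case
      unfolding series.S_def tail.S_def series.Y_def tail.Y_def by (simp add: mult_ac)
  qed
  have W: "?W \<phi> \<in> borel_measurable P" if "\<phi> \<in> test_functions" for \<phi>
    using series.X_facts(2)[OF that] tail.S_measurable[OF that] by simp
  have mean: "(LINT \<omega>|P. ?W \<phi> \<omega>) = (LINT \<omega>|P. series.S \<phi> \<omega>)" if "\<phi> \<in> test_functions" for \<phi>
    by (intro integral_cong_AE W[OF that] series.S_measurable[OF that] split[OF that])
  have cov: "covariance P (?W \<phi>) (?W \<psi>) = covariance P (series.S \<phi>) (series.S \<psi>)"
    if \<phi>: "\<phi> \<in> test_functions" and \<psi>: "\<psi> \<in> test_functions" for \<phi> \<psi>
    unfolding covariance_def mean[OF \<phi>] mean[OF \<psi>]
  proof (rule integral_cong_AE)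
    note [measurable] = series.X_facts(2)[OF \<phi>] series.X_facts(2)[OF \<psi>] tail.S_measurable[OF \<phi>] tail.S_measurable[OF \<psi>]
      series.S_measurable[OF \<phi>] series.S_measurable[OF \<psi>]
    show "(\<lambda>\<omega>. (?W \<phi> \<omega> - (LINT \<omega>|P. series.S \<phi> \<omega>)) * cnj (?W \<psi> \<omega> - (LINT \<omega>|P. series.S \<psi> \<omega>))) \<in> borel_measurable P"
      "(\<lambda>\<omega>. (series.S \<phi> \<omega> - (LINT \<omega>|P. series.S \<phi> \<omega>)) * cnj (series.S \<psi> \<omega> - (LINT \<omega>|P. series.S \<psi> \<omega>))) \<in> borel_measurable P"
      by measurable
    show "AE \<omega> in P. (?W \<phi> \<omega> - (LINT \<omega>|P. series.S \<phi> \<omega>)) * cnj (?W \<psi> \<omega> - (LINT \<omega>|P. series.S \<psi> \<omega>)) =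
        (series.S \<phi> \<omega> - (LINT \<omega>|P. series.S \<phi> \<omega>)) * cnj (series.S \<psi> \<omega> - (LINT \<omega>|P. series.S \<psi> \<omega>))"
      using split[OF \<phi>] split[OF \<psi>] by eventually_elim simp
  qed
  have "second_order_eq M u P ?W"
    using second_order unfolding second_order_eq_def by (intro conjI ballI) (simp_all only: mean cov)
  moreover have "l2_series P (\<lambda>j \<phi> \<omega>. complex_of_real (2 * pi * \<kappa> ^ Suc j) * X (Suc j) \<phi> \<omega>) tail.S"
    using tail.S_l2_limit by (simp add: l2_series_def mult.assoc)
  moreover have "independent_pair P (X 0) tail.S"
    by (rule series.head_tail_independent[of _ "\<lambda>j. 2 * pi * \<kappa> * \<kappa> ^ j"]) (simp add: tail.S_def tail.Y_def)
  moreover have "of_smoothness \<kappa> (\<alpha> + 2 - real CARD('d) / 2) P tail.S"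
    using tail.S_of_smoothness \<kappa> by (simp add: add.assoc)
  ultimately show ?thesis by blast
qed

end

text \<open>The expansion is asserted for every independent family, on whatever space it lives; the
  existence clause, on the space of real sequences, shows that such families occur. Families start
  at smoothness \<nu> + 1, so X j has smoothness \<nu> + 1 + j.\<close>

theorem theorem5p6:
  fixes \<kappa> :: real
  assumes "\<kappa> > 0"
  shows
    "(\<forall>\<alpha> (k :: int^'d::finite). k \<noteq> 0 \<longrightarrow>
        measure (mu_CM \<kappa> \<alpha>) {k} =
          4 * pi\<^sup>2 * lam \<kappa> k powr (-2 * (\<alpha> + 1)) + \<kappa>\<^sup>2 * measure (mu_CM \<kappa> (\<alpha> + 1)) {k}) \<and>
     (\<forall>\<alpha> (k :: int^'d). k \<noteq> 0 \<longrightarrow>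
        summable (\<lambda>j. \<bar>\<kappa> ^ (2 * j) * lam \<kappa> k powr (-2 * (\<alpha> + 1 + real j))\<bar>) \<and>
        measure (mu_CM \<kappa> \<alpha>) {k} =
          4 * pi\<^sup>2 * (\<Sum>j. \<kappa> ^ (2 * j) * lam \<kappa> k powr (-2 * (\<alpha> + 1 + real j)))) \<and>
     (\<forall>\<alpha> \<nu>. \<alpha> > 0 \<and> \<nu> = \<alpha> - real CARD('d) / 2 \<longrightarrow>
        (\<exists>(P :: (nat \<Rightarrow> real) measure) (X :: nat \<Rightarrow> (real^'d \<Rightarrow> complex) \<Rightarrow> (nat \<Rightarrow> real) \<Rightarrow> complex).
           independent_matern_family \<kappa> (\<nu> + 1) P X) \<and>
        (\<forall>(N :: 'c measure) G (M :: 'a measure) (u :: (real^'d \<Rightarrow> complex) \<Rightarrow> 'a \<Rightarrow> complex).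
           canonical_matern \<kappa> \<alpha> N G M u \<longrightarrow>
           (\<forall>(P :: 'b measure) X. independent_matern_family \<kappa> (\<nu> + 1) P X \<longrightarrow>
              (\<exists>S. gerf P S \<and>
                   l2_series P (\<lambda>j \<phi> \<omega>. complex_of_real (2 * pi * \<kappa> ^ j) * X j \<phi> \<omega>) S \<and>
                   second_order_eq M u P S \<and> eq_in_law M u P S) \<and>
              (\<exists>R. l2_series P
                     (\<lambda>j \<phi> \<omega>. complex_of_real (2 * pi * \<kappa> ^ Suc j) * X (Suc j) \<phi> \<omega>) R \<and>
                   independent_pair P (X 0) R \<and> of_smoothness \<kappa> (\<nu> + 2) P R \<and>
                   second_order_eq M u P
                     (\<lambda>\<phi> \<omega>. complex_of_real (2 * pi) * X 0 \<phi> \<omega> + R \<phi> \<omega>))) \<and>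
           (\<nu> + 1 > 0 \<longrightarrow>
              has_samples M u (holder_loc_minus (\<nu> + 1)) \<and>
              (\<forall>\<nu>'>\<nu> + 1. \<not> has_samples M u (holder_loc_minus \<nu>')))))"
proof (intro conjI allI impI)
  fix \<alpha> and k :: "int^'d" assume k: "k \<noteq> 0"
  have lw: "lam_weight \<kappa> \<beta> k = lam \<kappa> k powr (-2 * \<beta>)" for \<beta> using k by (simp add: lam_weight_def)
  show "measure (mu_CM \<kappa> \<alpha>) {k} =
      4 * pi\<^sup>2 * lam \<kappa> k powr (-2 * (\<alpha> + 1)) + \<kappa>\<^sup>2 * measure (mu_CM \<kappa> (\<alpha> + 1)) {k}"
    using cm_weight_rec[OF assms, of \<alpha> k] by (simp only: measure_mu lw)
  have "(\<lambda>j. 4 * pi\<^sup>2 * (\<kappa> ^ (2 * j) * lam \<kappa> k powr (-2 * (\<alpha> + 1 + real j)))) sums cm_weight \<kappa> \<alpha> k"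
    using cm_weight_sums[OF assms, of \<alpha> k] by (simp only: lw mult.assoc)
  from sums_divide[OF this, of "4 * pi\<^sup>2"]
  have s: "(\<lambda>j. \<kappa> ^ (2 * j) * lam \<kappa> k powr (-2 * (\<alpha> + 1 + real j))) sums (cm_weight \<kappa> \<alpha> k / (4 * pi\<^sup>2))"
    by simp
  \<comment> \<open>All terms are nonnegative, so convergence is already absolute.\<close>
  show "summable (\<lambda>j. \<bar>\<kappa> ^ (2 * j) * lam \<kappa> k powr (-2 * (\<alpha> + 1 + real j))\<bar>)"
    using sums_summable[OF s] by (simp add: abs_mult)
  show "measure (mu_CM \<kappa> \<alpha>) {k} =
      4 * pi\<^sup>2 * (\<Sum>j. \<kappa> ^ (2 * j) * lam \<kappa> k powr (-2 * (\<alpha> + 1 + real j)))"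
    unfolding sums_unique[OF s, symmetric] by (simp add: measure_mu)
next
  fix \<alpha> \<nu> assume "0 < \<alpha> \<and> \<nu> = \<alpha> - real CARD('d) / 2"
  then have \<alpha>: "0 < \<alpha>" and \<nu>: "\<nu> + 1 = \<alpha> + 1 - real CARD('d) / 2" "\<nu> + 2 = \<alpha> + 2 - real CARD('d) / 2" by simp_all
  show "\<exists>(P :: (nat \<Rightarrow> real) measure) (X :: nat \<Rightarrow> (real^'d \<Rightarrow> complex) \<Rightarrow> (nat \<Rightarrow> real) \<Rightarrow> complex).
      independent_matern_family \<kappa> (\<nu> + 1) P X"
    unfolding \<nu>(1) by (rule exists_independent_matern_family[OF assms]) (use \<alpha> in simp)
  fix N :: "'c measure" and G and M :: "'a measure" and u :: "(real^'d \<Rightarrow> complex) \<Rightarrow> 'a \<Rightarrow> complex"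
  assume cm: "canonical_matern \<kappa> \<alpha> N G M u"
  obtain \<mu> where \<mu>: "stationary_gerf M u \<mu>" "\<And>k. measure \<mu> {k} = cm_weight \<kappa> \<alpha> k"
    using canonical_matern_spectral[OF cm assms] by blast
  interpret cm_field \<kappa> \<alpha> M u \<mu>
    using assms \<alpha> cm \<mu> by unfold_locales (simp_all add: canonical_matern_def)
  {
    fix P :: "'b measure" and X :: "nat \<Rightarrow> (real^'d \<Rightarrow> complex) \<Rightarrow> 'b \<Rightarrow> complex"
    assume fam: "independent_matern_family \<kappa> (\<nu> + 1) P X"
    interpret cm_field_series \<kappa> \<alpha> M u \<mu> P X
      using assms \<alpha> fam by unfold_locales (simp_all add: \<nu>)
    show "\<exists>S. gerf P S \<and> l2_series P (\<lambda>j \<phi> \<omega>. complex_of_real (2 * pi * \<kappa> ^ j) * X j \<phi> \<omega>) S \<and>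
        second_order_eq M u P S \<and> eq_in_law M u P S"
      using series_expansion second_order law by blast
    show "\<exists>R. l2_series P (\<lambda>j \<phi> \<omega>. complex_of_real (2 * pi * \<kappa> ^ Suc j) * X (Suc j) \<phi> \<omega>) R \<and>
        independent_pair P (X 0) R \<and> of_smoothness \<kappa> (\<nu> + 2) P R \<and>
        second_order_eq M u P (\<lambda>\<phi> \<omega>. complex_of_real (2 * pi) * X 0 \<phi> \<omega> + R \<phi> \<omega>)"
      unfolding \<nu>(2) by (rule head_tail)
  }
  have reg: "regularity = \<nu> + 1" by (simp add: regularity_def \<nu>)
  {
    assume "0 < \<nu> + 1"
    then show "has_samples M u (holder_loc_minus (\<nu> + 1))"
      using has_regular_samples by (simp add: reg)
  }
  {
    fix \<nu>' assume "0 < \<nu> + 1" "\<nu> + 1 < \<nu>'"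
    then show "\<not> has_samples M u (holder_loc_minus \<nu>')"
      by (intro no_smoother_samples) (simp_all add: reg)
  }
qed

end
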